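(* Let $n\in\{1,2,3\}$, let $k$ be a kernel satisfying the standing assumptions (C1)–(C4) listed in the context, and let $u_0\in L^2(\mathbb{R}^n)$. Then the Cauchy problem $$\mathscr{D}_{(k)}u(t,x)=\triangle u(t,x),\quad t>0,\ x\in\mathbb{R}^n,\qquad u(0,x)=u_0(x),\quad x\in\mathbb{R}^n,$$ has a unique solution $u\in C([0,\infty);L^2(\mathbb{R}^n))$. Moreover, $u\in\bigcap_{\epsilon>0}C([\epsilon,\infty);H^2(\mathbb{R}^n))$, and the following relations hold, where $K_n$ is a constant depending only on the dimension $n$: $$\|u(t,\cdot)\|_{L^2(\mathbb{R}^n)}\le\|u_0\|_{L^2(\mathbb{R}^n)},\quad t\ge0;$$ $$\|u(t,\cdot)\|_{H^2(\mathbb{R}^n)}\le\left(1+\frac{\|k\|_{L^1(0,t)}}{t}\right)\|u_0\|_{L^2(\mathbb{R}^n)},\quad t>0;$$ $$\lim_{t\to0}\|u(t,\cdot)-u_0\|_{L^2(\mathbb{R}^n)}=0;$$ $$\|\mathscr{D}_{(k)}u(t,\cdot)\|_{L^2(\mathbb{R}^n)}\le\frac{\|k\|_{L^1(0,t)}}{t}\|u_0\|_{L^2(\mathbb{R}^n)},\quad t>0;$$ $$\|u(t,\cdot)\|_{L^\infty(\mathbb{R}^n)}\le K_n\left(\frac{\|k\|_{L^1(0,t)}}{t}\right)^{n/4}\|u_0\|_{L^2(\mathbb{R}^n)},\quad t>0.$$ If $u_0$ is nonnegative, then the solution is also nonnegative. If $u_0$ is bounded, then the solution is also bounded. If $u_0\in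 L^1(\mathbb{R}^n)\cap L^2(\mathbb{R}^n)$, then the solution $u$ satisfies $$\|u(t,\cdot)\|_{L^2(\mathbb{R}^n)}\le K_n\left(\frac{\|k\|_{L^1(0,t)}}{t}\right)^{n/4}\|u_0\|_{L^1(\mathbb{R}^n)},\quad t>0.$$
   Context: Kernel. $k\in L^1_{loc}(\mathbb{R}_+)$ (integrable on $(0,T)$ for every $T>0$) satisfies: (C1) the Laplace transform $\hat k(s)=\int_0^\infty k(t)e^{-ts}\,dt$ exists for all $s>0$; (C2) $\hat k$ is a Stieltjes function, i.e. $\hat k(s)=\frac{a}{s}+b+\int_{(0,\infty)}\frac{1}{s+r}\,\sigma(dr)$ for $s>0$, with $a,b\ge0$ and $\sigma$ a nonnegative measure on $(0,\infty)$ with $\int_{(0,\infty)}(1+r)^{-1}\sigma(dr)<\infty$; (C3) $\hat k(s)\to0$ and $s\hat k(s)\to\infty$ as $s\to\infty$; (C4) $\hat k(s)\to\infty$ and $s\hat k(s)\to0$ as $s\to0$. General Caputo-type operator (acting on the time variable): $\mathscr{D}_{(k)}v(t)=\frac{d}{dt}\int_0^t k(t-\tau)v(\tau)\,d\tau-k(t)v(0)$. Fourier transform: $\tilde w(\xi)=Fw(\xi)=(2\pi)^{-n/2}\int_{\mathbb{R}^n}w(x)e^{-ix\xi}\,dx$ (extended to $L^2$ as usual), with inverse $F^{-1}w(x)=(2\pi)^{-n/2}\int_{\mathbb{R}^n}w(\xi)e^{ix\xi}\,d\xi$. The Laplacian is $\triangle w=-F^{-1}(|\xi|^2\tilde w(\xi))$,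 and $\|w\|_{H^2(\mathbb{R}^n)}=\|(1+|\cdot|^2)\tilde w\|_{L^2(\mathbb{R}^n)}$. Solution. Solutions are understood via the spatial Fourier transform: $u$ solves the Cauchy problem if $\tilde u(t,\xi)$ (Fourier transform in $x$, for a suitable representative) is such that for almost every $\xi$ the function $t\mapsto\tilde u(t,\xi)$ is continuous on $[0,\infty)$, $\tilde u(0,\xi)=\tilde u_0(\xi)$, and $\mathscr{D}_{(k)}\tilde u(t,\xi)=-|\xi|^2\tilde u(t,\xi)$ for $t>0$. Correspondingly $\mathscr{D}_{(k)}u(t,\cdot)$ is the function whose spatial Fourier transform is $\mathscr{D}_{(k)}\tilde u(t,\cdot)$. *)

theory Defs
  imports "HOL-Analysis.Analysis" "HOL-Probability.Essential_Supremum"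
begin

text \<open>
  Function spaces are taken with respect to Lebesgue measure. Elements of \<open>L\<^sup>p\<close> are represented by
  functions, and all notions below are invariant under changes on null sets.
\<close>

section \<open>Kernels\<close>

definition L1_loc :: "(real \<Rightarrow> real) \<Rightarrow> bool" where
  "L1_loc k \<longleftrightarrow> (\<forall>T>0. set_integrable lebesgue {0<..<T} k)"

definition L1_norm_upto :: "(real \<Rightarrow> real) \<Rightarrow> real \<Rightarrow> real" where
  "L1_norm_upto k t = (LINT \<tau>:{0<..<t}|lebesgue. \<bar>k \<tau>\<bar>)"

definition laplace :: "(real \<Rightarrow> real) \<Rightarrow> real \<Rightarrow> real" where
  "laplace k s = (LINT t:{0<..}|lebesgue. k t * exp (- t * s))"

definition stieltjes_function :: "(real \<Rightarrow> real) \<Rightarrow> bool" where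
  "stieltjes_function f \<longleftrightarrow>
     (\<exists>a b \<sigma>. 0 \<le> a \<and> 0 \<le> b \<and> sets \<sigma> = sets (restrict_space borel {0<..}) \<and>
        integrable \<sigma> (\<lambda>r. 1 / (1 + r)) \<and>
        (\<forall>s>0. f s = a / s + b + (LINT r|\<sigma>. 1 / (s + r))))"

definition admissible_kernel :: "(real \<Rightarrow> real) \<Rightarrow> bool" where
  "admissible_kernel k \<longleftrightarrow>
     L1_loc k \<and>
     (\<forall>s>0. set_integrable lebesgue {0<..} (\<lambda>t. k t * exp (- t * s))) \<and>
     stieltjes_function (laplace k) \<and>
     (laplace k \<longlongrightarrow> 0) at_top \<and> filterlim (\<lambda>s. s * laplace k s) at_top at_top \<and>
     filterlim (laplace k) at_top (at_right 0) \<and> ((\<lambda>s. s * laplace k s) \<longlongrightarrow> 0) (at_right 0)"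

text \<open>
  A kernel is an element of \<open>L\<^sup>1\<^sub>l\<^sub>o\<^sub>c\<close>, i.e. a class modulo null sets, but the operator below
  evaluates it at a point. The pointwise value is that of the continuous representative on
  \<open>(0,\<infty>)\<close>. It is unique there, and it exists for every admissible kernel: by uniqueness of
  the Laplace transform, \<open>k\<close> agrees almost everywhere with the Laplace transform of \<open>\<sigma>\<close>
  (\<open>a = b = 0\<close> by the limit conditions).
\<close>

definition cont_rep :: "(real \<Rightarrow> real) \<Rightarrow> real \<Rightarrow> real" where
  "cont_rep k = (SOME h. continuous_on {0<..} h \<and> (AE t in lebesgue. 0 < t \<longrightarrow> h t = k t))"

lemma cont_rep_unique:
  assumes h: "continuous_on {0<..} h" and eq: "AE t in lebesgue. 0 < t \<longrightarrow> h t = k t"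
    and t: "0 < t"
  shows "cont_rep k t = h t"
proof -
  let ?c = "cont_rep k"
  have c: "continuous_on {0<..} ?c \<and> (AE t in lebesgue. 0 < t \<longrightarrow> ?c t = k t)"
    unfolding cont_rep_def by (rule someI[of _ h]) (use h eq in blast)
  let ?N = "{x \<in> {0<..}. ?c x - h x \<noteq> 0}"
  have "continuous_on {0<..} (\<lambda>x. ?c x - h x)"
    using c h by (intro continuous_on_diff) auto
  then have "open ((\<lambda>x. ?c x - h x) -` (- {0}) \<inter> {0<..})"
    by (metis continuous_on_open_vimage open_greaterThan open_Compl closed_singleton)
  moreover have "(\<lambda>x. ?c x - h x) -` (- {0}) \<inter> {0<..} = ?N" by auto
  ultimately have op: "open ?N" by simp
  have "AE t in lebesgue. 0 < t \<longrightarrow> ?c t = h t"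
    using conjunct2[OF c] eq by eventually_elim auto
  then have "AE t in lebesgue. t \<notin> ?N"
    by (rule AE_mp) (rule AE_I2, auto)
  then have "negligible ?N"
    using AE_iff_null_sets[of ?N lebesgue] op by (simp add: negligible_iff_null_sets)
  then have "?N = {}" using op open_not_negligible by blast
  then show ?thesis using t by auto
qed

lemma cont_rep_continuous:
  assumes "continuous_on {0<..} k" "0 < t"
  shows "cont_rep k t = k t"
  using assms by (intro cont_rep_unique) auto


section \<open>The Caputo-type operator\<close>

definition time_conv :: "(real \<Rightarrow> real) \<Rightarrow> (real \<Rightarrow> complex) \<Rightarrow> real \<Rightarrow> complex" where
  "time_conv k v t = (LINT \<tau>:{0..t}|lebesgue. k (t - \<tau>) *\<^sub>R v \<tau>)"

definition caputo_exists :: "(real \<Rightarrow> real) \<Rightarrow> (real \<Rightarrow> complex) \<Rightarrow> real \<Rightarrow> bool" where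
  "caputo_exists k v t \<longleftrightarrow> time_conv k v differentiable (at t)"

definition caputo :: "(real \<Rightarrow> real) \<Rightarrow> (real \<Rightarrow> complex) \<Rightarrow> real \<Rightarrow> complex" where
  "caputo k v t = vector_derivative (time_conv k v) (at t) - k t *\<^sub>R v 0"


section \<open>Lebesgue spaces and the Fourier transform\<close>

definition L1 :: "(real ^ 'n \<Rightarrow> complex) \<Rightarrow> bool" where
  "L1 w \<longleftrightarrow> integrable lebesgue w"

definition L1_norm :: "(real ^ 'n \<Rightarrow> complex) \<Rightarrow> real" where
  "L1_norm w = (LINT x|lebesgue. norm (w x))"

definition L2 :: "(real ^ 'n \<Rightarrow> complex) \<Rightarrow> bool" where
  "L2 w \<longleftrightarrow> w \<in> borel_measurable lebesgue \<and> integrable lebesgue (\<lambda>x. (norm (w x))\<^sup>2)"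

definition L2_norm :: "(real ^ 'n \<Rightarrow> complex) \<Rightarrow> real" where
  "L2_norm w = sqrt (LINT x|lebesgue. (norm (w x))\<^sup>2)"

definition Linf_norm :: "(real ^ 'n \<Rightarrow> complex) \<Rightarrow> ereal" where
  "Linf_norm w = esssup lebesgue (\<lambda>x. ereal (norm (w x)))"

definition fourier :: "(real ^ 'n \<Rightarrow> complex) \<Rightarrow> real ^ 'n \<Rightarrow> complex" where
  "fourier w \<xi> = ((2 * pi) powr (- (real CARD('n) / 2))) *\<^sub>R
     (LINT x|lebesgue. w x * exp (- \<i> * complex_of_real (x \<bullet> \<xi>)))"

text \<open>
  The extension to \<open>L\<^sup>2\<close>: \<open>g\<close> is the \<open>L\<^sup>2\<close>-limit, as \<open>R \<rightarrow> \<infty>\<close>, of the Fourier integrals of the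
  truncations of \<open>w\<close> to balls of radius \<open>R\<close>, which lie in \<open>L\<^sup>1\<close> and \<open>L\<^sup>2\<close> and converge to \<open>w\<close>.
  This determines \<open>g\<close> almost everywhere.
\<close>

definition is_fourier :: "(real ^ 'n \<Rightarrow> complex) \<Rightarrow> (real ^ 'n \<Rightarrow> complex) \<Rightarrow> bool" where
  "is_fourier w g \<longleftrightarrow> L2 w \<and> L2 g \<and>
     ((\<lambda>R. L2_norm (\<lambda>\<xi>. fourier (\<lambda>x. indicator (cball 0 R) x *\<^sub>R w x) \<xi> - g \<xi>)) \<longlongrightarrow> 0) at_top"

definition fourier_L2 :: "(real ^ 'n \<Rightarrow> complex) \<Rightarrow> real ^ 'n \<Rightarrow> complex" where
  "fourier_L2 w = (SOME g. is_fourier w g)"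

definition H2 :: "(real ^ 'n \<Rightarrow> complex) \<Rightarrow> bool" where
  "H2 w \<longleftrightarrow> L2 w \<and> L2 (\<lambda>\<xi>. (1 + (norm \<xi>)\<^sup>2) *\<^sub>R fourier_L2 w \<xi>)"

definition H2_norm :: "(real ^ 'n \<Rightarrow> complex) \<Rightarrow> real" where
  "H2_norm w = L2_norm (\<lambda>\<xi>. (1 + (norm \<xi>)\<^sup>2) *\<^sub>R fourier_L2 w \<xi>)"

definition continuous_into_L2 :: "real set \<Rightarrow> (real \<Rightarrow> real ^ 'n \<Rightarrow> complex) \<Rightarrow> bool" where
  "continuous_into_L2 S u \<longleftrightarrow> (\<forall>t\<in>S. L2 (u t)) \<and>
     (\<forall>t\<in>S. ((\<lambda>r. L2_norm (\<lambda>x. u r x - u t x)) \<longlongrightarrow> 0) (at t within S))"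

definition continuous_into_H2 :: "real set \<Rightarrow> (real \<Rightarrow> real ^ 'n \<Rightarrow> complex) \<Rightarrow> bool" where
  "continuous_into_H2 S u \<longleftrightarrow> (\<forall>t\<in>S. H2 (u t)) \<and>
     (\<forall>t\<in>S. ((\<lambda>r. H2_norm (\<lambda>x. u r x - u t x)) \<longlongrightarrow> 0) (at t within S))"


section \<open>Solutions of the Cauchy problem\<close>

text \<open>
  \<open>U\<close> is a suitable representative of the spatial Fourier transform of \<open>u\<close>, i.e. one whose
  time sections are continuous.
\<close>

definition fourier_rep ::
  "(real \<Rightarrow> real ^ 'n \<Rightarrow> complex) \<Rightarrow> (real \<Rightarrow> real ^ 'n \<Rightarrow> complex) \<Rightarrow> bool" where
  "fourier_rep u U \<longleftrightarrow> (\<forall>t\<ge>0. is_fourier (u t) (U t)) \<and>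
     (AE \<xi> in lebesgue. continuous_on {0..} (\<lambda>t. U t \<xi>))"

definition solution ::
  "(real \<Rightarrow> real) \<Rightarrow> (real ^ 'n \<Rightarrow> complex) \<Rightarrow> (real \<Rightarrow> real ^ 'n \<Rightarrow> complex) \<Rightarrow> bool" where
  "solution k u0 u \<longleftrightarrow>
     (\<exists>U U0. fourier_rep u U \<and> is_fourier u0 U0 \<and>
        (AE \<xi> in lebesgue. U 0 \<xi> = U0 \<xi> \<and>
           (\<forall>t>0. caputo_exists (cont_rep k) (\<lambda>s. U s \<xi>) t \<and>
              caputo (cont_rep k) (\<lambda>s. U s \<xi>) t = - ((norm \<xi>)\<^sup>2 *\<^sub>R U t \<xi>))))"

text \<open>
  \<open>w\<close> is the function whose spatial Fourier transform is the Caputo-type derivative at time \<open>t\<close>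
  of the spatial Fourier transform of \<open>u\<close>; it is determined almost everywhere.
\<close>

definition is_space_caputo ::
  "(real \<Rightarrow> real) \<Rightarrow> (real \<Rightarrow> real ^ 'n \<Rightarrow> complex) \<Rightarrow> real \<Rightarrow> (real ^ 'n \<Rightarrow> complex) \<Rightarrow> bool" where
  "is_space_caputo k u t w \<longleftrightarrow>
     (\<exists>U. fourier_rep u U \<and> (AE \<xi> in lebesgue. caputo_exists (cont_rep k) (\<lambda>s. U s \<xi>) t) \<and>
        is_fourier w (\<lambda>\<xi>. caputo (cont_rep k) (\<lambda>s. U s \<xi>) t))"

end

theory Submission
  imports Defs "HOL-Probability.Probability" "HOL-Real_Asymp.Real_Asymp"
begin

text \<open>
  In Fourier variables the problem is the scalar relaxation equation with parameter
  \<open>lam = |\<xi>|\<^sup>2\<close>. By uniqueness of the Laplace transform the kernel is \<open>\<integral> e\<^sup>-\<^sup>r\<^sup>t d\<sigma>(r)\<close>, so it is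
  convex and decreasing and blows up at \<open>0\<close>. Shifting it by \<open>\<epsilon>\<close> makes it bounded at \<open>0\<close> and turns
  the equation into a renewal equation, whose solution is a power series in \<open>1 / (k(\<epsilon>) + lam)\<close>
  with nonnegative coefficients that do not depend on \<open>lam\<close>. These solutions decrease in time, take
  values in \<open>[0, 1]\<close>, and increase as \<open>\<epsilon>\<close> tends to \<open>0\<close>; the limit \<open>s\<close> is the relaxation function.
  Monotonicity in time and the integrated equation give \<open>lam s(t) \<le> \<parallel>k\<parallel>\<^sub>1 / t\<close>, hence all the norm bounds.
  Powers of the resolvent \<open>(c - \<triangle>)\<^sup>-\<^sup>1\<close> are limits of positive combinations of Gaussian convolutions, so
  \<open>s(t, - \<triangle>)\<close> preserves positivity and contracts \<open>L\<^sup>\<infinity>\<close>.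
\<close>

section \<open>Square integrable functions\<close>

text \<open>The equation itself is not a renewal equation, because - k' has infinite mass near 0.
  After the shift this mass is the finite number k(\<epsilon>), and division by k(\<epsilon>) + lam
  leaves a kernel of mass below 1 when lam > 0. Prolonging the solution by 1 to negative times
  absorbs the initial value, so that positivity, the bound by 1 and monotonicity pass through the
  iteration one step at a time. That the coefficients do not see lam is what permits replacing lam
  by - \<triangle>: a partial sum becomes a positive combination of powers of one resolvent, and its
  value at lam = 0, at most 1, bounds it on L^\<infinity>. With A = ||k||_1 / t, the estimates lam s
  \<le> A and s \<le> 1 bound the symbol by min(1, A / |\<xi>|^2). The L2 norm of this majorant is a
  multiple of A^(n/4) and is finite exactly for n < 4, which explains the exponent, the restriction
  on the dimension and K_n. Continuity of s down to t = 0 comes from the blow-up of the kernel,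
  through a modulus of continuity of order lam / k(h).\<close>

lemma L2_measurable [measurable_dest]: "L2 f \<Longrightarrow> f \<in> borel_measurable lebesgue"
  by (simp add: L2_def)

lemma L2_integrable: "L2 f \<Longrightarrow> integrable lebesgue (\<lambda>x. (norm (f x))\<^sup>2)"
  by (simp add: L2_def)

lemma L2_norm_nonneg [simp]: "0 \<le> L2_norm f"
  by (simp add: L2_norm_def)

lemma L2_norm_power2: "(L2_norm f)\<^sup>2 = (LINT x|lebesgue. (norm (f x))\<^sup>2)"
  by (simp add: L2_norm_def)

lemma L2_bound:
  fixes f g :: "real ^ 'n \<Rightarrow> complex"
  assumes [measurable]: "f \<in> borel_measurable lebesgue" and g: "L2 g" and C: "0 \<le> C"
    and le: "AE x in lebesgue. norm (f x) \<le> C * norm (g x)"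
  shows "L2 f" "L2_norm f \<le> C * L2_norm g"
proof -
  have le2: "AE x in lebesgue. (norm (f x))\<^sup>2 \<le> C\<^sup>2 * (norm (g x))\<^sup>2"
    using le by eventually_elim (metis norm_ge_zero power_mono power_mult_distrib)
  have ig: "integrable lebesgue (\<lambda>x. C\<^sup>2 * (norm (g x))\<^sup>2)"
    using L2_integrable[OF g] by simp
  have i: "integrable lebesgue (\<lambda>x. (norm (f x))\<^sup>2)"
    by (rule Bochner_Integration.integrable_bound[OF ig]) (use le2 in auto)
  show "L2 f" using i by (simp add: L2_def)
  have "(LINT x|lebesgue. (norm (f x))\<^sup>2) \<le> (LINT x|lebesgue. C\<^sup>2 * (norm (g x))\<^sup>2)"
    using i ig le2 by (intro integral_mono_AE) auto
  then have "(L2_norm f)\<^sup>2 \<le> (C * L2_norm g)\<^sup>2"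
    by (simp add: L2_norm_power2 power_mult_distrib)
  then show "L2_norm f \<le> C * L2_norm g"
    using C by (meson L2_norm_nonneg mult_nonneg_nonneg power2_le_imp_le)
qed

lemma L2_zero: "L2 (\<lambda>x::real^'n. 0)" and L2_norm_zero: "L2_norm (\<lambda>x::real^'n. 0) = 0"
  by (auto simp: L2_def L2_norm_def)

text \<open>Lebesgue measure is complete, so a preimage that differs from a measurable set by a null
  set is itself measurable.\<close>

lemma measurable_lebesgue_cong_AE:
  fixes f :: "'a::euclidean_space \<Rightarrow> 'b::topological_space"
  assumes f: "f \<in> borel_measurable lebesgue" and eq: "AE x in lebesgue. f x = g x"
  shows "g \<in> borel_measurable lebesgue"
proof (rule borel_measurableI)
  fix S :: "'b set" assume S: "open S"
  have A: "f -` S \<inter> space lebesgue \<in> sets lebesgue"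
    using f S by (metis borel_open measurable_sets)
  show "g -` S \<inter> space lebesgue \<in> sets lebesgue"
  proof (rule complete_measure.in_sets_AE[OF _ _ A])
    show "complete_measure lebesgue" ..
    show "AE x in lebesgue. (x \<in> f -` S \<inter> space lebesgue) = (x \<in> g -` S \<inter> space lebesgue)"
      using eq by eventually_elim auto
  qed auto
qed

lemma L2_cong_AE:
  fixes f g :: "real ^ 'n \<Rightarrow> complex"
  assumes "L2 f" "AE x in lebesgue. f x = g x"
  shows "L2 g"
proof (rule L2_bound(1)[OF _ assms(1), of _ 1])
  show "g \<in> borel_measurable lebesgue"
    using assms by (auto intro: measurable_lebesgue_cong_AE L2_measurable)
  show "AE x in lebesgue. norm (g x) \<le> 1 * norm (f x)"
    using assms(2) by eventually_elim auto
qed auto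

lemma L2_norm_cong_AE:
  fixes f g :: "real ^ 'n \<Rightarrow> complex"
  assumes "f \<in> borel_measurable lebesgue" "AE x in lebesgue. f x = g x"
  shows "L2_norm f = L2_norm g"
  unfolding L2_norm_def
  by (rule arg_cong[where f=sqrt], rule integral_cong_AE)
     (use assms measurable_lebesgue_cong_AE[OF assms] in auto)

lemma L2_scaleR: "L2 f \<Longrightarrow> L2 (\<lambda>x::real^'n. c *\<^sub>R f x)"
  by (rule L2_bound(1)[of _ f "\<bar>c\<bar>"]) auto

lemma L2_cnj: "L2 f \<Longrightarrow> L2 (\<lambda>x::real^'n. cnj (f x))"
  by (rule L2_bound(1)[of _ f 1])
    (auto intro!: measurable_compose[OF L2_measurable, of f cnj] borel_measurable_continuous_onI continuous_intros)

lemma L2_norm_cnj [simp]: "L2_norm (\<lambda>x::real^'n. cnj (f x)) = L2_norm f"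
  by (simp add: L2_norm_def)

lemma L2_norm_uminus: "L2_norm (\<lambda>x::real^'n. f x - g x) = L2_norm (\<lambda>x. g x - f x)"
  by (simp add: L2_norm_def norm_minus_commute)

lemma L2_add:
  fixes f g :: "real ^ 'n \<Rightarrow> complex"
  assumes f: "L2 f" and g: "L2 g"
  shows "L2 (\<lambda>x. f x + g x)"
  unfolding L2_def
proof
  note [measurable] = L2_measurable[OF f] L2_measurable[OF g]
  show "(\<lambda>x. f x + g x) \<in> borel_measurable lebesgue" by simp
  have i: "integrable lebesgue (\<lambda>x. 2 * (norm (f x))\<^sup>2 + 2 * (norm (g x))\<^sup>2)"
    using L2_integrable[OF f] L2_integrable[OF g] by simp
  have "(norm (f x + g x))\<^sup>2 \<le> 2 * (norm (f x))\<^sup>2 + 2 * (norm (g x))\<^sup>2" for x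
  proof -
    have "(norm (f x + g x))\<^sup>2 \<le> (norm (f x) + norm (g x))\<^sup>2"
      by (simp add: norm_triangle_ineq power_mono)
    also have "\<dots> \<le> 2 * (norm (f x))\<^sup>2 + 2 * (norm (g x))\<^sup>2"
      using sum_squares_bound[of "norm (f x)" "norm (g x)"] by (simp add: power2_sum)
    finally show ?thesis .
  qed
  then show "integrable lebesgue (\<lambda>x. (norm (f x + g x))\<^sup>2)"
    by (intro Bochner_Integration.integrable_bound[OF i]) auto
qed

lemma L2_diff: "L2 f \<Longrightarrow> L2 g \<Longrightarrow> L2 (\<lambda>x::real^'n. f x - g x)"
  using L2_add[of f "\<lambda>x. (-1) *\<^sub>R g x"] L2_scaleR[of g "-1"] by simp

lemma L2_prod_integrable:
  fixes f g :: "real ^ 'n \<Rightarrow> complex"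
  assumes f: "L2 f" and g: "L2 g"
  shows "integrable lebesgue (\<lambda>x. f x * g x)" "integrable lebesgue (\<lambda>x. norm (f x) * norm (g x))"
proof -
  note [measurable] = L2_measurable[OF f] L2_measurable[OF g]
  have i: "integrable lebesgue (\<lambda>x. (norm (f x))\<^sup>2 + (norm (g x))\<^sup>2)"
    using L2_integrable[OF f] L2_integrable[OF g] by simp
  have b: "norm (f x) * norm (g x) \<le> (norm (f x))\<^sup>2 + (norm (g x))\<^sup>2" for x
    using sum_squares_bound[of "norm (f x)" "norm (g x)"]
      mult_nonneg_nonneg[OF norm_ge_zero[of "f x"] norm_ge_zero[of "g x"]] by linarith
  show "integrable lebesgue (\<lambda>x. f x * g x)"
    by (rule Bochner_Integration.integrable_bound[OF i]) (use b in \<open>auto simp: norm_mult\<close>)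
  show "integrable lebesgue (\<lambda>x. norm (f x) * norm (g x))"
    by (rule Bochner_Integration.integrable_bound[OF i]) (use b in \<open>auto simp: norm_mult\<close>)
qed

text \<open>The integral of (|f| - t |g|)^2 is nonnegative for every real t. The minimizer t = I / B
  yields the inequality; for B = 0 the quadratic is affine in t and would take the value -1 at some
  t unless I = 0.\<close>

lemma L2_Cauchy_Schwarz:
  fixes f g :: "real ^ 'n \<Rightarrow> complex"
  assumes f: "L2 f" and g: "L2 g"
  shows "(LINT x|lebesgue. norm (f x) * norm (g x)) \<le> L2_norm f * L2_norm g"
    "norm (LINT x|lebesgue. f x * g x) \<le> L2_norm f * L2_norm g"
proof -
  define I where "I = (LINT x|lebesgue. norm (f x) * norm (g x))"
  define A where "A = (LINT x|lebesgue. (norm (f x))\<^sup>2)"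
  define B where "B = (LINT x|lebesgue. (norm (g x))\<^sup>2)"
  note i = L2_integrable[OF f] L2_integrable[OF g] L2_prod_integrable(2)[OF f g]
  have q: "0 \<le> A - 2 * t * I + t\<^sup>2 * B" for t
  proof -
    have "0 \<le> (LINT x|lebesgue. (norm (f x) - t * norm (g x))\<^sup>2)" by simp
    also have "\<dots> = (LINT x|lebesgue. (norm (f x))\<^sup>2 - 2 * t * (norm (f x) * norm (g x)) + t\<^sup>2 * (norm (g x))\<^sup>2)"
      by (intro Bochner_Integration.integral_cong refl) (simp add: power2_eq_square algebra_simps)
    also have "\<dots> = A - 2 * t * I + t\<^sup>2 * B"
      unfolding A_def B_def I_def using i by simp
    finally show ?thesis .
  qed
  have I0: "0 \<le> I" unfolding I_def by simp
  have A0: "0 \<le> A" unfolding A_def by simp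
  have B0: "0 \<le> B" unfolding B_def by simp
  have "I\<^sup>2 \<le> A * B"
  proof (cases "B = 0")
    case True
    have "I = 0"
    proof (rule ccontr)
      assume "I \<noteq> 0"
      then show False using q[of "(A + 1) / (2 * I)"] I0 True by simp
    qed
    then show ?thesis using True by simp
  next
    case False
    then show ?thesis using q[of "I / B"] B0
      by (simp add: power2_eq_square field_simps)
  qed
  then have "I\<^sup>2 \<le> (L2_norm f * L2_norm g)\<^sup>2"
    by (simp add: power_mult_distrib L2_norm_power2 A_def B_def)
  then show 1: "(LINT x|lebesgue. norm (f x) * norm (g x)) \<le> L2_norm f * L2_norm g"
    unfolding I_def by (meson L2_norm_nonneg mult_nonneg_nonneg power2_le_imp_le)
  have "norm (LINT x|lebesgue. f x * g x) \<le> (LINT x|lebesgue. norm (f x * g x))"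
    by (rule integral_norm_bound)
  with 1 show "norm (LINT x|lebesgue. f x * g x) \<le> L2_norm f * L2_norm g"
    by (simp add: norm_mult)
qed

lemma L2_triangle:
  fixes f g :: "real ^ 'n \<Rightarrow> complex"
  assumes f: "L2 f" and g: "L2 g"
  shows "L2_norm (\<lambda>x. f x + g x) \<le> L2_norm f + L2_norm g"
proof -
  note i = L2_integrable[OF f] L2_integrable[OF g] L2_prod_integrable(2)[OF f g]
  have "(L2_norm (\<lambda>x. f x + g x))\<^sup>2 = (LINT x|lebesgue. (norm (f x + g x))\<^sup>2)"
    by (simp add: L2_norm_power2)
  also have "\<dots> \<le> (LINT x|lebesgue. (norm (f x))\<^sup>2 + 2 * (norm (f x) * norm (g x)) + (norm (g x))\<^sup>2)"
  proof (rule integral_mono)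
    show "integrable lebesgue (\<lambda>x. (norm (f x + g x))\<^sup>2)"
      using L2_integrable[OF L2_add[OF f g]] .
    show "(norm (f x + g x))\<^sup>2 \<le> (norm (f x))\<^sup>2 + 2 * (norm (f x) * norm (g x)) + (norm (g x))\<^sup>2" for x
      using power_mono[OF norm_triangle_ineq[of "f x" "g x"], of 2] by (simp add: power2_sum)
  qed (use i in auto)
  also have "\<dots> = (L2_norm f)\<^sup>2 + 2 * (LINT x|lebesgue. norm (f x) * norm (g x)) + (L2_norm g)\<^sup>2"
    using i by (simp add: L2_norm_power2)
  also have "\<dots> \<le> (L2_norm f + L2_norm g)\<^sup>2"
    using L2_Cauchy_Schwarz(1)[OF f g] by (simp add: power2_sum)
  finally show ?thesis by (meson L2_norm_nonneg add_nonneg_nonneg power2_le_imp_le)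
qed

lemma L2_triangle_diff:
  fixes f g h :: "real ^ 'n \<Rightarrow> complex"
  assumes "L2 f" "L2 g" "L2 h"
  shows "L2_norm (\<lambda>x. f x - h x) \<le> L2_norm (\<lambda>x. f x - g x) + L2_norm (\<lambda>x. g x - h x)"
  using L2_triangle[OF L2_diff[OF assms(1,2)] L2_diff[OF assms(2,3)]] by simp

lemma L2_norm_diff_le:
  fixes f g :: "real ^ 'n \<Rightarrow> complex"
  assumes "L2 f" "L2 g"
  shows "\<bar>L2_norm f - L2_norm g\<bar> \<le> L2_norm (\<lambda>x. f x - g x)"
  using L2_triangle_diff[OF assms L2_zero] L2_triangle_diff[OF assms(2,1) L2_zero]
  by (simp add: L2_norm_uminus[of g f])

lemma L2_norm_eq_0_AE:
  fixes f :: "real ^ 'n \<Rightarrow> complex"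
  assumes "L2 f" "L2_norm f = 0"
  shows "AE x in lebesgue. f x = 0"
  using integral_nonneg_eq_0_iff_AE[OF L2_integrable[OF assms(1)]] assms(2)
  by (simp add: L2_norm_def)

lemma L2_eq_AE:
  fixes f g :: "real ^ 'n \<Rightarrow> complex"
  assumes "L2 f" "L2 g" "L2_norm (\<lambda>x. f x - g x) = 0"
  shows "AE x in lebesgue. f x = g x"
  using L2_norm_eq_0_AE[OF L2_diff[OF assms(1,2)] assms(3)] by simp

lemma L2_tendsto_norm:
  fixes f :: "'a \<Rightarrow> real ^ 'n \<Rightarrow> complex"
  assumes f: "\<forall>\<^sub>F i in F. L2 (f i)" and g: "L2 g" and "((\<lambda>i. L2_norm (\<lambda>x. f i x - g x)) \<longlongrightarrow> 0) F"
  shows "((\<lambda>i. L2_norm (f i)) \<longlongrightarrow> L2_norm g) F"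
proof -
  have "((\<lambda>i. L2_norm (f i) - L2_norm g) \<longlongrightarrow> 0) F"
    by (rule Lim_null_comparison[OF _ assms(3)])
       (use f in \<open>auto elim!: eventually_mono intro!: L2_norm_diff_le g\<close>)
  then show ?thesis by (simp add: LIM_zero_iff)
qed

section \<open>Convergence and completeness in L2\<close>

text \<open>The norm bound is required only eventually, so that tails of Cauchy sequences can be
  inserted; square integrability and the bound then pass to the pointwise limit together.\<close>

lemma L2_Fatou:
  fixes f :: "nat \<Rightarrow> real ^ 'n \<Rightarrow> complex"
  assumes f: "\<And>j. L2 (f j)" and g: "g \<in> borel_measurable lebesgue"
    and lim: "AE x in lebesgue. (\<lambda>j. f j x) \<longlonglongrightarrow> g x" and B: "\<forall>\<^sub>F j in sequentially. L2_norm (f j) \<le> B"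
  shows "L2 g" "L2_norm g \<le> B"
proof -
  note [measurable] = L2_measurable[OF f] g
  have B0: "0 \<le> B" using B
    by (auto dest!: eventually_happens'[OF sequentially_bot] intro: order_trans[OF L2_norm_nonneg])
  have "(\<integral>\<^sup>+x. ennreal ((norm (g x))\<^sup>2) \<partial>lebesgue) = (\<integral>\<^sup>+x. liminf (\<lambda>j. ennreal ((norm (f j x))\<^sup>2)) \<partial>lebesgue)"
  proof (rule nn_integral_cong_AE)
    show "AE x in lebesgue. ennreal ((norm (g x))\<^sup>2) = liminf (\<lambda>j. ennreal ((norm (f j x))\<^sup>2))"
      using lim
    proof eventually_elim
      case (elim x)
      have "(\<lambda>j. ennreal ((norm (f j x))\<^sup>2)) \<longlonglongrightarrow> ennreal ((norm (g x))\<^sup>2)"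
        by (intro tendsto_intros elim)
      then show ?case by (rule lim_imp_Liminf[OF sequentially_bot, symmetric])
    qed
  qed
  also have "\<dots> \<le> liminf (\<lambda>j. \<integral>\<^sup>+x. ennreal ((norm (f j x))\<^sup>2) \<partial>lebesgue)"
    by (rule nn_integral_liminf) auto
  also have "\<dots> \<le> ennreal (B\<^sup>2)"
  proof (rule Liminf_le)
    show "\<forall>\<^sub>F j in sequentially. (\<integral>\<^sup>+x. ennreal ((norm (f j x))\<^sup>2) \<partial>lebesgue) \<le> ennreal (B\<^sup>2)"
      using B
    proof eventually_elim
      case (elim j)
      have "(\<integral>\<^sup>+x. ennreal ((norm (f j x))\<^sup>2) \<partial>lebesgue) = ennreal ((L2_norm (f j))\<^sup>2)"
        unfolding L2_norm_power2 by (rule nn_integral_eq_integral[OF L2_integrable[OF f]]) auto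
      also have "\<dots> \<le> ennreal (B\<^sup>2)" using elim by (intro ennreal_leI power_mono) auto
      finally show ?case .
    qed
  qed simp
  finally have le: "(\<integral>\<^sup>+x. ennreal ((norm (g x))\<^sup>2) \<partial>lebesgue) \<le> ennreal (B\<^sup>2)" .
  have i: "integrable lebesgue (\<lambda>x. (norm (g x))\<^sup>2)"
    by (rule integrableI_bounded) (use le_less_trans[OF le] in auto)
  show "L2 g" using i g by (simp add: L2_def)
  have "ennreal ((L2_norm g)\<^sup>2) \<le> ennreal (B\<^sup>2)"
    unfolding L2_norm_power2 using le nn_integral_eq_integral[OF i] by simp
  then have "(L2_norm g)\<^sup>2 \<le> B\<^sup>2" by (simp only: ennreal_le_iff zero_le_power2)
  then show "L2_norm g \<le> B" using B0 by (rule power2_le_imp_le)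
qed

lemma L2_dominated:
  fixes f :: "nat \<Rightarrow> real ^ 'n \<Rightarrow> complex"
  assumes [measurable]: "\<And>j. f j \<in> borel_measurable lebesgue" "g \<in> borel_measurable lebesgue" and h: "L2 h"
    and lim: "AE x in lebesgue. (\<lambda>j. f j x) \<longlonglongrightarrow> g x"
    and le: "\<And>j. AE x in lebesgue. norm (f j x) \<le> norm (h x)"
  shows "\<And>j. L2 (f j)" "L2 g" "(\<lambda>j. L2_norm (\<lambda>x. f j x - g x)) \<longlonglongrightarrow> 0"
proof -
  show Lf: "L2 (f j)" for j by (rule L2_bound(1)[OF _ h, of _ 1]) (use le in auto)
  show "L2 g"
  proof (rule L2_Fatou(1)[OF Lf _ lim])
    have "L2_norm (f j) \<le> 1 * L2_norm h" for j
      by (rule L2_bound(2)[OF _ h]) (use le in auto)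
    then show "\<forall>\<^sub>F j in sequentially. L2_norm (f j) \<le> L2_norm h" by simp
  qed simp
  have g: "AE x in lebesgue. norm (g x) \<le> norm (h x)"
  proof -
    have "AE x in lebesgue. \<forall>j. norm (f j x) \<le> norm (h x)" using le by (simp add: AE_all_countable)
    then show ?thesis using lim
    proof eventually_elim
      case (elim x)
      show ?case using Lim_bounded[OF tendsto_norm[OF elim(2)]] elim(1) by auto
    qed
  qed
  have "(\<lambda>j. LINT x|lebesgue. (norm (f j x - g x))\<^sup>2) \<longlonglongrightarrow> (LINT x::real^'n|lebesgue. 0)"
  proof (rule integral_dominated_convergence)
    show "integrable lebesgue (\<lambda>x. 4 * (norm (h x))\<^sup>2)" using L2_integrable[OF h] by simp
    show "AE x in lebesgue. (\<lambda>j. (norm (f j x - g x))\<^sup>2) \<longlonglongrightarrow> 0"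
      using lim
    proof eventually_elim
      case (elim x)
      have "(\<lambda>j. (norm (f j x - g x))\<^sup>2) \<longlonglongrightarrow> (norm (g x - g x))\<^sup>2" by (intro tendsto_intros elim)
      then show ?case by simp
    qed
    show "AE x in lebesgue. norm ((norm (f j x - g x))\<^sup>2) \<le> 4 * (norm (h x))\<^sup>2" for j
      using le[of j] g
    proof eventually_elim
      case (elim x)
      have "norm (f j x - g x) \<le> 2 * norm (h x)" using norm_triangle_ineq4[of "f j x" "g x"] elim by linarith
      then have "(norm (f j x - g x))\<^sup>2 \<le> (2 * norm (h x))\<^sup>2" by (intro power_mono) auto
      then show ?case by (simp add: power_mult_distrib)
    qed
  qed auto
  then have "(\<lambda>j. sqrt (LINT x|lebesgue. (norm (f j x - g x))\<^sup>2)) \<longlonglongrightarrow> sqrt 0"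
    by (intro tendsto_real_sqrt) simp
  then show "(\<lambda>j. L2_norm (\<lambda>x. f j x - g x)) \<longlonglongrightarrow> 0" by (simp add: L2_norm_def)
qed

text \<open>The squared differences converge to 0 in L1, which yields an almost everywhere
  convergent subsequence. Pointwise constraints such as positivity survive L2 limits in this
  way.\<close>

lemma L2_tendsto_AE_subseq:
  fixes f :: "nat \<Rightarrow> real ^ 'n \<Rightarrow> complex"
  assumes f: "\<And>j. L2 (f j)" and g: "L2 g" and lim: "(\<lambda>j. L2_norm (\<lambda>x. f j x - g x)) \<longlonglongrightarrow> 0"
  shows "\<exists>r. strict_mono r \<and> (AE x in lebesgue. (\<lambda>j. f (r j) x) \<longlonglongrightarrow> g x)"
proof -
  have "(\<lambda>j. (L2_norm (\<lambda>x. f j x - g x))\<^sup>2) \<longlonglongrightarrow> 0\<^sup>2" by (intro tendsto_intros lim)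
  then have "(\<lambda>j. LINT x|lebesgue. norm ((norm (f j x - g x))\<^sup>2)) \<longlonglongrightarrow> 0"
    by (simp add: L2_norm_power2)
  from tendsto_L1_AE_subseq[OF L2_integrable[OF L2_diff[OF f g]] this]
  obtain r where r: "strict_mono r" "AE x in lebesgue. (\<lambda>n. (norm (f (r n) x - g x))\<^sup>2) \<longlonglongrightarrow> 0"
    by auto
  have "AE x in lebesgue. (\<lambda>j. f (r j) x) \<longlonglongrightarrow> g x"
    using r(2)
  proof eventually_elim
    case (elim x)
    have "(\<lambda>n. sqrt ((norm (f (r n) x - g x))\<^sup>2)) \<longlonglongrightarrow> sqrt 0" by (intro tendsto_intros elim)
    then have "(\<lambda>n. f (r n) x - g x) \<longlonglongrightarrow> 0" by (simp add: tendsto_norm_zero_iff)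
    then show ?case by (simp add: LIM_zero_iff)
  qed
  with r(1) show ?thesis by blast
qed

lemma L2_complete:
  fixes f :: "nat \<Rightarrow> real ^ 'n \<Rightarrow> complex"
  assumes f: "\<And>j. L2 (f j)"
    and Cauchy: "\<And>e. 0 < e \<Longrightarrow> \<exists>N. \<forall>i\<ge>N. \<forall>j\<ge>N. L2_norm (\<lambda>x. f i x - f j x) \<le> e"
  shows "\<exists>g. L2 g \<and> (\<lambda>j. L2_norm (\<lambda>x. f j x - g x)) \<longlonglongrightarrow> 0"
proof -
  obtain N where N: "\<And>k i j. i \<ge> N k \<Longrightarrow> j \<ge> N k \<Longrightarrow> L2_norm (\<lambda>x. f i x - f j x) \<le> (1/2)^k"
    using Cauchy[of "(1/2)^k" for k] by (metis zero_less_divide_1_iff zero_less_numeral zero_less_power)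
  \<comment> \<open>Summing the thresholds makes all later indices admissible at once:
    \<open>r i\<close> is at least \<open>N k\<close> whenever i \<ge> k, without assuming that
    \<open>N\<close> is monotone.\<close>
  define r where "r k = (\<Sum>i\<le>k. N i)" for k
  have rN: "i \<ge> k \<Longrightarrow> r i \<ge> N k" for i k
    unfolding r_def by (rule member_le_sum) auto
  define D where "D k x = f (r (Suc k)) x - f (r k) x" for k x
  have LD: "L2 (D k)" for k unfolding D_def by (intro L2_diff f)
  note [measurable] = L2_measurable[OF LD] L2_measurable[OF f]
  have nD: "L2_norm (D k) \<le> (1/2)^k" for k
    unfolding D_def by (rule N) (auto intro: rN)
  text \<open>The weights \<open>2\<^sup>k\<close> turn square summability into absolute summability of the increments.\<close>
  have "(\<integral>\<^sup>+x. (\<Sum>k. ennreal (2^k * (norm (D k x))\<^sup>2)) \<partial>lebesgue) = (\<Sum>k. \<integral>\<^sup>+x. ennreal (2^k * (norm (D k x))\<^sup>2) \<partial>lebesgue)"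
    by (rule nn_integral_suminf) auto
  also have "\<dots> \<le> (\<Sum>k. ennreal ((1/2)^k))"
  proof (intro suminf_le summableI)
    fix k
    have "(\<integral>\<^sup>+x. ennreal (2^k * (norm (D k x))\<^sup>2) \<partial>lebesgue) = ennreal (LINT x|lebesgue. 2^k * (norm (D k x))\<^sup>2)"
      by (rule nn_integral_eq_integral) (use L2_integrable[OF LD] in auto)
    also have "\<dots> = ennreal (2^k * (L2_norm (D k))\<^sup>2)" by (simp add: L2_norm_power2)
    also have "\<dots> \<le> ennreal (2^k * ((1/2)^k)\<^sup>2)" using nD by (intro ennreal_leI mult_left_mono power_mono) auto
    also have "2^k * ((1/2)^k)\<^sup>2 = (1/2::real)^k" by (simp add: power2_eq_square power_divide)
    finally show "(\<integral>\<^sup>+x. ennreal (2^k * (norm (D k x))\<^sup>2) \<partial>lebesgue) \<le> ennreal ((1/2)^k)" .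
  qed
  also have "\<dots> = ennreal (\<Sum>k. (1/2)^k)" by (rule suminf_ennreal2) auto
  finally have fin: "(\<integral>\<^sup>+x. (\<Sum>k. ennreal (2^k * (norm (D k x))\<^sup>2)) \<partial>lebesgue) \<noteq> \<infinity>"
    by (auto simp: top_unique)
  have "AE x in lebesgue. (\<Sum>k. ennreal (2^k * (norm (D k x))\<^sup>2)) \<noteq> \<infinity>"
    by (rule nn_integral_PInf_AE[OF _ fin]) auto
  then have conv: "AE x in lebesgue. convergent (\<lambda>k. f (r k) x)"
  proof eventually_elim
    case (elim x)
    have "\<exists>C\<ge>0. z = ennreal C" if "z \<noteq> \<infinity>" for z :: ennreal using that by (cases z) auto
    from this[OF elim] obtain C where C: "0 \<le> C" "(\<Sum>k. ennreal (2^k * (norm (D k x))\<^sup>2)) = ennreal C"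
      by (elim exE conjE)
    have "norm (D k x) \<le> sqrt C * (sqrt (1/2))^k" for k
    proof -
      have "ennreal (2^k * (norm (D k x))\<^sup>2) \<le> ennreal C"
        using sum_le_suminf[OF summableI, of "{k}" "\<lambda>k. ennreal (2^k * (norm (D k x))\<^sup>2)"] unfolding C(2) by simp
      then have "2^k * (norm (D k x))\<^sup>2 \<le> C" using C(1) by (simp only: ennreal_le_iff)
      then have "(norm (D k x))\<^sup>2 \<le> C * (1/2)^k" by (simp add: field_simps power_divide)
      then have "sqrt ((norm (D k x))\<^sup>2) \<le> sqrt (C * (1/2)^k)" by (rule real_sqrt_le_mono)
      then show ?thesis by (simp add: real_sqrt_mult real_sqrt_power)
    qed
    moreover have "summable (\<lambda>k. sqrt C * (sqrt (1/2))^k)"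
      by (intro summable_mult summable_geometric) (simp add: real_less_lsqrt)
    ultimately have "summable (\<lambda>k. D k x)"
      using summable_comparison_test'[of _ 0 "\<lambda>k. D k x"] by blast
    then have "convergent (\<lambda>n. \<Sum>k<n. D k x)" by (simp add: summable_iff_convergent)
    moreover have "(\<Sum>k<n. D k x) = f (r n) x - f (r 0) x" for n
      unfolding D_def by (rule sum_lessThan_telescope)
    ultimately have "convergent (\<lambda>n. f (r n) x - f (r 0) x)" by simp
    then have "convergent (\<lambda>n. (f (r n) x - f (r 0) x) + f (r 0) x)"
      by (rule convergent_add) (rule convergent_const)
    then show ?case by simp
  qed
  define g where "g x = lim (\<lambda>k. f (r k) x)" for x
  have g[measurable]: "g \<in> borel_measurable lebesgue"
    unfolding g_def by (rule borel_measurable_lim_metric) simp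
  have lim: "AE x in lebesgue. (\<lambda>k. f (r k) x) \<longlonglongrightarrow> g x"
    using conv by eventually_elim (simp add: g_def convergent_LIMSEQ_iff)
  \<comment> \<open>Fatou in the subsequence index i with j fixed. This bounds the distance of the
    full sequence to g, and shows that g differs from a member of the sequence by an L2
    function.\<close>
  have ev: "L2 (\<lambda>x. f j x - g x) \<and> L2_norm (\<lambda>x. f j x - g x) \<le> (1/2)^k" if j: "j \<ge> N k" for j k
  proof -
    have a: "AE x in lebesgue. (\<lambda>i. f j x - f (r i) x) \<longlonglongrightarrow> f j x - g x"
      using lim by eventually_elim (intro tendsto_intros)
    have b: "\<forall>\<^sub>F i in sequentially. L2_norm (\<lambda>x. f j x - f (r i) x) \<le> (1/2)^k"
      using eventually_ge_at_top[of k] by eventually_elim (intro N j rN)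
    show ?thesis
      using L2_Fatou[of "\<lambda>i x. f j x - f (r i) x", OF L2_diff[OF f f] _ a b] by simp
  qed
  have "L2 (\<lambda>x. f (N 0) x - (f (N 0) x - g x))" by (rule L2_diff[OF f conjunct1[OF ev[OF order_refl]]])
  then have "L2 g" by simp
  moreover have "(\<lambda>j. L2_norm (\<lambda>x. f j x - g x)) \<longlonglongrightarrow> 0"
  proof (rule LIMSEQ_I)
    fix e :: real assume "0 < e"
    then obtain k where k: "(1/2)^k < e" using real_arch_pow_inv[of e "1/2"] by auto
    show "\<exists>no. \<forall>j\<ge>no. norm (L2_norm (\<lambda>x. f j x - g x) - 0) < e"
      using ev[of k] k by (intro exI[of _ "N k"]) force
  qed
  ultimately show ?thesis by blast
qed

text \<open>Double integrals are computed with respect to \<open>lborel\<close>; a Lebesgue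
  measurable function enters them through a Borel function that agrees with it almost
  everywhere.\<close>

lemma borel_version_complex:
  fixes f :: "'a::euclidean_space \<Rightarrow> complex"
  assumes "f \<in> borel_measurable lebesgue"
  obtains f' where "f' \<in> borel_measurable borel" "AE x in lebesgue. f x = f' x"
proof -
  have "(\<lambda>x. Re (f x)) \<in> borel_measurable lebesgue" "(\<lambda>x. Im (f x)) \<in> borel_measurable lebesgue"
    using assms by auto
  from this[THEN completion_ex_borel_measurable_real] obtain a b where ab:
    "a \<in> borel_measurable lborel" "AE x in lborel. Re (f x) = a x"
    "b \<in> borel_measurable lborel" "AE x in lborel. Im (f x) = b x" by blast
  have 1: "(\<lambda>x. Complex (a x) (b x)) \<in> borel_measurable borel"
    using ab(1,3) by (simp add: borel_measurable_complex_iff)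
  have "AE x in lborel. f x = Complex (a x) (b x)"
    using ab(2,4) by eventually_elim (simp add: complex_eq_iff)
  then have 2: "AE x in lebesgue. f x = Complex (a x) (b x)"
    by (simp add: AE_completion_iff)
  from 1 2 show ?thesis by (rule that)
qed

lemma integrable_lebesgue_borel:
  fixes f :: "'a::euclidean_space \<Rightarrow> 'b::{banach, second_countable_topology}"
  assumes "f' \<in> borel_measurable borel" "f \<in> borel_measurable lebesgue" "AE x in lebesgue. f x = f' x"
  shows "integrable lebesgue f \<longleftrightarrow> integrable lborel f'" "integral\<^sup>L lebesgue f = integral\<^sup>L lborel f'"
proof -
  have [measurable]: "f' \<in> borel_measurable lebesgue" using assms(1) by (simp add: measurable_completion)
  have "integrable lebesgue f \<longleftrightarrow> integrable lebesgue f'"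
    by (rule integrable_cong_AE) (use assms in auto)
  also have "\<dots> \<longleftrightarrow> integrable lborel f'" by (rule integrable_completion) (use assms in simp)
  finally show "integrable lebesgue f \<longleftrightarrow> integrable lborel f'" .
  have "integral\<^sup>L lebesgue f = integral\<^sup>L lebesgue f'"
    by (rule integral_cong_AE) (use assms in auto)
  also have "\<dots> = integral\<^sup>L lborel f'" by (rule integral_completion) (use assms in simp)
  finally show "integral\<^sup>L lebesgue f = integral\<^sup>L lborel f'" .
qed

section \<open>Gaussian integrals\<close>

text \<open>This is the characteristic function of the standard normal law, freed from the
  normalizing factor 1 / sqrt (2 pi).\<close>

lemma integral_gauss_1:
  fixes t :: real
  shows "integrable lborel (\<lambda>x::real. exp (- x\<^sup>2 / 2) *\<^sub>R iexp (t * x))"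
    "(LINT x|lborel. exp (- x\<^sup>2 / 2) *\<^sub>R iexp (t * x)) = complex_of_real (sqrt (2 * pi) * exp (- t\<^sup>2 / 2))"
proof -
  have "complex_of_real (exp (- t\<^sup>2 / 2)) = (LINT x|std_normal_distribution. iexp (t * x))"
    using char_std_normal_distribution unfolding char_def by (metis of_real_mult)
  also have "\<dots> = (LINT x|lborel. std_normal_density x *\<^sub>R iexp (t * x))"
    by (rule integral_density) (auto simp: normal_density_nonneg)
  also have "\<dots> = (LINT x|lborel. (1 / sqrt (2 * pi)) *\<^sub>R (exp (- x\<^sup>2 / 2) *\<^sub>R iexp (t * x)))"
    by (intro Bochner_Integration.integral_cong) (auto simp: std_normal_density_def)
  also have "\<dots> = (1 / sqrt (2 * pi)) *\<^sub>R (LINT x|lborel. exp (- x\<^sup>2 / 2) *\<^sub>R iexp (t * x))"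
    by (rule integral_scaleR_right)
  finally have e: "complex_of_real (exp (- t\<^sup>2 / 2)) =
    (1 / sqrt (2 * pi)) *\<^sub>R (LINT x|lborel. exp (- x\<^sup>2 / 2) *\<^sub>R iexp (t * x))" .
  have "sqrt (2 * pi) *\<^sub>R complex_of_real (exp (- t\<^sup>2 / 2)) = (LINT x|lborel. exp (- x\<^sup>2 / 2) *\<^sub>R iexp (t * x))"
    unfolding e by simp
  then show *: "(LINT x|lborel. exp (- x\<^sup>2 / 2) *\<^sub>R iexp (t * x)) = complex_of_real (sqrt (2 * pi) * exp (- t\<^sup>2 / 2))"
    by (metis of_real_mult scaleR_conv_of_real)
  \<comment> \<open>The integral of a nonintegrable function is 0 by convention, and the value just
    computed is not 0.\<close>
  show "integrable lborel (\<lambda>x::real. exp (- x\<^sup>2 / 2) *\<^sub>R iexp (t * x))"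
    using * not_integrable_integral_eq by fastforce
qed

text \<open>The integrand is a product over the coordinates and Lebesgue measure is the image of the
  product measure, so the formula in one dimension multiplies up. Integrability is again read off
  from the nonzero value.\<close>

lemma integral_gauss_std:
  fixes \<xi> :: "'a::euclidean_space"
  shows "integrable lborel (\<lambda>x. exp (- (norm x)\<^sup>2 / 2) *\<^sub>R iexp (x \<bullet> \<xi>))" (is ?I)
    "(LINT x|lborel. exp (- (norm x)\<^sup>2 / 2) *\<^sub>R iexp (x \<bullet> \<xi>)) =
       complex_of_real ((2 * pi) powr (real DIM('a) / 2) * exp (- (norm \<xi>)\<^sup>2 / 2))" (is ?E)
proof -
  interpret P: product_sigma_finite "\<lambda>_::'a. lborel :: real measure" ..
  define F where "F x = exp (- (norm x)\<^sup>2 / 2) *\<^sub>R iexp (x \<bullet> \<xi>)" for x :: 'a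
  have [measurable]: "F \<in> borel_measurable borel" unfolding F_def
    by (auto intro!: borel_measurable_continuous_onI continuous_intros)
  let ?s = "\<lambda>f::'a \<Rightarrow> real. \<Sum>b\<in>Basis. f b *\<^sub>R b"
  have Fs: "F (?s f) = (\<Prod>b\<in>Basis. exp (- (f b)\<^sup>2 / 2) *\<^sub>R iexp ((\<xi> \<bullet> b) * f b))" for f
  proof -
    have n: "(norm (?s f))\<^sup>2 = (\<Sum>b\<in>Basis. (f b)\<^sup>2)"
      unfolding power2_norm_eq_inner
      by (subst euclidean_inner) (auto intro!: sum.cong simp: power2_eq_square)
    have i: "?s f \<bullet> \<xi> = (\<Sum>b\<in>Basis. (\<xi> \<bullet> b) * f b)"

      by (subst euclidean_inner) (auto intro!: sum.cong)
    have "(\<Prod>b\<in>Basis. exp (- (f b)\<^sup>2 / 2) *\<^sub>R iexp ((\<xi> \<bullet> b) * f b))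
        = complex_of_real (\<Prod>b\<in>Basis. exp (- (f b)\<^sup>2 / 2)) * (\<Prod>b\<in>Basis. iexp ((\<xi> \<bullet> b) * f b))"
      by (simp add: scaleR_conv_of_real prod.distrib)
    also have "(\<Prod>b\<in>Basis. exp (- (f b)\<^sup>2 / 2)) = exp (- (norm (?s f))\<^sup>2 / 2)"
      unfolding n by (subst exp_sum[symmetric]) (auto simp: sum_negf sum_divide_distrib)
    also have "(\<Prod>b\<in>Basis. iexp ((\<xi> \<bullet> b) * f b)) = iexp (?s f \<bullet> \<xi>)"
      unfolding i by (subst exp_sum[symmetric]) (auto simp: sum_distrib_left)
    finally show ?thesis by (simp add: F_def scaleR_conv_of_real)
  qed
  have [measurable]: "?s \<in> measurable (Pi\<^sub>M Basis (\<lambda>_. lborel)) borel"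
    by measurable
  have L: "(LINT x|lborel. F x) = (\<Prod>b\<in>Basis. LINT x|lborel. exp (- x\<^sup>2 / 2) *\<^sub>R iexp ((\<xi> \<bullet> b) * x))"
  proof -
    have "(LINT x|lborel. F x) = (LINT f|(Pi\<^sub>M Basis (\<lambda>_. lborel)). F (?s f))"
      by (subst lborel_eq) (simp add: integral_distr)
    also have "\<dots> = (\<Prod>b\<in>Basis. LINT x|lborel. exp (- x\<^sup>2 / 2) *\<^sub>R iexp ((\<xi> \<bullet> b) * x))"
      unfolding Fs by (rule P.product_integral_prod) (simp_all only: finite_Basis integral_gauss_1)
    finally show ?thesis .
  qed
  also have "\<dots> = complex_of_real (\<Prod>b\<in>Basis. sqrt (2 * pi) * exp (- (\<xi> \<bullet> b)\<^sup>2 / 2))"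
    unfolding integral_gauss_1 by simp
  also have "(\<Prod>b\<in>Basis. sqrt (2 * pi) * exp (- (\<xi> \<bullet> b)\<^sup>2 / 2)) =
      sqrt (2 * pi) ^ DIM('a) * exp (- (norm \<xi>)\<^sup>2 / 2)"
    unfolding prod.distrib power2_norm_eq_inner euclidean_inner[of \<xi> \<xi>]
    by (subst exp_sum[symmetric]) (auto simp: sum_negf sum_divide_distrib power2_eq_square)
  also have "sqrt (2 * pi) ^ DIM('a) = (2 * pi) powr (real DIM('a) / 2)"
    by (simp add: powr_half_sqrt[symmetric] powr_powr flip: powr_realpow)
  finally show E: ?E unfolding F_def .
  show ?I
    using E not_integrable_integral_eq by fastforce
qed

lemma integral_lborel_scale:
  fixes f :: "'a::euclidean_space \<Rightarrow> 'b::{banach, second_countable_topology}"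
  assumes [measurable]: "f \<in> borel_measurable borel" and c: "c \<noteq> 0"
  shows "integral\<^sup>L lborel f = (\<bar>c\<bar> ^ DIM('a)) *\<^sub>R (LINT y|lborel. f (t + c *\<^sub>R y))"
    "integrable lborel f \<longleftrightarrow> integrable lborel (\<lambda>y. f (t + c *\<^sub>R y))"
proof -
  have [measurable]: "(\<lambda>x::'a. t + c *\<^sub>R x) \<in> borel_measurable borel" by measurable
  show "integral\<^sup>L lborel f = (\<bar>c\<bar> ^ DIM('a)) *\<^sub>R (LINT y|lborel. f (t + c *\<^sub>R y))"
    by (subst lborel_affine[OF c, of t]) (simp add: integral_density integral_distr)
  show "integrable lborel f \<longleftrightarrow> integrable lborel (\<lambda>y. f (t + c *\<^sub>R y))"
  proof -
    have "integrable lborel f \<longleftrightarrow> integrable lborel (\<lambda>y. (\<bar>c\<bar> ^ DIM('a)) *\<^sub>R f (t + c *\<^sub>R y))"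
      by (subst lborel_affine[OF c, of t]) (simp add: integrable_density integrable_distr_eq)
    also have "\<dots> \<longleftrightarrow> integrable lborel (\<lambda>y. f (t + c *\<^sub>R y))"
      using c integrable_scaleR_right[of "1 / \<bar>c\<bar> ^ DIM('a)" lborel "\<lambda>y. (\<bar>c\<bar> ^ DIM('a)) *\<^sub>R f (t + c *\<^sub>R y)"]
      by auto
    finally show ?thesis .
  qed
qed

lemma integral_gauss:
  fixes \<xi> :: "'a::euclidean_space"
  assumes \<tau>: "0 < \<tau>"
  shows "integrable lborel (\<lambda>x. exp (- \<tau> * (norm x)\<^sup>2) *\<^sub>R iexp (x \<bullet> \<xi>))" (is ?I)
    "(LINT x|lborel. exp (- \<tau> * (norm x)\<^sup>2) *\<^sub>R iexp (x \<bullet> \<xi>)) =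
       complex_of_real ((pi / \<tau>) powr (real DIM('a) / 2) * exp (- (norm \<xi>)\<^sup>2 / (4 * \<tau>)))" (is ?E)
proof -
  \<comment> \<open>The dilation with \<tau> c^2 = 1/2 turns the Gaussian into the standard
    one.\<close>
  define c where "c = 1 / sqrt (2 * \<tau>)"
  have c: "0 < c" and c2: "c\<^sup>2 = 1 / (2 * \<tau>)" using \<tau> by (auto simp: c_def power_divide)
  define F where "F x = exp (- \<tau> * (norm x)\<^sup>2) *\<^sub>R iexp (x \<bullet> \<xi>)" for x :: 'a
  have [measurable]: "F \<in> borel_measurable borel" unfolding F_def
    by (auto intro!: borel_measurable_continuous_onI continuous_intros)
  have Fc: "F (0 + c *\<^sub>R y) = exp (- (norm y)\<^sup>2 / 2) *\<^sub>R iexp (y \<bullet> (c *\<^sub>R \<xi>))" for y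
    unfolding F_def using \<tau> by (simp add: power_mult_distrib c2)
  show ?I
  proof -
    have "integrable lborel F \<longleftrightarrow> integrable lborel (\<lambda>y. F (0 + c *\<^sub>R y))"
      by (rule integral_lborel_scale(2)) (use c in auto)
    then have "integrable lborel F"
      unfolding Fc using integral_gauss_std(1)[of "c *\<^sub>R \<xi>"] by (rule iffD2)
    then show ?thesis unfolding F_def .
  qed
  have "(LINT x|lborel. F x) = c ^ DIM('a) *\<^sub>R (LINT y|lborel. exp (- (norm y)\<^sup>2 / 2) *\<^sub>R iexp (y \<bullet> (c *\<^sub>R \<xi>)))"
    using integral_lborel_scale(1)[of F c 0] c unfolding Fc by simp
  also have "\<dots> = complex_of_real ((c ^ DIM('a) * (2 * pi) powr (real DIM('a) / 2)) * exp (- (norm (c *\<^sub>R \<xi>))\<^sup>2 / 2))"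
    unfolding integral_gauss_std by (simp add: scaleR_conv_of_real)
  also have "c ^ DIM('a) * (2 * pi) powr (real DIM('a) / 2) = (pi / \<tau>) powr (real DIM('a) / 2)"
  proof -
    have "c ^ DIM('a) = (c\<^sup>2) powr (real DIM('a) / 2)"
    proof -
      have "(c\<^sup>2) powr (real DIM('a) / 2) = (c powr 2) powr (real DIM('a) / 2)"
        using c by (simp add: powr_numeral)
      also have "\<dots> = c powr (real DIM('a))" by (simp add: powr_powr)
      finally show ?thesis using c by (simp add: powr_realpow)
    qed
    also have "\<dots> * (2 * pi) powr (real DIM('a) / 2) = (pi / \<tau>) powr (real DIM('a) / 2)"
      unfolding c2 using \<tau> by (subst powr_mult[symmetric]) auto
    finally show ?thesis .
  qed
  also have "- (norm (c *\<^sub>R \<xi>))\<^sup>2 / 2 = - (norm \<xi>)\<^sup>2 / (4 * \<tau>)" using c by (simp add: power_mult_distrib c2)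
  finally show ?E unfolding F_def by simp
qed

lemma integral_gauss_real:
  assumes \<tau>: "0 < \<tau>"
  shows "integrable lborel (\<lambda>x::'a::euclidean_space. exp (- \<tau> * (norm x)\<^sup>2))"
    "(LINT x|lborel. exp (- \<tau> * (norm (x::'a::euclidean_space))\<^sup>2)) = (pi / \<tau>) powr (real DIM('a) / 2)"
proof -
  have e: "(\<lambda>x::'a. exp (- \<tau> * (norm x)\<^sup>2) *\<^sub>R iexp (x \<bullet> 0)) = (\<lambda>x. complex_of_real (exp (- \<tau> * (norm x)\<^sup>2)))"
    by (simp add: scaleR_conv_of_real)
  show "integrable lborel (\<lambda>x::'a. exp (- \<tau> * (norm x)\<^sup>2))"
    using integral_gauss(1)[OF \<tau>, of "0::'a"] unfolding e by (simp only: complex_of_real_integrable_eq)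
  have "complex_of_real (LINT x|lborel. exp (- \<tau> * (norm (x::'a))\<^sup>2)) =
      complex_of_real ((pi / \<tau>) powr (real DIM('a) / 2) * exp (- (norm (0::'a))\<^sup>2 / (4 * \<tau>)))"
    unfolding integral_complex_of_real[symmetric] integral_gauss(2)[OF \<tau>, of "0::'a", symmetric] e ..
  then show "(LINT x|lborel. exp (- \<tau> * (norm (x::'a))\<^sup>2)) = (pi / \<tau>) powr (real DIM('a) / 2)"
    unfolding of_real_eq_iff by simp
qed

section \<open>The Fourier transform on integrable functions\<close>

lemma lebesgue_borel_measurable: "f \<in> borel_measurable borel \<Longrightarrow> f \<in> borel_measurable lebesgue"
  by (simp add: measurable_completion)

lemma fourier_eq_borel:
  fixes f :: "real ^ 'n \<Rightarrow> complex"
  assumes f: "f \<in> borel_measurable lebesgue" and f': "f' \<in> borel_measurable borel"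
    and eq: "AE x in lebesgue. f x = f' x"
  shows "fourier f \<xi> = ((2 * pi) powr (- (real CARD('n) / 2))) *\<^sub>R
     (LINT x|lborel. f' x * exp (- \<i> * complex_of_real (x \<bullet> \<xi>)))"
proof -
  have e: "(\<lambda>x. exp (- \<i> * complex_of_real (x \<bullet> \<xi>))) \<in> borel_measurable borel"
    by (intro borel_measurable_continuous_onI continuous_intros)
  note [measurable] = e lebesgue_borel_measurable[OF e] f f'
  have "(LINT x|lebesgue. f x * exp (- \<i> * complex_of_real (x \<bullet> \<xi>)))
      = (LINT x|lborel. f' x * exp (- \<i> * complex_of_real (x \<bullet> \<xi>)))"
    by (rule integrable_lebesgue_borel(2)[OF borel_measurable_times[OF f' e]
          borel_measurable_times[OF f lebesgue_borel_measurable[OF e]]]) (use eq in auto)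
  then show ?thesis unfolding fourier_def by simp
qed

lemma fourier_measurable:
  fixes f :: "real ^ 'n \<Rightarrow> complex"
  assumes f: "f \<in> borel_measurable lebesgue"
  shows "fourier f \<in> borel_measurable borel"
proof -
  obtain f' where f'[measurable]: "f' \<in> borel_measurable borel" and eq: "AE x in lebesgue. f x = f' x"
    using borel_version_complex[OF f] by blast
  have "(\<lambda>\<xi>. LINT x|lborel. f' x * exp (- \<i> * complex_of_real (x \<bullet> \<xi>))) \<in> borel_measurable borel"
    by (rule lborel.borel_measurable_lebesgue_integral) measurable
  then show ?thesis
    unfolding fourier_eq_borel[OF f f' eq, abs_def] by measurable
qed

lemma norm_fourier_le:
  fixes f :: "real ^ 'n \<Rightarrow> complex"
  shows "norm (fourier f \<xi>) \<le> (2 * pi) powr (- (real CARD('n) / 2)) * (LINT x|lebesgue. norm (f x))"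
proof -
  have "norm (LINT x|lebesgue. f x * exp (- \<i> * complex_of_real (x \<bullet> \<xi>)))
      \<le> (LINT x|lebesgue. norm (f x * exp (- \<i> * complex_of_real (x \<bullet> \<xi>))))"
    by (rule integral_norm_bound)
  also have "\<dots> = (LINT x|lebesgue. norm (f x))" by (simp add: norm_mult)
  finally show ?thesis unfolding fourier_def by (simp add: mult_left_mono)
qed

lemma fourier_integrand_integrable:
  fixes f :: "real ^ 'n \<Rightarrow> complex"
  assumes "integrable lebesgue f"
  shows "integrable lebesgue (\<lambda>x. f x * exp (- \<i> * complex_of_real (x \<bullet> \<xi>)))"
proof (rule Bochner_Integration.integrable_bound[OF assms])
  have "(\<lambda>x::real^'n. exp (- \<i> * complex_of_real (x \<bullet> \<xi>))) \<in> borel_measurable borel"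
    by (intro borel_measurable_continuous_onI continuous_intros)
  note lebesgue_borel_measurable[OF this, measurable] borel_measurable_integrable[OF assms, measurable]
  then show "(\<lambda>x. f x * exp (- \<i> * complex_of_real (x \<bullet> \<xi>))) \<in> borel_measurable lebesgue" by (intro borel_measurable_times)
qed (simp add: norm_mult)

lemma fourier_diff:
  fixes f g :: "real ^ 'n \<Rightarrow> complex"
  assumes "integrable lebesgue f" "integrable lebesgue g"
  shows "fourier (\<lambda>x. f x - g x) \<xi> = fourier f \<xi> - fourier g \<xi>"
  unfolding fourier_def left_diff_distrib
  using assms[THEN fourier_integrand_integrable] by (simp add: algebra_simps)

text \<open>Fubini for f(x) g(\<xi>) exp(- i x \<xi>), whose modulus is the integrable product
  |f(x)| |g(\<xi>)|. Plancherel's theorem, inversion and the heat kernel representation all start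
  from this identity.\<close>

lemma fourier_multiplication_formula:
  fixes f g :: "real ^ 'n \<Rightarrow> complex"
  assumes f: "integrable lebesgue f" and g: "integrable lebesgue g"
  shows "(LINT \<xi>|lebesgue. fourier f \<xi> * g \<xi>) = (LINT x|lebesgue. f x * fourier g x)"
proof -
  note fm = borel_measurable_integrable[OF f] and gm = borel_measurable_integrable[OF g]
  obtain f' where f'[measurable]: "f' \<in> borel_measurable borel" and eqf: "AE x in lebesgue. f x = f' x"
    using borel_version_complex[OF fm] by blast
  obtain g' where g'[measurable]: "g' \<in> borel_measurable borel" and eqg: "AE x in lebesgue. g x = g' x"
    using borel_version_complex[OF gm] by blast
  note Fm = fourier_measurable[OF fm] and Gm = fourier_measurable[OF gm]
  note [measurable] = fm gm Fm Gm lebesgue_borel_measurable[OF Fm] lebesgue_borel_measurable[OF Gm]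
  have if': "integrable lborel f'" using integrable_lebesgue_borel(1)[OF f' fm eqf] f by simp
  have ig': "integrable lborel g'" using integrable_lebesgue_borel(1)[OF g' gm eqg] g by simp
  let ?c = "(2 * pi) powr (- (real CARD('n) / 2))"
  let ?e = "\<lambda>x y::real^'n. exp (- \<i> * complex_of_real (x \<bullet> y))"
  define H where "H x y = f' x * g' y * ?e x y" for x y
  have Hm[measurable]: "case_prod H \<in> borel_measurable (lborel \<Otimes>\<^sub>M lborel)"
    unfolding H_def case_prod_beta by measurable
  have nH: "norm (H x y) = norm (f' x) * norm (g' y)" for x y
    by (simp add: H_def norm_mult)
  have Hi: "integrable (lborel \<Otimes>\<^sub>M lborel) (case_prod H)"
  proof (rule lborel_pair.Fubini_integrable[OF Hm])
    show "integrable lborel (\<lambda>x. LINT y|lborel. norm (case (x, y) of (x, y) \<Rightarrow> H x y))"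
      using if' by (simp add: nH)
    show "AE x in lborel. integrable lborel (\<lambda>y. case (x, y) of (x, y) \<Rightarrow> H x y)"
    proof (rule AE_I2)
      fix x
      have "integrable lborel (\<lambda>y. norm (f' x) * norm (g' y))" using ig' by simp
      then show "integrable lborel (\<lambda>y. case (x, y) of (x, y) \<Rightarrow> H x y)"
        by (rule Bochner_Integration.integrable_bound) (use nH in \<open>simp_all add: H_def norm_mult\<close>)
    qed
  qed
  have Hl: "(LINT x|lborel. H x \<xi>) = (LINT x|lborel. f' x * ?e x \<xi>) * g' \<xi>" for \<xi>
    unfolding H_def by (subst integral_mult_left_zero[symmetric]) (simp add: ac_simps)
  have Hr: "(LINT \<xi>|lborel. H x \<xi>) = f' x * (LINT \<xi>|lborel. g' \<xi> * ?e \<xi> x)" for x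
    unfolding H_def by (subst integral_mult_right_zero[symmetric]) (simp add: ac_simps inner_commute)
  have "(LINT \<xi>|lebesgue. fourier f \<xi> * g \<xi>) = (LINT \<xi>|lborel. fourier f \<xi> * g' \<xi>)"
    by (rule integrable_lebesgue_borel(2)) (use eqg in auto)
  also have "\<dots> = (LINT \<xi>|lborel. ?c *\<^sub>R (LINT x|lborel. H x \<xi>))"
    unfolding fourier_eq_borel[OF fm f' eqf] Hl by simp
  also have "\<dots> = ?c *\<^sub>R (LINT \<xi>|lborel. LINT x|lborel. H x \<xi>)" by simp
  also have "(LINT \<xi>|lborel. LINT x|lborel. H x \<xi>) = (LINT x|lborel. LINT \<xi>|lborel. H x \<xi>)"
    by (rule lborel_pair.Fubini_integral[OF Hi])
  also have "?c *\<^sub>R \<dots> = (LINT x|lborel. ?c *\<^sub>R (LINT \<xi>|lborel. H x \<xi>))" by simp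
  also have "\<dots> = (LINT x|lborel. f' x * fourier g x)"
    unfolding fourier_eq_borel[OF gm g' eqg] Hr by simp
  also have "\<dots> = (LINT x|lebesgue. f x * fourier g x)"
    by (rule integrable_lebesgue_borel(2)[symmetric]) (use eqf in auto)
  finally show ?thesis .
qed

section \<open>The heat kernel and modulated Gaussians\<close>

text \<open>The usual heat kernel multiplied by (2 pi)^(n/2): with the symmetric normalization of
  the Fourier transform, this is exactly the transform of exp(- \<tau> |\<xi>|^2).\<close>

definition heat :: "real \<Rightarrow> real ^ 'n \<Rightarrow> real" where
  "heat \<tau> z = (2 * \<tau>) powr (- (real CARD('n) / 2)) * exp (- (norm z)\<^sup>2 / (4 * \<tau>))"

text \<open>A Gaussian carrying the phase of the point x. Paired with a transform it evaluates, up
  to the normalizing constant, the damped inverse Fourier integral at x.\<close>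

definition gauss_wave :: "real \<Rightarrow> real ^ 'n \<Rightarrow> real ^ 'n \<Rightarrow> complex" where
  "gauss_wave \<tau> x \<xi> = exp (- \<tau> * (norm \<xi>)\<^sup>2) *\<^sub>R iexp (\<xi> \<bullet> x)"

lemma heat_nonneg: "0 \<le> heat \<tau> z"
  by (simp add: heat_def)

lemma gauss_wave_measurable [measurable]:
  "gauss_wave \<tau> x \<in> borel_measurable borel" "gauss_wave \<tau> x \<in> borel_measurable lebesgue"
proof -
  show "gauss_wave \<tau> x \<in> borel_measurable borel"
    unfolding gauss_wave_def by (intro borel_measurable_continuous_onI continuous_intros)
  then show "gauss_wave \<tau> x \<in> borel_measurable lebesgue" by (rule lebesgue_borel_measurable)
qed

lemma norm_gauss_wave: "norm (gauss_wave \<tau> x \<xi>) = exp (- \<tau> * (norm \<xi>)\<^sup>2)"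
  by (simp add: gauss_wave_def)

lemma gauss_wave_L1_L2:
  assumes \<tau>: "0 < \<tau>"
  shows "integrable lebesgue (gauss_wave \<tau> (x::real^'n))" "L2 (gauss_wave \<tau> x)"
proof -
  have "integrable lborel (gauss_wave \<tau> x)"
    unfolding gauss_wave_def by (rule integral_gauss(1)[OF \<tau>])
  then show "integrable lebesgue (gauss_wave \<tau> x)" by (simp add: integrable_completion)
  have "integrable lborel (\<lambda>\<xi>::real^'n. exp (- (2 * \<tau>) * (norm \<xi>)\<^sup>2))"
    by (rule integral_gauss_real(1)) (use \<tau> in simp)
  then have "integrable lebesgue (\<lambda>\<xi>::real^'n. exp (- (2 * \<tau>) * (norm \<xi>)\<^sup>2))"
    by (subst integrable_completion) (auto dest: borel_measurable_integrable)
  moreover have "(norm (gauss_wave \<tau> x \<xi>))\<^sup>2 = exp (- (2 * \<tau>) * (norm \<xi>)\<^sup>2)" for \<xi>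
    unfolding norm_gauss_wave by (simp add: power2_eq_square flip: exp_add)
  ultimately show "L2 (gauss_wave \<tau> x)" by (simp add: L2_def)
qed

lemma fourier_gauss_wave:
  fixes x y :: "real ^ 'n"
  assumes \<tau>: "0 < \<tau>"
  shows "fourier (gauss_wave \<tau> x) y = complex_of_real (heat \<tau> (x - y))"
proof -
  let ?n = "real CARD('n)"
  have "fourier (gauss_wave \<tau> x) y = ((2 * pi) powr (- (?n / 2))) *\<^sub>R
     (LINT \<xi>|lborel. gauss_wave \<tau> x \<xi> * exp (- \<i> * complex_of_real (\<xi> \<bullet> y)))"
    by (rule fourier_eq_borel) auto
  also have "(LINT \<xi>|lborel. gauss_wave \<tau> x \<xi> * exp (- \<i> * complex_of_real (\<xi> \<bullet> y)))
     = (LINT \<xi>|lborel. exp (- \<tau> * (norm \<xi>)\<^sup>2) *\<^sub>R iexp (\<xi> \<bullet> (x - y)))"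
    unfolding gauss_wave_def
    by (intro Bochner_Integration.integral_cong refl)
       (simp add: exp_add[symmetric] inner_diff_right algebra_simps)
  also have "\<dots> = complex_of_real ((pi / \<tau>) powr (?n / 2) * exp (- (norm (x - y))\<^sup>2 / (4 * \<tau>)))"
    using integral_gauss(2)[OF \<tau>, of "x - y"] by simp
  also have "((2 * pi) powr (- (?n / 2))) *\<^sub>R \<dots> =
      complex_of_real ((2 * pi) powr (- (?n / 2)) * (pi / \<tau>) powr (?n / 2) * exp (- (norm (x - y))\<^sup>2 / (4 * \<tau>)))"
    by (simp add: scaleR_conv_of_real)
  also have "(2 * pi) powr (- (?n / 2)) * (pi / \<tau>) powr (?n / 2) = (2 * \<tau>) powr (- (?n / 2))"
    using \<tau> by (simp add: powr_minus_divide powr_divide powr_mult)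
  finally show ?thesis by (simp add: heat_def)
qed

lemma integral_heat:
  assumes \<tau>: "0 < \<tau>"
  shows "integrable lborel (\<lambda>y. heat \<tau> (x - y :: real^'n))"
    "(LINT y|lborel. heat \<tau> (x - y :: real^'n)) = (2 * pi) powr (real CARD('n) / 2)"
proof -
  let ?n = "real CARD('n)"
  let ?F = "\<lambda>y::real^'n. exp (- (1 / (4 * \<tau>)) * (norm y)\<^sup>2)"
  have [measurable]: "?F \<in> borel_measurable borel"
    by (intro borel_measurable_continuous_onI continuous_intros)
  have h: "heat \<tau> (x - y) = (2 * \<tau>) powr (- (?n / 2)) * ?F (x + (-1) *\<^sub>R y)" for y
    by (simp add: heat_def)
  have i: "integrable lborel ?F" and e: "integral\<^sup>L lborel ?F = (pi / (1 / (4 * \<tau>))) powr (real DIM(real^'n) / 2)"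
    using integral_gauss_real[where 'a="real^'n", of "1 / (4 * \<tau>)"] \<tau> by auto
  have "integrable lborel (\<lambda>y. ?F (x + (-1) *\<^sub>R y))"
    using integral_lborel_scale(2)[of ?F "-1" x] i by simp
  then show "integrable lborel (\<lambda>y. heat \<tau> (x - y :: real^'n))"
    unfolding h by simp
  have "(LINT y|lborel. ?F (x + (-1) *\<^sub>R y)) = integral\<^sup>L lborel ?F"
    using integral_lborel_scale(1)[of ?F "-1" x] by simp
  also have "\<dots> = (4 * pi * \<tau>) powr (?n / 2)" unfolding e by (simp add: ac_simps)
  finally have "(LINT y|lborel. heat \<tau> (x - y)) = (2 * \<tau>) powr (- (?n / 2)) * (4 * pi * \<tau>) powr (?n / 2)"
    unfolding h by simp
  also have "(4 * pi * \<tau>) powr (?n / 2) = (2 * \<tau>) powr (?n / 2) * (2 * pi) powr (?n / 2)"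
    using \<tau> by (subst powr_mult[symmetric]) (auto simp: ac_simps)
  also have "(2 * \<tau>) powr (- (?n / 2)) * \<dots> = (2 * pi) powr (?n / 2)"
    using \<tau> by (simp add: powr_minus)
  finally show "(LINT y|lborel. heat \<tau> (x - y :: real^'n)) = (2 * pi) powr (?n / 2)" .
qed

section \<open>Density of continuous functions with compact support\<close>

definition compact_support_continuous :: "(real ^ 'n \<Rightarrow> complex) \<Rightarrow> bool" where
  "compact_support_continuous h \<longleftrightarrow> continuous_on UNIV h \<and> (\<exists>R. \<forall>x. R < norm x \<longrightarrow> h x = 0)"

lemma compact_support_continuous_diff:
  assumes "compact_support_continuous f" "compact_support_continuous g"
  shows "compact_support_continuous (\<lambda>x. f x - g x)"
proof -
  obtain R S where "\<forall>x. R < norm x \<longrightarrow> f x = 0" "\<forall>x. S < norm x \<longrightarrow> g x = 0"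
    using assms unfolding compact_support_continuous_def by auto
  then have "\<forall>x. max R S < norm x \<longrightarrow> f x - g x = 0" by auto
  then have "\<exists>R. \<forall>x. R < norm x \<longrightarrow> f x - g x = 0" by (rule exI)
  moreover have "continuous_on UNIV (\<lambda>x. f x - g x)"
    using assms unfolding compact_support_continuous_def by (intro continuous_on_diff) auto
  ultimately show ?thesis unfolding compact_support_continuous_def by simp
qed

lemma compact_support_continuous_bounded:
  assumes "compact_support_continuous h"
  shows "\<exists>B R. 0 \<le> B \<and> (\<forall>x. norm (h x) \<le> B) \<and> (\<forall>x. norm (h x) \<le> B * indicator (cball 0 R) x)"
proof -
  obtain R where R: "\<forall>x. R < norm x \<longrightarrow> h x = 0" and c: "continuous_on UNIV h"
    using assms unfolding compact_support_continuous_def by auto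
  have "compact (h ` cball 0 R)"
    by (intro compact_continuous_image compact_cball continuous_on_subset[OF c]) auto
  then have "\<exists>B. \<forall>y\<in>h ` cball 0 R. norm y \<le> B"
    by (rule compact_imp_bounded[THEN bounded_iff[THEN iffD1]])
  then obtain B where B: "\<And>x. x \<in> cball 0 R \<Longrightarrow> norm (h x) \<le> B"
    by (elim exE) (meson imageI)
  have "norm (h x) \<le> max B 0 * indicator (cball 0 R) x" for x
  proof (cases "x \<in> cball 0 R")
    case True then show ?thesis using B[OF True] by auto
  next
    case False then show ?thesis using R by (auto simp: not_le)
  qed
  moreover have "norm (h x) \<le> max B 0" for x
    using calculation[of x] by (cases "x \<in> cball 0 R") auto
  moreover have "0 \<le> max B 0" by simp
  ultimately show ?thesis by blast
qed

lemma indicator_cball_L1_L2: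
  "integrable lebesgue (\<lambda>x::real^'n. complex_of_real (B * indicator (cball 0 R) x))"
  "L2 (\<lambda>x::real^'n. complex_of_real (B * indicator (cball 0 R) x))"
proof -
  have i: "integrable lebesgue (\<lambda>x::real^'n. indicator (cball 0 R) x :: real)"
    by (rule integrable_real_indicator) (simp_all add: emeasure_lborel_cball_finite[unfolded infinity_ennreal_def])
  show "integrable lebesgue (\<lambda>x::real^'n. complex_of_real (B * indicator (cball 0 R) x))"
    by (intro integrable_of_real integrable_mult_right i)
  have "(norm (complex_of_real (B * indicator (cball 0 R) x)))\<^sup>2 = B\<^sup>2 * indicator (cball 0 R) x" for x :: "real^'n"
    by (auto simp: indicator_def)
  then show "L2 (\<lambda>x::real^'n. complex_of_real (B * indicator (cball 0 R) x))"
    unfolding L2_def using i by (auto intro!: borel_measurable_of_real)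
qed

lemma compact_support_continuous_L1_L2:
  fixes h :: "real ^ 'n \<Rightarrow> complex"
  assumes "compact_support_continuous h"
  shows "h \<in> borel_measurable borel" "integrable lebesgue h" "L2 h"
proof -
  show m: "h \<in> borel_measurable borel"
    using assms unfolding compact_support_continuous_def by (auto intro: borel_measurable_continuous_onI)
  note [measurable] = lebesgue_borel_measurable[OF m]
  obtain B R where B: "0 \<le> B" "\<forall>x. norm (h x) \<le> B * indicator (cball 0 R) x"
    using compact_support_continuous_bounded[OF assms] by (elim exE conjE)
  then have B': "norm (h x) \<le> norm (complex_of_real (B * indicator (cball 0 R) x))" for x
    by (simp add: norm_mult)
  show "integrable lebesgue h"
    by (rule Bochner_Integration.integrable_bound[OF indicator_cball_L1_L2(1)[of B R]]) (use B' in auto)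
  show "L2 h"
    by (rule L2_bound(1)[OF _ indicator_cball_L1_L2(2)[of B R], of _ 1]) (use B' in auto)
qed

lemma L1_L2_dominated:
  fixes f :: "nat \<Rightarrow> real ^ 'n \<Rightarrow> complex"
  assumes [measurable]: "\<And>j. f j \<in> borel_measurable lebesgue" "g \<in> borel_measurable lebesgue"
    and h: "integrable lebesgue h" "L2 h"
    and lim: "AE x in lebesgue. (\<lambda>j. f j x) \<longlonglongrightarrow> g x"
    and le: "\<And>j x. norm (f j x) \<le> norm (h x)" and le': "\<And>x. norm (g x) \<le> norm (h x)"
  shows "(\<lambda>j. LINT x|lebesgue. norm (f j x - g x)) \<longlonglongrightarrow> 0" "(\<lambda>j. L2_norm (\<lambda>x. f j x - g x)) \<longlonglongrightarrow> 0"
proof -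
  have "(\<lambda>j. LINT x|lebesgue. norm (f j x - g x)) \<longlonglongrightarrow> (LINT x::real^'n|lebesgue. 0)"
  proof (rule integral_dominated_convergence)
    show "integrable lebesgue (\<lambda>x. 2 * norm (h x))" using h(1) by simp
    show "AE x in lebesgue. (\<lambda>j. norm (f j x - g x)) \<longlonglongrightarrow> 0"
      using lim by eventually_elim (simp add: tendsto_norm_zero LIM_zero)
    show "AE x in lebesgue. norm (norm (f j x - g x)) \<le> 2 * norm (h x)" for j
    proof (rule AE_I2)
      fix x show "norm (norm (f j x - g x)) \<le> 2 * norm (h x)"
        using norm_triangle_ineq4[of "f j x" "g x"] le[of j x] le'[of x] by simp
    qed
  qed auto
  then show "(\<lambda>j. LINT x|lebesgue. norm (f j x - g x)) \<longlonglongrightarrow> 0" by simp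
  show "(\<lambda>j. L2_norm (\<lambda>x. f j x - g x)) \<longlonglongrightarrow> 0"
    by (rule L2_dominated(3)[OF _ _ h(2) lim]) (use le in auto)
qed

text \<open>One function has to be close in both norms: the L1 error controls the Fourier transforms
  pointwise, the L2 error controls the norms. After truncation of f in space and in size, the
  continuous functions that converge to it almost everywhere are forced under a single bounded
  majorant with compact support, so that dominated convergence makes both errors small.\<close>

lemma compact_support_continuous_dense:
  fixes f :: "real ^ 'n \<Rightarrow> complex"
  assumes f: "integrable lebesgue f" "L2 f" and e: "0 < e"
  shows "\<exists>h. compact_support_continuous h \<and> (LINT x|lebesgue. norm (h x - f x)) < e \<and> L2_norm (\<lambda>x. h x - f x) < e"
proof -
  note [measurable] = L2_measurable[OF f(2)]
  define A where "A N = {x::real^'n. norm x \<le> real N \<and> norm (f x) \<le> real N}" for N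
  have [measurable]: "A N \<in> sets lebesgue" for N
  proof -
    have "{x \<in> space lebesgue. norm (f x) \<le> real N} \<in> sets lebesgue" by measurable
    moreover have "cball 0 (real N) \<in> sets (lebesgue :: (real^'n) measure)" by simp
    ultimately have "{x \<in> space lebesgue. norm (f x) \<le> real N} \<inter> cball 0 (real N) \<in> sets lebesgue" by (rule sets.Int)
    moreover have "{x \<in> space lebesgue. norm (f x) \<le> real N} \<inter> cball 0 (real N) = A N" by (auto simp: A_def)
    ultimately show ?thesis by simp
  qed
  define F where "F N x = indicator (A N) x *\<^sub>R f x" for N x
  have [measurable]: "F N \<in> borel_measurable lebesgue" for N unfolding F_def by measurable
  have Ff: "norm (F N x) \<le> norm (f x)" for N x by (simp add: F_def indicator_def)
  have lim: "(\<lambda>N. F N x) \<longlonglongrightarrow> f x" for x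
  proof (rule tendsto_eventually)
    obtain N0 :: nat where "max (norm x) (norm (f x)) \<le> real N0" using real_arch_simple by blast
    then show "\<forall>\<^sub>F N in sequentially. F N x = f x"
      by (intro eventually_sequentiallyI[of N0]) (auto simp: F_def A_def indicator_def)
  qed
  have "\<forall>\<^sub>F N in sequentially. (LINT x|lebesgue. norm (F N x - f x)) < e/2 \<and> L2_norm (\<lambda>x. F N x - f x) < e/2"
    using L1_L2_dominated[of F f f] f lim Ff e
    by (auto intro!: eventually_conj order_tendstoD(2)[where y=0])
  then obtain N where N: "(LINT x|lebesgue. norm (F N x - f x)) < e/2" "L2_norm (\<lambda>x. F N x - f x) < e/2"
    using eventually_happens'[OF sequentially_bot] by blast
  \<comment> \<open>The summand 1 keeps the radius positive even for N = 0, so that division by n is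
    legitimate.\<close>
  define n where "n = real N + 1"
  have n: "1 \<le> n" by (simp add: n_def)
  have Fn: "norm (F N x) \<le> n" "n < norm x \<Longrightarrow> F N x = 0" for x
    by (auto simp: F_def A_def n_def indicator_def)
  have "F N measurable_on UNIV" by (rule lebesgue_measurable_imp_measurable_on) auto
  then obtain Z g where Z: "negligible Z" and g: "\<And>j. continuous_on UNIV (g j)"
    and gl: "\<And>x. x \<notin> Z \<Longrightarrow> (\<lambda>j. g j x) \<longlonglongrightarrow> F N x"
    unfolding measurable_on_def by auto
  \<comment> \<open>\<open>clamp\<close> is the radial projection onto the disc of radius n and
    fixes all values of \<open>F N\<close>; \<open>cut\<close> is 1 on the ball of radius n and 0
    beyond radius n + 1. Both are continuous, and together they leave the limit unchanged.\<close>
  define clamp where "clamp z = (1 / max 1 (norm z / n)) *\<^sub>R z" for z :: complex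
  define cut where "cut x = max 0 (min 1 (n + 1 - norm x))" for x :: "real^'n"
  define h where "h j x = cut x *\<^sub>R clamp (g j x)" for j x
  have clamp_c: "continuous_on UNIV clamp" unfolding clamp_def
    by (intro continuous_intros) (use n in \<open>auto simp: max_def\<close>)
  have clamp_le: "norm (clamp z) \<le> n" for z
    using n by (auto simp: clamp_def max_def field_simps split: if_splits)
  have clamp_id: "norm z \<le> n \<Longrightarrow> clamp z = z" for z
    using n by (auto simp: clamp_def max_def field_simps)
  have cut01: "0 \<le> cut x" "cut x \<le> 1" for x by (auto simp: cut_def)
  have h_le: "norm (h j x) \<le> norm (complex_of_real (n * indicator (cball 0 (n + 1)) x))" for j x
  proof (cases "norm x \<le> n + 1")
    case True
    have "norm (h j x) \<le> 1 * n" unfolding h_def norm_scaleR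
      by (intro mult_mono clamp_le) (use cut01[of x] in auto)
    with True n show ?thesis by (simp add: norm_mult)
  qed (simp add: h_def cut_def)
  have csc: "compact_support_continuous (h j)" for j
    unfolding compact_support_continuous_def
  proof
    have "continuous_on UNIV (\<lambda>x. clamp (g j x))"
      using continuous_on_compose2[OF clamp_c g] by auto
    then show "continuous_on UNIV (h j)" unfolding h_def cut_def by (intro continuous_intros)
    show "\<exists>R. \<forall>x. R < norm x \<longrightarrow> h j x = 0"
      by (rule exI[of _ "n + 1"]) (auto simp: h_def cut_def)
  qed
  have hl: "(\<lambda>j. h j x) \<longlonglongrightarrow> F N x" if "x \<notin> Z" for x
  proof -
    have "(\<lambda>j. cut x *\<^sub>R clamp (g j x)) \<longlonglongrightarrow> cut x *\<^sub>R clamp (F N x)"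
      by (intro tendsto_intros continuous_on_tendsto_compose[OF clamp_c] gl that) auto
    moreover have "cut x *\<^sub>R clamp (F N x) = F N x"
    proof (cases "norm x \<le> n")
      case True then show ?thesis using clamp_id[OF Fn(1)] by (simp add: cut_def)
    next
      case False then show ?thesis using Fn(2)[of x] by (simp add: clamp_def)
    qed
    ultimately show ?thesis by (simp add: h_def)
  qed
  have AEl: "AE x in lebesgue. (\<lambda>j. h j x) \<longlonglongrightarrow> F N x"
  proof -
    have "AE x in lebesgue. x \<notin> Z" using Z by (simp add: negligible_iff_null_sets AE_not_in)
    then show ?thesis by eventually_elim (rule hl)
  qed
  have F_le: "norm (F N x) \<le> norm (complex_of_real (n * indicator (cball 0 (n + 1)) x))" for x
    using Fn[of x] n by (cases "norm x \<le> n + 1") (auto simp: norm_mult)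
  have "\<forall>\<^sub>F j in sequentially. (LINT x|lebesgue. norm (h j x - F N x)) < e/2 \<and> L2_norm (\<lambda>x. h j x - F N x) < e/2"
    by (intro eventually_conj order_tendstoD(2)[where y=0]
        L1_L2_dominated[OF lebesgue_borel_measurable[OF compact_support_continuous_L1_L2(1)[OF csc]]
          _ indicator_cball_L1_L2 AEl h_le F_le]) (use e in auto)
  then obtain j where j: "(LINT x|lebesgue. norm (h j x - F N x)) < e/2" "L2_norm (\<lambda>x. h j x - F N x) < e/2"
    using eventually_happens'[OF sequentially_bot] by blast
  note hj = compact_support_continuous_L1_L2[OF csc[of j]]
  have FL1: "integrable lebesgue (F N)" by (rule Bochner_Integration.integrable_bound[OF f(1)]) (use Ff in auto)
  have FL2: "L2 (F N)" by (rule L2_bound(1)[OF _ f(2), of _ 1]) (use Ff in auto)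
  have "(LINT x|lebesgue. norm (h j x - f x)) \<le> (LINT x|lebesgue. norm (h j x - F N x) + norm (F N x - f x))"
    using hj FL1 f(1) by (intro integral_mono) (auto intro: norm_diff_triangle_le)
  also have "\<dots> = (LINT x|lebesgue. norm (h j x - F N x)) + (LINT x|lebesgue. norm (F N x - f x))"
    using hj FL1 f(1) by simp
  finally have 1: "(LINT x|lebesgue. norm (h j x - f x)) < e" using j(1) N(1) by linarith
  have 2: "L2_norm (\<lambda>x. h j x - f x) < e"
    using L2_triangle_diff[OF hj(3) FL2 f(2)] j(2) N(2) by linarith
  from 1 2 csc show ?thesis by blast
qed

section \<open>Plancherel's theorem\<close>

text \<open>Conjugation before and after turns the forward transform into the inverse one, so
  inversion can be expressed with \<open>fourier\<close> alone.\<close>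

lemma cnj_integral_fourier:
  fixes g :: "real ^ 'n \<Rightarrow> complex"
  shows "cnj (fourier (\<lambda>\<xi>. cnj (g \<xi>)) x) = ((2 * pi) powr (- (real CARD('n) / 2))) *\<^sub>R
     (LINT \<xi>|lebesgue. g \<xi> * iexp (\<xi> \<bullet> x))"
proof -
  have "cnj (LINT \<xi>|lebesgue. cnj (g \<xi>) * exp (- \<i> * complex_of_real (\<xi> \<bullet> x)))
      = (LINT \<xi>|lebesgue. cnj (cnj (g \<xi>) * exp (- \<i> * complex_of_real (\<xi> \<bullet> x))))"
    by (rule Bochner_Integration.integral_cnj[symmetric])
  also have "\<dots> = (LINT \<xi>|lebesgue. g \<xi> * iexp (\<xi> \<bullet> x))"
    by (intro Bochner_Integration.integral_cong refl) (simp add: exp_cnj)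
  finally show ?thesis unfolding fourier_def complex_cnj_scaleR by simp
qed

text \<open>Plancherel's formula with a Gaussian factor. The factor makes the bounded transform of f
  integrable, so that the multiplication formula applies; on the right it reappears as a heat
  average of f, which for suitable f tends to f as \<tau> tends to 0.\<close>

lemma gauss_damped_integral:
  fixes f :: "real ^ 'n \<Rightarrow> complex"
  assumes f: "integrable lebesgue f" and \<tau>: "0 < \<tau>"
  shows "(LINT \<xi>|lebesgue. complex_of_real ((norm (fourier f \<xi>))\<^sup>2 * exp (- \<tau> * (norm \<xi>)\<^sup>2))) =
    (LINT x|lebesgue. f x * cnj (((2 * pi) powr (- (real CARD('n) / 2))) *\<^sub>R (LINT y|lebesgue. f y * complex_of_real (heat \<tau> (x - y)))))"
proof -
  let ?c = "(2 * pi) powr (- (real CARD('n) / 2))"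
  note F = fourier_measurable[OF borel_measurable_integrable[OF f]]
  note [measurable] = F lebesgue_borel_measurable[OF F]
  \<comment> \<open>Chosen so that \<open>fourier f\<close> times \<phi> is the damped square of the
    modulus, while the transform of \<phi> is the conjugate of the heat average.\<close>
  define \<phi> where "\<phi> \<xi> = cnj (fourier f \<xi> * complex_of_real (exp (- \<tau> * (norm \<xi>)\<^sup>2)))" for \<xi>
  have gw: "integrable lebesgue (gauss_wave \<tau> (0::real^'n))" by (rule gauss_wave_L1_L2(1)[OF \<tau>])
  have e: "complex_of_real (exp (- \<tau> * (norm \<xi>)\<^sup>2)) = gauss_wave \<tau> 0 \<xi>" for \<xi> :: "real^'n"
    by (simp add: gauss_wave_def scaleR_conv_of_real)
  have i: "integrable lebesgue (\<lambda>\<xi>. fourier f \<xi> * complex_of_real (exp (- \<tau> * (norm \<xi>)\<^sup>2)))"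
    unfolding e
  proof (rule Bochner_Integration.integrable_bound)
    show "integrable lebesgue (\<lambda>\<xi>. (?c * (LINT x|lebesgue. norm (f x))) * norm (gauss_wave \<tau> (0::real^'n) \<xi>))"
      using gw by (intro integrable_mult_right integrable_norm)
    show "AE \<xi> in lebesgue. norm (fourier f \<xi> * gauss_wave \<tau> (0::real^'n) \<xi>) \<le> norm ((?c * (LINT x|lebesgue. norm (f x))) * norm (gauss_wave \<tau> (0::real^'n) \<xi>))"
    proof (rule AE_I2)
      fix \<xi>
      have "norm (fourier f \<xi>) * norm (gauss_wave \<tau> (0::real^'n) \<xi>) \<le> (?c * (LINT x|lebesgue. norm (f x))) * norm (gauss_wave \<tau> (0::real^'n) \<xi>)"
        by (intro mult_right_mono norm_fourier_le) simp
      then show "norm (fourier f \<xi> * gauss_wave \<tau> (0::real^'n) \<xi>) \<le> norm ((?c * (LINT x|lebesgue. norm (f x))) * norm (gauss_wave \<tau> (0::real^'n) \<xi>))"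
        by (simp add: norm_mult)
    qed
  qed simp
  then have \<phi>i: "integrable lebesgue \<phi>" unfolding \<phi>_def by (simp only: integrable_cnj)
  have wave: "fourier f \<xi> * complex_of_real (exp (- \<tau> * (norm \<xi>)\<^sup>2)) * iexp (\<xi> \<bullet> x) = fourier f \<xi> * gauss_wave \<tau> x \<xi>" for \<xi> x
    by (simp add: gauss_wave_def scaleR_conv_of_real)
  have F\<phi>: "fourier \<phi> x = cnj (?c *\<^sub>R (LINT y|lebesgue. f y * complex_of_real (heat \<tau> (x - y))))" for x
  proof -
    have "cnj (fourier \<phi> x) = ?c *\<^sub>R (LINT \<xi>|lebesgue. fourier f \<xi> * gauss_wave \<tau> x \<xi>)"
      unfolding \<phi>_def cnj_integral_fourier wave ..
    also have "(LINT \<xi>|lebesgue. fourier f \<xi> * gauss_wave \<tau> x \<xi>) = (LINT y|lebesgue. f y * fourier (gauss_wave \<tau> x) y)"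
      by (rule fourier_multiplication_formula[OF f gauss_wave_L1_L2(1)[OF \<tau>]])
    finally have "cnj (fourier \<phi> x) = ?c *\<^sub>R (LINT y|lebesgue. f y * complex_of_real (heat \<tau> (x - y)))"
      unfolding fourier_gauss_wave[OF \<tau>] .
    then show ?thesis by (metis complex_cnj_cnj)
  qed
  have "complex_of_real ((norm (fourier f \<xi>))\<^sup>2 * exp (- \<tau> * (norm \<xi>)\<^sup>2)) = fourier f \<xi> * \<phi> \<xi>" for \<xi>
    unfolding \<phi>_def complex_cnj_mult complex_cnj_complex_of_real mult.assoc[symmetric] complex_norm_square[symmetric]
    by simp
  then have "(LINT \<xi>|lebesgue. complex_of_real ((norm (fourier f \<xi>))\<^sup>2 * exp (- \<tau> * (norm \<xi>)\<^sup>2))) = (LINT \<xi>|lebesgue. fourier f \<xi> * \<phi> \<xi>)"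
    by simp
  also have "\<dots> = (LINT x|lebesgue. f x * fourier \<phi> x)"
    by (rule fourier_multiplication_formula[OF f \<phi>i])
  finally show ?thesis unfolding F\<phi> .
qed

text \<open>The substitution y -> x + c y moves the parameter from the kernel into the argument of
  h, so that the limit c -> 0 concerns an average against a fixed Gaussian. The time c^2 / 2 is the
  one for which this Gaussian is the standard one.\<close>

lemma heat_average:
  fixes h :: "real ^ 'n \<Rightarrow> complex"
  assumes h: "h \<in> borel_measurable borel" and c: "0 < c"
  shows "(LINT y|lebesgue. h y * complex_of_real (heat (c\<^sup>2 / 2) (x - y)))
    = (LINT y|lborel. h (x + c *\<^sub>R y) * complex_of_real (exp (- (norm y)\<^sup>2 / 2)))"
proof -
  define G where "G y = h y * complex_of_real (heat (c\<^sup>2 / 2) (x - y))" for y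
  have "(\<lambda>y. complex_of_real (heat (c\<^sup>2 / 2) (x - y))) \<in> borel_measurable borel"
    unfolding heat_def using c by (intro borel_measurable_continuous_onI continuous_intros) auto
  note [measurable] = this h
  have [measurable]: "G \<in> borel_measurable borel" unfolding G_def by measurable
  have "(LINT y|lebesgue. G y) = (LINT y|lborel. G y)"
    by (rule integral_completion) simp
  also have "\<dots> = c ^ CARD('n) *\<^sub>R (LINT y|lborel. G (x + c *\<^sub>R y))"
    using integral_lborel_scale(1)[of G c x] c by simp
  also have "\<dots> = (LINT y|lborel. c ^ CARD('n) *\<^sub>R G (x + c *\<^sub>R y))" by simp
  also have "\<dots> = (LINT y|lborel. h (x + c *\<^sub>R y) * complex_of_real (exp (- (norm y)\<^sup>2 / 2)))"
  proof (intro Bochner_Integration.integral_cong refl)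
    fix y :: "real^'n"
    have "(2 * (c\<^sup>2 / 2)) powr (- (real CARD('n) / 2)) = (c powr 2) powr (- (real CARD('n) / 2))"
      using c by (simp add: powr_numeral)
    also have "\<dots> = c powr (- real CARD('n))" by (simp add: powr_powr)
    finally have "c ^ CARD('n) * (2 * (c\<^sup>2 / 2)) powr (- (real CARD('n) / 2)) = 1"
      using c by (simp add: powr_minus powr_realpow)
    moreover have "(norm (x - (x + c *\<^sub>R y)))\<^sup>2 / (4 * (c\<^sup>2 / 2)) = (norm y)\<^sup>2 / 2"
      using c by (simp add: power_mult_distrib)
    ultimately have "c ^ CARD('n) * heat (c\<^sup>2 / 2) (x - (x + c *\<^sub>R y)) = exp (- (norm y)\<^sup>2 / 2)"
      unfolding heat_def mult.assoc[symmetric] minus_divide_left[symmetric] by simp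
    then show "c ^ CARD('n) *\<^sub>R G (x + c *\<^sub>R y) = h (x + c *\<^sub>R y) * complex_of_real (exp (- (norm y)\<^sup>2 / 2))"
      unfolding G_def scaleR_conv_of_real by (metis mult.left_commute of_real_mult)
  qed
  finally show ?thesis unfolding G_def .
qed

lemma gauss_std_real:
  "integrable lborel (\<lambda>y::real^'n. exp (- (norm y)\<^sup>2 / 2))"
  "(LINT y|lborel. exp (- (norm (y::real^'n))\<^sup>2 / 2)) = (2 * pi) powr (real CARD('n) / 2)"
  using integral_gauss_real[where 'a="real^'n", of "1/2"] by (auto simp: ac_simps)

text \<open>Both sides of \<open>gauss_damped_integral\<close> are followed as the damping
  disappears. On the right, continuity and boundedness of h give the limit of the heat averages. On
  the left, Fatou first shows that the transform is square integrable; only then is it available as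
  the majorant that identifies the limit of the norms.\<close>

lemma fourier_isometry_compact_support:
  fixes h :: "real ^ 'n \<Rightarrow> complex"
  assumes h: "compact_support_continuous h"
  shows "L2 (fourier h)" "L2_norm (fourier h) = L2_norm h"
proof -
  let ?c = "(2 * pi) powr (- (real CARD('n) / 2))"
  note hm = compact_support_continuous_L1_L2(1)[OF h]
  note hi = compact_support_continuous_L1_L2(2)[OF h] and h2 = compact_support_continuous_L1_L2(3)[OF h]
  note F = fourier_measurable[OF borel_measurable_integrable[OF hi]]
  note [measurable] = F lebesgue_borel_measurable[OF F] hm lebesgue_borel_measurable[OF hm]
  obtain B R where B: "0 \<le> B" "\<forall>x. norm (h x) \<le> B" using compact_support_continuous_bounded[OF h] by (elim exE conjE)
  have hc: "continuous_on UNIV h" using h by (simp add: compact_support_continuous_def)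
  define d where "d j = 1 / real (Suc j)" for j
  have d: "0 < d j" for j by (simp add: d_def)
  have d0: "d \<longlonglongrightarrow> 0" unfolding d_def by (rule LIMSEQ_Suc[OF lim_1_over_n, unfolded])
  define A where "A j x = ?c *\<^sub>R (LINT y|lborel. h (x + d j *\<^sub>R y) * complex_of_real (exp (- (norm y)\<^sup>2 / 2)))" for j x
  have Ah: "A j x = ?c *\<^sub>R (LINT y|lebesgue. h y * complex_of_real (heat ((d j)\<^sup>2 / 2) (x - y)))" for j x
    unfolding A_def heat_average[OF hm d] ..
  have dmeas: "(\<lambda>y. h (x + d j *\<^sub>R y)) \<in> borel_measurable borel" for x j
    by measurable
  have gint: "integrable lborel (\<lambda>y::real^'n. B * exp (- (norm y)\<^sup>2 / 2))"
    by (intro integrable_mult_right gauss_std_real(1))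
  have emeas[measurable]: "(\<lambda>y::real^'n. complex_of_real (exp (- (norm y)\<^sup>2 / 2))) \<in> borel_measurable borel"
    by (auto intro!: borel_measurable_continuous_onI continuous_intros)
  have bnd: "norm (h (x + d j *\<^sub>R y) * complex_of_real (exp (- (norm y)\<^sup>2 / 2))) \<le> B * exp (- (norm y)\<^sup>2 / 2)" for x y j
    using B(2) by (simp add: norm_mult mult_right_mono)
  have Alim: "(\<lambda>j. A j x) \<longlonglongrightarrow> h x" for x
  proof -
    have lim: "(\<lambda>j. LINT y|lborel. h (x + d j *\<^sub>R y) * complex_of_real (exp (- (norm y)\<^sup>2 / 2)))
      \<longlonglongrightarrow> (LINT y::real^'n|lborel. h x * complex_of_real (exp (- (norm y)\<^sup>2 / 2)))"
    proof (rule integral_dominated_convergence[where w="\<lambda>y. B * exp (- (norm y)\<^sup>2 / 2)"])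
      show "integrable lborel (\<lambda>y::real^'n. B * exp (- (norm y)\<^sup>2 / 2))" by (rule gint)
      show "AE y in lborel. (\<lambda>j. h (x + d j *\<^sub>R y) * complex_of_real (exp (- (norm y)\<^sup>2 / 2)))
        \<longlonglongrightarrow> h x * complex_of_real (exp (- (norm y)\<^sup>2 / 2))"
      proof (rule AE_I2)
        fix y
        have "(\<lambda>j. x + d j *\<^sub>R y) \<longlonglongrightarrow> x + 0 *\<^sub>R y" by (intro tendsto_intros d0)
        then have "(\<lambda>j. h (x + d j *\<^sub>R y)) \<longlonglongrightarrow> h x"
          by (intro continuous_on_tendsto_compose[OF hc]) auto
        then show "(\<lambda>j. h (x + d j *\<^sub>R y) * complex_of_real (exp (- (norm y)\<^sup>2 / 2)))
          \<longlonglongrightarrow> h x * complex_of_real (exp (- (norm y)\<^sup>2 / 2))" by (intro tendsto_intros)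
      qed
    qed (use bnd in auto)
    have lim_eq: "?c *\<^sub>R (LINT y|lborel. h x * complex_of_real (exp (- (norm (y::real^'n))\<^sup>2 / 2))) = h x"
    proof -
      have "(LINT y|lborel. h x * complex_of_real (exp (- (norm (y::real^'n))\<^sup>2 / 2)))
          = h x * complex_of_real (LINT y|lborel. exp (- (norm (y::real^'n))\<^sup>2 / 2))"
        by (simp only: integral_mult_right_zero integral_complex_of_real)
      note E = this[unfolded gauss_std_real(2)]
      have "complex_of_real ?c * complex_of_real ((2 * pi) powr (real CARD('n) / 2)) = 1"
        unfolding of_real_mult[symmetric] by (simp add: powr_minus)
      then show ?thesis unfolding E scaleR_conv_of_real by (metis mult.left_commute mult.right_neutral)
    qed
    show ?thesis
      using tendsto_scaleR[OF tendsto_const[of ?c] lim] unfolding lim_eq A_def .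
  qed
  have Ab: "norm (A j x) \<le> B" for j x
  proof -
    have i: "integrable lborel (\<lambda>y. h (x + d j *\<^sub>R y) * complex_of_real (exp (- (norm y)\<^sup>2 / 2)))"
    proof (rule Bochner_Integration.integrable_bound[OF gint])
      show "AE y in lborel. norm (h (x + d j *\<^sub>R y) * complex_of_real (exp (- (norm y)\<^sup>2 / 2))) \<le> norm (B * exp (- (norm y)\<^sup>2 / 2))"
        using bnd B(1) by (intro AE_I2) (simp add: abs_mult)
    qed measurable
    have "norm (LINT y|lborel. h (x + d j *\<^sub>R y) * complex_of_real (exp (- (norm y)\<^sup>2 / 2)))
       \<le> (LINT y|lborel. norm (h (x + d j *\<^sub>R y) * complex_of_real (exp (- (norm y)\<^sup>2 / 2))))"
      by (rule integral_norm_bound)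
    also have "\<dots> \<le> (LINT y|lborel. B * exp (- (norm (y::real^'n))\<^sup>2 / 2))"
      by (rule integral_mono[OF integrable_norm[OF i] gint]) (rule bnd)
    also have "\<dots> = B * (2 * pi) powr (real CARD('n) / 2)" unfolding integral_mult_right_zero gauss_std_real(2) ..
    finally have "norm (A j x) \<le> ?c * (B * (2 * pi) powr (real CARD('n) / 2))"
      unfolding A_def by (simp add: mult_left_mono)
    also have "\<dots> = B" by (simp add: powr_minus)
    finally show ?thesis .
  qed
  have Am: "A j \<in> borel_measurable borel" for j
  proof -
    have "(\<lambda>x. LINT y|lborel. h (x + d j *\<^sub>R y) * complex_of_real (exp (- (norm y)\<^sup>2 / 2))) \<in> borel_measurable borel"
      by (rule lborel.borel_measurable_lebesgue_integral) measurable
    then show ?thesis unfolding A_def by measurable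
  qed
  note [measurable] = Am lebesgue_borel_measurable[OF Am]
  have inner: "(\<lambda>j. LINT x|lebesgue. h x * cnj (A j x)) \<longlonglongrightarrow> (LINT x|lebesgue. h x * cnj (h x))"
  proof (rule integral_dominated_convergence)
    show "integrable lebesgue (\<lambda>x. norm (h x) * B)" using hi by simp
    show "AE x in lebesgue. (\<lambda>j. h x * cnj (A j x)) \<longlonglongrightarrow> h x * cnj (h x)"
      by (intro AE_I2 tendsto_intros Alim)
    show "AE x in lebesgue. norm (h x * cnj (A j x)) \<le> norm (h x) * B" for j
      using Ab by (intro AE_I2) (simp add: norm_mult mult_left_mono)
    show "(\<lambda>x. h x * cnj (h x)) \<in> borel_measurable lebesgue"
      using L2_measurable[OF L2_cnj[OF h2]] by measurable
    have "(\<lambda>x. cnj (A j x)) \<in> borel_measurable lebesgue" for j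
      by (auto intro!: measurable_compose[OF lebesgue_borel_measurable[OF Am], of cnj] borel_measurable_continuous_onI continuous_intros)
    then show "(\<lambda>x. h x * cnj (A j x)) \<in> borel_measurable lebesgue" for j by measurable
  qed
  \<comment> \<open>Half of the damping rate that belongs to \<open>A j\<close>, because the norm of
    \<open>f j\<close> gets squared.\<close>
  define f where "f j \<xi> = exp (- ((d j)\<^sup>2 / 4) * (norm \<xi>)\<^sup>2) *\<^sub>R fourier h \<xi>" for j \<xi>
  have em: "(\<lambda>\<xi>::real^'n. exp (- ((d j)\<^sup>2 / 4) * (norm \<xi>)\<^sup>2)) \<in> borel_measurable borel" for j
    by (intro borel_measurable_continuous_onI continuous_intros)
  note [measurable] = lebesgue_borel_measurable[OF em]
  have fm[measurable]: "f j \<in> borel_measurable lebesgue" for j unfolding f_def by measurable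
  have nf: "(norm (f j \<xi>))\<^sup>2 = (norm (fourier h \<xi>))\<^sup>2 * exp (- ((d j)\<^sup>2 / 2) * (norm \<xi>)\<^sup>2)" for j \<xi>
  proof -
    have "(exp (- ((d j)\<^sup>2 / 4) * (norm \<xi>)\<^sup>2))\<^sup>2 = exp (- ((d j)\<^sup>2 / 2) * (norm \<xi>)\<^sup>2)"
      unfolding power2_eq_square exp_add[symmetric] by simp
    then show ?thesis unfolding f_def norm_scaleR power_mult_distrib by simp
  qed
  have fle: "norm (f j \<xi>) \<le> norm (fourier h \<xi>)" for j \<xi>
    unfolding f_def by (simp add: mult_left_le_one_le)
  have f2: "L2 (f j)" for j
  proof -
    have "L2 (gauss_wave ((d j)\<^sup>2 / 4) (0::real^'n))" by (rule gauss_wave_L1_L2(2)) (use d[of j] in auto)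
    then show ?thesis
    proof (rule L2_bound(1)[OF fm])
      show "AE \<xi> in lebesgue. norm (f j \<xi>) \<le> (?c * (LINT x|lebesgue. norm (h x))) * norm (gauss_wave ((d j)\<^sup>2 / 4) 0 \<xi>)"
        unfolding f_def norm_gauss_wave using norm_fourier_le[of h] by (intro AE_I2) (simp add: mult.commute mult_right_mono)
    qed simp
  qed
  have "complex_of_real ((L2_norm (f j))\<^sup>2) = (LINT x|lebesgue. h x * cnj (A j x))" for j
    unfolding L2_norm_power2 nf integral_complex_of_real[symmetric] Ah
    by (rule gauss_damped_integral[OF hi]) (use d[of j] in auto)
  with inner have "(\<lambda>j. complex_of_real ((L2_norm (f j))\<^sup>2)) \<longlonglongrightarrow> (LINT x|lebesgue. h x * cnj (h x))" by simp
  also have "(LINT x|lebesgue. h x * cnj (h x)) = complex_of_real ((L2_norm h)\<^sup>2)"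
    unfolding L2_norm_power2 integral_complex_of_real[symmetric] complex_norm_square ..
  finally have "(\<lambda>j. (L2_norm (f j))\<^sup>2) \<longlonglongrightarrow> (L2_norm h)\<^sup>2" by (simp only: tendsto_of_real_iff)
  then have "(\<lambda>j. sqrt ((L2_norm (f j))\<^sup>2)) \<longlonglongrightarrow> sqrt ((L2_norm h)\<^sup>2)" by (rule tendsto_real_sqrt)
  then have nlim: "(\<lambda>j. L2_norm (f j)) \<longlonglongrightarrow> L2_norm h" by simp
  have flim: "(\<lambda>j. f j \<xi>) \<longlonglongrightarrow> fourier h \<xi>" for \<xi>
  proof -
    have "(\<lambda>j. exp (- ((d j)\<^sup>2 / 4) * (norm \<xi>)\<^sup>2) *\<^sub>R fourier h \<xi>) \<longlonglongrightarrow> exp (- (0\<^sup>2 / 4) * (norm \<xi>)\<^sup>2) *\<^sub>R fourier h \<xi>"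
      by (intro tendsto_intros d0) auto
    then show ?thesis unfolding f_def by simp
  qed
  show L: "L2 (fourier h)"
  proof (rule L2_Fatou(1)[where f=f, OF f2])
    show "AE \<xi> in lebesgue. (\<lambda>j. f j \<xi>) \<longlonglongrightarrow> fourier h \<xi>" by (rule AE_I2[OF flim])
    show "\<forall>\<^sub>F j in sequentially. L2_norm (f j) \<le> L2_norm h + 1"
      using order_tendstoD(2)[OF nlim, of "L2_norm h + 1"] by (auto elim: eventually_mono)
  qed simp
  have "(\<lambda>j. L2_norm (\<lambda>\<xi>. f j \<xi> - fourier h \<xi>)) \<longlonglongrightarrow> 0"
    by (rule L2_dominated(3)[where f=f and h="fourier h", OF fm _ L AE_I2[OF flim] AE_I2[OF fle]]) simp
  then have "(\<lambda>j. L2_norm (f j)) \<longlonglongrightarrow> L2_norm (fourier h)"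
    by (rule L2_tendsto_norm[where f=f, OF always_eventually[OF allI[OF f2]] L])
  with nlim show "L2_norm (fourier h) = L2_norm h" by (metis LIMSEQ_unique)
qed

text \<open>The approximants converge in L1 and in L2 at once. The L1 error gives pointwise
  convergence of the transforms, and the isometry on the approximants gives convergence in L2 to the
  same function.\<close>

lemma fourier_isometry_L1_L2:
  fixes f :: "real ^ 'n \<Rightarrow> complex"
  assumes f: "integrable lebesgue f" "L2 f"
  shows "L2 (fourier f)" "L2_norm (fourier f) = L2_norm f"
proof -
  let ?c = "(2 * pi) powr (- (real CARD('n) / 2))"
  have "\<exists>h. compact_support_continuous h \<and> (LINT x|lebesgue. norm (h x - f x)) < 1 / real (Suc j) \<and>
      L2_norm (\<lambda>x. h x - f x) < 1 / real (Suc j)" for j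
    by (rule compact_support_continuous_dense[OF f]) simp
  then obtain h where h: "\<And>j. compact_support_continuous (h j)"
    and h1: "\<And>j. (LINT x|lebesgue. norm (h j x - f x)) < 1 / real (Suc j)"
    and h2: "\<And>j. L2_norm (\<lambda>x. h j x - f x) < 1 / real (Suc j)" by metis
  note hL = compact_support_continuous_L1_L2[OF h]
  have z: "(\<lambda>j. 1 / real (Suc j)) \<longlonglongrightarrow> 0" by (rule LIMSEQ_Suc[OF lim_1_over_n])
  have zc: "(\<lambda>j. ?c * (1 / real (Suc j))) \<longlonglongrightarrow> 0" by (rule tendsto_mult_right_zero[OF z])
  have Flim: "(\<lambda>j. fourier (h j) \<xi>) \<longlonglongrightarrow> fourier f \<xi>" for \<xi>
  proof -
    have "norm (fourier (h j) \<xi> - fourier f \<xi>) \<le> ?c * (1 / real (Suc j))" for j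
    proof -
      have "norm (fourier (h j) \<xi> - fourier f \<xi>) = norm (fourier (\<lambda>x. h j x - f x) \<xi>)"
        using fourier_diff[OF hL(2) f(1)] by simp
      also have "\<dots> \<le> ?c * (LINT x|lebesgue. norm (h j x - f x))" by (rule norm_fourier_le)
      also have "\<dots> \<le> ?c * (1 / real (Suc j))" using h1[of j] by (intro mult_left_mono) auto
      finally show ?thesis .
    qed
    then have "(\<lambda>j. fourier (h j) \<xi> - fourier f \<xi>) \<longlonglongrightarrow> 0"
      by (intro Lim_null_comparison[OF _ zc]) auto
    then show ?thesis by (simp add: LIM_zero_iff)
  qed
  have hF: "L2 (fourier (h j))" and hN: "L2_norm (fourier (h j)) = L2_norm (h j)" for j
    using fourier_isometry_compact_support[OF h] by auto
  note Fm = fourier_measurable[OF borel_measurable_integrable[OF f(1)]]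
  \<comment> \<open>Fatou with j fixed and i tending to infinity. The factor 2 comes from the
    triangle inequality through f, where both errors are at most 1 / (j + 1).\<close>
  have ev: "L2 (\<lambda>\<xi>. fourier (h j) \<xi> - fourier f \<xi>) \<and> L2_norm (\<lambda>\<xi>. fourier (h j) \<xi> - fourier f \<xi>) \<le> 2 * (1 / real (Suc j))" for j
  proof -
    have a: "AE \<xi> in lebesgue. (\<lambda>i. fourier (h j) \<xi> - fourier (h i) \<xi>) \<longlonglongrightarrow> fourier (h j) \<xi> - fourier f \<xi>"
      by (intro AE_I2 tendsto_intros Flim)
    have m: "(\<lambda>\<xi>. fourier (h j) \<xi> - fourier f \<xi>) \<in> borel_measurable lebesgue"
      using L2_measurable[OF hF[of j]] lebesgue_borel_measurable[OF Fm] by measurable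
    have b: "\<forall>\<^sub>F i in sequentially. L2_norm (\<lambda>\<xi>. fourier (h j) \<xi> - fourier (h i) \<xi>) \<le> 2 * (1 / real (Suc j))"
      using eventually_ge_at_top[of j]
    proof eventually_elim
      case (elim i)
      have "L2_norm (\<lambda>\<xi>. fourier (h j) \<xi> - fourier (h i) \<xi>) = L2_norm (fourier (\<lambda>x. h j x - h i x))"
        by (rule arg_cong[where f=L2_norm], rule ext) (rule fourier_diff[OF hL(2) hL(2), symmetric])
      also have "\<dots> = L2_norm (\<lambda>x. h j x - h i x)"
        by (rule fourier_isometry_compact_support(2)[OF compact_support_continuous_diff[OF h h]])
      also have "\<dots> \<le> L2_norm (\<lambda>x. h j x - f x) + L2_norm (\<lambda>x. f x - h i x)"
        by (rule L2_triangle_diff[OF hL(3) f(2) hL(3)])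
      also have "\<dots> \<le> 1 / real (Suc j) + 1 / real (Suc i)"
        using h2[of j] h2[of i] L2_norm_uminus[of f "h i"] by linarith
      also have "1 / real (Suc i) \<le> 1 / real (Suc j)" using elim by (simp add: frac_le)
      finally show ?case by simp
    qed
    show ?thesis using L2_Fatou[OF L2_diff[OF hF hF] m a b] by simp
  qed
  have "L2 (\<lambda>\<xi>. fourier (h 0) \<xi> - (fourier (h 0) \<xi> - fourier f \<xi>))"
    by (rule L2_diff[OF hF conjunct1[OF ev]])
  then show L: "L2 (fourier f)" by simp
  have "(\<lambda>j. L2_norm (\<lambda>\<xi>. fourier (h j) \<xi> - fourier f \<xi>)) \<longlonglongrightarrow> 0"
    by (rule Lim_null_comparison[OF always_eventually tendsto_mult_right_zero[OF z, of 2]], rule allI)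
       (use conjunct2[OF ev] in simp)
  then have 1: "(\<lambda>j. L2_norm (fourier (h j))) \<longlonglongrightarrow> L2_norm (fourier f)"
    by (rule L2_tendsto_norm[where f="\<lambda>j. fourier (h j)", OF always_eventually[OF allI[OF hF]] L])
  have "(\<lambda>j. L2_norm (\<lambda>x. h j x - f x)) \<longlonglongrightarrow> 0"
    by (rule Lim_null_comparison[OF always_eventually z], rule allI) (use less_imp_le[OF h2] in simp)
  then have 2: "(\<lambda>j. L2_norm (h j)) \<longlonglongrightarrow> L2_norm f"
    by (rule L2_tendsto_norm[where f=h, OF always_eventually[OF allI[OF hL(3)]] f(2)])
  from 1 2 show "L2_norm (fourier f) = L2_norm f" unfolding hN by (metis LIMSEQ_unique)
qed

section \<open>The Fourier transform on square integrable functions\<close>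

definition truncation :: "(real ^ 'n \<Rightarrow> complex) \<Rightarrow> real \<Rightarrow> real ^ 'n \<Rightarrow> complex" where
  "truncation w R x = indicator (cball 0 R) x *\<^sub>R w x"

lemma is_fourier_truncation:
  "is_fourier w g \<longleftrightarrow> L2 w \<and> L2 g \<and>
     ((\<lambda>R. L2_norm (\<lambda>\<xi>. fourier (truncation w R) \<xi> - g \<xi>)) \<longlongrightarrow> 0) at_top"
  unfolding is_fourier_def truncation_def ..

lemma is_fourier_L2: "is_fourier w g \<Longrightarrow> L2 w" "is_fourier w g \<Longrightarrow> L2 g"
  by (auto simp: is_fourier_def)

lemma truncation_measurable:
  fixes w :: "real ^ 'n \<Rightarrow> complex"
  assumes [measurable]: "w \<in> borel_measurable lebesgue"
  shows "truncation w R \<in> borel_measurable lebesgue"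
  unfolding truncation_def[abs_def]
  by (intro borel_measurable_scaleR borel_measurable_indicator assms) simp

lemma norm_truncation_le: "norm (truncation w R x) \<le> norm (w x)"
  by (simp add: truncation_def indicator_def)

lemma truncation_L2:
  fixes w :: "real ^ 'n \<Rightarrow> complex"
  assumes "L2 w" shows "L2 (truncation w R)"
  by (rule L2_bound(1)[OF truncation_measurable[OF L2_measurable[OF assms]] assms, of 1])
     (use norm_truncation_le in auto)

lemma truncation_L1:
  fixes w :: "real ^ 'n \<Rightarrow> complex"
  assumes "L2 w" shows "integrable lebesgue (truncation w R)"
proof -
  have "integrable lebesgue (\<lambda>x. complex_of_real (1 * indicator (cball 0 R) x) * w x)"
    by (rule L2_prod_integrable(1)[OF indicator_cball_L1_L2(2) assms])
  moreover have "(\<lambda>x. complex_of_real (1 * indicator (cball 0 R) x) * w x) = truncation w R"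
    by (auto simp: truncation_def indicator_def fun_eq_iff)
  ultimately show ?thesis by simp
qed

lemma truncation_tendsto:
  fixes w :: "real ^ 'n \<Rightarrow> complex"
  assumes w: "L2 w"
  shows "((\<lambda>R. L2_norm (\<lambda>x. truncation w R x - w x)) \<longlongrightarrow> 0) at_top"
proof (rule tendsto_at_topI_sequentially)
  fix X :: "nat \<Rightarrow> real" assume X: "filterlim X at_top sequentially"
  have lim: "(\<lambda>j. truncation w (X j) x) \<longlonglongrightarrow> w x" for x
  proof (rule tendsto_eventually)
    have "\<forall>\<^sub>F j in sequentially. norm x \<le> X j"
      using X by (simp add: filterlim_at_top)
    then show "\<forall>\<^sub>F j in sequentially. truncation w (X j) x = w x"
      by eventually_elim (simp add: truncation_def)
  qed
  show "(\<lambda>j. L2_norm (\<lambda>x. truncation w (X j) x - w x)) \<longlonglongrightarrow> 0"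
    by (rule L2_dominated(3)[where f="\<lambda>j. truncation w (X j)" and h=w,
          OF truncation_measurable[OF L2_measurable[OF w]] L2_measurable[OF w] w AE_I2[OF lim] AE_I2[OF norm_truncation_le]])
qed

lemma L2_norm_fourier_diff:
  fixes f g :: "real ^ 'n \<Rightarrow> complex"
  assumes f: "integrable lebesgue f" "L2 f" and g: "integrable lebesgue g" "L2 g"
  shows "L2_norm (\<lambda>\<xi>. fourier f \<xi> - fourier g \<xi>) = L2_norm (\<lambda>x. f x - g x)"
proof -
  have "(\<lambda>\<xi>. fourier f \<xi> - fourier g \<xi>) = fourier (\<lambda>x. f x - g x)"
    by (rule ext) (rule fourier_diff[OF f(1) g(1), symmetric])
  then show ?thesis
    using fourier_isometry_L1_L2(2)[OF Bochner_Integration.integrable_diff[OF f(1) g(1)] L2_diff[OF f(2) g(2)]] by simp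
qed

lemma is_fourier_fourier:
  fixes f :: "real ^ 'n \<Rightarrow> complex"
  assumes f: "integrable lebesgue f" "L2 f"
  shows "is_fourier f (fourier f)"
  unfolding is_fourier_truncation
    L2_norm_fourier_diff[OF truncation_L1[OF f(2)] truncation_L2[OF f(2)] f]
  using f fourier_isometry_L1_L2(1)[OF f] truncation_tendsto[OF f(2)] by simp

text \<open>Completeness provides a limit along integer radii. The distance of two truncated
  transforms is the distance of the truncations, and this quantitative bound extends the limit to
  all radii.\<close>

lemma is_fourier_exists:
  fixes w :: "real ^ 'n \<Rightarrow> complex"
  assumes w: "L2 w"
  shows "\<exists>g. is_fourier w g"
proof -
  note t = truncation_L1[OF w] truncation_L2[OF w]
  define F where "F R = fourier (truncation w R)" for R
  have F: "L2 (F R)" for R unfolding F_def by (rule fourier_isometry_L1_L2(1)[OF t])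
  have FF: "L2_norm (\<lambda>\<xi>. F R \<xi> - F S \<xi>) = L2_norm (\<lambda>x. truncation w R x - truncation w S x)" for R S
    unfolding F_def by (rule L2_norm_fourier_diff[OF t t])
  have FFle: "L2_norm (\<lambda>\<xi>. F R \<xi> - F S \<xi>) \<le> L2_norm (\<lambda>x. truncation w R x - w x) + L2_norm (\<lambda>x. truncation w S x - w x)" for R S
    unfolding FF using L2_triangle_diff[OF t(2) w t(2), of R S] by (simp add: L2_norm_uminus[of w])
  have tn: "(\<lambda>j. L2_norm (\<lambda>x. truncation w (real j) x - w x)) \<longlonglongrightarrow> 0"
    by (rule filterlim_compose[OF truncation_tendsto[OF w] filterlim_real_sequentially])
  have "\<exists>g. L2 g \<and> (\<lambda>j. L2_norm (\<lambda>\<xi>. F (real j) \<xi> - g \<xi>)) \<longlonglongrightarrow> 0"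
  proof (rule L2_complete[where f="\<lambda>j. F (real j)", OF F])
    fix e :: real assume e: "0 < e"
    then have "\<forall>\<^sub>F j in sequentially. L2_norm (\<lambda>x. truncation w (real j) x - w x) < e / 2"
      by (intro order_tendstoD(2)[OF tn]) simp
    then obtain N where N: "\<forall>j\<ge>N. L2_norm (\<lambda>x. truncation w (real j) x - w x) < e / 2"
      unfolding eventually_sequentially by (elim exE)
    have "L2_norm (\<lambda>\<xi>. F (real i) \<xi> - F (real j) \<xi>) \<le> e" if "i \<ge> N" "j \<ge> N" for i j
    proof -
      have "L2_norm (\<lambda>x. truncation w (real i) x - w x) < e / 2" "L2_norm (\<lambda>x. truncation w (real j) x - w x) < e / 2"
        using N that by auto
      then show ?thesis using FFle[of "real i" "real j"] by linarith
    qed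
    then show "\<exists>N. \<forall>i\<ge>N. \<forall>j\<ge>N. L2_norm (\<lambda>\<xi>. F (real i) \<xi> - F (real j) \<xi>) \<le> e" by blast
  qed
  then obtain g where g: "L2 g" "(\<lambda>j. L2_norm (\<lambda>\<xi>. F (real j) \<xi> - g \<xi>)) \<longlonglongrightarrow> 0" by (elim exE conjE)
  have le: "L2_norm (\<lambda>\<xi>. F R \<xi> - g \<xi>) \<le> L2_norm (\<lambda>x. truncation w R x - w x)" for R
  proof (rule LIMSEQ_le_const)
    have "(\<lambda>j. L2_norm (\<lambda>x. truncation w R x - w x) + L2_norm (\<lambda>x. truncation w (real j) x - w x) + L2_norm (\<lambda>\<xi>. F (real j) \<xi> - g \<xi>))
      \<longlonglongrightarrow> L2_norm (\<lambda>x. truncation w R x - w x) + 0 + 0"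
      by (intro tendsto_intros tn g(2))
    then show "(\<lambda>j. L2_norm (\<lambda>x. truncation w R x - w x) + L2_norm (\<lambda>x. truncation w (real j) x - w x) + L2_norm (\<lambda>\<xi>. F (real j) \<xi> - g \<xi>))
      \<longlonglongrightarrow> L2_norm (\<lambda>x. truncation w R x - w x)" by simp
    have "L2_norm (\<lambda>\<xi>. F R \<xi> - g \<xi>) \<le> L2_norm (\<lambda>x. truncation w R x - w x) + L2_norm (\<lambda>x. truncation w (real j) x - w x) + L2_norm (\<lambda>\<xi>. F (real j) \<xi> - g \<xi>)" for j
      using L2_triangle_diff[OF F F g(1), of R "real j"] FFle[of R "real j"] by linarith
    then show "\<exists>N. \<forall>j\<ge>N. L2_norm (\<lambda>\<xi>. F R \<xi> - g \<xi>) \<le> L2_norm (\<lambda>x. truncation w R x - w x) + L2_norm (\<lambda>x. truncation w (real j) x - w x) + L2_norm (\<lambda>\<xi>. F (real j) \<xi> - g \<xi>)"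
      by blast
  qed
  have "((\<lambda>R. L2_norm (\<lambda>\<xi>. F R \<xi> - g \<xi>)) \<longlongrightarrow> 0) at_top"
    by (rule Lim_null_comparison[OF always_eventually truncation_tendsto[OF w]]) (use le in auto)
  then show ?thesis using w g(1) unfolding is_fourier_truncation F_def by blast
qed

lemma fourier_truncation_L2: "L2 w \<Longrightarrow> L2 (fourier (truncation w R))"
  using fourier_isometry_L1_L2(1)[OF truncation_L1 truncation_L2] by blast

lemma is_fourier_isometry:
  assumes "is_fourier w g" shows "L2_norm g = L2_norm w"
proof -
  note wg = is_fourier_L2[OF assms]
  have "((\<lambda>R. L2_norm (fourier (truncation w R))) \<longlongrightarrow> L2_norm g) at_top"
    by (rule L2_tendsto_norm[where f="\<lambda>R. fourier (truncation w R)", OF always_eventually[OF allI[OF fourier_truncation_L2[OF wg(1)]]] wg(2)])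
       (use assms in \<open>simp add: is_fourier_truncation\<close>)
  moreover have "((\<lambda>R. L2_norm (truncation w R)) \<longlongrightarrow> L2_norm w) at_top"
    by (rule L2_tendsto_norm[where f="truncation w", OF always_eventually[OF allI[OF truncation_L2[OF wg(1)]]] wg(1) truncation_tendsto[OF wg(1)]])
  ultimately show ?thesis
    unfolding fourier_isometry_L1_L2(2)[OF truncation_L1[OF wg(1)] truncation_L2[OF wg(1)]]
    by (rule tendsto_unique[OF trivial_limit_at_top_linorder])
qed

lemma truncation_diff: "truncation (\<lambda>x. f x - g x) R = (\<lambda>x. truncation f R x - truncation g R x)"
  by (auto simp: truncation_def scaleR_diff_right)

lemma is_fourier_diff:
  fixes v w :: "real ^ 'n \<Rightarrow> complex"
  assumes v: "is_fourier v f" and w: "is_fourier w g"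
  shows "is_fourier (\<lambda>x. v x - w x) (\<lambda>\<xi>. f \<xi> - g \<xi>)"
proof -
  note Lv = is_fourier_L2[OF v] and Lw = is_fourier_L2[OF w]
  let ?F = "\<lambda>u R. fourier (truncation u R)"
  have "((\<lambda>R. L2_norm (\<lambda>\<xi>. ?F v R \<xi> - f \<xi>) + L2_norm (\<lambda>\<xi>. ?F w R \<xi> - g \<xi>)) \<longlongrightarrow> 0 + 0) at_top"
    by (intro tendsto_add) (use v w in \<open>auto simp: is_fourier_truncation\<close>)
  then have s: "((\<lambda>R. L2_norm (\<lambda>\<xi>. ?F v R \<xi> - f \<xi>) + L2_norm (\<lambda>\<xi>. ?F w R \<xi> - g \<xi>)) \<longlongrightarrow> 0) at_top" by simp
  have le: "L2_norm (\<lambda>\<xi>. ?F (\<lambda>x. v x - w x) R \<xi> - (f \<xi> - g \<xi>)) \<le> L2_norm (\<lambda>\<xi>. ?F v R \<xi> - f \<xi>) + L2_norm (\<lambda>\<xi>. ?F w R \<xi> - g \<xi>)" for R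
  proof -
    have "(\<lambda>\<xi>. ?F (\<lambda>x. v x - w x) R \<xi> - (f \<xi> - g \<xi>)) = (\<lambda>\<xi>. (?F v R \<xi> - f \<xi>) + (g \<xi> - ?F w R \<xi>))"
      unfolding truncation_diff fourier_diff[OF truncation_L1[OF Lv(1)] truncation_L1[OF Lw(1)]] by auto
    then show ?thesis
      using L2_triangle[OF L2_diff[OF fourier_truncation_L2[OF Lv(1)] Lv(2)] L2_diff[OF Lw(2) fourier_truncation_L2[OF Lw(1)]], of R R]
      by (simp add: L2_norm_uminus[of g])
  qed
  have "((\<lambda>R. L2_norm (\<lambda>\<xi>. ?F (\<lambda>x. v x - w x) R \<xi> - (f \<xi> - g \<xi>))) \<longlongrightarrow> 0) at_top"
    by (rule Lim_null_comparison[OF always_eventually s]) (use le in simp)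
  then show ?thesis unfolding is_fourier_truncation using Lv Lw by (auto intro: L2_diff)
qed

text \<open>Either side says that an L2 distance vanishes, and the transform preserves this
  distance. Uniqueness statements are carried between frequency and space in this way.\<close>

lemma is_fourier_eq_iff:
  fixes v w :: "real ^ 'n \<Rightarrow> complex"
  assumes v: "is_fourier v f" and w: "is_fourier w g"
  shows "(AE \<xi> in lebesgue. f \<xi> = g \<xi>) \<longleftrightarrow> (AE x in lebesgue. v x = w x)"
proof -
  note Lv = is_fourier_L2[OF v] and Lw = is_fourier_L2[OF w]
  have e: "L2_norm (\<lambda>\<xi>. f \<xi> - g \<xi>) = L2_norm (\<lambda>x. v x - w x)"
    by (rule is_fourier_isometry[OF is_fourier_diff[OF v w]])
  have "(AE x in lebesgue. p x = q x) \<longleftrightarrow> L2_norm (\<lambda>x. p x - q x) = 0" if "L2 p" "L2 q" for p q :: "real ^ 'n \<Rightarrow> complex"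
  proof
    assume "AE x in lebesgue. p x = q x"
    then have "AE x in lebesgue. p x - q x = 0" by eventually_elim simp
    then have "L2_norm (\<lambda>x. p x - q x) = L2_norm (\<lambda>x::real^'n. 0)"
      by (rule L2_norm_cong_AE[OF L2_measurable[OF L2_diff[OF that]]])
    then show "L2_norm (\<lambda>x. p x - q x) = 0" by (simp add: L2_norm_zero)
  qed (rule L2_eq_AE[OF that])
  with Lv Lw e show ?thesis by simp
qed

lemma is_fourier_cong:
  fixes w :: "real ^ 'n \<Rightarrow> complex"
  assumes w: "is_fourier w g" and eq: "AE \<xi> in lebesgue. g \<xi> = g' \<xi>"
  shows "is_fourier w g'"
proof -
  note L = is_fourier_L2[OF w]
  have "L2_norm (\<lambda>\<xi>. fourier (truncation w R) \<xi> - g' \<xi>) = L2_norm (\<lambda>\<xi>. fourier (truncation w R) \<xi> - g \<xi>)" for R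
  proof (rule L2_norm_cong_AE[symmetric])
    show "(\<lambda>\<xi>. fourier (truncation w R) \<xi> - g \<xi>) \<in> borel_measurable lebesgue"
      by (rule L2_measurable[OF L2_diff[OF fourier_truncation_L2[OF L(1)] L(2)]])
  qed (use eq in auto)
  with w L2_cong_AE[OF L(2) eq] show ?thesis by (simp add: is_fourier_truncation)
qed

lemma is_fourier_AE_unique:
  "is_fourier w f \<Longrightarrow> is_fourier w g \<Longrightarrow> AE \<xi> in lebesgue. f \<xi> = g \<xi>"
  by (simp add: is_fourier_eq_iff)

lemma is_fourier_fourier_L2:
  assumes "L2 w" shows "is_fourier w (fourier_L2 w)"
  unfolding fourier_L2_def using is_fourier_exists[OF assms] by (rule someI_ex)

section \<open>The multiplication formula and inversion in L2\<close>

lemma L2_integral_tendsto: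
  fixes f :: "'a \<Rightarrow> real ^ 'n \<Rightarrow> complex"
  assumes f: "\<And>i. L2 (f i)" and f0: "L2 f0" and h: "\<And>i. L2 (h i)" and h0: "L2 h0"
    and flim: "((\<lambda>i. L2_norm (\<lambda>x. f i x - f0 x)) \<longlongrightarrow> 0) F"
    and hlim: "((\<lambda>i. L2_norm (\<lambda>x. h i x - h0 x)) \<longlongrightarrow> 0) F"
  shows "((\<lambda>i. LINT x|lebesgue. f i x * h i x) \<longlongrightarrow> (LINT x|lebesgue. f0 x * h0 x)) F"
proof -
  have nh: "((\<lambda>i. L2_norm (h i)) \<longlongrightarrow> L2_norm h0) F"
    by (rule L2_tendsto_norm[OF always_eventually[OF allI[OF h]] h0 hlim])
  have "((\<lambda>i. L2_norm (\<lambda>x. f i x - f0 x) * L2_norm (h i) + L2_norm f0 * L2_norm (\<lambda>x. h i x - h0 x)) \<longlongrightarrow> 0 * L2_norm h0 + L2_norm f0 * 0) F"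
    by (intro tendsto_intros flim hlim nh)
  then have z: "((\<lambda>i. L2_norm (\<lambda>x. f i x - f0 x) * L2_norm (h i) + L2_norm f0 * L2_norm (\<lambda>x. h i x - h0 x)) \<longlongrightarrow> 0) F" by simp
  have "((\<lambda>i. (LINT x|lebesgue. f i x * h i x) - (LINT x|lebesgue. f0 x * h0 x)) \<longlongrightarrow> 0) F"
  proof (rule Lim_null_comparison[OF always_eventually z], rule allI)
    fix i
    note ip = L2_prod_integrable(1)
    have "(LINT x|lebesgue. f i x * h i x) - (LINT x|lebesgue. f0 x * h0 x)
      = (LINT x|lebesgue. (f i x - f0 x) * h i x) + (LINT x|lebesgue. f0 x * (h i x - h0 x))"
      by (simp add: left_diff_distrib right_diff_distrib Bochner_Integration.integral_diff ip[OF f h] ip[OF f0 h] ip[OF f0 h0])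
    also have "norm \<dots> \<le> L2_norm (\<lambda>x. f i x - f0 x) * L2_norm (h i) + L2_norm f0 * L2_norm (\<lambda>x. h i x - h0 x)"
      by (rule order_trans[OF norm_triangle_ineq add_mono[OF L2_Cauchy_Schwarz(2)[OF L2_diff[OF f f0] h] L2_Cauchy_Schwarz(2)[OF f0 L2_diff[OF h h0]]]])
    finally show "norm ((LINT x|lebesgue. f i x * h i x) - (LINT x|lebesgue. f0 x * h0 x))
      \<le> L2_norm (\<lambda>x. f i x - f0 x) * L2_norm (h i) + L2_norm f0 * L2_norm (\<lambda>x. h i x - h0 x)" .
  qed
  then show ?thesis by (simp add: LIM_zero_iff)
qed

lemma is_fourier_multiplication_formula:
  fixes v w :: "real ^ 'n \<Rightarrow> complex"
  assumes v: "is_fourier v f" and w: "is_fourier w g"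
  shows "(LINT \<xi>|lebesgue. f \<xi> * w \<xi>) = (LINT x|lebesgue. v x * g x)"
proof -
  note Lv = is_fourier_L2[OF v] and Lw = is_fourier_L2[OF w]
  have 1: "((\<lambda>R. LINT \<xi>|lebesgue. fourier (truncation v R) \<xi> * truncation w R \<xi>) \<longlongrightarrow> (LINT \<xi>|lebesgue. f \<xi> * w \<xi>)) at_top"
    using v by (intro L2_integral_tendsto fourier_truncation_L2 truncation_L2 truncation_tendsto Lv Lw)
      (simp add: is_fourier_truncation)
  have 2: "((\<lambda>R. LINT x|lebesgue. truncation v R x * fourier (truncation w R) x) \<longlongrightarrow> (LINT x|lebesgue. v x * g x)) at_top"
    using w by (intro L2_integral_tendsto fourier_truncation_L2 truncation_L2 truncation_tendsto Lv Lw)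
      (simp add: is_fourier_truncation)
  have "(LINT \<xi>|lebesgue. fourier (truncation v R) \<xi> * truncation w R \<xi>) = (LINT x|lebesgue. truncation v R x * fourier (truncation w R) x)" for R
    by (rule fourier_multiplication_formula[OF truncation_L1[OF Lv(1)] truncation_L1[OF Lw(1)]])
  with 1 2 show ?thesis by (simp add: tendsto_unique[OF trivial_limit_at_top_linorder])
qed

text \<open>With \<open>w = cnj (F (cnj g))\<close>, the multiplication formula gives \<open>\<langle>F w, g\<rangle> = \<parallel>g\<parallel>\<^sup>2 = \<parallel>F w\<parallel>\<^sup>2\<close>,
  so \<open>\<parallel>F w - g\<parallel> = 0\<close>.\<close>

lemma is_fourier_inverse:
  fixes g h :: "real ^ 'n \<Rightarrow> complex"
  assumes h: "is_fourier (\<lambda>\<xi>. cnj (g \<xi>)) h"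
  shows "is_fourier (\<lambda>x. cnj (h x)) g"
proof -
  note Lh = is_fourier_L2[OF h]
  have Lg: "L2 g" using L2_cnj[OF Lh(1)] by simp
  obtain f where f: "is_fourier (\<lambda>x. cnj (h x)) f" using is_fourier_exists[OF L2_cnj[OF Lh(2)]] by blast
  note Lf = is_fourier_L2(2)[OF f]
  have nf: "L2_norm f = L2_norm g"
    using is_fourier_isometry[OF f] is_fourier_isometry[OF h] by simp
  have "(LINT \<xi>|lebesgue. f \<xi> * cnj (g \<xi>)) = (LINT x|lebesgue. cnj (h x) * h x)"
    by (rule is_fourier_multiplication_formula[OF f h])
  also have "\<dots> = (LINT x|lebesgue. complex_of_real ((norm (h x))\<^sup>2))"
    unfolding complex_norm_square by (simp add: mult.commute)
  also have "\<dots> = complex_of_real ((L2_norm g)\<^sup>2)"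
    unfolding integral_complex_of_real L2_norm_power2[symmetric] is_fourier_isometry[OF h] by simp
  finally have ip: "(LINT \<xi>|lebesgue. f \<xi> * cnj (g \<xi>)) = complex_of_real ((L2_norm g)\<^sup>2)" .
  have "complex_of_real ((L2_norm (\<lambda>\<xi>. f \<xi> - g \<xi>))\<^sup>2) = (LINT \<xi>|lebesgue. (f \<xi> - g \<xi>) * cnj (f \<xi> - g \<xi>))"
    unfolding L2_norm_power2 integral_complex_of_real[symmetric] complex_norm_square ..
  also have "\<dots> = (LINT \<xi>|lebesgue. f \<xi> * cnj (f \<xi>) - f \<xi> * cnj (g \<xi>) - (cnj (f \<xi> * cnj (g \<xi>)) - g \<xi> * cnj (g \<xi>)))"
    by (intro Bochner_Integration.integral_cong refl) (simp add: algebra_simps)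
  also have "\<dots> = (LINT \<xi>|lebesgue. f \<xi> * cnj (f \<xi>)) - (LINT \<xi>|lebesgue. f \<xi> * cnj (g \<xi>))
      - (cnj (LINT \<xi>|lebesgue. f \<xi> * cnj (g \<xi>)) - (LINT \<xi>|lebesgue. g \<xi> * cnj (g \<xi>)))"
  proof -
    note i = L2_prod_integrable(1)[OF Lf L2_cnj[OF Lf]] L2_prod_integrable(1)[OF Lf L2_cnj[OF Lg]]
      L2_prod_integrable(1)[OF Lg L2_cnj[OF Lg]]
    have "integrable lebesgue (\<lambda>\<xi>. cnj (f \<xi> * cnj (g \<xi>)))" using i(2) by (simp only: integrable_cnj)
    with i show ?thesis
      by (simp only: Bochner_Integration.integral_diff Bochner_Integration.integrable_diff Bochner_Integration.integral_cnj)
  qed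
  also have "\<dots> = 0"
    unfolding ip complex_norm_square[symmetric] integral_complex_of_real L2_norm_power2[symmetric] nf by simp
  finally have "L2_norm (\<lambda>\<xi>. f \<xi> - g \<xi>) = 0" by simp
  then have "AE \<xi> in lebesgue. f \<xi> = g \<xi>" by (rule L2_eq_AE[OF Lf Lg])
  then show ?thesis by (rule is_fourier_cong[OF f])
qed

lemma is_fourier_surj:
  fixes g :: "real ^ 'n \<Rightarrow> complex"
  assumes "L2 g"
  shows "\<exists>w. is_fourier w g"
  using is_fourier_exists[OF L2_cnj[OF assms]] is_fourier_inverse by blast

text \<open>The integral on the right is, after conjugation, the classical transform of cnj g, hence
  a function whose transform is g; injectivity identifies it with w.\<close>

lemma is_fourier_inversion:
  fixes g w :: "real ^ 'n \<Rightarrow> complex"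
  assumes w: "is_fourier w g" and g: "integrable lebesgue g"
  shows "AE x in lebesgue. w x = ((2 * pi) powr (- (real CARD('n) / 2))) *\<^sub>R (LINT \<xi>|lebesgue. g \<xi> * iexp (\<xi> \<bullet> x))"
proof -
  have "is_fourier (\<lambda>\<xi>. cnj (g \<xi>)) (fourier (\<lambda>\<xi>. cnj (g \<xi>)))"
    using g is_fourier_L2(2)[OF w] by (intro is_fourier_fourier L2_cnj) (simp_all only: integrable_cnj)
  from is_fourier_inverse[OF this]
  have "is_fourier (\<lambda>x. cnj (fourier (\<lambda>\<xi>. cnj (g \<xi>)) x)) g" .
  from is_fourier_eq_iff[OF w this] show ?thesis unfolding cnj_integral_fourier by simp
qed

section \<open>A renewal equation\<close>

lemma integrable_indicator_Icc: "integrable lborel (indicator {a..b} :: real \<Rightarrow> real)"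
  by (rule integrable_real_indicator) (auto simp: emeasure_lborel_Icc_eq)

definition renewal_kernel :: "(real \<Rightarrow> real) \<Rightarrow> bool" where
  "renewal_kernel G \<longleftrightarrow> integrable lborel G \<and> (\<forall>t. 0 \<le> G t) \<and> (\<forall>t<0. G t = 0) \<and> 0 < integral\<^sup>L lborel G"

text \<open>For a kernel of mass 1, this is the probability that the i-th arrival of a renewal
  process with waiting time density \<open>G\<close> is the first arrival after time t; in general
  it is multiplied by the i-th power of the mass. Accordingly \<open>renewal_fun\<close> is the
  generating function of the index of that arrival, evaluated at x times the mass.\<close>

primrec renewal_coef :: "(real \<Rightarrow> real) \<Rightarrow> nat \<Rightarrow> real \<Rightarrow> real" where
  "renewal_coef G 0 t = (if t < 0 then 1 else 0)"
| "renewal_coef G (Suc i) t = (if t < 0 then 0 else LINT \<tau>|lborel. G \<tau> * renewal_coef G i (t - \<tau>))"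

definition renewal_sum :: "(real \<Rightarrow> real) \<Rightarrow> real \<Rightarrow> nat \<Rightarrow> real \<Rightarrow> real" where
  "renewal_sum G x J t = (\<Sum>i\<le>J. renewal_coef G i t * x ^ i)"

text \<open>The fixed point of \<open>V \<mapsto> x \<integral> G(\<tau>) V(\<cdot> - \<tau>) d\<tau>\<close> with \<open>V = 1\<close> on negative times.\<close>

definition renewal_fun :: "(real \<Rightarrow> real) \<Rightarrow> real \<Rightarrow> real \<Rightarrow> real" where
  "renewal_fun G x t = lim (\<lambda>J. renewal_sum G x J t)"

context
  fixes G :: "real \<Rightarrow> real"
  assumes G: "renewal_kernel G"
begin

lemma renewal_kernel_integrable: "integrable lborel G"
  and renewal_kernel_nonneg: "0 \<le> G t"
  and renewal_kernel_mass_pos: "0 < integral\<^sup>L lborel G"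
  using G by (auto simp: renewal_kernel_def)

lemma renewal_kernel_measurable [measurable]: "G \<in> borel_measurable borel"
  using borel_measurable_integrable[OF renewal_kernel_integrable] by simp

lemma renewal_integrable:
  assumes [measurable]: "V \<in> borel_measurable borel" and b: "\<And>t. \<bar>V t\<bar> \<le> B"
  shows "integrable lborel (\<lambda>\<tau>. G \<tau> * V (t - \<tau>))"
proof (rule Bochner_Integration.integrable_bound)
  show "integrable lborel (\<lambda>\<tau>. B * G \<tau>)" using renewal_kernel_integrable by simp
  show "AE \<tau> in lborel. norm (G \<tau> * V (t - \<tau>)) \<le> norm (B * G \<tau>)"
  proof (rule AE_I2)
    fix \<tau>
    have "\<bar>V (t - \<tau>)\<bar> * G \<tau> \<le> \<bar>B\<bar> * G \<tau>"
      using b[of "t - \<tau>"] renewal_kernel_nonneg by (intro mult_right_mono) auto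
    then show "norm (G \<tau> * V (t - \<tau>)) \<le> norm (B * G \<tau>)"
      using renewal_kernel_nonneg[of \<tau>] by (simp add: abs_mult mult.commute)
  qed
qed measurable

lemma renewal_integral_le:
  assumes V: "V \<in> borel_measurable borel" and b: "\<And>t. \<bar>V t\<bar> \<le> B" and le: "\<And>t. V t \<le> C"
  shows "(LINT \<tau>|lborel. G \<tau> * V (t - \<tau>)) \<le> integral\<^sup>L lborel G * C"
proof -
  have "(LINT \<tau>|lborel. G \<tau> * V (t - \<tau>)) \<le> (LINT \<tau>|lborel. G \<tau> * C)"
    by (rule integral_mono[OF renewal_integrable[OF V b]])
       (use renewal_kernel_integrable renewal_kernel_nonneg le in \<open>auto intro: mult_left_mono\<close>)
  then show ?thesis by simp
qed

lemma renewal_coef_properties: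
  "renewal_coef G i \<in> borel_measurable borel \<and> (\<forall>t. 0 \<le> renewal_coef G i t \<and> renewal_coef G i t \<le> integral\<^sup>L lborel G ^ i)"
proof (induction i)
  case 0
  have "renewal_coef G 0 = (\<lambda>t. if t < 0 then 1 else 0)" by (rule ext) simp
  then show ?case by simp
next
  case (Suc i)
  then have [measurable]: "renewal_coef G i \<in> borel_measurable borel"
    and b: "\<And>t. 0 \<le> renewal_coef G i t" "\<And>t. renewal_coef G i t \<le> integral\<^sup>L lborel G ^ i" by auto
  have "(\<lambda>t. LINT \<tau>|lborel. G \<tau> * renewal_coef G i (t - \<tau>)) \<in> borel_measurable borel"
    by (rule lborel.borel_measurable_lebesgue_integral) measurable
  then have "(\<lambda>t. if t < 0 then 0 else LINT \<tau>|lborel. G \<tau> * renewal_coef G i (t - \<tau>)) \<in> borel_measurable borel"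
    by measurable
  moreover have "renewal_coef G (Suc i) = (\<lambda>t. if t < 0 then 0 else LINT \<tau>|lborel. G \<tau> * renewal_coef G i (t - \<tau>))"
    by (rule ext) simp
  moreover have "0 \<le> (LINT \<tau>|lborel. G \<tau> * renewal_coef G i (t - \<tau>))" for t
    by (rule Bochner_Integration.integral_nonneg) (use renewal_kernel_nonneg b in simp)
  moreover have "(LINT \<tau>|lborel. G \<tau> * renewal_coef G i (t - \<tau>)) \<le> integral\<^sup>L lborel G * integral\<^sup>L lborel G ^ i" for t
    by (rule renewal_integral_le[where B="integral\<^sup>L lborel G ^ i"]) (use b in auto)
  ultimately show ?case using renewal_kernel_mass_pos by auto
qed

lemma renewal_coef_measurable [measurable]: "renewal_coef G i \<in> borel_measurable borel"
  and renewal_coef_nonneg: "0 \<le> renewal_coef G i t"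
  and renewal_coef_le: "renewal_coef G i t \<le> integral\<^sup>L lborel G ^ i"
  using renewal_coef_properties by auto

lemma renewal_sum_measurable [measurable]: "renewal_sum G x J \<in> borel_measurable borel"
  unfolding renewal_sum_def[abs_def] by measurable

lemma renewal_sum_neg: "t < 0 \<Longrightarrow> renewal_sum G x J t = 1"
  unfolding renewal_sum_def by (induction J) auto

text \<open>The partial sums are the iterates of the fixed point map started at the indicator of the
  negative times; the coefficient of index 0 vanishes for t \<ge> 0. The inductions below run along
  this recursion.\<close>

lemma renewal_sum_Suc:
  assumes "0 \<le> t"
  shows "renewal_sum G x (Suc J) t = x * (LINT \<tau>|lborel. G \<tau> * renewal_sum G x J (t - \<tau>))"
proof -
  have i: "integrable lborel (\<lambda>\<tau>. G \<tau> * renewal_coef G i (t - \<tau>))" for i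
    by (rule renewal_integrable[where B="integral\<^sup>L lborel G ^ i"])
       (use renewal_coef_nonneg renewal_coef_le in auto)
  have "(LINT \<tau>|lborel. G \<tau> * renewal_sum G x J (t - \<tau>))
      = (LINT \<tau>|lborel. (\<Sum>i\<le>J. x ^ i * (G \<tau> * renewal_coef G i (t - \<tau>))))"
    unfolding renewal_sum_def sum_distrib_left by (simp add: ac_simps)
  also have "\<dots> = (\<Sum>i\<le>J. x ^ i * (LINT \<tau>|lborel. G \<tau> * renewal_coef G i (t - \<tau>)))"
    using i by (simp add: Bochner_Integration.integral_sum)
  also have "x * \<dots> = (\<Sum>i\<le>J. renewal_coef G (Suc i) t * x ^ Suc i)"
    using assms by (simp add: sum_distrib_left ac_simps)
  also have "\<dots> = renewal_sum G x (Suc J) t"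
    unfolding renewal_sum_def sum.atMost_Suc_shift using assms by simp
  finally show ?thesis ..
qed

context
  fixes x :: real
  assumes x0: "0 \<le> x" and xS: "x * integral\<^sup>L lborel G \<le> 1"
begin

lemma renewal_sum_nonneg: "0 \<le> renewal_sum G x J t"
  unfolding renewal_sum_def using renewal_coef_nonneg x0 by (intro sum_nonneg) simp

lemma renewal_sum_le_1: "renewal_sum G x J t \<le> 1"
proof (induction J arbitrary: t)
  case 0
  then show ?case by (simp add: renewal_sum_def)
next
  case (Suc J)
  show ?case
  proof (cases "t < 0")
    case True then show ?thesis by (simp add: renewal_sum_neg)
  next
    case False
    have "(LINT \<tau>|lborel. G \<tau> * renewal_sum G x J (t - \<tau>)) \<le> integral\<^sup>L lborel G * 1"
      by (rule renewal_integral_le[where B=1]) (use Suc renewal_sum_nonneg in auto)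
    then have "x * (LINT \<tau>|lborel. G \<tau> * renewal_sum G x J (t - \<tau>)) \<le> x * integral\<^sup>L lborel G"
      using x0 by (intro mult_left_mono) auto
    with False xS show ?thesis by (simp add: renewal_sum_Suc)
  qed
qed

lemma renewal_sum_abs_le: "\<bar>renewal_sum G x J t\<bar> \<le> 1"
  using renewal_sum_nonneg renewal_sum_le_1 by simp

text \<open>The integral operator preserves monotonicity on t \<ge> 0, and the prolongation by 1,
  the largest possible value, excludes an increase across t = 0.\<close>

lemma renewal_sum_antimono: "s \<le> t \<Longrightarrow> renewal_sum G x J t \<le> renewal_sum G x J s"
proof (induction J arbitrary: s t)
  case 0
  then show ?case by (simp add: renewal_sum_def)
next
  case (Suc J)
  show ?case
  proof (cases "s < 0")
    case True then show ?thesis by (simp add: renewal_sum_neg renewal_sum_le_1)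
  next
    case False
    have "(LINT \<tau>|lborel. G \<tau> * renewal_sum G x J (t - \<tau>)) \<le> (LINT \<tau>|lborel. G \<tau> * renewal_sum G x J (s - \<tau>))"
      by (intro integral_mono renewal_integrable[where B=1] mult_left_mono Suc.IH)
         (use Suc.prems renewal_kernel_nonneg renewal_sum_abs_le in auto)
    then have "x * (LINT \<tau>|lborel. G \<tau> * renewal_sum G x J (t - \<tau>)) \<le> x * (LINT \<tau>|lborel. G \<tau> * renewal_sum G x J (s - \<tau>))"
      using x0 by (rule mult_left_mono)
    with False Suc.prems show ?thesis by (simp add: renewal_sum_Suc)
  qed
qed

lemma renewal_sum_tendsto: "(\<lambda>J. renewal_sum G x J t) \<longlonglongrightarrow> renewal_fun G x t"
proof -
  have "incseq (\<lambda>J. renewal_sum G x J t)"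
    by (rule incseq_SucI) (simp add: renewal_sum_def renewal_coef_nonneg x0 del: renewal_coef.simps)
  then have "convergent (\<lambda>J. renewal_sum G x J t)"
    using renewal_sum_le_1 incseq_convergent by (metis convergent_def)
  then show ?thesis unfolding renewal_fun_def by (simp add: convergent_LIMSEQ_iff)
qed

lemma renewal_fun_measurable [measurable]: "renewal_fun G x \<in> borel_measurable borel"
  by (rule borel_measurable_LIMSEQ_real[OF renewal_sum_tendsto]) simp

lemma renewal_fun_nonneg: "0 \<le> renewal_fun G x t"
  by (rule LIMSEQ_le_const[OF renewal_sum_tendsto]) (use renewal_sum_nonneg in blast)

lemma renewal_fun_le_1: "renewal_fun G x t \<le> 1"
  by (rule LIMSEQ_le_const2[OF renewal_sum_tendsto]) (use renewal_sum_le_1 in blast)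

lemma renewal_fun_abs_le: "\<bar>renewal_fun G x t\<bar> \<le> 1"
  using renewal_fun_nonneg renewal_fun_le_1 by simp

lemma renewal_fun_antimono: "s \<le> t \<Longrightarrow> renewal_fun G x t \<le> renewal_fun G x s"
  by (rule LIMSEQ_le[OF renewal_sum_tendsto renewal_sum_tendsto]) (use renewal_sum_antimono in blast)

lemma renewal_fun_neg: "t < 0 \<Longrightarrow> renewal_fun G x t = 1"
  using renewal_sum_tendsto[of t] by (simp add: renewal_sum_neg LIMSEQ_const_iff)

lemma renewal_fun_eq:
  assumes "0 \<le> t"
  shows "renewal_fun G x t = x * (LINT \<tau>|lborel. G \<tau> * renewal_fun G x (t - \<tau>))"
proof -
  have "(\<lambda>J. LINT \<tau>|lborel. G \<tau> * renewal_sum G x J (t - \<tau>)) \<longlonglongrightarrow> (LINT \<tau>|lborel. G \<tau> * renewal_fun G x (t - \<tau>))"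
  proof (rule integral_dominated_convergence[where w=G])
    show "AE \<tau> in lborel. (\<lambda>J. G \<tau> * renewal_sum G x J (t - \<tau>)) \<longlonglongrightarrow> G \<tau> * renewal_fun G x (t - \<tau>)"
      by (intro AE_I2 tendsto_intros renewal_sum_tendsto)
    show "AE \<tau> in lborel. norm (G \<tau> * renewal_sum G x J (t - \<tau>)) \<le> G \<tau>" for J
      using renewal_kernel_nonneg renewal_sum_nonneg renewal_sum_le_1
      by (intro AE_I2) (simp add: abs_mult mult_left_le)
  qed (use renewal_kernel_integrable in auto)
  then have "(\<lambda>J. renewal_sum G x (Suc J) t) \<longlonglongrightarrow> x * (LINT \<tau>|lborel. G \<tau> * renewal_fun G x (t - \<tau>))"
    unfolding renewal_sum_Suc[OF assms] by (intro tendsto_intros)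
  then show ?thesis
    using LIMSEQ_unique LIMSEQ_Suc[OF renewal_sum_tendsto[of t]] by blast
qed

text \<open>A comparison principle for subsolutions. The excess of U over the solution is at most 0
  at negative times and at most 1 elsewhere, and each use of the equation multiplies the bound by
  the contraction factor x times the mass. It serves to compare the solutions for different
  shifts.\<close>

lemma renewal_fun_greatest:
  assumes U[measurable]: "U \<in> borel_measurable borel" and U01: "\<And>t. 0 \<le> U t" "\<And>t. U t \<le> 1"
    and sub: "\<And>t. 0 \<le> t \<Longrightarrow> U t \<le> x * (LINT \<tau>|lborel. G \<tau> * U (t - \<tau>))"
    and strict: "x * integral\<^sup>L lborel G < 1"
  shows "U t \<le> renewal_fun G x t"
proof -
  let ?q = "x * integral\<^sup>L lborel G"
  have q: "0 \<le> ?q" using x0 renewal_kernel_mass_pos by simp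
  have abs: "\<bar>U t\<bar> \<le> 1" for t using U01[of t] by simp
  have "U t - renewal_fun G x t \<le> ?q ^ j" for j t
  proof (induction j arbitrary: t)
    case 0
    show ?case using U01(2)[of t] renewal_fun_nonneg[of t] by simp
  next
    case (Suc j)
    show ?case
    proof (cases "t < 0")
      case True
      then show ?thesis using U01(2)[of t] renewal_fun_neg[of t] zero_le_power[OF q, of "Suc j"] by linarith
    next
      case False
      then have t: "0 \<le> t" by simp
      have "U t - renewal_fun G x t \<le> x * (LINT \<tau>|lborel. G \<tau> * U (t - \<tau>)) - x * (LINT \<tau>|lborel. G \<tau> * renewal_fun G x (t - \<tau>))"
        using sub[OF t] renewal_fun_eq[OF t] by simp
      also have "\<dots> = x * (LINT \<tau>|lborel. G \<tau> * (U (t - \<tau>) - renewal_fun G x (t - \<tau>)))"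
        using renewal_integrable[OF U abs, of t] renewal_integrable[OF renewal_fun_measurable renewal_fun_abs_le, of t]
        by (simp add: right_diff_distrib)
      also have "\<dots> \<le> x * (integral\<^sup>L lborel G * ?q ^ j)"
      proof (rule mult_left_mono[OF _ x0])
        have "\<bar>U t - renewal_fun G x t\<bar> \<le> 1" for t
          using U01[of t] renewal_fun_nonneg[of t] renewal_fun_le_1[of t] by (simp add: abs_le_iff)
        then show "(LINT \<tau>|lborel. G \<tau> * (U (t - \<tau>) - renewal_fun G x (t - \<tau>))) \<le> integral\<^sup>L lborel G * ?q ^ j"
          using renewal_integral_le[where V="\<lambda>t. U t - renewal_fun G x t" and B=1 and C="?q ^ j" and t=t] Suc.IH by simp
      qed
      finally show ?thesis by (simp add: mult.assoc)
    qed
  qed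
  moreover have "(\<lambda>j. ?q ^ j) \<longlonglongrightarrow> 0" using q strict by (intro LIMSEQ_realpow_zero)
  ultimately have "U t - renewal_fun G x t \<le> 0" by (intro LIMSEQ_le_const) auto
  then show ?thesis by simp
qed

end

text \<open>With V the solution and w = 1 - V, the fixed point equation reads lam V(y) = \<integral>
  G(\<tau>) (w(y) - w(y - \<tau>)) d\<tau>. Integration over y in [0, t] and an exchange of the
  integrals collect the tail of G as a convolution kernel. This is the integrated relaxation
  equation, in which the tail plays the part of k.\<close>

lemma renewal_fun_conv_eq:
  assumes "0 \<le> lam" "0 \<le> t" and x: "x = 1 / (integral\<^sup>L lborel G + lam)"
  shows "(LINT y|lborel. indicator {0..t} y * ((LINT \<tau>|lborel. G \<tau> * indicator {t - y<..} \<tau>) * (1 - renewal_fun G x y)))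
    = lam * (LINT y|lborel. indicator {0..t} y * renewal_fun G x y)"
proof -
  let ?S = "integral\<^sup>L lborel G"
  have S: "0 < ?S" by (rule renewal_kernel_mass_pos)
  have x0: "0 \<le> x" and xS: "x * ?S \<le> 1" and xl: "(?S + lam) * x = 1"
    unfolding x using S assms(1) by (auto simp: field_simps)
  note V = renewal_fun_measurable[OF x0 xS] renewal_fun_nonneg[OF x0 xS] renewal_fun_le_1[OF x0 xS]
    renewal_fun_abs_le[OF x0 xS] renewal_fun_neg[OF x0 xS] renewal_fun_eq[OF x0 xS]
  note [measurable] = V(1)
  define w where "w y = 1 - renewal_fun G x y" for y
  have w[measurable]: "w \<in> borel_measurable borel" unfolding w_def by measurable
  have w01: "0 \<le> w y" "w y \<le> 1" "\<bar>w y\<bar> \<le> 1" for y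
    using V(2)[of y] V(3)[of y] by (auto simp: w_def)
  have wneg: "y < 0 \<Longrightarrow> w y = 0" for y using V(5) by (simp add: w_def)
  have weq: "lam * renewal_fun G x y = (LINT \<tau>|lborel. G \<tau> * (w y - w (y - \<tau>)))" if "0 \<le> y" for y
  proof -
    have "(?S + lam) * renewal_fun G x y = (LINT \<tau>|lborel. G \<tau> * renewal_fun G x (y - \<tau>))"
      using V(6)[OF that] xl by (metis mult.assoc mult_1)
    moreover have "(LINT \<tau>|lborel. G \<tau> * (w y - w (y - \<tau>))) = (LINT \<tau>|lborel. G \<tau> * renewal_fun G x (y - \<tau>) - G \<tau> * renewal_fun G x y)"
      by (simp add: w_def algebra_simps)
    moreover have "\<dots> = (LINT \<tau>|lborel. G \<tau> * renewal_fun G x (y - \<tau>)) - ?S * renewal_fun G x y"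
      using renewal_integrable[OF V(1) V(4)] renewal_kernel_integrable by simp
    ultimately show ?thesis by (simp add: algebra_simps)
  qed
  define H1 where "H1 y \<tau> = indicator {0..t} y * (G \<tau> * (w y - w (y - \<tau>)))" for y \<tau> :: real
  define H2 where "H2 y \<tau> = indicator {0..t} y * (G \<tau> * (indicator {t - y<..} \<tau> * w y))" for y \<tau> :: real
  have I0: "integrable (lborel \<Otimes>\<^sub>M lborel) (\<lambda>(y, \<tau>). indicator {0..t} y * G \<tau>)"
  proof (rule lborel_pair.Fubini_integrable)
    show "integrable lborel (\<lambda>y. LINT \<tau>|lborel. norm (case (y, \<tau>) of (y, \<tau>) \<Rightarrow> indicator {0..t} y * G \<tau>))"
      using renewal_kernel_nonneg integrable_indicator_Icc[of 0 t] by (simp add: abs_mult)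
    show "AE y in lborel. integrable lborel (\<lambda>\<tau>. case (y, \<tau>) of (y, \<tau>) \<Rightarrow> indicator {0..t} y * G \<tau>)"
      using renewal_kernel_integrable by simp
  qed measurable
  have bound: "integrable (lborel \<Otimes>\<^sub>M lborel) (case_prod H)"
    if "case_prod H \<in> borel_measurable (lborel \<Otimes>\<^sub>M lborel)" "\<And>y \<tau>. \<bar>H y \<tau>\<bar> \<le> indicator {0..t} y * G \<tau>" for H
  proof (rule Bochner_Integration.integrable_bound[OF I0 that(1)], rule AE_I2)
    fix p :: "real \<times> real"
    show "norm (case_prod H p) \<le> norm (case p of (y, \<tau>) \<Rightarrow> indicator {0..t} y * G \<tau>)"
      using that(2)[of "fst p" "snd p"] by (simp add: case_prod_beta)
  qed
  have H1i: "integrable (lborel \<Otimes>\<^sub>M lborel) (case_prod H1)"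
  proof (rule bound)
    show "case_prod H1 \<in> borel_measurable (lborel \<Otimes>\<^sub>M lborel)" unfolding H1_def by measurable
    fix y \<tau>
    have "\<bar>w y - w (y - \<tau>)\<bar> \<le> 1" using w01(1,2)[of y] w01(1,2)[of "y - \<tau>"] by (simp add: abs_le_iff)
    then show "\<bar>H1 y \<tau>\<bar> \<le> indicator {0..t} y * G \<tau>"
      unfolding H1_def using renewal_kernel_nonneg[of \<tau>] by (simp add: abs_mult mult_left_le indicator_def)
  qed
  have H2i: "integrable (lborel \<Otimes>\<^sub>M lborel) (case_prod H2)"
  proof (rule bound)
    have "case_prod H2 = (\<lambda>p. indicator {0..t} (fst p) * (G (snd p) * ((if t - fst p < snd p then 1 else 0) * w (fst p))))"
      by (auto simp: H2_def fun_eq_iff indicator_def)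
    also have "\<dots> \<in> borel_measurable (lborel \<Otimes>\<^sub>M lborel)" by measurable
    finally show "case_prod H2 \<in> borel_measurable (lborel \<Otimes>\<^sub>M lborel)" .
    fix y \<tau> show "\<bar>H2 y \<tau>\<bar> \<le> indicator {0..t} y * G \<tau>"
      unfolding H2_def using renewal_kernel_nonneg[of \<tau>] w01[of y] by (simp add: abs_mult mult_left_le indicator_def)
  qed
  have wI: "integrable lborel (\<lambda>y. indicator {a..b} y * w (y - c))" for a b c
  proof (rule Bochner_Integration.integrable_bound[OF integrable_indicator_Icc[of a b]])
    show "AE y in lborel. norm (indicator {a..b} y * w (y - c)) \<le> norm (indicator {a..b} y :: real)"
      using w01 by (intro AE_I2) (auto simp: indicator_def)
  qed measurable
  \<comment> \<open>For fixed \<tau> \<ge> 0 the time integrals of w and of its translate differ by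
    the integral of w over the last stretch (t - \<tau>, t], since w vanishes at negative
    times.\<close>
  have inner: "(LINT y|lborel. H1 y \<tau>) = (LINT y|lborel. H2 y \<tau>)" for \<tau>
  proof (cases "\<tau> < 0")
    case True
    then have "G \<tau> = 0" using G by (simp add: renewal_kernel_def)
    then show ?thesis by (simp add: H1_def H2_def)
  next
    case False
    let ?I = "\<lambda>a b. indicator {a..b} :: real \<Rightarrow> real"
    have "(LINT y|lborel. ?I 0 t y * w (y - \<tau>)) = (LINT y|lborel. ?I 0 t (\<tau> + 1 * y) * w (\<tau> + 1 * y - \<tau>))"
      using lborel_integral_real_affine[of 1 "\<lambda>y. ?I 0 t y * w (y - \<tau>)" \<tau>] by simp
    also have "\<dots> = (LINT y|lborel. ?I 0 (t - \<tau>) y * w y)"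
      using False wneg by (intro Bochner_Integration.integral_cong) (auto simp: indicator_def not_le not_less)
    finally have sh: "(LINT y|lborel. ?I 0 t y * w (y - \<tau>)) = (LINT y|lborel. ?I 0 (t - \<tau>) y * w y)" .
    have "(LINT y|lborel. H1 y \<tau>) = (LINT y|lborel. G \<tau> * (?I 0 t y * w y - ?I 0 t y * w (y - \<tau>)))"
      unfolding H1_def by (simp add: algebra_simps)
    also have "\<dots> = G \<tau> * ((LINT y|lborel. ?I 0 t y * w y) - (LINT y|lborel. ?I 0 t y * w (y - \<tau>)))"
      using wI[of 0 t 0] wI[of 0 t \<tau>] by simp
    also have "\<dots> = G \<tau> * (LINT y|lborel. ?I 0 t y * w y - ?I 0 (t - \<tau>) y * w y)"
      unfolding sh using wI[of 0 t 0] wI[of 0 "t - \<tau>" 0] by simp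
    also have "\<dots> = (LINT y|lborel. G \<tau> * (?I 0 t y * w y - ?I 0 (t - \<tau>) y * w y))" by simp
    also have "\<dots> = (LINT y|lborel. H2 y \<tau>)"
      unfolding H2_def using False wneg
      by (intro Bochner_Integration.integral_cong) (auto simp: indicator_def not_le not_less)
    finally show ?thesis .
  qed
  have "lam * (LINT y|lborel. indicator {0..t} y * renewal_fun G x y) = (LINT y|lborel. indicator {0..t} y * (lam * renewal_fun G x y))"
    by (simp add: ac_simps flip: integral_mult_right_zero)
  also have "\<dots> = (LINT y|lborel. LINT \<tau>|lborel. H1 y \<tau>)"
    by (intro Bochner_Integration.integral_cong) (auto simp: H1_def weq indicator_def)
  also have "\<dots> = (LINT \<tau>|lborel. LINT y|lborel. H1 y \<tau>)"
    by (rule lborel_pair.Fubini_integral[OF H1i, symmetric])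
  also have "\<dots> = (LINT \<tau>|lborel. LINT y|lborel. H2 y \<tau>)" unfolding inner ..
  also have "\<dots> = (LINT y|lborel. LINT \<tau>|lborel. H2 y \<tau>)"
    by (rule lborel_pair.Fubini_integral[OF H2i])
  also have "\<dots> = (LINT y|lborel. indicator {0..t} y * ((LINT \<tau>|lborel. G \<tau> * indicator {t - y<..} \<tau>) * (1 - renewal_fun G x y)))"
  proof (intro Bochner_Integration.integral_cong refl)
    fix y
    have "(LINT \<tau>|lborel. H2 y \<tau>) = (LINT \<tau>|lborel. (indicator {0..t} y * w y) * (G \<tau> * indicator {t - y<..} \<tau>))"
      unfolding H2_def by (intro Bochner_Integration.integral_cong refl) simp
    also have "\<dots> = (indicator {0..t} y * w y) * (LINT \<tau>|lborel. G \<tau> * indicator {t - y<..} \<tau>)"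
      by (rule integral_mult_right_zero)
    finally show "(LINT \<tau>|lborel. H2 y \<tau>)
      = indicator {0..t} y * ((LINT \<tau>|lborel. G \<tau> * indicator {t - y<..} \<tau>) * (1 - renewal_fun G x y))"
      by (simp add: w_def ac_simps)
  qed
  finally show ?thesis ..
qed

end

declare renewal_kernel_measurable [measurable del]

section \<open>Convolution on the half line\<close>

text \<open>The indicator makes this an integral over the whole line, to which affine substitutions
  and Fubini apply directly.\<close>

definition conv :: "(real \<Rightarrow> real) \<Rightarrow> (real \<Rightarrow> real) \<Rightarrow> real \<Rightarrow> real" where
  "conv f a t = (LINT y|lborel. indicator {0..t} y * (f (t - y) * a y))"

definition locally_integrable :: "(real \<Rightarrow> real) \<Rightarrow> bool" where
  "locally_integrable f \<longleftrightarrow> f \<in> borel_measurable borel \<and> (\<forall>T. integrable lborel (\<lambda>y. indicator {0..T} y * f y))"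

definition locally_bounded :: "(real \<Rightarrow> real) \<Rightarrow> bool" where
  "locally_bounded a \<longleftrightarrow> a \<in> borel_measurable borel \<and> (\<forall>T. \<exists>B. \<forall>y\<in>{0..T}. \<bar>a y\<bar> \<le> B)"

lemma locally_bounded_obtain:
  assumes "locally_bounded a" obtains B where "0 \<le> B" "\<forall>y\<in>{0..T}. \<bar>a y\<bar> \<le> B"
proof -
  obtain B where "\<forall>y\<in>{0..T}. \<bar>a y\<bar> \<le> B" using assms unfolding locally_bounded_def by blast
  then show ?thesis by (intro that[of "max B 0"]) auto
qed

lemma locally_bounded_const: "locally_bounded (\<lambda>_. c)"
  unfolding locally_bounded_def by auto

lemma locally_bounded_imp_integrable:
  assumes "locally_bounded a" shows "locally_integrable a"
  unfolding locally_integrable_def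
proof (intro conjI allI)
  show [measurable]: "a \<in> borel_measurable borel" using assms by (simp add: locally_bounded_def)
  fix T
  obtain B where B: "0 \<le> B" "\<forall>y\<in>{0..T}. \<bar>a y\<bar> \<le> B" using locally_bounded_obtain[OF assms] .
  have "integrable lborel (\<lambda>y. B * indicator {0..T} y)" by (intro integrable_mult_right integrable_indicator_Icc)
  then show "integrable lborel (\<lambda>y. indicator {0..T} y * a y)"
  proof (rule Bochner_Integration.integrable_bound)
    show "AE y in lborel. norm (indicator {0..T} y * a y) \<le> norm (B * indicator {0..T} y)"
      using B by (intro AE_I2) (auto simp: indicator_def)
  qed measurable
qed

lemma conv_commute: "conv f a t = conv a f t"
proof -
  have "conv f a t = (LINT y|lborel. indicator {0..t} (t + (-1) * y) * (f (t - (t + (-1) * y)) * a (t + (-1) * y)))"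
    unfolding conv_def by (subst lborel_integral_real_affine[of "-1" _ t]) simp_all
  also have "\<dots> = conv a f t"
    unfolding conv_def by (intro Bochner_Integration.integral_cong) (auto simp: indicator_def)
  finally show ?thesis .
qed

lemma conv_const: "conv (\<lambda>_. 1) f t = (LINT y|lborel. indicator {0..t} y * f y)"
  by (simp add: conv_def)

lemma conv_le_0 [simp]: "t \<le> 0 \<Longrightarrow> conv f a t = 0"
proof -
  assume t: "t \<le> 0"
  \<comment> \<open>For t = 0 the indicator still sees the point 0, which is a null set.\<close>
  have "conv f a t = (LINT y::real|lborel. 0)"
    unfolding conv_def by (rule integral_discrete_difference[where X="{0}"]) (use t in \<open>auto simp: indicator_def\<close>)
  then show ?thesis by simp
qed

lemma locally_integrable_reflect:
  assumes "locally_integrable f"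
  shows "integrable lborel (\<lambda>y. indicator {0..t} y * f (t - y))"
proof -
  have "integrable lborel (\<lambda>y. indicator {0..t} y * f y)" using assms by (simp add: locally_integrable_def)
  then have "integrable lborel (\<lambda>y. indicator {0..t} (t + (-1) * y) * f (t + (-1) * y))"
    by (rule lborel_integrable_real_affine) simp
  moreover have "(\<lambda>y. indicator {0..t} (t + (-1) * y) * f (t + (-1) * y)) = (\<lambda>y. indicator {0..t} y * f (t - y))"
    by (auto simp: indicator_def fun_eq_iff)
  ultimately show ?thesis by simp
qed

lemma conv_integrable:
  assumes f: "locally_integrable f" and a: "locally_bounded a"
  shows "integrable lborel (\<lambda>y. indicator {0..t} y * (f (t - y) * a y))"
proof -
  have [measurable]: "f \<in> borel_measurable borel" "a \<in> borel_measurable borel"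
    using assms by (auto simp: locally_integrable_def locally_bounded_def)
  obtain B where B: "0 \<le> B" "\<forall>y\<in>{0..t}. \<bar>a y\<bar> \<le> B" using locally_bounded_obtain[OF a] .
  have "integrable lborel (\<lambda>y. B * (indicator {0..t} y * f (t - y)))"
    by (intro integrable_mult_right locally_integrable_reflect f)
  then show ?thesis
  proof (rule Bochner_Integration.integrable_bound)
    show "AE y in lborel. norm (indicator {0..t} y * (f (t - y) * a y)) \<le> norm (B * (indicator {0..t} y * f (t - y)))"
      using B by (intro AE_I2) (auto simp: indicator_def abs_mult mult.commute intro: mult_right_mono)
  qed measurable
qed

lemma conv_diff:
  assumes f: "locally_integrable f" and a: "locally_bounded a" and b: "locally_bounded b"
  shows "conv f (\<lambda>y. a y - b y) t = conv f a t - conv f b t"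
  unfolding conv_def right_diff_distrib
  by (rule Bochner_Integration.integral_diff) (intro conv_integrable assms)+

text \<open>Fubini on the triangle 0 \<le> y \<le> u \<le> t. Only f may be unbounded, and it enters
  through t - u, so A B |f(t - u)| on the square is an integrable majorant.\<close>

lemma conv_assoc:
  assumes f: "locally_integrable f" and a: "locally_bounded a" and b: "locally_bounded b"
  shows "conv (conv f a) b t = conv f (conv a b) t"
proof -
  have [measurable]: "f \<in> borel_measurable borel" "a \<in> borel_measurable borel" "b \<in> borel_measurable borel"
    using assms by (auto simp: locally_integrable_def locally_bounded_def)
  obtain A where A: "0 \<le> A" "\<forall>y\<in>{0..t}. \<bar>a y\<bar> \<le> A" using locally_bounded_obtain[OF a] .
  obtain B where B: "0 \<le> B" "\<forall>y\<in>{0..t}. \<bar>b y\<bar> \<le> B" using locally_bounded_obtain[OF b] .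
  define H where "H y u = (if 0 \<le> y \<and> y \<le> u \<and> u \<le> t then f (t - u) * a (u - y) * b y else 0)" for y u
  define M where "M = (\<lambda>(y, u). indicator {0..t} y * ((A * B) * (indicator {0..t} u * f (t - u))))"
  have Mi: "integrable (lborel \<Otimes>\<^sub>M lborel) M"
  proof (rule lborel_pair.Fubini_integrable)
    have i: "integrable lborel (\<lambda>u. (A * B) * (indicator {0..t} u * f (t - u)))"
      by (intro integrable_mult_right locally_integrable_reflect f)
    show "M \<in> borel_measurable (lborel \<Otimes>\<^sub>M lborel)" unfolding M_def by measurable
    show "AE y in lborel. integrable lborel (\<lambda>u. M (y, u))"
      unfolding M_def using i by simp
    have "(\<lambda>y. LINT u|lborel. norm (M (y, u))) = (\<lambda>y. indicator {0..t} y * (LINT u|lborel. norm ((A * B) * (indicator {0..t} u * f (t - u)))))"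
      unfolding M_def by (simp add: abs_mult)
    then show "integrable lborel (\<lambda>y. LINT u|lborel. norm (M (y, u)))"
      using integrable_indicator_Icc[of 0 t] by (simp only: integrable_mult_left)
  qed
  have Hi: "integrable (lborel \<Otimes>\<^sub>M lborel) (case_prod H)"
  proof (rule Bochner_Integration.integrable_bound[OF Mi])
    have "case_prod H = (\<lambda>p. if 0 \<le> fst p \<and> fst p \<le> snd p \<and> snd p \<le> t then f (t - snd p) * a (snd p - fst p) * b (fst p) else 0)"
      by (auto simp: H_def fun_eq_iff)
    also have "\<dots> \<in> borel_measurable (lborel \<Otimes>\<^sub>M lborel)" by measurable
    finally show "case_prod H \<in> borel_measurable (lborel \<Otimes>\<^sub>M lborel)" .
    show "AE p in lborel \<Otimes>\<^sub>M lborel. norm (case_prod H p) \<le> norm (M p)"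
    proof (rule AE_I2)
      fix p :: "real \<times> real"
      obtain y u where p: "p = (y, u)" by (cases p)
      show "norm (case_prod H p) \<le> norm (M p)"
      proof (cases "0 \<le> y \<and> y \<le> u \<and> u \<le> t")
        case True
        then have "\<bar>a (u - y)\<bar> * \<bar>b y\<bar> \<le> A * B"
          using A B by (intro mult_mono) auto
        then have "\<bar>a (u - y)\<bar> * \<bar>b y\<bar> * \<bar>f (t - u)\<bar> \<le> A * B * \<bar>f (t - u)\<bar>"
          by (rule mult_right_mono) simp
        with True A(1) B(1) show ?thesis by (simp add: p H_def M_def abs_mult ac_simps)
      next
        case False
        then have "case_prod H p = 0" by (auto simp: p H_def)
        then show ?thesis by simp
      qed
    qed
  qed
  have 1: "(LINT u|lborel. H y u) = indicator {0..t} y * (conv f a (t - y) * b y)" for y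
  proof (cases "y \<in> {0..t}")
    case True
    have "(LINT u|lborel. H y u) = (LINT z|lborel. H y (y + 1 * z))"
      using lborel_integral_real_affine[of 1 "H y" y] by simp
    also have "\<dots> = (LINT z|lborel. (indicator {0..t - y} z * (f (t - y - z) * a z)) * b y)"
      using True by (intro Bochner_Integration.integral_cong) (auto simp: H_def indicator_def algebra_simps)
    also have "\<dots> = conv f a (t - y) * b y" unfolding conv_def by (rule integral_mult_left_zero)
    finally show ?thesis using True by simp
  next
    case False
    then have "H y = (\<lambda>u. 0)" by (auto simp: H_def fun_eq_iff)
    then show ?thesis using False by simp
  qed
  have 2: "(LINT y|lborel. H y u) = indicator {0..t} u * (f (t - u) * conv a b u)" for u
  proof (cases "u \<in> {0..t}")
    case True
    have "(LINT y|lborel. H y u) = (LINT y|lborel. f (t - u) * (indicator {0..u} y * (a (u - y) * b y)))"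
      using True by (intro Bochner_Integration.integral_cong) (auto simp: H_def indicator_def)
    also have "\<dots> = f (t - u) * conv a b u" unfolding conv_def by (rule integral_mult_right_zero)
    finally show ?thesis using True by simp
  next
    case False
    then have "(\<lambda>y. H y u) = (\<lambda>y. 0)" by (auto simp: H_def fun_eq_iff)
    then show ?thesis using False by simp
  qed
  have "conv (conv f a) b t = (LINT y|lborel. LINT u|lborel. H y u)" unfolding 1 conv_def[of "conv f a"] ..
  also have "\<dots> = (LINT u|lborel. LINT y|lborel. H y u)"
    by (rule lborel_pair.Fubini_integral[OF Hi, symmetric])
  also have "\<dots> = conv f (conv a b) t" unfolding 2 conv_def[of f] ..
  finally show ?thesis .
qed

lemma conv_const_split:
  assumes f: "locally_integrable f" and "0 \<le> a" "a \<le> u"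
  shows "conv (\<lambda>_. 1) f u = conv (\<lambda>_. 1) f a + (LBINT y=a..u. f y)"
proof -
  have i: "set_integrable lborel {0..u} f"
    using f by (simp add: locally_integrable_def set_integrable_def)
  have "(LBINT y:{0..u}. f y) = (LBINT y=0..u. f y)" using assms by (simp add: interval_integral_Icc zero_ereal_def)
  also have "\<dots> = (LBINT y=0..a. f y) + (LBINT y=a..u. f y)"
  proof (rule interval_integral_sum[symmetric])
    show "interval_lebesgue_integrable lborel (min 0 (min (ereal a) (ereal u))) (max 0 (max (ereal a) (ereal u))) f"
    proof -
      have "min 0 (min (ereal a) (ereal u)) = ereal 0" "max 0 (max (ereal a) (ereal u)) = ereal u"
        using assms by (auto simp: min_def max_def zero_ereal_def)
      moreover have "set_integrable lborel {0<..<u} f"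
        by (rule set_integrable_subset[OF i]) auto
      moreover have "einterval 0 (ereal u) = {0<..<u}" by (auto simp: einterval_def)
      ultimately show ?thesis using assms by (simp add: interval_lebesgue_integrable_def)
    qed
  qed
  also have "(LBINT y=0..a. f y) = (LBINT y:{0..a}. f y)" using assms by (simp add: interval_integral_Icc zero_ereal_def)
  finally show ?thesis unfolding conv_const by (simp add: set_lebesgue_integral_def)
qed

lemma conv_const_has_derivative:
  assumes f: "locally_integrable f" and c: "continuous_on {0<..} f" and t: "0 < t"
  shows "(conv (\<lambda>_. 1) f has_real_derivative f t) (at t)"
proof -
  \<comment> \<open>The fundamental theorem is applied from the positive time t / 2 on, away from 0,
    where f may be singular.\<close>
  define a where "a = t / 2"
  have a: "0 < a" "a < t" using t by (auto simp: a_def)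
  have "((\<lambda>u. LBINT y=a..u. f y) has_vector_derivative f t) (at t within {a..t + 1})"
    by (rule interval_integral_FTC2) (use a in \<open>auto intro!: continuous_on_subset[OF c]\<close>)
  then have d: "((\<lambda>u. LBINT y=a..u. f y) has_vector_derivative f t) (at t)"
    using a by (simp add: at_within_Icc_at)
  have "((\<lambda>u. conv (\<lambda>_. 1) f a + (LBINT y=a..u. f y)) has_vector_derivative f t) (at t)"
    using has_vector_derivative_add[OF has_vector_derivative_const d] by simp
  then have "((\<lambda>u. conv (\<lambda>_. 1) f u) has_vector_derivative f t) (at t)"
  proof (rule has_vector_derivative_transform_within_open[where S="{a<..}"])
    fix u assume "u \<in> {a<..}"
    then show "conv (\<lambda>_. 1) f a + (LBINT y=a..u. f y) = conv (\<lambda>_. 1) f u"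
      using conv_const_split[OF f, of a u] a by simp
  qed (use a in auto)
  then show ?thesis by (simp add: has_real_derivative_iff_has_vector_derivative)
qed

section \<open>The relaxation function of a kernel\<close>

text \<open>\<open>kap\<close> is the kernel and \<open>g\<close> stands for - kap'. Monotonicity of
  \<open>g\<close> encodes convexity, and the tail formula takes the place of differentiability. The
  value 0 at nonpositive times is a convention under which convolutions become integrals over the
  whole line.\<close>

locale relaxation_kernel =
  fixes g kap :: "real \<Rightarrow> real"
  assumes g_measurable [measurable]: "g \<in> borel_measurable borel"
    and g_nonneg: "\<And>t. 0 \<le> g t"
    and g_antimono: "\<And>s t. 0 < s \<Longrightarrow> s \<le> t \<Longrightarrow> g t \<le> g s"
    and kap_tail: "\<And>t. 0 < t \<Longrightarrow> has_bochner_integral lborel (\<lambda>\<tau>. g \<tau> * indicator {t<..} \<tau>) (kap t)"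
    and kap_nonpos_time: "\<And>t. t \<le> 0 \<Longrightarrow> kap t = 0"
    and kap_pos: "\<And>t. 0 < t \<Longrightarrow> 0 < kap t"
    and kap_locally_integrable: "locally_integrable kap"
    and kap_blowup: "filterlim kap at_top (at_right 0)"
begin

lemma kap_measurable [measurable]: "kap \<in> borel_measurable borel"
  using kap_locally_integrable by (simp add: locally_integrable_def)

lemma kap_nonneg: "0 \<le> kap t"
  using kap_pos[of t] kap_nonpos_time[of t] by (cases "0 < t") auto

lemma kap_eq: "0 < t \<Longrightarrow> kap t = (LINT \<tau>|lborel. g \<tau> * indicator {t<..} \<tau>)"
  using kap_tail has_bochner_integral_integral_eq by metis

lemma g_tail_integrable: "0 < t \<Longrightarrow> integrable lborel (\<lambda>\<tau>. g \<tau> * indicator {t<..} \<tau>)"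
  using kap_tail integrable.intros by metis

lemma kap_antimono: "0 < s \<Longrightarrow> s \<le> t \<Longrightarrow> kap t \<le> kap s"
  using g_tail_integrable[of s] g_tail_integrable[of t] g_nonneg
  by (simp add: kap_eq) (intro integral_mono; auto simp: indicator_def)

lemma kap_Lipschitz:
  assumes "0 < s" "s \<le> t" shows "kap s - kap t \<le> g s * (t - s)"
proof -
  have "kap s - kap t = (LINT \<tau>|lborel. g \<tau> * indicator {s<..} \<tau> - g \<tau> * indicator {t<..} \<tau>)"
    using assms g_tail_integrable[of s] g_tail_integrable[of t] by (simp add: kap_eq)
  also have "\<dots> \<le> (LINT \<tau>|lborel. g s * indicator {s..t} \<tau>)"
  proof (rule integral_mono)
    show "integrable lborel (\<lambda>\<tau>. g \<tau> * indicator {s<..} \<tau> - g \<tau> * indicator {t<..} \<tau>)"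
      using assms by (intro Bochner_Integration.integrable_diff g_tail_integrable) auto
    show "integrable lborel (\<lambda>\<tau>. g s * indicator {s..t} \<tau>)"
      by (intro integrable_mult_right integrable_indicator_Icc)
    show "g \<tau> * indicator {s<..} \<tau> - g \<tau> * indicator {t<..} \<tau> \<le> g s * indicator {s..t} \<tau>" for \<tau>
      using assms g_antimono[of s \<tau>] g_nonneg[of s] by (auto simp: indicator_def)
  qed
  also have "\<dots> = g s * (t - s)" using assms by simp
  finally show ?thesis .
qed

lemma kap_continuous: "continuous_on {0<..} kap"
  unfolding continuous_on_iff
proof (intro ballI allI impI)
  fix t e :: real assume t: "t \<in> {0<..}" and e: "0 < e"
  define a where "a = t / 2"
  have a: "0 < a" "a < t" using t by (auto simp: a_def)
  define d where "d = min a (e / (g a + 1))"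
  have ga: "0 \<le> g a" by (rule g_nonneg)
  have d: "0 < d" using a e ga by (simp add: d_def)
  have *: "\<bar>kap u - kap v\<bar> \<le> g a * \<bar>u - v\<bar>" if "a \<le> u" "u \<le> v" for u v
  proof -
    have "kap u - kap v \<le> g u * (v - u)" using that a by (intro kap_Lipschitz) auto
    also have "\<dots> \<le> g a * (v - u)" using that a by (intro mult_right_mono g_antimono) auto
    finally show ?thesis using kap_antimono[of u v] that a by simp
  qed
  have "dist (kap x) (kap t) < e" if x: "dist x t < d" for x
  proof -
    have "\<bar>x - t\<bar> < d" using x by (simp add: dist_real_def)
    then have "\<bar>x - t\<bar> < a" by (simp add: d_def)
    then have "a \<le> x" unfolding a_def abs_less_iff by linarith
    have "\<bar>kap x - kap t\<bar> \<le> g a * \<bar>x - t\<bar>"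
    proof (cases "x \<le> t")
      case True then show ?thesis using *[OF \<open>a \<le> x\<close> True] by simp
    next
      case False then show ?thesis using *[of t x] a by (simp add: abs_minus_commute)
    qed
    also have "\<dots> \<le> (g a + 1) * \<bar>x - t\<bar>" by (simp add: algebra_simps)
    also have "\<dots> < (g a + 1) * (e / (g a + 1))"
      using \<open>\<bar>x - t\<bar> < d\<close> ga by (intro mult_strict_left_mono) (auto simp: d_def)
    also have "\<dots> = e" using ga by simp
    finally show ?thesis by (simp add: dist_real_def)
  qed
  then show "\<exists>d>0. \<forall>x'\<in>{0<..}. dist x' t < d \<longrightarrow> dist (kap x') (kap t) < e" using d by blast
qed

section \<open>Approximation by shifted kernels\<close>

text \<open>Minus the derivative of t -> kap(t + \<epsilon>). Its mass is kap(\<epsilon>), finite,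
  whereas the mass of \<open>g\<close> itself is infinite because \<open>kap\<close> blows up at
  0.\<close>

definition shifted :: "real \<Rightarrow> real \<Rightarrow> real" where
  "shifted \<epsilon> \<tau> = (if 0 < \<tau> then g (\<tau> + \<epsilon>) else 0)"

lemma shifted_tail:
  assumes "0 < \<epsilon>" "0 \<le> t"
  shows "has_bochner_integral lborel (\<lambda>\<tau>. shifted \<epsilon> \<tau> * indicator {t<..} \<tau>) (kap (t + \<epsilon>))"
proof -
  let ?f = "\<lambda>\<tau>. g \<tau> * indicator {t + \<epsilon><..} \<tau>"
  have te: "0 < t + \<epsilon>" using assms by simp
  have e: "(\<lambda>\<tau>. shifted \<epsilon> \<tau> * indicator {t<..} \<tau>) = (\<lambda>\<tau>. ?f (\<epsilon> + 1 * \<tau>))"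
    using assms by (auto simp: fun_eq_iff shifted_def indicator_def add.commute)
  have "integrable lborel (\<lambda>\<tau>. ?f (\<epsilon> + 1 * \<tau>))"
    by (rule lborel_integrable_real_affine[OF g_tail_integrable[OF te]]) simp
  moreover have "(LINT \<tau>|lborel. ?f (\<epsilon> + 1 * \<tau>)) = kap (t + \<epsilon>)"
    unfolding kap_eq[OF te] using lborel_integral_real_affine[of 1 ?f \<epsilon>] by simp
  ultimately show ?thesis unfolding e by (simp add: has_bochner_integral_iff)
qed

lemma shifted_mass:
  assumes "0 < \<epsilon>"
  shows "integrable lborel (shifted \<epsilon>)" "integral\<^sup>L lborel (shifted \<epsilon>) = kap \<epsilon>"
proof -
  have "(\<lambda>\<tau>. shifted \<epsilon> \<tau> * indicator {0<..} \<tau>) = shifted \<epsilon>" by (auto simp: shifted_def fun_eq_iff)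
  with shifted_tail[OF assms order_refl] have "has_bochner_integral lborel (shifted \<epsilon>) (kap \<epsilon>)" by simp
  then show "integrable lborel (shifted \<epsilon>)" "integral\<^sup>L lborel (shifted \<epsilon>) = kap \<epsilon>"
    by (auto simp: has_bochner_integral_iff)
qed

lemma shifted_renewal_kernel: "0 < \<epsilon> \<Longrightarrow> renewal_kernel (shifted \<epsilon>)"
  unfolding renewal_kernel_def using shifted_mass kap_pos g_nonneg by (auto simp: shifted_def)

text \<open>The weight comes from differentiating the equation with the shifted kernel: for w = 1 -
  V it becomes kap(\<epsilon>) w(t) - \<integral> g(\<tau> + \<epsilon>) w(t - \<tau>) d\<tau> = lam
  V(t), and collecting the terms with V(t) produces the factor kap(\<epsilon>) + lam.\<close>

definition approx_relax :: "real \<Rightarrow> real \<Rightarrow> real \<Rightarrow> real" where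
  "approx_relax \<epsilon> lam t = renewal_fun (shifted \<epsilon>) (1 / (kap \<epsilon> + lam)) t"

text \<open>At lam = 0 the exact solution is the constant 1, and the value is set instead of being
  obtained as a limit; the origin of the frequency space is therefore treated separately when limits
  are taken. For lam < 0 the value 1 is a default.\<close>

definition relax :: "real \<Rightarrow> real \<Rightarrow> real" where
  "relax lam t = (if t \<le> 0 \<or> lam \<le> 0 then 1 else lim (\<lambda>m. approx_relax (1 / real (Suc m)) lam t))"

context
  fixes lam :: real
  assumes lam: "0 < lam"
begin

lemma approx_weight:
  assumes "0 < \<epsilon>"
  shows "0 \<le> 1 / (kap \<epsilon> + lam)" "1 / (kap \<epsilon> + lam) * integral\<^sup>L lborel (shifted \<epsilon>) < 1"
    "1 / (kap \<epsilon> + lam) * integral\<^sup>L lborel (shifted \<epsilon>) \<le> 1"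
  using kap_pos[OF assms] lam by (auto simp: shifted_mass[OF assms] field_simps)

lemmas approx_weight' = approx_weight(1,3)

text \<open>A smaller shift adds the nonnegative amount g(\<tau> + e') - g(\<tau> + \<epsilon>) to
  the kernel. Since the old solution U decreases in time, U(t) \<le> U(t - \<tau>), so the added
  mass makes U a subsolution of the new equation, and the comparison principle applies.\<close>

lemma approx_relax_mono:
  assumes e: "0 < e'" "e' \<le> \<epsilon>"
  shows "approx_relax \<epsilon> lam t \<le> approx_relax e' lam t"
proof -
  have \<epsilon>: "0 < \<epsilon>" using e by simp
  note K = shifted_renewal_kernel[OF \<epsilon>] and K' = shifted_renewal_kernel[OF e(1)]
  note U = renewal_fun_measurable[OF K approx_weight'[OF \<epsilon>]] renewal_fun_nonneg[OF K approx_weight'[OF \<epsilon>]]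
    renewal_fun_le_1[OF K approx_weight'[OF \<epsilon>]] renewal_fun_abs_le[OF K approx_weight'[OF \<epsilon>]]
  let ?U = "renewal_fun (shifted \<epsilon>) (1 / (kap \<epsilon> + lam))"
  show ?thesis unfolding approx_relax_def
  proof (rule renewal_fun_greatest[OF K' approx_weight'[OF e(1)] U(1,2,3) _ approx_weight(2)[OF e(1)]])
    fix t :: real assume t: "0 \<le> t"
    note i = renewal_integrable[OF K U(1) U(4), of t] renewal_integrable[OF K' U(1) U(4), of t]
      shifted_mass(1)[OF \<epsilon>] shifted_mass(1)[OF e(1)]
    have eq: "(kap \<epsilon> + lam) * ?U t = (LINT \<tau>|lborel. shifted \<epsilon> \<tau> * ?U (t - \<tau>))"
      using renewal_fun_eq[OF K approx_weight'[OF \<epsilon>] t] kap_pos[OF \<epsilon>] lam by (simp add: field_simps)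
    have "(kap e' + lam) * ?U t = (kap e' - kap \<epsilon>) * ?U t + (LINT \<tau>|lborel. shifted \<epsilon> \<tau> * ?U (t - \<tau>))"
      unfolding eq[symmetric] by (simp add: algebra_simps)
    also have "(kap e' - kap \<epsilon>) * ?U t = (LINT \<tau>|lborel. (shifted e' \<tau> - shifted \<epsilon> \<tau>) * ?U t)"
      using i by (simp add: shifted_mass[OF \<epsilon>] shifted_mass[OF e(1)])
    also have "\<dots> + (LINT \<tau>|lborel. shifted \<epsilon> \<tau> * ?U (t - \<tau>))
        = (LINT \<tau>|lborel. (shifted e' \<tau> - shifted \<epsilon> \<tau>) * ?U t + shifted \<epsilon> \<tau> * ?U (t - \<tau>))"
      using i by (intro Bochner_Integration.integral_add[symmetric] integrable_mult_left Bochner_Integration.integrable_diff)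
    also have "\<dots> \<le> (LINT \<tau>|lborel. shifted e' \<tau> * ?U (t - \<tau>))"
    proof (rule integral_mono)
      fix \<tau>
      have "(shifted e' \<tau> - shifted \<epsilon> \<tau>) * ?U t \<le> (shifted e' \<tau> - shifted \<epsilon> \<tau>) * ?U (t - \<tau>)"
      proof (cases "0 < \<tau>")
        case True
        then show ?thesis
          using e by (intro mult_left_mono renewal_fun_antimono[OF K approx_weight'[OF \<epsilon>]])
            (auto simp: shifted_def intro!: g_antimono)
      qed (simp add: shifted_def)
      then show "(shifted e' \<tau> - shifted \<epsilon> \<tau>) * ?U t + shifted \<epsilon> \<tau> * ?U (t - \<tau>) \<le> shifted e' \<tau> * ?U (t - \<tau>)"
        by (simp add: algebra_simps)
    qed (use i in auto)
    finally show "?U t \<le> 1 / (kap e' + lam) * (LINT \<tau>|lborel. shifted e' \<tau> * ?U (t - \<tau>))"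
      using kap_pos[OF e(1)] lam by (simp add: field_simps)
  qed
qed

lemma approx_relax_bounds: "0 < \<epsilon> \<Longrightarrow> 0 \<le> approx_relax \<epsilon> lam t" "0 < \<epsilon> \<Longrightarrow> approx_relax \<epsilon> lam t \<le> 1"
  unfolding approx_relax_def
  using renewal_fun_nonneg[OF shifted_renewal_kernel approx_weight'] renewal_fun_le_1[OF shifted_renewal_kernel approx_weight'] by auto

lemma approx_relax_tendsto:
  assumes "0 < t" shows "(\<lambda>m. approx_relax (1 / real (Suc m)) lam t) \<longlonglongrightarrow> relax lam t"
proof -
  have inc: "incseq (\<lambda>m. approx_relax (1 / real (Suc m)) lam t)"
    by (rule incseq_SucI, rule approx_relax_mono) (auto simp: frac_le)
  have "\<forall>m. approx_relax (1 / real (Suc m)) lam t \<le> 1" by (intro allI approx_relax_bounds(2)) simp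
  then obtain L where "(\<lambda>m. approx_relax (1 / real (Suc m)) lam t) \<longlonglongrightarrow> L"
    by (rule incseq_convergent[OF inc])
  then have "convergent (\<lambda>m. approx_relax (1 / real (Suc m)) lam t)" by (rule convergentI)
  then show ?thesis unfolding relax_def using assms lam by (simp add: convergent_LIMSEQ_iff)
qed

end

lemma relax_nonneg: "0 \<le> relax lam t"
proof (cases "t \<le> 0 \<or> lam \<le> 0")
  case False
  then have l: "0 < lam" and t: "0 < t" by auto
  show ?thesis
    by (rule LIMSEQ_le_const[OF approx_relax_tendsto[OF l t]], intro exI allI impI approx_relax_bounds[OF l]) simp
qed (auto simp: relax_def)

lemma relax_le_1: "relax lam t \<le> 1"
proof (cases "t \<le> 0 \<or> lam \<le> 0")
  case False
  then have l: "0 < lam" and t: "0 < t" by auto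
  show ?thesis
    by (rule LIMSEQ_le_const2[OF approx_relax_tendsto[OF l t]], intro exI allI impI approx_relax_bounds[OF l]) simp
qed (auto simp: relax_def)

lemma relax_antimono:
  assumes "s \<le> t" shows "relax lam t \<le> relax lam s"
proof (cases "s \<le> 0 \<or> lam \<le> 0")
  case True
  show ?thesis
  proof (cases "lam \<le> 0")
    case False
    then have "relax lam s = 1" using True by (simp add: relax_def)
    then show ?thesis by (simp add: relax_le_1)
  qed (simp add: relax_def)
next
  case False
  then have l: "0 < lam" and s: "0 < s" and t: "0 < t" using assms by auto
  show ?thesis
  proof (rule LIMSEQ_le[OF approx_relax_tendsto[OF l t] approx_relax_tendsto[OF l s]])
    have "approx_relax (1 / real (Suc m)) lam t \<le> approx_relax (1 / real (Suc m)) lam s" for m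
      unfolding approx_relax_def
      by (rule renewal_fun_antimono[OF shifted_renewal_kernel approx_weight'[OF l]]) (use assms in auto)
    then show "\<exists>N. \<forall>m\<ge>N. approx_relax (1 / real (Suc m)) lam t \<le> approx_relax (1 / real (Suc m)) lam s" by blast
  qed
qed

lemma relax_nonpos_time: "t \<le> 0 \<Longrightarrow> relax lam t = 1"
  by (simp add: relax_def)

lemma relax_abs_le: "\<bar>relax lam t\<bar> \<le> 1"
  using relax_nonneg relax_le_1 by simp

lemma relax_time_measurable [measurable]: "relax lam \<in> borel_measurable borel"
proof -
  have "mono (\<lambda>t. - relax lam t)" by (rule monoI) (simp add: relax_antimono)
  then have "(\<lambda>t. - relax lam t) \<in> borel_measurable borel" by (rule borel_measurable_mono)
  then have "(\<lambda>t. - (- relax lam t)) \<in> borel_measurable borel" by (rule borel_measurable_uminus)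
  then show ?thesis by simp
qed

lemma relax_locally_bounded: "locally_bounded (relax lam)" "locally_bounded (\<lambda>t. 1 - relax lam t)"
  unfolding locally_bounded_def using relax_abs_le relax_nonneg relax_le_1
  by (auto intro!: exI[of _ 1])

text \<open>The integrated form makes sense before any continuity of the relaxation function is
  known. It is inherited from the approximations: \<open>kap\<close> decreases, so kap(t - y)
  dominates all shifted kernels.\<close>

lemma relax_equation:
  assumes "0 \<le> lam"
  shows "conv kap (\<lambda>y. 1 - relax lam y) t = lam * conv (\<lambda>_. 1) (relax lam) t"
proof (cases "lam = 0 \<or> t \<le> 0")
  case True
  show ?thesis
  proof (cases "t \<le> 0")
    case False
    with True have "lam = 0" by simp
    then show ?thesis by (simp add: relax_def conv_def)
  qed simp
next
  case False
  then have l: "0 < lam" and t: "0 < t" using assms by auto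
  define e where "e m = 1 / real (Suc m)" for m
  have e: "0 < e m" for m by (simp add: e_def)
  have e0: "e \<longlonglongrightarrow> 0" unfolding e_def by (rule LIMSEQ_Suc[OF lim_1_over_n])
  let ?V = "\<lambda>m. approx_relax (e m) lam"
  have Vm[measurable]: "?V m \<in> borel_measurable borel" for m
    using renewal_fun_measurable[OF shifted_renewal_kernel[OF e] approx_weight'[OF l e]]
    by (simp add: approx_relax_def[abs_def])
  have V01: "0 \<le> ?V m y" "?V m y \<le> 1" for m y using approx_relax_bounds[OF l e] by auto
  have Vlim: "(\<lambda>m. ?V m y) \<longlonglongrightarrow> relax lam y" if "0 < y" for y
    using approx_relax_tendsto[OF l that] by (simp add: e_def)
  have Veq: "(LINT y|lborel. indicator {0..t} y * (kap (t - y + e m) * (1 - ?V m y))) = lam * (LINT y|lborel. indicator {0..t} y * ?V m y)" for m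
  proof -
    have B: "(LINT \<tau>|lborel. shifted (e m) \<tau> * indicator {t - y<..} \<tau>) = kap (t - y + e m)" if "y \<in> {0..t}" for y
      using shifted_tail[OF e, of "t - y" m] that by (simp add: has_bochner_integral_iff)
    have "(LINT y|lborel. indicator {0..t} y * (kap (t - y + e m) * (1 - ?V m y)))
      = (LINT y|lborel. indicator {0..t} y * ((LINT \<tau>|lborel. shifted (e m) \<tau> * indicator {t - y<..} \<tau>) * (1 - ?V m y)))"
    proof (intro Bochner_Integration.integral_cong refl)
      fix y
      show "indicator {0..t} y * (kap (t - y + e m) * (1 - ?V m y))
        = indicator {0..t} y * ((LINT \<tau>|lborel. shifted (e m) \<tau> * indicator {t - y<..} \<tau>) * (1 - ?V m y))"
      proof (cases "y \<in> {0..t}")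
        case True
        show ?thesis unfolding B[OF True] ..
      next
        case False
        then have "indicator {0..t} y = (0::real)" by (rule indicator_simps(2))
        then show ?thesis by (simp only: mult_zero_left)
      qed
    qed
    also have "\<dots> = lam * (LINT y|lborel. indicator {0..t} y * ?V m y)"
      unfolding approx_relax_def
      by (rule renewal_fun_conv_eq[OF shifted_renewal_kernel[OF e]]) (use l t in \<open>auto simp: shifted_mass[OF e]\<close>)
    finally show ?thesis .
  qed
  \<comment> \<open>At y = t the integrand contains kap(e m), which tends to infinity, and the limit
    of the approximations is known only for y > 0; both points are null.\<close>
  have ae: "AE y in lborel. y \<noteq> 0 \<and> y \<noteq> t"
    using AE_lborel_singleton[of 0] AE_lborel_singleton[of t] by eventually_elim auto
  have "(\<lambda>m. LINT y|lborel. indicator {0..t} y * (kap (t - y + e m) * (1 - ?V m y)))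
     \<longlonglongrightarrow> (LINT y|lborel. indicator {0..t} y * (kap (t - y) * (1 - relax lam y)))"
  proof (rule integral_dominated_convergence[where w="\<lambda>y. indicator {0..t} y * kap (t - y)"])
    show "integrable lborel (\<lambda>y. indicator {0..t} y * kap (t - y))"
      by (rule locally_integrable_reflect[OF kap_locally_integrable])
    show "AE y in lborel. (\<lambda>m. indicator {0..t} y * (kap (t - y + e m) * (1 - ?V m y))) \<longlonglongrightarrow> indicator {0..t} y * (kap (t - y) * (1 - relax lam y))"
      using ae
    proof eventually_elim
      case (elim y)
      show ?case
      proof (cases "y \<in> {0..t}")
        case True
        with elim have y: "0 < y" "0 < t - y" by auto
        have "(\<lambda>m. t - y + e m) \<longlonglongrightarrow> t - y + 0" by (intro tendsto_intros e0)
        then have "(\<lambda>m. kap (t - y + e m)) \<longlonglongrightarrow> kap (t - y)"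
          by (intro continuous_on_tendsto_compose[OF kap_continuous])
             (use y e in \<open>auto intro!: always_eventually add_pos_pos\<close>)
        then show ?thesis by (intro tendsto_intros Vlim y)
      qed simp
    qed
    show "AE y in lborel. norm (indicator {0..t} y * (kap (t - y + e m) * (1 - ?V m y))) \<le> indicator {0..t} y * kap (t - y)" for m
      using ae
    proof eventually_elim
      case (elim y)
      show ?case
      proof (cases "y \<in> {0..t}")
        case True
        with elim have y: "0 < t - y" by auto
        have "kap (t - y + e m) * (1 - ?V m y) \<le> kap (t - y) * 1"
          using y e[of m] V01[of m y] by (intro mult_mono kap_antimono kap_nonneg) auto
        moreover have "0 \<le> kap (t - y + e m) * (1 - ?V m y)" using kap_nonneg V01[of m y] by simp
        ultimately show ?thesis using True by simp
      qed simp
    qed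
  qed measurable
  moreover have "(\<lambda>m. LINT y|lborel. indicator {0..t} y * ?V m y) \<longlonglongrightarrow> (LINT y|lborel. indicator {0..t} y * relax lam y)"
  proof (rule integral_dominated_convergence[where w="indicator {0..t}"])
    show "AE y in lborel. (\<lambda>m. indicator {0..t} y * ?V m y) \<longlonglongrightarrow> indicator {0..t} y * relax lam y"
      using ae
    proof eventually_elim
      case (elim y)
      show ?case
      proof (cases "y \<in> {0..t}")
        case True then show ?thesis using elim by (intro tendsto_intros Vlim) auto
      qed simp
    qed
    show "AE y in lborel. norm (indicator {0..t} y * ?V m y) \<le> indicator {0..t} y" for m
      using V01 by (intro AE_I2) (simp add: indicator_def)
  qed (use integrable_indicator_Icc in auto)
  ultimately show ?thesis unfolding Veq conv_def[of kap] conv_const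
    by (intro LIMSEQ_unique[OF _ tendsto_mult_left]) auto
qed

end

section \<open>Bounds and derivatives of convolutions\<close>

lemma locally_bounded_continuous:
  fixes f :: "real \<Rightarrow> real"
  assumes "continuous_on {0..} f"
  shows "locally_bounded (\<lambda>y. if 0 \<le> y then f y else 0)"
  unfolding locally_bounded_def
proof (intro conjI allI)
  have "(\<lambda>y. indicator {0..} y *\<^sub>R f y) \<in> borel_measurable borel"
    by (rule borel_measurable_continuous_on_indicator[OF _ assms]) simp
  moreover have "(\<lambda>y. indicator {0..} y *\<^sub>R f y) = (\<lambda>y. if 0 \<le> y then f y else 0)"
    by (auto simp: fun_eq_iff indicator_def)
  ultimately show "(\<lambda>y. if 0 \<le> y then f y else 0) \<in> borel_measurable borel" by simp
  fix T :: real
  have "compact (f ` {0..T})"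
    by (intro compact_continuous_image continuous_on_subset[OF assms]) auto
  then have "\<exists>B. \<forall>y\<in>f ` {0..T}. norm y \<le> B"
    by (rule compact_imp_bounded[THEN bounded_iff[THEN iffD1]])
  then show "\<exists>B. \<forall>y\<in>{0..T}. \<bar>if 0 \<le> y then f y else 0\<bar> \<le> B" by auto
qed

lemma conv_const_locally_bounded:
  assumes f: "locally_integrable f" shows "locally_bounded (conv (\<lambda>_. 1) f)"
  unfolding locally_bounded_def
proof (intro conjI allI)
  have [measurable]: "f \<in> borel_measurable borel" using f by (simp add: locally_integrable_def)
  have "(\<lambda>t. LINT y|lborel. (if 0 \<le> y \<and> y \<le> t then 1 else 0) * f y) \<in> borel_measurable borel"
    by (rule lborel.borel_measurable_lebesgue_integral) measurable
  moreover have "conv (\<lambda>_. 1) f = (\<lambda>t. LINT y|lborel. (if 0 \<le> y \<and> y \<le> t then 1 else 0) * f y)"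
    unfolding conv_const fun_eq_iff by (intro allI Bochner_Integration.integral_cong) (auto simp: indicator_def)
  ultimately show "conv (\<lambda>_. 1) f \<in> borel_measurable borel" by simp
  fix T
  have i: "integrable lborel (\<lambda>y. indicator {0..T} y * f y)" for T using f by (simp add: locally_integrable_def)
  have "\<bar>conv (\<lambda>_. 1) f t\<bar> \<le> (LINT y|lborel. norm (indicator {0..T} y * f y))" if "t \<in> {0..T}" for t
  proof -
    have "norm (conv (\<lambda>_. 1) f t) \<le> (LINT y|lborel. norm (indicator {0..t} y * f y))"
      unfolding conv_const by (rule integral_norm_bound)
    also have "\<dots> \<le> (LINT y|lborel. norm (indicator {0..T} y * f y))"
      by (rule integral_mono[OF integrable_norm[OF i] integrable_norm[OF i]]) (use that in \<open>auto simp: indicator_def\<close>)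
    finally show ?thesis by simp
  qed
  then show "\<exists>B. \<forall>t\<in>{0..T}. \<bar>conv (\<lambda>_. 1) f t\<bar> \<le> B" by blast
qed

lemma conv_const_eq_0:
  assumes f: "locally_integrable f" "continuous_on {0<..} f" and z: "\<And>t. 0 < t \<Longrightarrow> conv (\<lambda>_. 1) f t = 0" and t: "0 < t"
  shows "f t = 0"
proof -
  have "(conv (\<lambda>_. 1) f has_real_derivative f t) (at t)"
    by (rule conv_const_has_derivative[OF f t])
  moreover have "(conv (\<lambda>_. 1) f has_real_derivative 0) (at t)"
    by (rule DERIV_cong_ev[THEN iffD2, OF refl _ refl DERIV_const[of 0]])
       (use z t in \<open>auto intro: eventually_mono[OF eventually_nhds_in_open[of "{0<..}"]]\<close>)
  ultimately show ?thesis by (rule DERIV_unique)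
qed

lemma conv_scale: "conv f (\<lambda>y. c * a y) t = c * conv f a t"
  unfolding conv_def by (subst integral_mult_right_zero[symmetric]) (simp add: ac_simps)

lemma conv_scale_left: "conv (\<lambda>y. c * a y) f t = c * conv a f t"
  unfolding conv_commute[of _ f] by (rule conv_scale)

lemma conv_abs_le:
  assumes f: "locally_integrable f" and a: "locally_bounded a" and B: "\<And>y. y \<in> {0..t} \<Longrightarrow> \<bar>a y\<bar> \<le> B"
  shows "\<bar>conv f a t\<bar> \<le> B * (LINT y|lborel. indicator {0..t} y * \<bar>f y\<bar>)"
proof -
  have fi: "integrable lborel (\<lambda>y. \<bar>indicator {0..t} y * f y\<bar>)"
    using f by (intro integrable_abs) (simp add: locally_integrable_def)
  then have i: "integrable lborel (\<lambda>y. indicator {0..t} y * \<bar>f y\<bar>)" by (simp add: abs_mult)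
  have ci: "integrable lborel (\<lambda>y. indicator {0..t} y * (a (t - y) * f y))"
  proof -
    have "integrable lborel (\<lambda>y. indicator {0..t} (t + (-1) * y) * (f (t - (t + (-1) * y)) * a (t + (-1) * y)))"
      using conv_integrable[OF f a, of t] by (rule lborel_integrable_real_affine) simp
    also have "(\<lambda>y. indicator {0..t} (t + (-1) * y) * (f (t - (t + (-1) * y)) * a (t + (-1) * y))) = (\<lambda>y. indicator {0..t} y * (a (t - y) * f y))"
      by (auto simp: fun_eq_iff indicator_def)
    finally show ?thesis .
  qed
  have "\<bar>conv f a t\<bar> \<le> (LINT y|lborel. norm (indicator {0..t} y * (a (t - y) * f y)))"
    unfolding conv_commute[of f a] unfolding conv_def using integral_norm_bound by fastforce
  also have "\<dots> \<le> (LINT y|lborel. B * (indicator {0..t} y * \<bar>f y\<bar>))"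
  proof (rule integral_mono)
    show "norm (indicator {0..t} y * (a (t - y) * f y)) \<le> B * (indicator {0..t} y * \<bar>f y\<bar>)" for y
      using B[of "t - y"] by (cases "y \<in> {0..t}") (auto simp: abs_mult intro: mult_right_mono)
  qed (use i ci in auto)
  also have "\<dots> = B * (LINT y|lborel. indicator {0..t} y * \<bar>f y\<bar>)" by (rule integral_mult_right_zero)
  finally show ?thesis .
qed

section \<open>Regularity, decay and uniqueness of the relaxation function\<close>

context relaxation_kernel
begin

lemma kap_mass_pos:
  assumes "0 < t" shows "0 < conv (\<lambda>_. 1) kap t"
proof -
  have "t * kap t = (LINT y|lborel. indicator {0<..t} y * kap t)" using assms by simp
  also have "\<dots> \<le> conv (\<lambda>_. 1) kap t"
    unfolding conv_const
  proof (rule integral_mono)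
    show "integrable lborel (\<lambda>y. indicator {0<..t} y * kap t)"
      using assms by (intro integrable_mult_left integrable_real_indicator) (auto simp: less_top[symmetric])
    show "integrable lborel (\<lambda>y. indicator {0..t} y * kap y)"
      using kap_locally_integrable by (simp add: locally_integrable_def)
    show "indicator {0<..t} y * kap t \<le> indicator {0..t} y * kap y" for y
      using kap_antimono[of y t] kap_nonneg[of y] by (auto simp: indicator_def)
  qed
  finally show ?thesis using kap_pos[OF assms] assms by (metis mult_pos_pos less_le_trans)
qed

lemma kap_conv_line:
  assumes w: "locally_bounded w" "\<And>y. y < 0 \<Longrightarrow> w y = 0"
  shows "integrable lborel (\<lambda>\<rho>. kap \<rho> * w (t - \<rho>))" "conv kap w t = (LINT \<rho>|lborel. kap \<rho> * w (t - \<rho>))"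
proof -
  have e: "(\<lambda>y. indicator {0..t} (t + (-1) * y) * (kap (t - (t + (-1) * y)) * w (t + (-1) * y))) = (\<lambda>y. kap y * w (t - y))"
  proof
    fix y :: real
    consider "y \<le> 0" | "0 < y" "t < y" | "0 < y" "y \<le> t" by linarith
    then show "indicator {0..t} (t + (-1) * y) * (kap (t - (t + (-1) * y)) * w (t + (-1) * y)) = kap y * w (t - y)"
      by cases (simp_all add: kap_nonpos_time w(2))
  qed
  have "integrable lborel (\<lambda>y. indicator {0..t} (t + (-1) * y) * (kap (t - (t + (-1) * y)) * w (t + (-1) * y)))"
    using conv_integrable[OF kap_locally_integrable w(1), of t] by (rule lborel_integrable_real_affine) simp
  then show "integrable lborel (\<lambda>\<rho>. kap \<rho> * w (t - \<rho>))" unfolding e .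
  show "conv kap w t = (LINT \<rho>|lborel. kap \<rho> * w (t - \<rho>))"
    unfolding conv_def e[symmetric] by (subst lborel_integral_real_affine[of "-1" _ t]) simp_all
qed

text \<open>The integrated equation is compared at the times b + h and a, where h = b - a. With w =
  1 - relax, each delay \<rho> in (0, h] contributes at least kap(h) (w(b) - w(a)), because b + h -
  \<rho> \<ge> b and a - \<rho> \<le> a, and all other delays contribute nonnegatively; the total is
  at least h kap(h) (w(b) - w(a)). The other side of the equation grows by at most lam times the
  elapsed time 2 h.\<close>

lemma relax_modulus:
  assumes lam: "0 \<le> lam" and ab: "0 \<le> a" "a < b"
  shows "(relax lam a - relax lam b) * kap (b - a) \<le> 2 * lam"
proof -
  define h where "h = b - a"
  have h: "0 < h" using ab by (simp add: h_def)
  define w where "w y = 1 - relax lam y" for y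
  have wb: "locally_bounded w" unfolding w_def[abs_def] by (rule relax_locally_bounded)
  have wneg: "y < 0 \<Longrightarrow> w y = 0" for y by (simp add: w_def relax_nonpos_time)
  have wmono: "x \<le> y \<Longrightarrow> w x \<le> w y" for x y by (simp add: w_def relax_antimono)
  note line = kap_conv_line[OF wb wneg]
  have rel: "integrable lborel (\<lambda>y. indicator {0..T} y * relax lam y)" for T
    using locally_bounded_imp_integrable[OF relax_locally_bounded(1)[of lam]] by (simp add: locally_integrable_def)
  have "h * (kap h * (w b - w a)) = (LINT \<rho>|lborel. indicator {0<..h} \<rho> * (kap h * (w b - w a)))" using h by simp
  also have "\<dots> \<le> (LINT \<rho>|lborel. kap \<rho> * w (b + h - \<rho>) - kap \<rho> * w (a - \<rho>))"
  proof (rule integral_mono)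
    show "integrable lborel (\<lambda>\<rho>. indicator {0<..h} \<rho> * (kap h * (w b - w a)))"
      using h by (intro integrable_mult_left integrable_real_indicator) (auto simp: less_top[symmetric])
    show "integrable lborel (\<lambda>\<rho>. kap \<rho> * w (b + h - \<rho>) - kap \<rho> * w (a - \<rho>))"
      by (intro Bochner_Integration.integrable_diff line)
    fix \<rho>
    have nn: "0 \<le> w b - w a" "0 \<le> w (b + h - \<rho>) - w (a - \<rho>)" using wmono[of a b] wmono[of "a - \<rho>" "b + h - \<rho>"] ab h by auto
    show "indicator {0<..h} \<rho> * (kap h * (w b - w a)) \<le> kap \<rho> * w (b + h - \<rho>) - kap \<rho> * w (a - \<rho>)"
    proof (cases "\<rho> \<in> {0<..h}")
      case True
      have "kap h * (w b - w a) \<le> kap \<rho> * (w (b + h - \<rho>) - w (a - \<rho>))"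
        using True nn kap_nonneg wmono[of b "b + h - \<rho>"] wmono[of "a - \<rho>" a]
        by (intro mult_mono kap_antimono) auto
      then show ?thesis using True by (simp add: right_diff_distrib)
    next
      case False
      then show ?thesis using mult_nonneg_nonneg[OF kap_nonneg nn(2)] by (simp add: right_diff_distrib)
    qed
  qed
  also have "\<dots> = conv kap w (b + h) - conv kap w a"
    using Bochner_Integration.integral_diff[OF line(1)[of "b + h"] line(1)[of a]] by (simp add: line(2))
  also have "\<dots> = lam * (conv (\<lambda>_. 1) (relax lam) (b + h) - conv (\<lambda>_. 1) (relax lam) a)"
    unfolding w_def relax_equation[OF lam] by (simp add: right_diff_distrib)
  also have "\<dots> \<le> lam * (2 * h)"
  proof (rule mult_left_mono[OF _ lam])
    have "conv (\<lambda>_. 1) (relax lam) (b + h) - conv (\<lambda>_. 1) (relax lam) a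
        = (LINT y|lborel. indicator {0..b + h} y * relax lam y - indicator {0..a} y * relax lam y)"
      unfolding conv_const using rel by simp
    also have "\<dots> \<le> (LINT y|lborel. indicator {0..b + h} y - indicator {0..a} y)"
    proof (rule integral_mono)
      show "indicator {0..b + h} y * relax lam y - indicator {0..a} y * relax lam y \<le> indicator {0..b + h} y - indicator {0..a} y" for y
        using relax_le_1[of lam y] ab h by (auto simp: indicator_def)
    qed (use rel integrable_indicator_Icc in auto)
    also have "\<dots> = 2 * h" using ab h integrable_indicator_Icc by (simp add: h_def)
    finally show "conv (\<lambda>_. 1) (relax lam) (b + h) - conv (\<lambda>_. 1) (relax lam) a \<le> 2 * h" .
  qed
  finally have "h * (kap h * (w b - w a)) \<le> h * (2 * lam)" by (simp add: ac_simps)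
  then have "kap h * (w b - w a) \<le> 2 * lam" using h by (simp only: mult_le_cancel_left_pos)
  then show ?thesis by (simp add: w_def h_def mult.commute)
qed

text \<open>A drop of size e over a step h would force e kap(h) \<le> 2 lam, which the blow-up of
  \<open>kap\<close> excludes for small h. The modulus also covers steps that start at time
  0.\<close>

lemma relax_continuous:
  assumes lam: "0 \<le> lam" shows "continuous_on {0..} (relax lam)"
  unfolding continuous_on_iff
proof (intro ballI allI impI)
  fix t e :: real assume t: "t \<in> {0..}" and e: "0 < e"
  have "eventually (\<lambda>h. 2 * lam / e < kap h) (at_right 0)"
    using kap_blowup by (simp add: filterlim_at_top_dense)
  then obtain d where d: "0 < d" "\<And>h. 0 < h \<Longrightarrow> h < d \<Longrightarrow> 2 * lam / e < kap h"
    unfolding eventually_at_right_field by auto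
  have *: "relax lam a - relax lam b < e" if "0 \<le> a" "a < b" "b - a < d" for a b
  proof (rule ccontr)
    assume "\<not> relax lam a - relax lam b < e"
    then have "e * kap (b - a) \<le> (relax lam a - relax lam b) * kap (b - a)"
      using kap_nonneg by (intro mult_right_mono) auto
    also have "\<dots> \<le> 2 * lam" by (rule relax_modulus[OF lam that(1,2)])
    finally show False using d(2)[of "b - a"] that e by (simp add: field_simps)
  qed
  have "dist (relax lam x) (relax lam t) < e" if "x \<in> {0..}" "dist x t < d" for x
  proof (cases x t rule: linorder_cases)
    case less
    then show ?thesis using *[of x t] relax_antimono[of x t lam] that by (simp add: dist_real_def)
  next
    case greater
    then show ?thesis using *[of t x] relax_antimono[of t x lam] that t by (simp add: dist_real_def)
  qed (use e in simp)
  then show "\<exists>d>0. \<forall>x'\<in>{0..}. dist x' t < d \<longrightarrow> dist (relax lam x') (relax lam t) < e" using d(1) by blast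
qed

lemma relax_decay:
  assumes lam: "0 \<le> lam" and t: "0 < t"
  shows "lam * relax lam t \<le> conv (\<lambda>_. 1) kap t / t"
proof -
  have rel: "integrable lborel (\<lambda>y. indicator {0..t} y * relax lam y)"
    using locally_bounded_imp_integrable[OF relax_locally_bounded(1)[of lam]] by (simp add: locally_integrable_def)
  have "t * relax lam t = (LINT y|lborel. indicator {0..t} y * relax lam t)" using t by simp
  also have "\<dots> \<le> conv (\<lambda>_. 1) (relax lam) t" unfolding conv_const
    by (rule integral_mono[OF integrable_mult_left[OF integrable_indicator_Icc] rel])
       (auto simp: indicator_def relax_antimono)
  finally have "lam * (t * relax lam t) \<le> lam * conv (\<lambda>_. 1) (relax lam) t" using lam by (rule mult_left_mono)
  also have "\<dots> = conv kap (\<lambda>y. 1 - relax lam y) t" by (rule relax_equation[OF lam, symmetric])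
  also have "\<dots> \<le> conv kap (\<lambda>_. 1) t"
    unfolding conv_def
    by (rule integral_mono[OF conv_integrable[OF kap_locally_integrable relax_locally_bounded(2)]
          conv_integrable[OF kap_locally_integrable locally_bounded_const]])
       (auto simp: indicator_def kap_nonneg relax_nonneg mult_left_le)
  also have "\<dots> = conv (\<lambda>_. 1) kap t" by (rule conv_commute)
  finally show ?thesis using t by (simp add: field_simps)
qed

lemma conv_kap_relax:
  assumes "0 \<le> lam"
  shows "conv kap (relax lam) t = conv (\<lambda>_. 1) kap t - lam * conv (\<lambda>_. 1) (relax lam) t"
proof -
  have "conv kap (\<lambda>y. 1 - relax lam y) t = conv kap (\<lambda>_. 1) t - conv kap (relax lam) t"
    by (rule conv_diff[OF kap_locally_integrable locally_bounded_const relax_locally_bounded(1)])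
  then show ?thesis using relax_equation[OF assms, of t] conv_commute[of kap "\<lambda>_. 1" t] by simp
qed

text \<open>The convolution is not differentiated under the integral sign. By the integrated
  equation it is a combination of the primitives of \<open>kap\<close> and of the relaxation
  function, and these two functions are continuous on (0, \<infinity>).\<close>

lemma conv_kap_relax_derivative:
  assumes lam: "0 \<le> lam" and t: "0 < t"
  shows "(conv kap (relax lam) has_real_derivative (kap t - lam * relax lam t)) (at t)"
proof -
  have 1: "(conv (\<lambda>_. 1) kap has_real_derivative kap t) (at t)"
    by (rule conv_const_has_derivative[OF kap_locally_integrable kap_continuous t])
  have 2: "(conv (\<lambda>_. 1) (relax lam) has_real_derivative relax lam t) (at t)"
    by (rule conv_const_has_derivative[OF locally_bounded_imp_integrable[OF relax_locally_bounded(1)] _ t])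
       (rule continuous_on_subset[OF relax_continuous[OF lam]], auto)
  have "((\<lambda>t. conv (\<lambda>_. 1) kap t - lam * conv (\<lambda>_. 1) (relax lam) t) has_real_derivative (kap t - lam * relax lam t)) (at t)"
    by (intro DERIV_diff 1 DERIV_cmult 2)
  then show ?thesis unfolding conv_kap_relax[OF lam, symmetric] .
qed

text \<open>Convolving the homogeneous equation for \<open>d\<close> with \<open>1 - relax mu\<close> gives \<open>- lam J = mu (L - J)\<close>,
  where \<open>L\<close> is the double primitive of \<open>d\<close>; take \<open>mu = lam\<close>, or \<open>mu \<longrightarrow> 0\<close> if \<open>lam = 0\<close>.\<close>

lemma homogeneous_equation_unique:
  assumes lam: "0 \<le> lam" and d: "locally_bounded d" "continuous_on {0<..} d"
    and eq: "\<And>t. 0 < t \<Longrightarrow> conv kap d t + lam * conv (\<lambda>_. 1) d t = 0" and t: "0 < t"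
  shows "d t = 0"
proof -
  let ?one = "\<lambda>_. 1 :: real"
  define D where "D = conv ?one d"
  note di = locally_bounded_imp_integrable[OF d(1)]
  have Db: "locally_bounded D" unfolding D_def by (rule conv_const_locally_bounded[OF di])
  note Di = locally_bounded_imp_integrable[OF Db]
  note oneb = locally_bounded_const[of 1] and onei = locally_bounded_imp_integrable[OF locally_bounded_const[of 1]]
  define w where "w mu y = 1 - relax mu y" for mu y
  have wb: "locally_bounded (w mu)" for mu unfolding w_def[abs_def] by (rule relax_locally_bounded)
  have kd: "conv kap d = (\<lambda>u. - lam * D u)"
  proof
    fix u show "conv kap d u = - lam * D u"
      using eq[of u] by (cases "0 < u") (auto simp: D_def)
  qed
  have key: "- lam * conv D (w mu) t = mu * (conv ?one D t - conv D (w mu) t)" if mu: "0 < mu" for mu t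
  proof -
    have kw: "conv kap (w mu) = (\<lambda>u. mu * (conv ?one ?one u - conv ?one (w mu) u))"
    proof
      fix u
      have "conv ?one (relax mu) u = conv ?one ?one u - conv ?one (w mu) u"
        using conv_diff[OF onei oneb wb[of mu], of u] by (simp add: w_def)
      then show "conv kap (w mu) u = mu * (conv ?one ?one u - conv ?one (w mu) u)"
        using relax_equation[of mu u] mu unfolding w_def[abs_def] by simp
    qed
    have wd: "conv d (w mu) = conv (w mu) d" by (rule ext) (rule conv_commute)
    have J: "conv (conv ?one (w mu)) d t = conv D (w mu) t"
      unfolding conv_assoc[OF onei wb d(1)] wd[symmetric] D_def conv_assoc[OF onei d(1) wb] ..
    have L: "conv (conv ?one ?one) d t = conv ?one D t"
      unfolding conv_assoc[OF onei oneb d(1)] D_def ..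
    have "- lam * conv D (w mu) t = conv (conv kap d) (w mu) t" unfolding kd by (rule conv_scale_left[symmetric])
    also have "\<dots> = conv (conv kap (w mu)) d t"
      unfolding conv_assoc[OF kap_locally_integrable d(1) wb] conv_assoc[OF kap_locally_integrable wb d(1)] wd ..
    also have "\<dots> = mu * conv (\<lambda>u. conv ?one ?one u - conv ?one (w mu) u) d t"
      unfolding kw by (rule conv_scale_left)
    also have "conv (\<lambda>u. conv ?one ?one u - conv ?one (w mu) u) d t = conv ?one D t - conv D (w mu) t"
      unfolding conv_commute[of _ d]
        conv_diff[OF di conv_const_locally_bounded[OF onei] conv_const_locally_bounded[OF locally_bounded_imp_integrable[OF wb]]]
      unfolding conv_commute[of d] J L ..
    finally show ?thesis .
  qed
  have L0: "conv ?one D t = 0" if t: "0 < t" for t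
  proof (cases "lam = 0")
    case False
    then show ?thesis using key[of lam t] lam by (simp add: right_diff_distrib)
  next
    case True
    \<comment> \<open>\<open>relax_modulus\<close>, started at time 0, bounds \<open>w mu\<close> on
      [0, t] by 2 mu / kap(t), so the convolution is of order mu.\<close>
    define C where "C = 2 / kap t * (LINT y|lborel. indicator {0..t} y * \<bar>D y\<bar>)"
    have C: "0 \<le> C" unfolding C_def using kap_nonneg by (intro mult_nonneg_nonneg) auto
    have le: "\<bar>conv ?one D t\<bar> \<le> mu * C" if mu: "0 < mu" for mu
    proof -
      have wle: "\<bar>w mu y\<bar> \<le> 2 * mu / kap t" if "y \<in> {0..t}" for y
      proof -
        have "\<bar>w mu y\<bar> \<le> relax mu 0 - relax mu t"
          using relax_antimono[of y t mu] relax_le_1[of mu y] that by (simp add: w_def relax_nonpos_time)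
        also have "\<dots> \<le> 2 * mu / kap t"
          using relax_modulus[of mu 0 t] kap_pos[OF t] mu t by (simp add: field_simps)
        finally show ?thesis .
      qed
      have "conv ?one D t = conv D (w mu) t" using key[OF mu, of t] True mu by simp
      also have "\<bar>\<dots>\<bar> \<le> 2 * mu / kap t * (LINT y|lborel. indicator {0..t} y * \<bar>D y\<bar>)"
        by (rule conv_abs_le[OF Di wb wle])
      finally show ?thesis by (simp add: C_def ac_simps)
    qed
    show ?thesis
    proof (rule ccontr)
      assume "conv ?one D t \<noteq> 0"
      then have p: "0 < \<bar>conv ?one D t\<bar>" by simp
      define mu where "mu = \<bar>conv ?one D t\<bar> / (2 * (C + 1))"
      have "0 < mu" using p C by (simp add: mu_def)
      from le[OF this] have "\<bar>conv ?one D t\<bar> * (2 * (C + 1)) \<le> \<bar>conv ?one D t\<bar> * C"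
        using C unfolding mu_def by (simp add: field_simps)
      then have "2 * (C + 1) \<le> C" using p by (simp only: mult_le_cancel_left_pos)
      then show False using C by simp
    qed
  qed
  \<comment> \<open>The double primitive of d vanishes at positive times; one differentiation gives
    D = 0, a second one d = 0.\<close>
  have Dder: "(D has_real_derivative d t) (at t)" if "0 < t" for t
    unfolding D_def by (rule conv_const_has_derivative[OF di d(2) that])
  have "continuous_on {0<..} D"
    by (intro continuous_at_imp_continuous_on ballI DERIV_isCont[OF Dder]) simp
  then have "D u = 0" if "0 < u" for u
    by (rule conv_const_eq_0[OF Di _ L0 that])
  then show ?thesis
    unfolding D_def by (intro conv_const_eq_0[OF di d(2) _ t])
qed

lemma kap_mass_tendsto_0: "((\<lambda>t. conv (\<lambda>_. 1) kap t) \<longlongrightarrow> 0) (at_right 0)"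
proof (rule tendsto_at_right_sequentially[of 0 1])
  fix S :: "nat \<Rightarrow> real" assume S: "\<And>n. 0 < S n" "\<And>n. S n < 1" "S \<longlonglongrightarrow> 0"
  have "(\<lambda>n. LINT y|lborel. indicator {0..S n} y * kap y) \<longlonglongrightarrow> (LINT y::real|lborel. 0)"
  proof (rule integral_dominated_convergence[where w="\<lambda>y. indicator {0..1} y * kap y"])
    show "integrable lborel (\<lambda>y. indicator {0..1} y * kap y)"
      using kap_locally_integrable by (simp add: locally_integrable_def)
    show "AE y in lborel. norm (indicator {0..S n} y * kap y) \<le> indicator {0..1} y * kap y" for n
      using S(2)[of n] kap_nonneg by (intro AE_I2) (auto simp: indicator_def)
    show "AE y in lborel. (\<lambda>n. indicator {0..S n} y * kap y) \<longlonglongrightarrow> 0"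
    proof (rule AE_I2, rule tendsto_eventually)
      fix y :: real
      show "\<forall>\<^sub>F n in sequentially. indicator {0..S n} y * kap y = 0"
      proof (cases "0 < y")
        case True
        from order_tendstoD(2)[OF S(3) True] show ?thesis by eventually_elim simp
      qed (simp add: kap_nonpos_time)
    qed
  qed measurable
  then show "(\<lambda>n. conv (\<lambda>_. 1) kap (S n)) \<longlonglongrightarrow> 0" unfolding conv_const by simp
qed simp

text \<open>The equation is integrated back: for the difference d, the function Z has derivative 0
  at positive times, and it tends to 0 at time 0 because d is bounded there and \<open>kap\<close>
  is integrable. Thus Z = 0, which is the homogeneous integrated equation.\<close>

lemma relax_unique:
  assumes lam: "0 \<le> lam" and v: "locally_bounded v" "continuous_on {0..} v"
    and der: "\<And>t. 0 < t \<Longrightarrow> (conv kap v has_real_derivative (kap t * v 0 - lam * v t)) (at t)" and t: "0 \<le> t"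
  shows "v t = v 0 * relax lam t"
proof -
  define d where "d y = v y - v 0 * relax lam y" for y
  have rb: "locally_bounded (\<lambda>y. v 0 * relax lam y)"
    unfolding locally_bounded_def
  proof (intro conjI allI)
    fix T :: real
    have "\<bar>v 0 * relax lam y\<bar> \<le> \<bar>v 0\<bar>" for y using relax_abs_le[of lam y] by (simp add: abs_mult mult_left_le)
    then show "\<exists>B. \<forall>y\<in>{0..T}. \<bar>v 0 * relax lam y\<bar> \<le> B" by blast
  qed measurable
  have db: "locally_bounded d"
    unfolding locally_bounded_def
  proof (intro conjI allI)
    have [measurable]: "v \<in> borel_measurable borel" using v(1) by (simp add: locally_bounded_def)
    show "d \<in> borel_measurable borel" unfolding d_def by measurable
    fix T
    obtain B where B: "0 \<le> B" "\<forall>y\<in>{0..T}. \<bar>v y\<bar> \<le> B" using locally_bounded_obtain[OF v(1)] .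
    obtain C where C: "0 \<le> C" "\<forall>y\<in>{0..T}. \<bar>v 0 * relax lam y\<bar> \<le> C" using locally_bounded_obtain[OF rb] .
    have "\<bar>d y\<bar> \<le> B + C" if "y \<in> {0..T}" for y
    proof -
      have "\<bar>v y\<bar> \<le> B" "\<bar>v 0 * relax lam y\<bar> \<le> C" using B C that by auto
      then show ?thesis unfolding d_def by linarith
    qed
    then show "\<exists>B. \<forall>y\<in>{0..T}. \<bar>d y\<bar> \<le> B" by blast
  qed
  have dc: "continuous_on {0..} d"
    unfolding d_def by (intro continuous_intros v(2) relax_continuous[OF lam])
  have dc': "continuous_on {0<..} d" by (rule continuous_on_subset[OF dc]) auto
  have cd: "conv kap d = (\<lambda>u. conv kap v u - v 0 * conv kap (relax lam) u)"
    unfolding d_def[abs_def] conv_scale[symmetric] by (rule ext) (rule conv_diff[OF kap_locally_integrable v(1) rb])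
  define Z where "Z u = conv kap d u + lam * conv (\<lambda>_. 1) d u" for u
  have Zder: "(Z has_real_derivative 0) (at u)" if u: "0 < u" for u
  proof -
    have "(conv kap d has_real_derivative ((kap u * v 0 - lam * v u) - v 0 * (kap u - lam * relax lam u))) (at u)"
      unfolding cd by (intro DERIV_diff der u DERIV_cmult conv_kap_relax_derivative lam)
    moreover have "(conv (\<lambda>_. 1) d has_real_derivative d u) (at u)"
      by (rule conv_const_has_derivative[OF locally_bounded_imp_integrable[OF db] dc' u])
    ultimately have "(Z has_real_derivative (((kap u * v 0 - lam * v u) - v 0 * (kap u - lam * relax lam u)) + lam * d u)) (at u)"
      unfolding Z_def[abs_def] by (intro DERIV_add DERIV_cmult)
    then show ?thesis by (simp add: d_def algebra_simps)
  qed
  have Zconst: "Z x = Z y" if "0 < x" "x < y" for x y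
  proof -
    have "Z y = Z x"
      by (rule DERIV_isconst_end[OF that(2)])
         (use that in \<open>auto intro!: Zder continuous_at_imp_continuous_on DERIV_isCont[OF Zder]\<close>)
    then show ?thesis ..
  qed
  obtain B where B: "0 \<le> B" "\<forall>y\<in>{0..1}. \<bar>d y\<bar> \<le> B" using locally_bounded_obtain[OF db] .
  have Zb: "\<bar>Z x\<bar> \<le> B * conv (\<lambda>_. 1) kap x + lam * (B * x)" if x: "0 < x" "x < 1" for x
  proof -
    have dB: "\<bar>d y\<bar> \<le> B" if "y \<in> {0..x}" for y using B that x by auto
    have "\<bar>conv kap d x\<bar> \<le> B * (LINT y|lborel. indicator {0..x} y * \<bar>kap y\<bar>)"
      by (rule conv_abs_le[OF kap_locally_integrable db dB])
    then have 1: "\<bar>conv kap d x\<bar> \<le> B * conv (\<lambda>_. 1) kap x" using kap_nonneg by (simp add: conv_const)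
    have "\<bar>conv (\<lambda>_. 1) d x\<bar> \<le> B * (LINT y|lborel. indicator {0..x} y * \<bar>1\<bar>)"
      by (rule conv_abs_le[OF locally_bounded_imp_integrable[OF locally_bounded_const] db dB])
    then have "\<bar>conv (\<lambda>_. 1) d x\<bar> \<le> B * x" using x by simp
    then have 2: "\<bar>lam * conv (\<lambda>_. 1) d x\<bar> \<le> lam * (B * x)" using lam by (simp add: abs_mult mult_left_mono)
    show ?thesis using 1 2 abs_triangle_ineq[of "conv kap d x" "lam * conv (\<lambda>_. 1) d x"] unfolding Z_def by linarith
  qed
  have Z0: "Z u = 0" if u: "0 < u" for u
  proof -
    have "((\<lambda>x. B * conv (\<lambda>_. 1) kap x + lam * (B * x)) \<longlongrightarrow> B * 0 + lam * (B * 0)) (at_right 0)"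
      by (intro tendsto_intros kap_mass_tendsto_0)
    then have lim: "((\<lambda>x. B * conv (\<lambda>_. 1) kap x + lam * (B * x)) \<longlongrightarrow> 0) (at_right 0)" by simp
    have "\<bar>Z u\<bar> \<le> 0"
    proof (rule tendsto_lowerbound[OF lim])
      show "\<forall>\<^sub>F x in at_right 0. \<bar>Z u\<bar> \<le> B * conv (\<lambda>_. 1) kap x + lam * (B * x)"
        unfolding eventually_at_right_field
        by (rule exI[of _ "min u 1"]) (use u Zb Zconst in fastforce)
    qed simp
    then show ?thesis by simp
  qed
  have "d t = 0"
  proof (cases "t = 0")
    case True then show ?thesis by (simp add: d_def relax_nonpos_time)
  next
    case False
    then have t0: "0 < t" using t by simp
    show ?thesis
    proof (rule homogeneous_equation_unique[OF lam db dc' _ t0])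
      show "conv kap d u + lam * conv (\<lambda>_. 1) d u = 0" if "0 < u" for u
        using Z0[OF that] by (simp add: Z_def)
    qed
  qed
  then show ?thesis by (simp add: d_def)
qed

end

section \<open>Uniqueness of the Laplace transform\<close>

text \<open>In the variable x = exp(- t), the transforms at s = 1, 2, 3, ... are the moments of h(t)
  = f(t) exp(- t). Vanishing moments annihilate polynomials in x and, by Weierstrass, continuous
  functions on [0, 1]; continuous approximations of sgn h then give \<integral> |h| = 0.\<close>

lemma Laplace_unique:
  fixes f :: "real \<Rightarrow> real"
  assumes i: "\<And>s. 0 < s \<Longrightarrow> set_integrable lebesgue {0<..} (\<lambda>t. f t * exp (- t * s))"
    and z: "\<And>s. 0 < s \<Longrightarrow> (LINT t:{0<..}|lebesgue. f t * exp (- t * s)) = 0"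
  shows "AE t in lebesgue. 0 < t \<longrightarrow> f t = 0"
proof -
  define h where "h t = indicator {0<..} t * (f t * exp (- t))" for t
  have hi: "integrable lebesgue h"
    using i[of 1] by (simp add: set_integrable_def h_def[abs_def])
  note [measurable] = borel_measurable_integrable[OF hi]
  have em[measurable]: "(\<lambda>t::real. exp (- t)) \<in> borel_measurable lebesgue"
    by (rule lebesgue_borel_measurable) measurable
  have hm: "integrable lebesgue (\<lambda>t. h t * q (exp (- t)))" if [measurable]: "q \<in> borel_measurable borel" and B: "\<And>x. x \<in> {0..1} \<Longrightarrow> \<bar>q x\<bar> \<le> B" for q B
  proof (rule Bochner_Integration.integrable_bound)
    show "integrable lebesgue (\<lambda>t. B * h t)" using hi by simp
    show "AE t in lebesgue. norm (h t * q (exp (- t))) \<le> norm (B * h t)"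
    proof (rule AE_I2)
      fix t
      show "norm (h t * q (exp (- t))) \<le> norm (B * h t)"
      proof (cases "0 < t")
        case True
        then have "\<bar>q (exp (- t))\<bar> \<le> \<bar>B\<bar>" using B[of "exp (- t)"] by auto
        then have "\<bar>h t\<bar> * \<bar>q (exp (- t))\<bar> \<le> \<bar>h t\<bar> * \<bar>B\<bar>" by (rule mult_left_mono) simp
        then show ?thesis by (simp add: abs_mult mult.commute)
      qed (simp add: h_def)
    qed
  qed measurable
  \<comment> \<open>The power n corresponds to s = n + 1, since h already contains one factor exp(-
    t). This keeps s positive also for n = 0.\<close>
  have mono: "integrable lebesgue (\<lambda>t. h t * exp (- t) ^ n)" "(LINT t|lebesgue. h t * exp (- t) ^ n) = 0" for n
  proof -
    have e: "h t * exp (- t) ^ n = indicator {0<..} t *\<^sub>R (f t * exp (- t * real (Suc n)))" for t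
      by (simp add: h_def exp_of_nat_mult[symmetric] exp_add[symmetric] algebra_simps)
    show "integrable lebesgue (\<lambda>t. h t * exp (- t) ^ n)" "(LINT t|lebesgue. h t * exp (- t) ^ n) = 0"
      unfolding e using i[of "real (Suc n)"] z[of "real (Suc n)"]
      by (simp_all add: set_integrable_def set_lebesgue_integral_def)
  qed
  have poly: "(LINT t|lebesgue. h t * p (exp (- t))) = 0" if "real_polynomial_function p" for p
  proof -
    obtain a n where p: "p = (\<lambda>x. \<Sum>j\<le>n. a j * x ^ j)"
      using \<open>real_polynomial_function p\<close> unfolding real_polynomial_function_iff_sum by (elim exE)
    have "(LINT t|lebesgue. h t * p (exp (- t))) = (LINT t|lebesgue. (\<Sum>j\<le>n. a j * (h t * exp (- t) ^ j)))"
      unfolding p sum_distrib_left by (simp add: ac_simps)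
    also have "\<dots> = (\<Sum>j\<le>n. a j * (LINT t|lebesgue. h t * exp (- t) ^ j))"
      using mono(1) by (simp add: Bochner_Integration.integral_sum)
    finally show ?thesis using mono(2) by simp
  qed
  have cont: "(LINT t|lebesgue. h t * q (exp (- t))) = 0" if q: "continuous_on UNIV q" for q
  proof -
    let ?N = "LINT t|lebesgue. \<bar>h t\<bar>"
    have qm[measurable]: "q \<in> borel_measurable borel" by (rule borel_measurable_continuous_onI[OF q])
    have le: "\<bar>LINT t|lebesgue. h t * q (exp (- t))\<bar> \<le> e * ?N" if e: "0 < e" for e
    proof -
      obtain p where p: "real_polynomial_function p" "\<And>x. x \<in> {0..1} \<Longrightarrow> \<bar>q x - p x\<bar> < e"
        using Stone_Weierstrass_real_polynomial_function[OF compact_Icc continuous_on_subset[OF q] e] by blast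
      have pm[measurable]: "p \<in> borel_measurable borel"
        by (intro borel_measurable_continuous_onI continuous_on_polymonial_function) (use p(1) in \<open>simp add: real_polynomial_function_eq\<close>)
      have bdd: "\<exists>B. \<forall>x\<in>{0..1}. \<bar>r x\<bar> \<le> B" if "continuous_on UNIV r" for r :: "real \<Rightarrow> real"
      proof -
        have "compact (r ` {0..1})" by (intro compact_continuous_image continuous_on_subset[OF that]) auto
        from compact_imp_bounded[OF this, unfolded bounded_iff] show ?thesis by auto
      qed
      obtain B where B: "\<forall>x\<in>{0..1}. \<bar>q x\<bar> \<le> B" using bdd[OF q] by (elim exE)
      have qi: "integrable lebesgue (\<lambda>t. h t * q (exp (- t)))" by (rule hm[OF qm]) (use B in blast)
      have di: "integrable lebesgue (\<lambda>t. h t * (q (exp (- t)) - p (exp (- t))))"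
        by (rule hm[of "\<lambda>x. q x - p x" e]) (use p(2) in \<open>auto intro: less_imp_le\<close>)
      have pi: "integrable lebesgue (\<lambda>t. h t * p (exp (- t)))"
      proof -
        have "integrable lebesgue (\<lambda>t. h t * q (exp (- t)) - h t * (q (exp (- t)) - p (exp (- t))))"
          by (rule Bochner_Integration.integrable_diff[OF qi di])
        then show ?thesis by (simp add: algebra_simps)
      qed
      have "(LINT t|lebesgue. h t * q (exp (- t))) = (LINT t|lebesgue. h t * (q (exp (- t)) - p (exp (- t))))"
        using Bochner_Integration.integral_diff[OF qi pi] poly[OF p(1)] by (simp add: right_diff_distrib)
      also have "\<bar>\<dots>\<bar> \<le> (LINT t|lebesgue. norm (h t * (q (exp (- t)) - p (exp (- t)))))"
        using integral_norm_bound[of lebesgue "\<lambda>t. h t * (q (exp (- t)) - p (exp (- t)))"] by simp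
      also have "\<dots> \<le> (LINT t|lebesgue. e * \<bar>h t\<bar>)"
      proof (rule integral_mono[OF integrable_norm[OF di]])
        show "integrable lebesgue (\<lambda>t. e * \<bar>h t\<bar>)" using hi by simp
        fix t
        show "norm (h t * (q (exp (- t)) - p (exp (- t)))) \<le> e * \<bar>h t\<bar>"
        proof (cases "0 < t")
          case True
          then have "\<bar>q (exp (- t)) - p (exp (- t))\<bar> \<le> e" using p(2)[of "exp (- t)"] by auto
          then have "\<bar>q (exp (- t)) - p (exp (- t))\<bar> * \<bar>h t\<bar> \<le> e * \<bar>h t\<bar>" by (rule mult_right_mono) simp
          then show ?thesis by (simp add: abs_mult mult.commute)
        qed (simp add: h_def)
      qed
      finally show ?thesis by simp
    qed
    have N: "0 \<le> ?N" by simp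
    show ?thesis
    proof (rule ccontr)
      assume ne: "(LINT t|lebesgue. h t * q (exp (- t))) \<noteq> 0"
      let ?I = "\<bar>LINT t|lebesgue. h t * q (exp (- t))\<bar>"
      have I: "0 < ?I" using ne by simp
      have P: "0 < 2 * (?N + 1)" using add_nonneg_pos[OF N zero_less_one] by (rule mult_pos_pos[OF zero_less_numeral])
      have "?I \<le> ?I / (2 * (?N + 1)) * ?N" by (rule le[OF divide_pos_pos[OF I P]])
      then have "?I * (2 * (?N + 1)) \<le> ?I * ?N" using N by (simp add: field_simps)
      then have "2 * (?N + 1) \<le> ?N" using I by (simp only: mult_le_cancel_left_pos)
      then show False using N by simp
    qed
  qed
  have "(\<lambda>t. sgn (h t)) \<in> borel_measurable lebesgue" by measurable
  then have "(\<lambda>t. sgn (h t)) measurable_on UNIV" by (rule lebesgue_measurable_imp_measurable_on) simp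
  then obtain Z r where Z: "negligible Z" and r: "\<And>n. continuous_on UNIV (r n)"
    and rl: "\<And>t. t \<notin> Z \<Longrightarrow> (\<lambda>n. r n t) \<longlonglongrightarrow> sgn (h t)"
    unfolding measurable_on_def by auto
  \<comment> \<open>\<open>c n\<close> is 0 for x \<le> 1 / (n + 1) and 1 for x \<ge> 2 / (n + 1).
    It removes the neighbourhood of x = 0, that is of t = \<infinity>, where - ln x is singular; the
    inner maximum keeps the logarithm defined and continuous there, and clamping to [-1, 1] leaves
    |h| as majorant.\<close>
  define c where "c n x = max 0 (min 1 (real (Suc n) * x - 1))" for n x
  define \<psi> where "\<psi> n x = c n x * max (- 1) (min 1 (r n (- ln (max x (1 / real (Suc n))))))" for n x
  have c01: "0 \<le> c n x" "c n x \<le> 1" for n x by (auto simp: c_def)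
  have \<psi>c: "continuous_on UNIV (\<psi> n)" for n
  proof -
    have "continuous_on UNIV (\<lambda>x. r n (- ln (max x (1 / real (Suc n)))))"
    proof (rule continuous_on_compose2[OF r])
      have "max x (1 / real (Suc n)) \<noteq> 0" for x
      proof -
        have "0 < 1 / real (Suc n)" by simp
        then show ?thesis by (metis less_max_iff_disj less_irrefl)
      qed
      then show "continuous_on UNIV (\<lambda>x. - ln (max x (1 / real (Suc n))))"
        by (intro continuous_intros) auto
    qed auto
    then show ?thesis unfolding \<psi>_def c_def by (intro continuous_intros)
  qed
  have \<psi>1: "\<bar>\<psi> n x\<bar> \<le> 1" for n x
  proof -
    have "\<bar>\<psi> n x\<bar> \<le> 1 * 1" unfolding \<psi>_def abs_mult using c01[of n x] by (intro mult_mono) auto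
    then show ?thesis by simp
  qed
  have \<psi>l: "(\<lambda>n. h t * \<psi> n (exp (- t))) \<longlonglongrightarrow> \<bar>h t\<bar>" if "t \<notin> Z" for t
  proof (cases "0 < t")
    case True
    define x where "x = exp (- t)"
    have x: "0 < x" and lnx: "- ln x = t" by (auto simp: x_def)
    obtain n0 :: nat where n0: "2 / x \<le> real n0" using real_arch_simple by blast
    have "\<psi> n x = max (- 1) (min 1 (r n t))" if "n \<ge> n0" for n
    proof -
      have "2 / x \<le> real (Suc n)" using n0 that by simp
      then have *: "2 \<le> real (Suc n) * x" using x by (simp add: field_simps)
      then have "1 \<le> real (Suc n) * x" by linarith
      then have "max x (1 / real (Suc n)) = x" by (simp add: max_def field_simps)
      moreover have "c n x = 1" using * by (simp add: c_def)
      ultimately show ?thesis unfolding \<psi>_def using lnx by simp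
    qed
    then have ev: "\<forall>\<^sub>F n in sequentially. \<psi> n x = max (- 1) (min 1 (r n t))" by (auto simp: eventually_sequentially)
    have "(\<lambda>n. max (- 1) (min 1 (r n t))) \<longlonglongrightarrow> max (- 1) (min 1 (sgn (h t)))"
      by (intro tendsto_intros rl that)
    also have "max (- 1) (min 1 (sgn (h t))) = sgn (h t)" by (simp add: sgn_if)
    finally have "(\<lambda>n. \<psi> n x) \<longlonglongrightarrow> sgn (h t)" using ev by (simp add: tendsto_cong)
    then have "(\<lambda>n. h t * \<psi> n x) \<longlonglongrightarrow> h t * sgn (h t)" by (intro tendsto_intros)
    then show ?thesis by (simp add: x_def abs_sgn)
  qed (simp add: h_def)
  have \<psi>m: "\<psi> n \<in> borel_measurable borel" for n by (rule borel_measurable_continuous_onI[OF \<psi>c])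
  have "(\<lambda>n. LINT t|lebesgue. h t * \<psi> n (exp (- t))) \<longlonglongrightarrow> (LINT t|lebesgue. \<bar>h t\<bar>)"
  proof (rule integral_dominated_convergence[where w="\<lambda>t. \<bar>h t\<bar>"])
    show "integrable lebesgue (\<lambda>t. \<bar>h t\<bar>)" using hi by simp
    have "AE t in lebesgue. t \<notin> Z" using Z by (simp add: negligible_iff_null_sets AE_not_in)
    then show "AE t in lebesgue. (\<lambda>n. h t * \<psi> n (exp (- t))) \<longlonglongrightarrow> \<bar>h t\<bar>"
      by eventually_elim (rule \<psi>l)
    show "AE t in lebesgue. norm (h t * \<psi> n (exp (- t))) \<le> \<bar>h t\<bar>" for n
      using \<psi>1 by (intro AE_I2) (simp add: abs_mult mult_left_le)
    show "(\<lambda>t. h t * \<psi> n (exp (- t))) \<in> borel_measurable lebesgue" for n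
      using hm[OF \<psi>m \<psi>1] by (rule borel_measurable_integrable)
  qed measurable
  then have "(LINT t|lebesgue. \<bar>h t\<bar>) = 0" unfolding cont[OF \<psi>c] by (simp add: LIMSEQ_const_iff)
  then have "AE t in lebesgue. \<bar>h t\<bar> = 0"
    using integral_nonneg_eq_0_iff_AE[of lebesgue "\<lambda>t. \<bar>h t\<bar>"] hi by simp
  then show ?thesis by eventually_elim (auto simp: h_def)
qed

section \<open>Kernels with Stieltjes Laplace transform\<close>

text \<open>The measure is regarded as one on the whole line that is concentrated on (0,
  \<infinity>), so that measurability is plain Borel measurability.\<close>

locale stieltjes_measure =
  fixes M :: "real measure"
  assumes sets_M [measurable_cong]: "sets M = sets borel"
    and M_pos: "AE r in M. 0 < r"
    and M_int: "integrable M (\<lambda>r. 1 / (1 + r))"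
begin

lemma finite_Ioc: "emeasure M {0<..real n} < \<infinity>"
proof -
  have "integrable M (\<lambda>r. indicator {0<..real n} r :: real)"
  proof (rule Bochner_Integration.integrable_bound)
    show "integrable M (\<lambda>r. (1 + real n) * (1 / (1 + r)))" using M_int by (rule integrable_mult_right)
    show "AE r in M. norm (indicator {0<..real n} r :: real) \<le> norm ((1 + real n) * (1 / (1 + r)))"
      by (intro AE_I2) (auto simp: indicator_def field_simps)
  qed measurable
  then show ?thesis by (simp add: integrable_indicator_iff)
qed

text \<open>The nonpositive half line is null, and each interval (0, n] has finite measure because 1
  / (1 + r) is bounded below there. This opens the way to Tonelli's theorem for the transforms
  below.\<close>

lemma sigma_finite: "sigma_finite_measure M"
proof
  have "emeasure M {..0} = 0"
    using M_pos by (subst (asm) AE_iff_measurable[of "{..0}"]) (auto simp: not_less sets_eq_imp_space_eq[OF sets_M])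
  moreover have "(\<Union>n. {0<..real n}) \<union> {..0} = (UNIV :: real set)"
  proof (intro set_eqI iffI UNIV_I)
    fix x :: real
    obtain n :: nat where "x \<le> real n" using real_arch_simple by blast
    then show "x \<in> (\<Union>n. {0<..real n}) \<union> {..0}" by (cases "x \<le> 0") auto
  qed
  ultimately show "\<exists>A. countable A \<and> A \<subseteq> sets M \<and> \<Union>A = space M \<and> (\<forall>a\<in>A. emeasure M a \<noteq> \<infinity>)"
    using finite_Ioc by (intro exI[of _ "insert {..0} (range (\<lambda>n. {0<..real n}))"])
      (auto simp: sets_eq_imp_space_eq[OF sets_M] less_top[symmetric])
qed

text \<open>From y exp(- y) \<le> 1 with y = r t. Integrability over the measure is given for 1 / (1
  + r), so other integrands are compared with this function.\<close>

lemma exp_bound: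
  assumes "0 < t" "0 < (r::real)" shows "exp (- (r * t)) \<le> (1 + 1 / t) * (1 / (1 + r))"
proof -
  have 1: "exp (- (r * t)) \<le> 1" using assms by simp
  have "r * t \<le> exp (r * t)" using exp_ge_add_one_self[of "r * t"] by linarith
  then have "r * t * exp (- (r * t)) \<le> exp (r * t) * exp (- (r * t))"
    by (rule mult_right_mono) simp
  then have "r * t * exp (- (r * t)) \<le> 1" by (simp add: exp_minus)
  then have "r * exp (- (r * t)) \<le> 1 / t" using assms by (simp add: field_simps)
  moreover have "(1 + r) * exp (- (r * t)) = exp (- (r * t)) + r * exp (- (r * t))" by (simp add: algebra_simps)
  ultimately have "(1 + r) * exp (- (r * t)) \<le> 1 + 1 / t" using 1 by linarith
  moreover have "e \<le> C * (1 / (1 + r))" if "(1 + r) * e \<le> C" for e C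
    using that assms by (simp add: field_simps)
  ultimately show ?thesis by blast
qed

text \<open>One half of the exponent absorbs the factor r, the other half is compared with 1 / (1 +
  r); hence the time t / 2 in the constant.\<close>

lemma r_exp_bound:
  assumes "0 < t" "0 < (r::real)" shows "r * exp (- (r * t)) \<le> (2 / t * (1 + 2 / t)) * (1 / (1 + r))"
proof -
  have "r * (t / 2) \<le> exp (r * (t / 2))" using exp_ge_add_one_self[of "r * (t / 2)"] by linarith
  then have "r * (t / 2) * exp (- (r * (t / 2))) \<le> exp (r * (t / 2)) * exp (- (r * (t / 2)))"
    by (rule mult_right_mono) simp
  then have "r * (t / 2) * exp (- (r * (t / 2))) \<le> 1" by (simp add: exp_minus)
  then have 1: "r * exp (- (r * (t / 2))) \<le> 2 / t" using assms by (simp add: field_simps)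
  have 2: "exp (- (r * (t / 2))) \<le> (1 + 2 / t) * (1 / (1 + r))" using exp_bound[of "t / 2" r] assms by simp
  have "r * exp (- (r * t)) = (r * exp (- (r * (t / 2)))) * exp (- (r * (t / 2)))"
    by (simp add: exp_add[symmetric])
  also have "\<dots> \<le> (2 / t) * ((1 + 2 / t) * (1 / (1 + r)))"
    by (rule mult_mono[OF 1 2]) (use assms in auto)
  finally show ?thesis by (simp add: mult.assoc)
qed

lemma exp_integrable:
  assumes "0 < t" shows "integrable M (\<lambda>r. exp (- (r * t)))"
proof (rule Bochner_Integration.integrable_bound)
  show "integrable M (\<lambda>r. (1 + 1 / t) * (1 / (1 + r)))" using M_int by (rule integrable_mult_right)
  show "AE r in M. norm (exp (- (r * t))) \<le> norm ((1 + 1 / t) * (1 / (1 + r)))"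
    using M_pos
  proof eventually_elim
    case (elim r)
    have n: "0 \<le> (1 + 1 / t) * (1 / (1 + r))" using elim assms by simp
    show ?case unfolding real_norm_def abs_of_nonneg[OF n] using exp_bound[OF assms elim] by simp
  qed
qed measurable

lemma r_exp_integrable:
  assumes "0 < t" shows "integrable M (\<lambda>r. r * exp (- (r * t)))"
proof (rule Bochner_Integration.integrable_bound)
  show "integrable M (\<lambda>r. (2 / t * (1 + 2 / t)) * (1 / (1 + r)))" using M_int by (rule integrable_mult_right)
  show "AE r in M. norm (r * exp (- (r * t))) \<le> norm ((2 / t * (1 + 2 / t)) * (1 / (1 + r)))"
    using M_pos
  proof eventually_elim
    case (elim r)
    have n: "0 \<le> (2 / t * (1 + 2 / t)) * (1 / (1 + r))" "0 \<le> r * exp (- (r * t))" using elim assms by auto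
    show ?case unfolding real_norm_def abs_of_nonneg[OF n(1)] abs_of_nonneg[OF n(2)] by (rule r_exp_bound[OF assms elim])
  qed
qed measurable

lemma inv_integrable:
  assumes "0 < s" shows "integrable M (\<lambda>r. 1 / (s + r))"
proof (rule Bochner_Integration.integrable_bound)
  show "integrable M (\<lambda>r. (1 + 1 / s) * (1 / (1 + r)))" using M_int by (rule integrable_mult_right)
  show "AE r in M. norm (1 / (s + r)) \<le> norm ((1 + 1 / s) * (1 / (1 + r)))"
    using M_pos
  proof eventually_elim
    case (elim r)
    have "1 + r \<le> (1 + 1 / s) * (s + r)" using elim assms by (simp add: field_simps)
    moreover have "1 / (s + r) \<le> C * (1 / (1 + r))" if "1 + r \<le> C * (s + r)" for C
      using that elim assms by (simp add: field_simps)
    ultimately have le: "1 / (s + r) \<le> (1 + 1 / s) * (1 / (1 + r))" by blast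
    have n: "0 \<le> 1 / (s + r)" using elim assms by simp
    show ?case unfolding real_norm_def abs_of_nonneg[OF n] abs_of_nonneg[OF order_trans[OF n le]] by (rule le)
  qed
qed measurable

definition kern :: "real \<Rightarrow> real" where
  "kern t = (if 0 < t then LINT r|M. exp (- (r * t)) else 0)"

text \<open>Minus the derivative of \<open>kern\<close>; the relation between the two is established
  in the integrated form \<open>kern_tail\<close>.\<close>

definition kern_slope :: "real \<Rightarrow> real" where
  "kern_slope t = (if 0 < t then LINT r|M. r * exp (- (r * t)) else 0)"

lemma kern_measurable [measurable]: "kern \<in> borel_measurable borel"
proof -
  interpret sigma_finite_measure M by (rule sigma_finite)
  have "(\<lambda>t. LINT r|M. exp (- (r * t))) \<in> borel_measurable borel"
    by (rule borel_measurable_lebesgue_integral) measurable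
  then show ?thesis unfolding kern_def[abs_def] by measurable
qed

lemma kern_slope_measurable [measurable]: "kern_slope \<in> borel_measurable borel"
proof -
  interpret sigma_finite_measure M by (rule sigma_finite)
  have "(\<lambda>t. LINT r|M. r * exp (- (r * t))) \<in> borel_measurable borel"
    by (rule borel_measurable_lebesgue_integral) measurable
  then show ?thesis unfolding kern_slope_def[abs_def] by measurable
qed

lemma kern_nonneg: "0 \<le> kern t"
  unfolding kern_def by simp

lemma kern_slope_nonneg: "0 \<le> kern_slope t"
proof (cases "0 < t")
  case True
  have "0 \<le> (LINT r|M. r * exp (- (r * t)))"
    by (rule integral_nonneg_AE) (use M_pos in eventually_elim, simp)
  then show ?thesis by (simp add: kern_slope_def)
qed (simp add: kern_slope_def)

lemma exp_antimono: "0 < r \<Longrightarrow> s \<le> t \<Longrightarrow> exp (- (r * t)) \<le> exp (- (r * (s::real)))"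
  by (simp add: mult_left_mono)

lemma kern_antimono: assumes "0 < s" "s \<le> t" shows "kern t \<le> kern s"
proof -
  have "(LINT r|M. exp (- (r * t))) \<le> (LINT r|M. exp (- (r * s)))"
  proof (rule integral_mono_AE)
    show "AE r in M. exp (- (r * t)) \<le> exp (- (r * s))"
      using M_pos by eventually_elim (rule exp_antimono[OF _ assms(2)])
  qed (use assms exp_integrable in auto)
  then show ?thesis using assms by (simp add: kern_def)
qed

lemma kern_slope_antimono: assumes "0 < s" "s \<le> t" shows "kern_slope t \<le> kern_slope s"
proof -
  have "(LINT r|M. r * exp (- (r * t))) \<le> (LINT r|M. r * exp (- (r * s)))"
  proof (rule integral_mono_AE)
    show "AE r in M. r * exp (- (r * t)) \<le> r * exp (- (r * s))"
      using M_pos by eventually_elim (intro mult_left_mono exp_antimono[OF _ assms(2)], auto)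
  qed (use assms r_exp_integrable in auto)
  then show ?thesis using assms by (simp add: kern_slope_def)
qed

lemma nn_exp_tail:
  assumes "0 < c"
  shows "(\<integral>\<^sup>+x. ennreal (exp (- (c * x))) * indicator {t<..} x \<partial>lborel) = ennreal (exp (- (c * t)) / c)"
proof -
  have "(\<integral>\<^sup>+x. ennreal (exp (- (c * x))) * indicator {t<..} x \<partial>lborel)
    = (\<integral>\<^sup>+x. ennreal (exp (- (c * x))) * indicator {t..} x \<partial>lborel)"
    by (rule nn_integral_cong_AE) (use AE_lborel_singleton[of t] in eventually_elim, auto simp: indicator_def)
  also have "\<dots> = ennreal (0 - (- exp (- (c * t)) / c))"
  proof (rule nn_integral_FTC_atLeast)
    show "((\<lambda>x. - exp (- (c * x)) / c) \<longlongrightarrow> 0) at_top"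
      using assms by real_asymp
    show "((\<lambda>x. - exp (- (c * x)) / c) has_real_derivative exp (- (c * x))) (at x)" if "t \<le> x" for x
      using assms by (auto intro!: derivative_eq_intros)
  qed auto
  finally show ?thesis by simp
qed

text \<open>For each single r the integral of r exp(- r \<tau>) over \<tau> > t is exp(- r t). All
  terms are nonnegative, so Tonelli passes this to the measure and yields integrability at the same
  time.\<close>

lemma kern_tail:
  assumes t: "0 < t"
  shows "has_bochner_integral lborel (\<lambda>\<tau>. kern_slope \<tau> * indicator {t<..} \<tau>) (kern t)"
proof (rule has_bochner_integral_nn_integral)
  interpret sigma_finite_measure M by (rule sigma_finite)
  interpret pair_sigma_finite lborel M ..
  have eq: "ennreal (kern_slope \<tau> * indicator {t<..} \<tau>) = (\<integral>\<^sup>+r. ennreal (r * exp (- (r * \<tau>))) * indicator {t<..} \<tau> \<partial>M)" for \<tau>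
  proof (cases "t < \<tau>")
    case True
    have "(\<integral>\<^sup>+r. ennreal (r * exp (- (r * \<tau>))) \<partial>M) = ennreal (LINT r|M. r * exp (- (r * \<tau>)))"
      by (rule nn_integral_eq_integral[OF r_exp_integrable]) (use True t M_pos in \<open>auto elim: eventually_mono\<close>)
    then show ?thesis using True t by (simp add: kern_slope_def)
  qed simp
  have "(\<integral>\<^sup>+\<tau>. ennreal (kern_slope \<tau> * indicator {t<..} \<tau>) \<partial>lborel)
    = (\<integral>\<^sup>+\<tau>. (\<integral>\<^sup>+r. ennreal (r * exp (- (r * \<tau>))) * indicator {t<..} \<tau> \<partial>M) \<partial>lborel)" unfolding eq ..
  also have "\<dots> = (\<integral>\<^sup>+r. (\<integral>\<^sup>+\<tau>. ennreal (r * exp (- (r * \<tau>))) * indicator {t<..} \<tau> \<partial>lborel) \<partial>M)"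
    by (rule Fubini'[symmetric]) measurable
  also have "\<dots> = (\<integral>\<^sup>+r. ennreal (exp (- (r * t))) \<partial>M)"
  proof (rule nn_integral_cong_AE)
    show "AE r in M. (\<integral>\<^sup>+\<tau>. ennreal (r * exp (- (r * \<tau>))) * indicator {t<..} \<tau> \<partial>lborel) = ennreal (exp (- (r * t)))"
      using M_pos
    proof eventually_elim
      case (elim r)
      have "(\<integral>\<^sup>+\<tau>. ennreal (r * exp (- (r * \<tau>))) * indicator {t<..} \<tau> \<partial>lborel)
        = (\<integral>\<^sup>+\<tau>. ennreal r * (ennreal (exp (- (r * \<tau>))) * indicator {t<..} \<tau>) \<partial>lborel)"
        using elim by (simp add: ennreal_mult mult.assoc)
      also have "\<dots> = ennreal r * ennreal (exp (- (r * t)) / r)"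
        unfolding nn_exp_tail[OF elim, symmetric] by (rule nn_integral_cmult) measurable
      also have "\<dots> = ennreal (exp (- (r * t)))" using elim by (simp flip: ennreal_mult)
      finally show ?case .
    qed
  qed
  also have "\<dots> = ennreal (kern t)"
    unfolding kern_def using t by (simp add: nn_integral_eq_integral[OF exp_integrable])
  finally show "(\<integral>\<^sup>+\<tau>. ennreal (kern_slope \<tau> * indicator {t<..} \<tau>) \<partial>lborel) = ennreal (kern t)" .
qed (use kern_nonneg kern_slope_nonneg in auto)

lemma kern_laplace:
  assumes s: "0 < s"
  shows "has_bochner_integral lborel (\<lambda>t. indicator {0<..} t * (kern t * exp (- t * s))) (LINT r|M. 1 / (s + r))"
proof (rule has_bochner_integral_nn_integral)
  interpret sigma_finite_measure M by (rule sigma_finite)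
  interpret pair_sigma_finite lborel M ..
  have eq: "ennreal (indicator {0<..} t * (kern t * exp (- t * s))) = (\<integral>\<^sup>+r. ennreal (exp (- ((s + r) * t))) * indicator {0<..} t \<partial>M)" for t
  proof (cases "0 < t")
    case True
    have "(\<integral>\<^sup>+r. ennreal (exp (- ((s + r) * t))) \<partial>M) = (\<integral>\<^sup>+r. ennreal (exp (- t * s)) * ennreal (exp (- (r * t))) \<partial>M)"
      by (intro nn_integral_cong) (simp add: algebra_simps flip: ennreal_mult exp_add)
    also have "\<dots> = ennreal (exp (- t * s)) * (\<integral>\<^sup>+r. ennreal (exp (- (r * t))) \<partial>M)"
      by (rule nn_integral_cmult) measurable
    also have "\<dots> = ennreal (exp (- t * s)) * ennreal (kern t)"
      using True by (simp add: kern_def nn_integral_eq_integral[OF exp_integrable])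
    finally show ?thesis using True kern_nonneg by (simp add: mult.commute flip: ennreal_mult)
  qed simp
  have "(\<integral>\<^sup>+t. ennreal (indicator {0<..} t * (kern t * exp (- t * s))) \<partial>lborel)
    = (\<integral>\<^sup>+t. (\<integral>\<^sup>+r. ennreal (exp (- ((s + r) * t))) * indicator {0<..} t \<partial>M) \<partial>lborel)" unfolding eq ..
  also have "\<dots> = (\<integral>\<^sup>+r. (\<integral>\<^sup>+t. ennreal (exp (- ((s + r) * t))) * indicator {0<..} t \<partial>lborel) \<partial>M)"
    by (rule Fubini'[symmetric]) measurable
  also have "\<dots> = (\<integral>\<^sup>+r. ennreal (1 / (s + r)) \<partial>M)"
  proof (rule nn_integral_cong_AE)
    show "AE r in M. (\<integral>\<^sup>+t. ennreal (exp (- ((s + r) * t))) * indicator {0<..} t \<partial>lborel) = ennreal (1 / (s + r))"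
      using M_pos
    proof eventually_elim
      case (elim r)
      then have "0 < s + r" using s by simp
      from nn_exp_tail[OF this, of 0] show ?case by simp
    qed
  qed
  also have "\<dots> = ennreal (LINT r|M. 1 / (s + r))"
    by (rule nn_integral_eq_integral[OF inv_integrable[OF s]]) (use M_pos s in \<open>auto elim: eventually_mono\<close>)
  finally show "(\<integral>\<^sup>+t. ennreal (indicator {0<..} t * (kern t * exp (- t * s))) \<partial>lborel) = ennreal (LINT r|M. 1 / (s + r))" .
  show "0 \<le> (LINT r|M. 1 / (s + r))"
    by (rule integral_nonneg_AE) (use M_pos s in \<open>auto elim: eventually_mono\<close>)
qed (use kern_nonneg in auto)

text \<open>The Laplace integrand at s = 1 is integrable, and on [0, T] the factor exp(T - t) is at
  least 1.\<close>

lemma kern_locally_integrable: "locally_integrable kern"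
  unfolding locally_integrable_def
proof (intro conjI allI)
  fix T :: real
  show "integrable lborel (\<lambda>y. indicator {0..T} y * kern y)"
  proof (rule Bochner_Integration.integrable_bound)
    show "integrable lborel (\<lambda>t. exp T * (indicator {0<..} t * (kern t * exp (- t * 1))))"
      by (intro integrable_mult_right integrable.intros[OF kern_laplace]) simp
    show "AE t in lborel. norm (indicator {0..T} t * kern t) \<le> norm (exp T * (indicator {0<..} t * (kern t * exp (- t * 1))))"
    proof (rule AE_I2)
      fix t
      show "norm (indicator {0..T} t * kern t) \<le> norm (exp T * (indicator {0<..} t * (kern t * exp (- t * 1))))"
      proof (cases "0 < t \<and> t \<le> T")
        case True
        have "1 \<le> exp (T - t)" using True by simp
        also have "\<dots> = exp T * exp (- t)" by (simp flip: exp_add)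
        finally have "kern t * 1 \<le> kern t * (exp T * exp (- t))" using kern_nonneg by (rule mult_left_mono)
        then show ?thesis using True kern_nonneg[of t] by (simp add: abs_mult ac_simps)
      next
        case False
        then have z: "indicator {0..T} t * kern t = 0" by (auto simp: kern_def indicator_def)
        show ?thesis unfolding z norm_zero by (rule norm_ge_zero)
      qed
    qed
  qed measurable
qed measurable

end

section \<open>From admissible kernels to relaxation kernels\<close>

lemma stieltjes_function_measure:
  assumes "stieltjes_function f"
  shows "\<exists>a b M. 0 \<le> a \<and> 0 \<le> b \<and> stieltjes_measure M \<and> (\<forall>s>0. f s = a / s + b + (LINT r|M. 1 / (s + r)))"
proof -
  obtain a b \<sigma> where ab: "0 \<le> a" "0 \<le> b" and sets: "sets \<sigma> = sets (restrict_space borel {0<..})"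
    and i: "integrable \<sigma> (\<lambda>r. 1 / (1 + r))" and f: "\<And>s. 0 < s \<Longrightarrow> f s = a / s + b + (LINT r|\<sigma>. 1 / (s + r))"
    using assms unfolding stieltjes_function_def by blast
  define M where "M = distr \<sigma> borel (\<lambda>r. r)"
  have id: "(\<lambda>r. r) \<in> measurable \<sigma> borel"
    unfolding measurable_cong_sets[OF sets refl] by (rule measurable_restrict_space1) simp
  have sp: "space \<sigma> = {0<..}" using sets_eq_imp_space_eq[OF sets] by (simp add: space_restrict_space)
  have int: "integrable M q \<longleftrightarrow> integrable \<sigma> q" "integral\<^sup>L M q = integral\<^sup>L \<sigma> q"
    if "q \<in> borel_measurable borel" for q :: "real \<Rightarrow> real"
    unfolding M_def using integrable_distr_eq[OF id that] integral_distr[OF id that] by auto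
  have "stieltjes_measure M"
  proof
    show "sets M = sets borel" by (simp add: M_def)
    show "AE r in M. 0 < r"
      unfolding M_def by (subst AE_distr_iff[OF id]) (auto simp: sp)
    show "integrable M (\<lambda>r. 1 / (1 + r))" using i by (subst int) auto
  qed
  moreover have "(LINT r|M. 1 / (s + r)) = (LINT r|\<sigma>. 1 / (s + r))" for s
    by (rule int) measurable
  ultimately have "\<forall>s>0. f s = a / s + b + (LINT r|M. 1 / (s + r))" using f by simp
  with ab \<open>stieltjes_measure M\<close> show ?thesis by blast
qed

text \<open>The limit of s times the transform at 0 forces a = 0, and the limit of the transform at
  infinity forces b = 0; uniqueness of the transform then identifies k with \<open>kern\<close>
  almost everywhere. Divergence of s times the transform at infinity makes \<open>kern\<close>
  unbounded, and by monotonicity this is blow-up at 0.\<close>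

lemma admissible_kernel_relaxation_kernel:
  assumes k: "admissible_kernel k"
  shows "\<exists>g kap. relaxation_kernel g kap \<and> (\<forall>t>0. cont_rep k t = kap t) \<and> (\<forall>t>0. L1_norm_upto k t = conv (\<lambda>_. 1) kap t)"
proof -
  have kl: "L1_loc k" and ki: "\<And>s. 0 < s \<Longrightarrow> set_integrable lebesgue {0<..} (\<lambda>t. k t * exp (- t * s))"
    and st: "stieltjes_function (laplace k)" and C3: "(laplace k \<longlongrightarrow> 0) at_top" "filterlim (\<lambda>s. s * laplace k s) at_top at_top"
    and C4: "((\<lambda>s. s * laplace k s) \<longlongrightarrow> 0) (at_right 0)"
    using k unfolding admissible_kernel_def by auto
  obtain a b M where ab: "0 \<le> a" "0 \<le> b" and M: "stieltjes_measure M"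
    and lap_all: "\<forall>s>0. laplace k s = a / s + b + (LINT r|M. 1 / (s + r))"
    using stieltjes_function_measure[OF st] by (elim exE conjE)
  note lap = lap_all[rule_format]
  interpret stieltjes_measure M by fact
  have F0: "0 \<le> (LINT r|M. 1 / (s + r))" if "0 < s" for s
    by (rule integral_nonneg_AE) (use M_pos that in \<open>auto elim: eventually_mono\<close>)
  have "a \<le> 0"
  proof (rule tendsto_lowerbound[OF C4])
    show "\<forall>\<^sub>F s in at_right 0. a \<le> s * laplace k s"
      unfolding eventually_at_right_field
    proof (intro exI[of _ 1] conjI allI impI)
      fix s :: real assume s: "0 < s" "s < 1"
      have "s * laplace k s = a + s * b + s * (LINT r|M. 1 / (s + r))"
        using s lap[of s] by (simp add: field_simps)
      then show "a \<le> s * laplace k s" using s ab F0[of s] by simp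
    qed simp
  qed simp
  then have a0: "a = 0" using ab by simp
  have "b \<le> 0"
  proof (rule tendsto_lowerbound[OF C3(1)])
    show "\<forall>\<^sub>F s in at_top. b \<le> laplace k s"
      using eventually_gt_at_top[of 0]
    proof eventually_elim
      case (elim s)
      then show ?case using lap[OF elim] ab F0[OF elim] by simp
    qed
  qed simp
  then have b0: "b = 0" using ab by simp
  have lap': "laplace k s = (LINT r|M. 1 / (s + r))" if "0 < s" for s
    using lap[OF that] a0 b0 by simp
  have kern_lap: "laplace k s = (LINT t|lborel. indicator {0<..} t * (kern t * exp (- t * s)))" if "0 < s" for s
    using has_bochner_integral_integral_eq[OF kern_laplace[OF that]] lap'[OF that] by simp
  have kern_lap_i: "integrable lborel (\<lambda>t. indicator {0<..} t * (kern t * exp (- t * s)))" if "0 < s" for s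
    using kern_laplace[OF that] by (rule integrable.intros)
  have m: "(\<lambda>t. indicator {0<..} t * (kern t * exp (- t * s))) \<in> borel_measurable lborel" for s :: real
    by measurable
  have AEk: "AE t in lebesgue. 0 < t \<longrightarrow> k t - kern t = 0"
  proof (rule Laplace_unique)
    fix s :: real assume s: "0 < s"
    have 2: "set_integrable lebesgue {0<..} (\<lambda>t. kern t * exp (- t * s))"
      unfolding set_integrable_def using kern_lap_i[OF s] integrable_completion[OF m] by simp
    have 3: "(LINT t:{0<..}|lebesgue. kern t * exp (- t * s)) = laplace k s"
      unfolding set_lebesgue_integral_def kern_lap[OF s] using integral_completion[OF m] by simp
    show "set_integrable lebesgue {0<..} (\<lambda>t. (k t - kern t) * exp (- t * s))"
      unfolding left_diff_distrib by (rule set_integral_diff(1)[OF ki[OF s] 2])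
    show "(LINT t:{0<..}|lebesgue. (k t - kern t) * exp (- t * s)) = 0"
      unfolding left_diff_distrib set_integral_diff(2)[OF ki[OF s] 2] 3 by (simp add: laplace_def)
  qed
  \<comment> \<open>A bound B on the kernel bounds its transform by B / s, so s times the transform
    would remain bounded.\<close>
  have le: "s * laplace k s \<le> B" if s: "0 < s" and B: "\<And>t. 0 < t \<Longrightarrow> kern t \<le> B" for s B
  proof -
    have "0 \<le> B" using B[of 1] kern_nonneg[of 1] by simp
    have "(\<integral>\<^sup>+t. ennreal (exp (- (s * t))) * indicator {0<..} t \<partial>lborel) = ennreal (1 / s)"
      using nn_exp_tail[OF s, of 0] by simp
    then have "(\<integral>\<^sup>+t. ennreal (indicator {0<..} t * exp (- (s * t))) \<partial>lborel) = ennreal (1 / s)"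
      by (simp add: ennreal_mult'' mult.commute flip: ennreal_indicator)
    then have e: "has_bochner_integral lborel (\<lambda>t. indicator {0<..} t * exp (- (s * t))) (1 / s)"
      by (intro has_bochner_integral_nn_integral) (use s in auto)
    have "laplace k s \<le> (LINT t|lborel. B * (indicator {0<..} t * exp (- (s * t))))"
      unfolding kern_lap[OF s]
    proof (rule integral_mono[OF kern_lap_i[OF s]])
      show "integrable lborel (\<lambda>t. B * (indicator {0<..} t * exp (- (s * t))))"
        using e by (intro integrable_mult_right integrable.intros)
      show "indicator {0<..} t * (kern t * exp (- t * s)) \<le> B * (indicator {0<..} t * exp (- (s * t)))" for t
        using B[of t] by (auto simp: indicator_def mult.commute intro: mult_right_mono)
    qed
    also have "\<dots> = B / s" using has_bochner_integral_integral_eq[OF e] by simp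
    finally show ?thesis using s by (simp add: field_simps)
  qed
  have unbounded: "\<exists>t>0. B < kern t" for B
  proof (rule ccontr)
    assume "\<not> (\<exists>t>0. B < kern t)"
    then have B: "kern t \<le> B" if "0 < t" for t using that by (meson not_less)
    have "eventually (\<lambda>s. B + 1 \<le> s * laplace k s \<and> 0 < s) at_top"
      using C3(2) by (intro eventually_conj eventually_gt_at_top) (simp add: filterlim_at_top)
    then obtain s where s: "B + 1 \<le> s * laplace k s" "0 < s"
      using eventually_happens'[OF trivial_limit_at_top_linorder] by blast
    then show False using le[OF s(2) B] by linarith
  qed
  \<comment> \<open>A zero of this integral of a positive function makes the measure null; the
    kernel would then vanish identically, contrary to its unboundedness.\<close>
  have pos: "0 < kern t" if t: "0 < t" for t
  proof (rule ccontr)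
    assume "\<not> 0 < kern t"
    then have "kern t = 0" using kern_nonneg[of t] by linarith
    then have "(LINT r|M. exp (- (r * t))) = 0" using t by (simp add: kern_def)
    then have "AE r in M. exp (- (r * t)) = 0"
      using integral_nonneg_eq_0_iff_AE[OF exp_integrable[OF t]] by simp
    then have F: "AE r in M. False" by simp
    have "kern u = 0" if "0 < u" for u
    proof -
      have "(LINT r|M. exp (- (r * u))) = (LINT r|M. 0)"
        by (rule integral_cong_AE) (use F in auto)
      then show ?thesis by (simp add: kern_def)
    qed
    then show False using unbounded[of 0] by auto
  qed
  have "relaxation_kernel kern_slope kern"
  proof
    show "filterlim kern at_top (at_right 0)"
      unfolding filterlim_at_top_dense
    proof
      fix B
      obtain t where t: "0 < t" "B < kern t" using unbounded by blast
      show "eventually (\<lambda>u. B < kern u) (at_right 0)"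
        unfolding eventually_at_right_field
        by (rule exI[of _ t]) (use t kern_antimono in \<open>auto intro: less_le_trans\<close>)
    qed
  qed (use kern_slope_nonneg kern_slope_antimono kern_tail pos kern_locally_integrable in \<open>auto simp: kern_def\<close>)
  then interpret R: relaxation_kernel kern_slope kern .
  have "cont_rep k t = kern t" if "0 < t" for t
  proof (rule cont_rep_unique[OF R.kap_continuous _ that])
    show "AE t in lebesgue. 0 < t \<longrightarrow> kern t = k t" using AEk by eventually_elim auto
  qed
  moreover have "L1_norm_upto k t = conv (\<lambda>_. 1) kern t" if t: "0 < t" for t
  proof -
    have "set_integrable lebesgue {0<..<t} k" using kl t by (simp add: L1_loc_def)
    then have km: "(\<lambda>\<tau>. indicator {0<..<t} \<tau> *\<^sub>R k \<tau>) \<in> borel_measurable lebesgue"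
      unfolding set_integrable_def by (rule borel_measurable_integrable)
    have "(\<lambda>\<tau>. \<bar>indicator {0<..<t} \<tau> *\<^sub>R k \<tau>\<bar>) \<in> borel_measurable lebesgue" using km by (rule borel_measurable_abs)
    moreover have "(\<lambda>\<tau>. \<bar>indicator {0<..<t} \<tau> *\<^sub>R k \<tau>\<bar>) = (\<lambda>\<tau>. indicator {0<..<t} \<tau> *\<^sub>R \<bar>k \<tau>\<bar>)"
      by (simp add: fun_eq_iff abs_mult)
    ultimately have km': "(\<lambda>\<tau>. indicator {0<..<t} \<tau> *\<^sub>R \<bar>k \<tau>\<bar>) \<in> borel_measurable lebesgue" by simp
    have n0: "AE \<tau> in lebesgue. \<tau> \<noteq> (c::real)" for c
      using AE_lborel_singleton[of c] by (simp add: AE_completion_iff)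
    have "L1_norm_upto k t = (LINT \<tau>|lborel. indicator {0..t} \<tau> * kern \<tau>)"
      unfolding L1_norm_upto_def set_lebesgue_integral_def
    proof (rule integrable_lebesgue_borel(2)[OF _ km'])
      show "AE \<tau> in lebesgue. indicator {0<..<t} \<tau> *\<^sub>R \<bar>k \<tau>\<bar> = indicator {0..t} \<tau> * kern \<tau>"
        using AEk n0[of 0] n0[of t] by eventually_elim (auto simp: indicator_def kern_nonneg)
    qed measurable
    then show ?thesis by (simp add: conv_const)
  qed
  ultimately show ?thesis using \<open>relaxation_kernel kern_slope kern\<close> by blast
qed

section \<open>The Caputo-type relaxation equation\<close>

context relaxation_kernel
begin

lemma time_conv_eq:
  assumes h: "\<forall>t>0. h t = kap t" and v: "v \<in> borel_measurable borel"
  shows "time_conv h v t = (LINT \<tau>|lborel. indicator {0..t} \<tau> *\<^sub>R (kap (t - \<tau>) *\<^sub>R v \<tau>))"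
proof -
  \<comment> \<open>At \<tau> = t the kernels are evaluated at 0, where \<open>h\<close> is
    arbitrary and \<open>kap\<close> is 0 by convention; this single point is discarded.\<close>
  have "time_conv h v t = (LINT \<tau>|lebesgue. indicator {0..t} \<tau> *\<^sub>R (kap (t - \<tau>) *\<^sub>R v \<tau>))"
    unfolding time_conv_def set_lebesgue_integral_def
  proof (rule integral_discrete_difference[where X="{t}"])
    show "indicator {0..t} \<tau> *\<^sub>R (h (t - \<tau>) *\<^sub>R v \<tau>) = indicator {0..t} \<tau> *\<^sub>R (kap (t - \<tau>) *\<^sub>R v \<tau>)"
      if "\<tau> \<in> space lebesgue" "\<tau> \<notin> {t}" for \<tau>
      using that h[rule_format, of "t - \<tau>"] by (auto simp: indicator_def)
  qed auto
  also have "\<dots> = (LINT \<tau>|lborel. indicator {0..t} \<tau> *\<^sub>R (kap (t - \<tau>) *\<^sub>R v \<tau>))"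
    by (rule integral_completion) (use v in measurable)
  finally show ?thesis .
qed

lemma time_conv_relax:
  assumes h: "\<forall>t>0. h t = kap t"
  shows "time_conv h (\<lambda>s. relax lam s *\<^sub>R c) t = conv kap (relax lam) t *\<^sub>R c"
proof -
  have "time_conv h (\<lambda>s. relax lam s *\<^sub>R c) t = (LINT \<tau>|lborel. indicator {0..t} \<tau> *\<^sub>R (kap (t - \<tau>) *\<^sub>R (relax lam \<tau> *\<^sub>R c)))"
    by (rule time_conv_eq[OF h]) measurable
  also have "\<dots> = (LINT \<tau>|lborel. (indicator {0..t} \<tau> * (kap (t - \<tau>) * relax lam \<tau>)) *\<^sub>R c)"
    by (simp add: mult.assoc)
  also have "\<dots> = conv kap (relax lam) t *\<^sub>R c"
    unfolding conv_def by (rule integral_scaleR_left) (rule conv_integrable[OF kap_locally_integrable relax_locally_bounded(1)])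
  finally show ?thesis .
qed

text \<open>The derivative of the convolution contains the singular term kap(t) c. Since the
  relaxation function is 1 at time 0, the initial value correction of the Caputo-type operator
  removes exactly this term.\<close>

lemma caputo_relax:
  assumes h: "\<forall>t>0. h t = kap t" and lam: "0 \<le> lam" and t: "0 < t"
  shows "caputo_exists h (\<lambda>s. relax lam s *\<^sub>R c) t"
    "caputo h (\<lambda>s. relax lam s *\<^sub>R c) t = - (lam *\<^sub>R (relax lam t *\<^sub>R c))"
proof -
  have "((\<lambda>u. conv kap (relax lam) u *\<^sub>R c) has_vector_derivative (kap t - lam * relax lam t) *\<^sub>R c) (at t)"
    using has_vector_derivative_scaleR[OF conv_kap_relax_derivative[OF lam t] has_vector_derivative_const[of c]] by simp
  then have d: "(time_conv h (\<lambda>s. relax lam s *\<^sub>R c) has_vector_derivative (kap t - lam * relax lam t) *\<^sub>R c) (at t)"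
    unfolding time_conv_relax[OF h, abs_def] .
  show "caputo_exists h (\<lambda>s. relax lam s *\<^sub>R c) t"
    unfolding caputo_exists_def using d by (rule differentiableI_vector)
  show "caputo h (\<lambda>s. relax lam s *\<^sub>R c) t = - (lam *\<^sub>R (relax lam t *\<^sub>R c))"
    unfolding caputo_def vector_derivative_at[OF d] by (simp add: h[rule_format, OF t] relax_nonpos_time algebra_simps)
qed

text \<open>A bounded linear functional commutes with the convolution integral and with the
  derivative, which reduces the complex problem to the real one; real and imaginary part are the
  intended choices of \<open>P\<close>.\<close>

lemma caputo_unique_component:
  fixes v :: "real \<Rightarrow> complex"
  assumes h: "\<forall>t>0. h t = kap t" and lam: "0 \<le> lam" and v: "continuous_on {0..} v"
    and eq: "\<And>t. 0 < t \<Longrightarrow> caputo_exists h v t \<and> caputo h v t = - (lam *\<^sub>R v t)" and t: "0 \<le> t"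
    and P: "bounded_linear (P :: complex \<Rightarrow> real)"
  shows "P (v t) = P (v 0) * relax lam t"
proof -
  \<comment> \<open>Nothing is known about v at negative times; cutting it off there gives a Borel
    function with the same convolution.\<close>
  define v' where "v' y = indicator {0..} y *\<^sub>R v y" for y
  have [measurable]: "v' \<in> borel_measurable borel"
    unfolding v'_def[abs_def] by (rule borel_measurable_continuous_on_indicator[OF _ v]) simp
  have tv: "time_conv h v = time_conv h v'"
    unfolding time_conv_def set_lebesgue_integral_def
    by (rule ext, rule Bochner_Integration.integral_cong) (auto simp: v'_def indicator_def)
  let ?p = "\<lambda>y. if 0 \<le> y then P (v y) else 0"
  have Pc: "continuous_on {0..} (\<lambda>y. P (v y))" using bounded_linear.continuous_on[OF P v] .
  have pb: "locally_bounded ?p" by (rule locally_bounded_continuous[OF Pc])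
  have nb: "locally_bounded (\<lambda>y. if 0 \<le> y then norm (v y) else 0)"
    by (rule locally_bounded_continuous) (intro continuous_intros v)
  have vi: "integrable lborel (\<lambda>\<tau>. indicator {0..u} \<tau> *\<^sub>R (kap (u - \<tau>) *\<^sub>R v' \<tau>))" for u
  proof (rule Bochner_Integration.integrable_bound[OF conv_integrable[OF kap_locally_integrable nb, of u]])
    show "AE \<tau> in lborel. norm (indicator {0..u} \<tau> *\<^sub>R (kap (u - \<tau>) *\<^sub>R v' \<tau>))
      \<le> norm (indicator {0..u} \<tau> * (kap (u - \<tau>) * (if 0 \<le> \<tau> then norm (v \<tau>) else 0)))"
      by (intro AE_I2) (auto simp: v'_def indicator_def abs_mult)
  qed measurable
  have Pt: "P (time_conv h v u) = conv kap ?p u" for u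
  proof -
    have "P (time_conv h v u) = (LINT \<tau>|lborel. P (indicator {0..u} \<tau> *\<^sub>R (kap (u - \<tau>) *\<^sub>R v' \<tau>)))"
      unfolding tv time_conv_eq[OF h \<open>v' \<in> borel_measurable borel\<close>] by (rule integral_bounded_linear[OF P vi, symmetric])
    also have "\<dots> = conv kap ?p u"
      unfolding conv_def
    proof (intro Bochner_Integration.integral_cong refl)
      fix \<tau>
      show "P (indicator {0..u} \<tau> *\<^sub>R (kap (u - \<tau>) *\<^sub>R v' \<tau>)) = indicator {0..u} \<tau> * (kap (u - \<tau>) * ?p \<tau>)"
        using bounded_linear.linear[OF P] by (cases "\<tau> \<in> {0..u}") (auto simp: v'_def linear_scale linear_0)
    qed
    finally show ?thesis .
  qed
  have der: "(conv kap ?p has_real_derivative (kap u * ?p 0 - lam * ?p u)) (at u)" if u: "0 < u" for u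
  proof -
    have "time_conv h v differentiable (at u)" using eq[OF u] by (simp add: caputo_exists_def)
    then have 1: "(time_conv h v has_vector_derivative vector_derivative (time_conv h v) (at u)) (at u)"
      by (simp add: vector_derivative_works)
    have "vector_derivative (time_conv h v) (at u) = kap u *\<^sub>R v 0 - lam *\<^sub>R v u"
      using eq[OF u] h[rule_format, OF u] by (simp add: caputo_def algebra_simps)
    with 1 have "(time_conv h v has_vector_derivative (kap u *\<^sub>R v 0 - lam *\<^sub>R v u)) (at u)" by simp
    then have "((\<lambda>x. P (time_conv h v x)) has_vector_derivative P (kap u *\<^sub>R v 0 - lam *\<^sub>R v u)) (at u)"
      by (rule bounded_linear.has_vector_derivative[OF P])
    then have "((\<lambda>x. conv kap ?p x) has_vector_derivative P (kap u *\<^sub>R v 0 - lam *\<^sub>R v u)) (at u)" unfolding Pt .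
    moreover have "P (kap u *\<^sub>R v 0 - lam *\<^sub>R v u) = kap u * ?p 0 - lam * ?p u"
      using u bounded_linear.linear[OF P] by (simp add: linear_diff linear_scale)
    ultimately show ?thesis by (simp add: has_real_derivative_iff_has_vector_derivative)
  qed
  have "continuous_on {0..} ?p" using Pc by (rule continuous_on_eq) simp
  from relax_unique[OF lam pb this der t] t show ?thesis by simp
qed

lemma caputo_unique:
  fixes v :: "real \<Rightarrow> complex"
  assumes "\<forall>t>0. h t = kap t" "0 \<le> lam" "continuous_on {0..} v"
    and "\<And>t. 0 < t \<Longrightarrow> caputo_exists h v t \<and> caputo h v t = - (lam *\<^sub>R v t)" and "0 \<le> t"
  shows "v t = relax lam t *\<^sub>R v 0"
  using caputo_unique_component[OF assms bounded_linear_Re] caputo_unique_component[OF assms bounded_linear_Im]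
  by (simp add: complex_eq_iff mult.commute)

end

section \<open>Positivity preserving Fourier multipliers\<close>

lemma fourier_scaleR: "fourier (\<lambda>x::real^'n. a *\<^sub>R f x) \<xi> = a *\<^sub>R fourier f \<xi>"
  unfolding fourier_def by (simp add: scaleR_left_commute)

lemma L2_norm_scaleR: "L2_norm (\<lambda>x::real^'n. a *\<^sub>R f x) = \<bar>a\<bar> * L2_norm f"
  unfolding L2_norm_def by (simp add: power_mult_distrib real_sqrt_mult)

lemma is_fourier_scaleR:
  fixes w :: "real ^ 'n \<Rightarrow> complex"
  assumes w: "is_fourier w g" shows "is_fourier (\<lambda>x. a *\<^sub>R w x) (\<lambda>\<xi>. a *\<^sub>R g \<xi>)"
proof -
  have t: "truncation (\<lambda>x. a *\<^sub>R w x) R = (\<lambda>x. a *\<^sub>R truncation w R x)" for R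
    by (simp add: truncation_def fun_eq_iff)
  have "((\<lambda>R. \<bar>a\<bar> * L2_norm (\<lambda>\<xi>. fourier (truncation w R) \<xi> - g \<xi>)) \<longlongrightarrow> 0) at_top"
    by (rule tendsto_mult_right_zero) (use w in \<open>simp add: is_fourier_truncation\<close>)
  moreover have "\<bar>a\<bar> * L2_norm (\<lambda>\<xi>. fourier (truncation w R) \<xi> - g \<xi>) = L2_norm (\<lambda>\<xi>. fourier (truncation (\<lambda>x. a *\<^sub>R w x) R) \<xi> - a *\<^sub>R g \<xi>)" for R
    unfolding t fourier_scaleR scaleR_diff_right[symmetric] L2_norm_scaleR ..
  ultimately show ?thesis
    using is_fourier_L2[OF w] unfolding is_fourier_truncation by (simp add: L2_scaleR)
qed

definition bounded_multiplier :: "(real ^ 'n \<Rightarrow> real) \<Rightarrow> bool" where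
  "bounded_multiplier m \<longleftrightarrow> m \<in> borel_measurable borel \<and> (\<exists>B. \<forall>\<xi>. \<bar>m \<xi>\<bar> \<le> B)"

lemma multiplier_L2:
  fixes g :: "real ^ 'n \<Rightarrow> complex"
  assumes m: "m \<in> borel_measurable borel" and B: "\<And>\<xi>. \<bar>m \<xi>\<bar> \<le> B" and g: "L2 g"
  shows "L2 (\<lambda>\<xi>. m \<xi> *\<^sub>R g \<xi>)" "L2_norm (\<lambda>\<xi>. m \<xi> *\<^sub>R g \<xi>) \<le> B * L2_norm g"
proof -
  have B0: "0 \<le> B" using B[of 0] by simp
  have [measurable]: "(\<lambda>\<xi>. m \<xi> *\<^sub>R g \<xi>) \<in> borel_measurable lebesgue"
    by (intro borel_measurable_scaleR lebesgue_borel_measurable[OF m] L2_measurable[OF g])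
  have le: "AE \<xi> in lebesgue. norm (m \<xi> *\<^sub>R g \<xi>) \<le> B * norm (g \<xi>)"
    using B by (intro AE_I2) (simp add: mult_right_mono)
  show "L2 (\<lambda>\<xi>. m \<xi> *\<^sub>R g \<xi>)" "L2_norm (\<lambda>\<xi>. m \<xi> *\<^sub>R g \<xi>) \<le> B * L2_norm g"
    using L2_bound[OF _ g B0 le] by auto
qed

lemma bounded_multiplier_L2:
  fixes g :: "real ^ 'n \<Rightarrow> complex"
  assumes "bounded_multiplier m" "L2 g" shows "L2 (\<lambda>\<xi>. m \<xi> *\<^sub>R g \<xi>)"
proof -
  obtain B where "m \<in> borel_measurable borel" "\<forall>\<xi>. \<bar>m \<xi>\<bar> \<le> B"
    using assms(1) unfolding bounded_multiplier_def by (elim exE conjE)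
  then show ?thesis by (intro multiplier_L2(1)[OF _ _ assms(2)]) auto
qed

lemma bounded_multiplier_add:
  assumes "bounded_multiplier m" "bounded_multiplier n"
  shows "bounded_multiplier (\<lambda>\<xi>. m \<xi> + n \<xi>)"
proof -
  obtain B C where "\<forall>\<xi>. \<bar>m \<xi>\<bar> \<le> B" "\<forall>\<xi>. \<bar>n \<xi>\<bar> \<le> C"
    using assms unfolding bounded_multiplier_def by (elim exE conjE)
  then have "\<forall>\<xi>. \<bar>m \<xi> + n \<xi>\<bar> \<le> B + C" by (metis abs_triangle_ineq add_mono order_trans)
  with assms show ?thesis unfolding bounded_multiplier_def by (auto intro: borel_measurable_add)
qed

lemma bounded_multiplier_mult:
  assumes "bounded_multiplier m" "bounded_multiplier n"
  shows "bounded_multiplier (\<lambda>\<xi>. m \<xi> * n \<xi>)"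
proof -
  obtain B C where BC: "\<forall>\<xi>. \<bar>m \<xi>\<bar> \<le> B" "\<forall>\<xi>. \<bar>n \<xi>\<bar> \<le> C"
    using assms unfolding bounded_multiplier_def by (elim exE conjE)
  then have "\<bar>m \<xi> * n \<xi>\<bar> \<le> B * C" for \<xi>
    unfolding abs_mult by (intro mult_mono) (auto intro: order_trans[OF abs_ge_zero])
  with assms show ?thesis unfolding bounded_multiplier_def by (auto intro: borel_measurable_times)
qed

text \<open>The operator with symbol m is described by its graph, so no representative of the
  inverse transform has to be chosen. The sets A and B express pointwise constraints, and real
  values, nonnegative values and discs are treated uniformly.\<close>

definition multiplier_maps :: "(real ^ 'n \<Rightarrow> real) \<Rightarrow> complex set \<Rightarrow> complex set \<Rightarrow> bool" where
  "multiplier_maps m A B \<longleftrightarrow> (\<forall>f F w. is_fourier f F \<longrightarrow> is_fourier w (\<lambda>\<xi>. m \<xi> *\<^sub>R F \<xi>) \<longrightarrow>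
     (AE x in lebesgue. f x \<in> A) \<longrightarrow> (AE x in lebesgue. w x \<in> B))"

lemma multiplier_mapsD:
  "multiplier_maps m A B \<Longrightarrow> is_fourier f F \<Longrightarrow> is_fourier w (\<lambda>\<xi>. m \<xi> *\<^sub>R F \<xi>) \<Longrightarrow>
    AE x in lebesgue. f x \<in> A \<Longrightarrow> AE x in lebesgue. w x \<in> B"
  unfolding multiplier_maps_def by blast

lemma multiplier_maps_mono:
  assumes m: "multiplier_maps m A B" and BC: "B \<subseteq> C" shows "multiplier_maps m A C"
  unfolding multiplier_maps_def
proof (intro allI impI)
  fix f F w assume "is_fourier f F" "is_fourier w (\<lambda>\<xi>. m \<xi> *\<^sub>R F \<xi>)" "AE x in lebesgue. f x \<in> A"
  from multiplier_mapsD[OF m this] show "AE x in lebesgue. w x \<in> C"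
    by eventually_elim (use BC in auto)
qed

text \<open>Surjectivity of the transform supplies u with transform m F; then w - u has transform n
  F, and the two constraints add pointwise.\<close>

lemma multiplier_maps_add:
  assumes m: "bounded_multiplier m" "multiplier_maps m A B" and n: "multiplier_maps n A C"
    and BC: "\<And>b c. b \<in> B \<Longrightarrow> c \<in> C \<Longrightarrow> b + c \<in> D"
  shows "multiplier_maps (\<lambda>\<xi>. m \<xi> + n \<xi>) A D"
  unfolding multiplier_maps_def
proof (intro allI impI)
  fix f F w assume f: "is_fourier f F" and w: "is_fourier w (\<lambda>\<xi>. (m \<xi> + n \<xi>) *\<^sub>R F \<xi>)"
    and A: "AE x in lebesgue. f x \<in> A"
  obtain u where u: "is_fourier u (\<lambda>\<xi>. m \<xi> *\<^sub>R F \<xi>)"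
    using is_fourier_surj[OF bounded_multiplier_L2[OF m(1) is_fourier_L2(2)[OF f]]] by blast
  have "is_fourier (\<lambda>x. w x - u x) (\<lambda>\<xi>. n \<xi> *\<^sub>R F \<xi>)"
    using is_fourier_diff[OF w u] by (simp add: scaleR_add_left)
  from multiplier_mapsD[OF n f this A] multiplier_mapsD[OF m(2) f u A]
  show "AE x in lebesgue. w x \<in> D"
  proof eventually_elim
    case (elim x) then show ?case using BC[OF elim(2,1)] by simp
  qed
qed

lemma multiplier_maps_comp:
  assumes m: "bounded_multiplier m" "multiplier_maps m A B" and n: "multiplier_maps n B C"
  shows "multiplier_maps (\<lambda>\<xi>. n \<xi> * m \<xi>) A C"
  unfolding multiplier_maps_def
proof (intro allI impI)
  fix f F w assume f: "is_fourier f F" and w: "is_fourier w (\<lambda>\<xi>. (n \<xi> * m \<xi>) *\<^sub>R F \<xi>)"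
    and A: "AE x in lebesgue. f x \<in> A"
  obtain u where u: "is_fourier u (\<lambda>\<xi>. m \<xi> *\<^sub>R F \<xi>)"
    using is_fourier_surj[OF bounded_multiplier_L2[OF m(1) is_fourier_L2(2)[OF f]]] by blast
  show "AE x in lebesgue. w x \<in> C"
    using multiplier_mapsD[OF n u _ multiplier_mapsD[OF m(2) f u A]] w by simp
qed

text \<open>Dominated convergence in frequency is L2 convergence in space by the isometry, and along
  a subsequence it holds almost everywhere, where closed constraints persist. The sets B k may vary
  with k, which admits operator bounds that only converge; for this reason the closedness condition
  is stated along subsequences.\<close>

lemma multiplier_maps_limit:
  assumes m: "\<And>k. bounded_multiplier (m k)" "\<And>k. multiplier_maps (m k) A (B k)"
    and n: "n \<in> borel_measurable borel" and lim: "AE \<xi> in lebesgue. (\<lambda>k. m k \<xi>) \<longlonglongrightarrow> n \<xi>"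
    and bound: "\<And>k \<xi>. \<bar>m k \<xi>\<bar> \<le> D"
    and closed: "\<And>r y z. strict_mono r \<Longrightarrow> (\<And>k. y k \<in> B (r k)) \<Longrightarrow> y \<longlonglongrightarrow> z \<Longrightarrow> z \<in> C"
  shows "multiplier_maps n A C"
  unfolding multiplier_maps_def
proof (intro allI impI)
  fix f F w assume f: "is_fourier f F" and w: "is_fourier w (\<lambda>\<xi>. n \<xi> *\<^sub>R F \<xi>)"
    and A: "AE x in lebesgue. f x \<in> A"
  note LF = is_fourier_L2(2)[OF f]
  have "\<forall>k. \<exists>u. is_fourier u (\<lambda>\<xi>. m k \<xi> *\<^sub>R F \<xi>)"
    using is_fourier_surj[OF bounded_multiplier_L2[OF m(1) LF]] by blast
  then obtain u where u: "\<And>k. is_fourier (u k) (\<lambda>\<xi>. m k \<xi> *\<^sub>R F \<xi>)" by metis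
  have "(\<lambda>k. L2_norm (\<lambda>\<xi>. m k \<xi> *\<^sub>R F \<xi> - n \<xi> *\<^sub>R F \<xi>)) \<longlonglongrightarrow> 0"
  proof (rule L2_dominated(3)[where f="\<lambda>k \<xi>. m k \<xi> *\<^sub>R F \<xi>"])
    show "L2 (\<lambda>\<xi>. D *\<^sub>R F \<xi>)" by (rule L2_scaleR[OF LF])
    show "(\<lambda>\<xi>. m k \<xi> *\<^sub>R F \<xi>) \<in> borel_measurable lebesgue" for k
      by (rule L2_measurable[OF bounded_multiplier_L2[OF m(1) LF]])
    show "(\<lambda>\<xi>. n \<xi> *\<^sub>R F \<xi>) \<in> borel_measurable lebesgue"
      by (rule L2_measurable[OF is_fourier_L2(2)[OF w]])
    show "AE \<xi> in lebesgue. (\<lambda>k. m k \<xi> *\<^sub>R F \<xi>) \<longlonglongrightarrow> n \<xi> *\<^sub>R F \<xi>"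
      using lim by eventually_elim (intro tendsto_intros)
    show "AE \<xi> in lebesgue. norm (m k \<xi> *\<^sub>R F \<xi>) \<le> norm (D *\<^sub>R F \<xi>)" for k
      using bound by (intro AE_I2) (auto intro!: mult_right_mono intro: order_trans[OF _ abs_ge_self])
  qed
  then have "(\<lambda>k. L2_norm (\<lambda>x. u k x - w x)) \<longlonglongrightarrow> 0"
    unfolding is_fourier_isometry[OF is_fourier_diff[OF u w]] .
  from L2_tendsto_AE_subseq[OF is_fourier_L2(1)[OF u] is_fourier_L2(1)[OF w] this]
  obtain r where r: "strict_mono r" "AE x in lebesgue. (\<lambda>k. u (r k) x) \<longlonglongrightarrow> w x" by blast
  have "AE x in lebesgue. \<forall>k. u k x \<in> B k"
    unfolding AE_all_countable using multiplier_mapsD[OF m(2) f u A] by simp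
  with r(2) show "AE x in lebesgue. w x \<in> C"
  proof eventually_elim
    case (elim x)
    show ?case by (rule closed[OF r(1) _ elim(1)]) (use elim(2) in simp)
  qed
qed

text \<open>The constant \<open>c\<close> bounds the norm of the multiplier operator on \<open>L\<^sup>\<infinity>\<close>.\<close>

definition positive_multiplier :: "(real ^ 'n \<Rightarrow> real) \<Rightarrow> real \<Rightarrow> bool" where
  "positive_multiplier m c \<longleftrightarrow> bounded_multiplier m \<and> 0 \<le> c \<and> multiplier_maps m \<real> \<real> \<and>
     multiplier_maps m \<real>\<^sub>\<ge>\<^sub>0 \<real>\<^sub>\<ge>\<^sub>0 \<and> (\<forall>M\<ge>0. multiplier_maps m (cball 0 M) (cball 0 (c * M)))"

lemma positive_multiplier_add:
  assumes "positive_multiplier m c" "positive_multiplier n d"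
  shows "positive_multiplier (\<lambda>\<xi>. m \<xi> + n \<xi>) (c + d)"
  unfolding positive_multiplier_def
proof (intro conjI allI impI)
  have m: "bounded_multiplier m" using assms(1) by (simp add: positive_multiplier_def)
  show "bounded_multiplier (\<lambda>\<xi>. m \<xi> + n \<xi>)"
    using assms by (intro bounded_multiplier_add) (auto simp: positive_multiplier_def)
  show "0 \<le> c + d" using assms by (simp add: positive_multiplier_def)
  show "multiplier_maps (\<lambda>\<xi>. m \<xi> + n \<xi>) \<real> \<real>"
    by (rule multiplier_maps_add[OF m, where B="\<real>" and C="\<real>"]) (use assms in \<open>auto simp: positive_multiplier_def\<close>)
  show "multiplier_maps (\<lambda>\<xi>. m \<xi> + n \<xi>) \<real>\<^sub>\<ge>\<^sub>0 \<real>\<^sub>\<ge>\<^sub>0"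
    by (rule multiplier_maps_add[OF m, where B="\<real>\<^sub>\<ge>\<^sub>0" and C="\<real>\<^sub>\<ge>\<^sub>0"]) (use assms in \<open>auto simp: positive_multiplier_def\<close>)
  fix M :: real assume M: "0 \<le> M"
  show "multiplier_maps (\<lambda>\<xi>. m \<xi> + n \<xi>) (cball 0 M) (cball 0 ((c + d) * M))"
  proof (rule multiplier_maps_add[OF m])
    show "multiplier_maps m (cball 0 M) (cball 0 (c * M))" "multiplier_maps n (cball 0 M) (cball 0 (d * M))"
      using assms M by (auto simp: positive_multiplier_def)
    show "b + e \<in> cball 0 ((c + d) * M)" if "b \<in> cball 0 (c * M)" "e \<in> cball 0 (d * M)" for b e :: complex
      using that norm_triangle_ineq[of b e] by (simp add: distrib_right)
  qed
qed

lemma positive_multiplier_mult: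
  assumes "positive_multiplier m c" "positive_multiplier n d"
  shows "positive_multiplier (\<lambda>\<xi>. n \<xi> * m \<xi>) (d * c)"
  unfolding positive_multiplier_def
proof (intro conjI allI impI)
  show "bounded_multiplier (\<lambda>\<xi>. n \<xi> * m \<xi>)" "0 \<le> d * c" "multiplier_maps (\<lambda>\<xi>. n \<xi> * m \<xi>) \<real> \<real>"
    "multiplier_maps (\<lambda>\<xi>. n \<xi> * m \<xi>) \<real>\<^sub>\<ge>\<^sub>0 \<real>\<^sub>\<ge>\<^sub>0"
    using assms unfolding positive_multiplier_def by (auto intro: bounded_multiplier_mult multiplier_maps_comp)
  fix M :: real assume M: "0 \<le> M"
  then have "0 \<le> c * M" using assms unfolding positive_multiplier_def by simp
  then have "multiplier_maps n (cball 0 (c * M)) (cball 0 (d * (c * M)))"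
    using assms unfolding positive_multiplier_def by blast
  then show "multiplier_maps (\<lambda>\<xi>. n \<xi> * m \<xi>) (cball 0 M) (cball 0 (d * c * M))"
    using assms M unfolding positive_multiplier_def mult.assoc by (auto intro: multiplier_maps_comp)
qed

lemma positive_multiplier_const:
  assumes a: "0 \<le> a" shows "positive_multiplier (\<lambda>\<xi>::real^'n. a) a"
proof -
  have w: "AE x in lebesgue. w x = a *\<^sub>R f x" if "is_fourier f F" "is_fourier w (\<lambda>\<xi>. a *\<^sub>R F \<xi>)" for f w F :: "real^'n \<Rightarrow> complex"
    by (rule iffD1[OF is_fourier_eq_iff[OF that(2) is_fourier_scaleR[OF that(1), of a]]]) simp
  have maps: "multiplier_maps (\<lambda>\<xi>::real^'n. a) A B" if AB: "\<And>z. z \<in> A \<Longrightarrow> a *\<^sub>R z \<in> B" for A B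
    unfolding multiplier_maps_def
  proof (intro allI impI)
    fix f F v assume f: "is_fourier f F" "is_fourier v (\<lambda>\<xi>::real^'n. a *\<^sub>R F \<xi>)" and A: "AE x in lebesgue. f x \<in> A"
    from w[OF f] A show "AE x in lebesgue. v x \<in> B" by eventually_elim (simp add: AB)
  qed
  show ?thesis
    unfolding positive_multiplier_def
  proof (intro conjI allI impI a)
    show "bounded_multiplier (\<lambda>\<xi>::real^'n. a)" by (auto simp: bounded_multiplier_def)
    show "multiplier_maps (\<lambda>\<xi>::real^'n. a) \<real> \<real>" by (rule maps) (simp add: complex_is_Real_iff)
    show "multiplier_maps (\<lambda>\<xi>::real^'n. a) \<real>\<^sub>\<ge>\<^sub>0 \<real>\<^sub>\<ge>\<^sub>0"
      by (rule maps) (use a in \<open>simp add: complex_nonneg_Reals_iff\<close>)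
    show "multiplier_maps (\<lambda>\<xi>::real^'n. a) (cball 0 M) (cball 0 (a * M))" for M
      by (rule maps) (use a in \<open>simp add: mult_left_mono\<close>)
  qed
qed

lemma positive_multiplier_weaken:
  assumes "positive_multiplier m c" "c \<le> d" shows "positive_multiplier m d"
proof -
  have "multiplier_maps m (cball 0 M) (cball 0 (d * M))" if "0 \<le> M" for M
  proof -
    have "multiplier_maps m (cball 0 M) (cball 0 (c * M))" using assms(1) that by (simp add: positive_multiplier_def)
    moreover have "cball 0 (c * M) \<subseteq> (cball 0 (d * M) :: complex set)"
      using mult_right_mono[OF assms(2) that] by auto
    ultimately show ?thesis by (rule multiplier_maps_mono)
  qed
  then show ?thesis using assms by (auto simp: positive_multiplier_def)
qed

lemma positive_multiplier_sum:
  assumes "\<And>i. i \<in> I \<Longrightarrow> positive_multiplier (m i) (c i)"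
  shows "positive_multiplier (\<lambda>\<xi>::real^'n. \<Sum>i\<in>I. m i \<xi>) (\<Sum>i\<in>I. c i)"
  using assms
proof (induction I rule: infinite_finite_induct)
  case (insert i I)
  then show ?case by (simp add: positive_multiplier_add)
qed (use positive_multiplier_const[of 0] in auto)

lemma positive_multiplier_power:
  assumes "positive_multiplier m c" shows "positive_multiplier (\<lambda>\<xi>::real^'n. m \<xi> ^ i) (c ^ i)"
proof (induction i)
  case 0 then show ?case using positive_multiplier_const[of 1] by simp
next
  case (Suc i) then show ?case using positive_multiplier_mult[OF Suc.IH assms] by simp
qed

lemma positive_multiplier_limit:
  assumes m: "\<And>k. positive_multiplier (m k) (c k)"
    and n: "n \<in> borel_measurable borel" and lim: "AE \<xi> in lebesgue. (\<lambda>k. m k \<xi>) \<longlonglongrightarrow> n \<xi>"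
    and bound: "\<And>k \<xi>. \<bar>m k \<xi>\<bar> \<le> D" and nb: "\<And>\<xi>. \<bar>n \<xi>\<bar> \<le> D" and c: "c \<longlonglongrightarrow> d"
  shows "positive_multiplier n d"
  unfolding positive_multiplier_def
proof (intro conjI allI impI)
  have bm: "bounded_multiplier (m k)" for k using m[of k] by (simp add: positive_multiplier_def)
  show "bounded_multiplier n" using n nb by (auto simp: bounded_multiplier_def)
  show "0 \<le> d" by (rule LIMSEQ_le_const[OF c]) (use m in \<open>auto simp: positive_multiplier_def\<close>)
  show "multiplier_maps n \<real> \<real>"
  proof (rule multiplier_maps_limit[OF bm _ n lim bound])
    show "multiplier_maps (m k) \<real> \<real>" for k using m[of k] by (simp add: positive_multiplier_def)
    show "z \<in> \<real>" if "\<And>k. y k \<in> \<real>" "y \<longlonglongrightarrow> z" for y and z :: complex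
      using closed_sequentially[OF closed_complex_Reals] that by blast
  qed
  show "multiplier_maps n \<real>\<^sub>\<ge>\<^sub>0 \<real>\<^sub>\<ge>\<^sub>0"
  proof (rule multiplier_maps_limit[OF bm _ n lim bound])
    show "multiplier_maps (m k) \<real>\<^sub>\<ge>\<^sub>0 \<real>\<^sub>\<ge>\<^sub>0" for k using m[of k] by (simp add: positive_multiplier_def)
    show "z \<in> \<real>\<^sub>\<ge>\<^sub>0" if "\<And>k. y k \<in> \<real>\<^sub>\<ge>\<^sub>0" "y \<longlonglongrightarrow> z" for y and z :: complex
      using closed_sequentially[OF closed_nonneg_Reals_complex] that by blast
  qed
  fix M :: real assume M: "0 \<le> M"
  show "multiplier_maps n (cball 0 M) (cball 0 (d * M))"
  proof (rule multiplier_maps_limit[OF bm _ n lim bound])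
    show "multiplier_maps (m k) (cball 0 M) (cball 0 (c k * M))" for k using m[of k] M by (simp add: positive_multiplier_def)
    fix r :: "nat \<Rightarrow> nat" and y and z :: complex
    assume r: "strict_mono r" and y: "\<And>k. y k \<in> cball 0 (c (r k) * M)" "y \<longlonglongrightarrow> z"
    have "(\<lambda>k. c (r k) * M) \<longlonglongrightarrow> d * M"
      using LIMSEQ_subseq_LIMSEQ[OF c r] by (intro tendsto_intros) (simp add: o_def)
    then have "norm z \<le> d * M"
      by (rule LIMSEQ_le[OF tendsto_norm[OF y(2)]]) (use y(1) in auto)
    then show "z \<in> cball 0 (d * M)" by simp
  qed
qed

section \<open>Gaussians and resolvents as positive multipliers\<close>

text \<open>The damped inverse integral is the pairing of F with a modulated Gaussian. The
  multiplication formula moves the transform onto that Gaussian, which becomes the heat kernel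
  centred at x.\<close>

lemma gauss_multiplier_kernel:
  fixes f w :: "real ^ 'n \<Rightarrow> complex"
  assumes \<tau>: "0 < \<tau>" and f: "is_fourier f F" and w: "is_fourier w (\<lambda>\<xi>. exp (- \<tau> * (norm \<xi>)\<^sup>2) *\<^sub>R F \<xi>)"
  shows "AE x in lebesgue. w x = ((2 * pi) powr (- (real CARD('n) / 2))) *\<^sub>R (LINT y|lebesgue. f y * complex_of_real (heat \<tau> (x - y)))"
proof -
  note Lf = is_fourier_L2[OF f]
  have e: "exp (- \<tau> * (norm \<xi>)\<^sup>2) *\<^sub>R F \<xi> = gauss_wave \<tau> 0 \<xi> * F \<xi>" for \<xi>
    by (simp add: gauss_wave_def)
  have i: "integrable lebesgue (\<lambda>\<xi>. exp (- \<tau> * (norm \<xi>)\<^sup>2) *\<^sub>R F \<xi>)"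
    unfolding e by (rule L2_prod_integrable(1)[OF gauss_wave_L1_L2(2)[OF \<tau>] Lf(2)])
  have "(LINT \<xi>|lebesgue. exp (- \<tau> * (norm \<xi>)\<^sup>2) *\<^sub>R F \<xi> * iexp (\<xi> \<bullet> x)) = (LINT y|lebesgue. f y * complex_of_real (heat \<tau> (x - y)))" for x
  proof -
    have "(LINT \<xi>|lebesgue. exp (- \<tau> * (norm \<xi>)\<^sup>2) *\<^sub>R F \<xi> * iexp (\<xi> \<bullet> x)) = (LINT \<xi>|lebesgue. F \<xi> * gauss_wave \<tau> x \<xi>)"
      by (intro Bochner_Integration.integral_cong refl) (simp add: gauss_wave_def)
    also have "\<dots> = (LINT y|lebesgue. f y * fourier (gauss_wave \<tau> x) y)"
      by (rule is_fourier_multiplication_formula[OF f is_fourier_fourier[OF gauss_wave_L1_L2[OF \<tau>]]])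
    finally show ?thesis unfolding fourier_gauss_wave[OF \<tau>] .
  qed
  with is_fourier_inversion[OF w i] show ?thesis by simp
qed

lemma heat_lebesgue:
  assumes \<tau>: "0 < \<tau>"
  shows "integrable lebesgue (\<lambda>y. heat \<tau> (x - y :: real^'n))"
    "(LINT y|lebesgue. heat \<tau> (x - y :: real^'n)) = (2 * pi) powr (real CARD('n) / 2)"
    "L2 (\<lambda>y. complex_of_real (heat \<tau> (x - y :: real^'n)))"
proof -
  note b = borel_measurable_integrable[OF integral_heat(1)[OF \<tau>, of x]]
  show "integrable lebesgue (\<lambda>y. heat \<tau> (x - y))" using integral_heat(1)[OF \<tau>, of x] integrable_completion[OF b] by simp
  show "(LINT y|lebesgue. heat \<tau> (x - y)) = (2 * pi) powr (real CARD('n) / 2)"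
    using integral_heat(2)[OF \<tau>, of x] integral_completion[OF b] by simp
  show "L2 (\<lambda>y. complex_of_real (heat \<tau> (x - y)))"
    using fourier_isometry_L1_L2(1)[OF gauss_wave_L1_L2[OF \<tau>, of x]] unfolding fourier_gauss_wave[OF \<tau>, abs_def] .
qed

text \<open>The heat kernel is nonnegative, and its mass times (2 pi)^(-n/2) equals 1. The operator
  is therefore an average, which preserves real values, nonnegative values and every disc around
  0.\<close>

lemma positive_multiplier_gauss_pos:
  assumes \<tau>: "0 < \<tau>" shows "positive_multiplier (\<lambda>\<xi>::real^'n. exp (- \<tau> * (norm \<xi>)\<^sup>2)) 1"
proof -
  let ?c = "(2 * pi) powr (- (real CARD('n) / 2))"
  let ?m = "\<lambda>\<xi>::real^'n. exp (- \<tau> * (norm \<xi>)\<^sup>2)"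
  have maps: "multiplier_maps ?m A B"
    if AB: "\<And>f x. L2 f \<Longrightarrow> AE y in lebesgue. f y \<in> A \<Longrightarrow> ?c *\<^sub>R (LINT y|lebesgue. f y * complex_of_real (heat \<tau> (x - y :: real^'n))) \<in> B" for A B
    unfolding multiplier_maps_def
  proof (intro allI impI)
    fix f F w assume f: "is_fourier f F" and w: "is_fourier w (\<lambda>\<xi>. ?m \<xi> *\<^sub>R F \<xi>)" and A: "AE x in lebesgue. f x \<in> A"
    from gauss_multiplier_kernel[OF \<tau> f w] show "AE x in lebesgue. w x \<in> B"
      by eventually_elim (simp add: AB[OF is_fourier_L2(1)[OF f] A])
  qed
  have real: "(LINT y|lebesgue. f y * complex_of_real (heat \<tau> (x - y))) = complex_of_real (LINT y|lebesgue. Re (f y) * heat \<tau> (x - y))"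
    if f: "L2 f" and re: "AE y in lebesgue. Im (f y) = 0" for f :: "real^'n \<Rightarrow> complex" and x
  proof -
    note [measurable] = L2_measurable[OF f] L2_measurable[OF heat_lebesgue(3)[OF \<tau>, of x]] borel_measurable_integrable[OF heat_lebesgue(1)[OF \<tau>, of x]]
    have "(LINT y|lebesgue. f y * complex_of_real (heat \<tau> (x - y))) = (LINT y|lebesgue. complex_of_real (Re (f y) * heat \<tau> (x - y)))"
    proof (rule integral_cong_AE)
      show "AE y in lebesgue. f y * complex_of_real (heat \<tau> (x - y)) = complex_of_real (Re (f y) * heat \<tau> (x - y))"
        using re by eventually_elim (simp add: complex_eq_iff)
    qed measurable
    then show ?thesis by (simp only: integral_complex_of_real)
  qed
  have 1: "multiplier_maps ?m \<real> \<real>"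
  proof (rule maps)
    fix f :: "real^'n \<Rightarrow> complex" and x assume f: "L2 f" "AE y in lebesgue. f y \<in> \<real>"
    then have "AE y in lebesgue. Im (f y) = 0" by (simp add: complex_is_Real_iff)
    from real[OF f(1) this, of x] show "?c *\<^sub>R (LINT y|lebesgue. f y * complex_of_real (heat \<tau> (x - y))) \<in> \<real>"
      by (simp add: complex_is_Real_iff)
  qed
  have 2: "multiplier_maps ?m \<real>\<^sub>\<ge>\<^sub>0 \<real>\<^sub>\<ge>\<^sub>0"
  proof (rule maps)
    fix f :: "real^'n \<Rightarrow> complex" and x assume f: "L2 f" "AE y in lebesgue. f y \<in> \<real>\<^sub>\<ge>\<^sub>0"
    then have im: "AE y in lebesgue. Im (f y) = 0" by (simp add: complex_nonneg_Reals_iff)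
    have "0 \<le> (LINT y|lebesgue. Re (f y) * heat \<tau> (x - y))"
      using f(2) by (intro integral_nonneg_AE) (auto elim!: eventually_mono simp: complex_nonneg_Reals_iff heat_nonneg)
    then show "?c *\<^sub>R (LINT y|lebesgue. f y * complex_of_real (heat \<tau> (x - y))) \<in> \<real>\<^sub>\<ge>\<^sub>0"
      unfolding real[OF f(1) im, of x] by (simp add: complex_nonneg_Reals_iff)
  qed
  have 3: "multiplier_maps ?m (cball 0 M) (cball 0 (1 * M))" if M: "0 \<le> M" for M
  proof (rule maps)
    fix f :: "real^'n \<Rightarrow> complex" and x assume f: "L2 f" "AE y in lebesgue. f y \<in> cball 0 M"
    have "norm (LINT y|lebesgue. f y * complex_of_real (heat \<tau> (x - y))) \<le> (LINT y|lebesgue. norm (f y * complex_of_real (heat \<tau> (x - y))))"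
      by (rule integral_norm_bound)
    also have "\<dots> \<le> (LINT y|lebesgue. M * heat \<tau> (x - y))"
    proof (rule integral_mono_AE)
      show "integrable lebesgue (\<lambda>y. norm (f y * complex_of_real (heat \<tau> (x - y))))"
        by (rule integrable_norm[OF L2_prod_integrable(1)[OF f(1) heat_lebesgue(3)[OF \<tau>]]])
      show "integrable lebesgue (\<lambda>y. M * heat \<tau> (x - y))" by (intro integrable_mult_right heat_lebesgue(1)[OF \<tau>])
      show "AE y in lebesgue. norm (f y * complex_of_real (heat \<tau> (x - y))) \<le> M * heat \<tau> (x - y)"
        using f(2) by eventually_elim (simp add: norm_mult heat_nonneg mult_right_mono)
    qed
    also have "\<dots> = M * (2 * pi) powr (real CARD('n) / 2)" by (simp add: heat_lebesgue(2)[OF \<tau>])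
    finally have "?c * norm (LINT y|lebesgue. f y * complex_of_real (heat \<tau> (x - y))) \<le> ?c * (M * (2 * pi) powr (real CARD('n) / 2))"
      by (rule mult_left_mono) simp
    also have "\<dots> = M" by (simp add: powr_minus)
    finally show "?c *\<^sub>R (LINT y|lebesgue. f y * complex_of_real (heat \<tau> (x - y))) \<in> cball 0 (1 * M)" by simp
  qed
  have "bounded_multiplier ?m"
    unfolding bounded_multiplier_def
  proof
    show "?m \<in> borel_measurable borel" by (intro borel_measurable_continuous_onI continuous_intros)
    show "\<exists>B. \<forall>\<xi>. \<bar>?m \<xi>\<bar> \<le> B" by (rule exI[of _ 1]) (use \<tau> in simp)
  qed
  with 1 2 3 show ?thesis by (simp add: positive_multiplier_def)
qed

text \<open>\<tau> = 0 is the identity operator; it occurs as the node j = 0 of the Riemann sum for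
  the resolvent.\<close>

lemma positive_multiplier_gauss:
  assumes "0 \<le> \<tau>" shows "positive_multiplier (\<lambda>\<xi>::real^'n. exp (- \<tau> * (norm \<xi>)\<^sup>2)) 1"
  using positive_multiplier_gauss_pos[of \<tau>] positive_multiplier_const[of 1] assms by (cases "\<tau> = 0") auto

text \<open>A Riemann sum for \<open>1 / (S + lam) = \<integral> exp (- (S + lam) \<tau>) d\<tau>\<close> exhibits the resolvent of the
  Laplacian as a limit of positive combinations of Gaussians.\<close>

lemma resolvent_Riemann_sum:
  assumes a: "0 < a"
  shows "(\<lambda>k. \<Sum>j<Suc k * Suc k. 1 / real (Suc k) * exp (- a * (real j / real (Suc k)))) \<longlonglongrightarrow> 1 / a"
proof -
  \<comment> \<open>Mesh 1 / (k + 1) with (k + 1)^2 nodes covers [0, k + 1), so a single index both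
    refines the mesh and exhausts the half line. The sum is geometric.\<close>
  have e: "(\<Sum>j<Suc k * Suc k. 1 / real (Suc k) * exp (- a * (real j / real (Suc k))))
    = 1 / (real k + 1) * ((1 - exp (- a * (real k + 1))) / (1 - exp (- a / (real k + 1))))" for k
  proof -
    let ?q = "exp (- a / real (Suc k))"
    have q: "?q \<noteq> 1" using a by simp
    have pw: "exp (- a * (real j / real (Suc k))) = ?q ^ j" for j
      by (simp add: exp_of_nat_mult[symmetric] field_simps)
    have "(\<Sum>j<Suc k * Suc k. ?q ^ j) = (1 - ?q ^ (Suc k * Suc k)) / (1 - ?q)"
      using sum_gp_strict[of ?q "Suc k * Suc k"] q by simp
    also have "?q ^ (Suc k * Suc k) = exp (- a * real (Suc k))"
      unfolding exp_of_nat_mult[symmetric] by (simp add: field_simps del: of_nat_Suc mult_Suc mult_Suc_right)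
    finally show ?thesis unfolding pw sum_distrib_left[symmetric] by (simp add: add.commute)
  qed
  show ?thesis unfolding e inverse_eq_divide[of a, symmetric] using a by real_asymp
qed

text \<open>The L^\<infinity> constant of a positive combination of Gaussians is the sum of its
  weights, that is, its value at \<xi> = 0. The same Riemann sum taken there converges to 1 /
  S.\<close>

lemma positive_multiplier_resolvent:
  assumes S: "0 < S" shows "positive_multiplier (\<lambda>\<xi>::real^'n. 1 / (S + (norm \<xi>)\<^sup>2)) (1 / S)"
proof -
  let ?N = "\<lambda>k. Suc k * Suc k"
  let ?h = "\<lambda>k. 1 / real (Suc k)"
  let ?t = "\<lambda>k j. real j / real (Suc k)"
  define m where "m k \<xi> = (\<Sum>j<?N k. (?h k * exp (- S * ?t k j)) * exp (- ?t k j * (norm \<xi>)\<^sup>2))" for k and \<xi> :: "real^'n"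
  define c where "c k = (\<Sum>j<?N k. ?h k * exp (- S * ?t k j))" for k
  have m: "positive_multiplier (m k) (c k)" for k
    unfolding m_def c_def
  proof (rule positive_multiplier_sum)
    fix j
    show "positive_multiplier (\<lambda>\<xi>::real^'n. (?h k * exp (- S * ?t k j)) * exp (- ?t k j * (norm \<xi>)\<^sup>2)) (?h k * exp (- S * ?t k j))"
      using positive_multiplier_mult[OF positive_multiplier_gauss[of "?t k j"] positive_multiplier_const[of "?h k * exp (- S * ?t k j)"]] by simp
  qed
  have mlim: "(\<lambda>k. m k \<xi>) \<longlonglongrightarrow> 1 / (S + (norm \<xi>)\<^sup>2)" for \<xi>
  proof -
    have "m k \<xi> = (\<Sum>j<?N k. ?h k * exp (- (S + (norm \<xi>)\<^sup>2) * ?t k j))" for k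
      unfolding m_def by (intro sum.cong refl) (simp add: exp_add[symmetric] algebra_simps)
    then show ?thesis using resolvent_Riemann_sum[of "S + (norm \<xi>)\<^sup>2"] S by (simp add: add_pos_nonneg)
  qed
  have clim: "c \<longlonglongrightarrow> 1 / S" unfolding c_def by (rule resolvent_Riemann_sum[OF S])
  then obtain D where D: "\<And>k. norm (c k) \<le> D"
    using convergent_imp_Bseq[OF convergentI[OF clim]] unfolding Bseq_def by blast
  have mD: "\<bar>m k \<xi>\<bar> \<le> D" for k \<xi>
  proof -
    have "0 \<le> m k \<xi>" unfolding m_def by (intro sum_nonneg) auto
    moreover have "m k \<xi> \<le> c k" unfolding m_def c_def
    proof (rule sum_mono)
      fix j
      have "exp (- ?t k j * (norm \<xi>)\<^sup>2) \<le> 1" by simp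
      then show "(?h k * exp (- S * ?t k j)) * exp (- ?t k j * (norm \<xi>)\<^sup>2) \<le> ?h k * exp (- S * ?t k j)"
        by (rule mult_left_le) simp
    qed
    ultimately show ?thesis using D[of k] by simp
  qed
  show ?thesis
  proof (rule positive_multiplier_limit[OF m _ AE_I2[OF mlim] mD _ clim])
    show "(\<lambda>\<xi>::real^'n. 1 / (S + (norm \<xi>)\<^sup>2)) \<in> borel_measurable borel" by measurable
    show "\<bar>1 / (S + (norm \<xi>)\<^sup>2)\<bar> \<le> D" for \<xi> :: "real^'n"
      by (rule LIMSEQ_le_const2[OF tendsto_rabs[OF mlim]]) (use mD in auto)
  qed
qed

section \<open>The relaxation function as a positive multiplier\<close>

context relaxation_kernel
begin

text \<open>Measurability in the frequency comes from the series: for fixed t the partial sums are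
  polynomials in 1 / (kap(\<epsilon>) + |\<xi>|^2), and two limits lead to the relaxation
  function.\<close>

lemma relax_space_measurable:
  "(\<lambda>\<xi>::real^'n. relax ((norm \<xi>)\<^sup>2) t) \<in> borel_measurable borel"
proof (cases "t \<le> 0")
  case False
  then have t: "0 < t" by simp
  define a where "a k \<xi> = (if \<xi> = 0 then 1 else approx_relax (1 / real (Suc k)) ((norm \<xi>)\<^sup>2) t)" for k and \<xi> :: "real^'n"
  show ?thesis
  proof (rule borel_measurable_LIMSEQ_real)
    show "(\<lambda>k. a k \<xi>) \<longlonglongrightarrow> relax ((norm \<xi>)\<^sup>2) t" for \<xi>
      unfolding a_def using approx_relax_tendsto[of "(norm \<xi>)\<^sup>2" t] t by (cases "\<xi> = 0") (auto simp: relax_def)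
    show "a k \<in> borel_measurable borel" for k
    proof -
      let ?e = "1 / real (Suc k)"
      have e: "0 < ?e" by simp
      define b where "b J \<xi> = (if \<xi> = 0 then 1 else renewal_sum (shifted ?e) (1 / (kap ?e + (norm \<xi>)\<^sup>2)) J t)" for J and \<xi> :: "real^'n"
      have "(\<lambda>J. b J \<xi>) \<longlonglongrightarrow> a k \<xi>" for \<xi>
      proof (cases "\<xi> = 0")
        case False
        then have l: "0 < (norm \<xi>)\<^sup>2" by simp
        show ?thesis using False renewal_sum_tendsto[OF shifted_renewal_kernel[OF e] approx_weight'[OF l e], of t]
          by (simp add: a_def b_def approx_relax_def)
      qed (simp add: a_def b_def)
      moreover have "b J \<in> borel_measurable borel" for J
        unfolding b_def renewal_sum_def by measurable
      ultimately show ?thesis by (rule borel_measurable_LIMSEQ_real)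
    qed
  qed
qed (simp add: relax_def)

lemma AE_nonzero: "AE \<xi> in lebesgue. \<xi> \<noteq> (0::real^'n)"
  using AE_lborel_singleton[of "0::real^'n"] by (simp add: AE_completion_iff)

text \<open>Each partial sum is a combination of resolvent powers with nonnegative coefficients.
  Positivity and the L^\<infinity> constant 1 then pass through two limits, the one of the series
  and the one of the shift, the latter for \<xi> \<noteq> 0.\<close>

lemma positive_multiplier_relax:
  assumes t: "0 < t" shows "positive_multiplier (\<lambda>\<xi>::real^'n. relax ((norm \<xi>)\<^sup>2) t) 1"
proof -
  have sum: "positive_multiplier (\<lambda>\<xi>::real^'n. renewal_sum (shifted e) (1 / (kap e + (norm \<xi>)\<^sup>2)) J t) 1" if e: "0 < e" for e J
  proof -
    note K = shifted_renewal_kernel[OF e]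
    have S: "0 < kap e" by (rule kap_pos[OF e])
    have "positive_multiplier (\<lambda>\<xi>::real^'n. renewal_sum (shifted e) (1 / (kap e + (norm \<xi>)\<^sup>2)) J t)
        (\<Sum>i\<le>J. renewal_coef (shifted e) i t * (1 / kap e) ^ i)"
      unfolding renewal_sum_def
    proof (rule positive_multiplier_sum)
      fix i
      show "positive_multiplier (\<lambda>\<xi>::real^'n. renewal_coef (shifted e) i t * (1 / (kap e + (norm \<xi>)\<^sup>2)) ^ i) (renewal_coef (shifted e) i t * (1 / kap e) ^ i)"
        by (rule positive_multiplier_mult[OF positive_multiplier_power[OF positive_multiplier_resolvent[OF S]]
              positive_multiplier_const[OF renewal_coef_nonneg[OF K]]])
    qed
    \<comment> \<open>The left side is the partial sum at lam = 0, where weight times mass is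
      exactly 1; the bound by 1 still holds in this borderline case.\<close>
    moreover have "(\<Sum>i\<le>J. renewal_coef (shifted e) i t * (1 / kap e) ^ i) \<le> 1"
      using renewal_sum_le_1[OF K, of "1 / kap e" J t] S by (simp add: shifted_mass[OF e] renewal_sum_def)
    ultimately show ?thesis by (rule positive_multiplier_weaken)
  qed
  have meas: "(\<lambda>\<xi>::real^'n. approx_relax e ((norm \<xi>)\<^sup>2) t) \<in> borel_measurable borel \<and> (\<forall>\<xi>::real^'n. \<bar>approx_relax e ((norm \<xi>)\<^sup>2) t\<bar> \<le> 1)
     \<and> positive_multiplier (\<lambda>\<xi>::real^'n. approx_relax e ((norm \<xi>)\<^sup>2) t) 1" if e: "0 < e" for e
  proof -
    note K = shifted_renewal_kernel[OF e]
    have S: "0 < kap e" by (rule kap_pos[OF e])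
    have wt: "0 \<le> 1 / (kap e + (norm \<xi>)\<^sup>2)" "1 / (kap e + (norm \<xi>)\<^sup>2) * integral\<^sup>L lborel (shifted e) \<le> 1" for \<xi> :: "real^'n"
      using S zero_le_power2[of "norm \<xi>"] by (auto simp: shifted_mass[OF e] add_pos_nonneg)
    have lim: "(\<lambda>J. renewal_sum (shifted e) (1 / (kap e + (norm \<xi>)\<^sup>2)) J t) \<longlonglongrightarrow> approx_relax e ((norm \<xi>)\<^sup>2) t" for \<xi> :: "real^'n"
      unfolding approx_relax_def by (rule renewal_sum_tendsto[OF K wt])
    have meas: "(\<lambda>\<xi>::real^'n. approx_relax e ((norm \<xi>)\<^sup>2) t) \<in> borel_measurable borel"
    proof (rule borel_measurable_LIMSEQ_real[OF lim])
      show "(\<lambda>\<xi>::real^'n. renewal_sum (shifted e) (1 / (kap e + (norm \<xi>)\<^sup>2)) J t) \<in> borel_measurable borel" for J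
        using sum[OF e, of J] by (simp add: positive_multiplier_def bounded_multiplier_def)
    qed
    have b: "\<bar>approx_relax e ((norm \<xi>)\<^sup>2) t\<bar> \<le> 1" for \<xi> :: "real^'n"
      unfolding approx_relax_def by (rule renewal_fun_abs_le[OF K wt])
    have "positive_multiplier (\<lambda>\<xi>::real^'n. approx_relax e ((norm \<xi>)\<^sup>2) t) 1"
      by (rule positive_multiplier_limit[OF sum[OF e] meas AE_I2[OF lim] renewal_sum_abs_le[OF K wt] b tendsto_const])
    with meas b show ?thesis by blast
  qed
  have e: "0 < 1 / real (Suc k)" for k by simp
  show ?thesis
  proof (rule positive_multiplier_limit[OF conjunct2[OF conjunct2[OF meas[OF e]]] relax_space_measurable _ _ _ tendsto_const])
    show "AE \<xi> in lebesgue. (\<lambda>k. approx_relax (1 / real (Suc k)) ((norm (\<xi>::real^'n))\<^sup>2) t) \<longlonglongrightarrow> relax ((norm \<xi>)\<^sup>2) t"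
      using AE_nonzero by eventually_elim (rule approx_relax_tendsto[OF _ t], simp)
    show "\<bar>approx_relax (1 / real (Suc k)) ((norm \<xi>)\<^sup>2) t\<bar> \<le> 1" for k and \<xi> :: "real^'n"
      using meas[OF e] by blast
    show "\<bar>relax ((norm \<xi>)\<^sup>2) t\<bar> \<le> 1" for \<xi> :: "real^'n" by (rule relax_abs_le)
  qed
qed

end

section \<open>Decay of the multiplier and the solution\<close>

lemma inverse_square_decay_L2:
  assumes n: "CARD('n::finite) \<le> 3"
  shows "\<exists>K\<ge>0. \<forall>A (m :: real^'n \<Rightarrow> real). 0 < A \<longrightarrow> m \<in> borel_measurable borel \<longrightarrow> (\<forall>\<xi>. \<bar>m \<xi>\<bar> \<le> 1) \<longrightarrow>
     (\<forall>\<xi>. (norm \<xi>)\<^sup>2 * \<bar>m \<xi>\<bar> \<le> A) \<longrightarrow>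
     L2 (\<lambda>\<xi>. complex_of_real (m \<xi>)) \<and> L2_norm (\<lambda>\<xi>. complex_of_real (m \<xi>)) \<le> K * A powr (real CARD('n) / 4)"
proof -
  let ?n = "CARD('n)"
  let ?v = "unit_ball_vol (real ?n)"
  \<comment> \<open>From one ball to the next the volume grows by the factor 2^n while the bound on
    m^2 falls by the factor 16; the ratio is below 1 exactly when n < 4.\<close>
  define q where "q = (2::real) ^ ?n / 16"
  have "(2::real) ^ ?n \<le> 2 ^ 3" using n by (intro power_increasing) auto
  then have q: "0 \<le> q" "q < 1" by (auto simp: q_def)
  define C where "C = ?v * 2 ^ ?n * (\<Sum>j. q ^ j)"
  have sq: "summable (\<lambda>j. q ^ j)" using q by (intro summable_geometric) simp
  have C: "0 \<le> C" unfolding C_def using q by (intro mult_nonneg_nonneg suminf_nonneg sq) auto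
  have "L2 (\<lambda>\<xi>. complex_of_real (m \<xi>)) \<and> L2_norm (\<lambda>\<xi>. complex_of_real (m \<xi>)) \<le> sqrt C * A powr (real ?n / 4)"
    if A: "0 < A" and m: "m \<in> borel_measurable borel" and m1: "\<forall>\<xi>. \<bar>m \<xi>\<bar> \<le> 1" and mA: "\<forall>\<xi>. (norm \<xi>)\<^sup>2 * \<bar>m \<xi>\<bar> \<le> A"
    for A and m :: "real^'n \<Rightarrow> real"
  proof -
    \<comment> \<open>The radius at which the bounds 1 and A / |\<xi>|^2 meet. Measuring in units of
      R makes the constant independent of A and leaves R^n = A^(n/2) for the squared norm.\<close>
    define R where "R = sqrt A"
    have R: "0 < R" and R2: "R\<^sup>2 = A" using A by (auto simp: R_def)
    \<comment> \<open>Full balls in place of shells overestimate only by a constant and have an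
      explicit volume.\<close>
    define T where "T j \<xi> = ennreal ((1/16) ^ j) * indicator (cball 0 (R * 2 ^ Suc j)) \<xi>" for j and \<xi> :: "real^'n"
    text \<open>Dyadic decomposition into the shells \<open>R 2\<^sup>j < |\<xi>| \<le> R 2\<^sup>j\<^sup>+\<^sup>1\<close>, on which \<open>|m| \<le> 4\<^sup>-\<^sup>j\<close>.\<close>
    have bound: "ennreal ((m \<xi>)\<^sup>2) \<le> (\<Sum>j. T j \<xi>)" for \<xi>
    proof -
      obtain j0 where "norm \<xi> / R < 2 ^ j0" using real_arch_pow[of 2 "norm \<xi> / R"] by auto
      then have "norm \<xi> < R * 2 ^ j0" using R by (simp add: field_simps)
      moreover have "R * 2 ^ j0 \<le> R * 2 ^ Suc j0" using R by simp
      ultimately have ex: "norm \<xi> \<le> R * 2 ^ Suc j0" by linarith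
      \<comment> \<open>Minimality provides the lower bound for |\<xi>| when j > 0; in the innermost
        ball, j = 0, the bound |m| \<le> 1 is used.\<close>
      define j where "j = (LEAST j. norm \<xi> \<le> R * 2 ^ Suc j)"
      have j: "norm \<xi> \<le> R * 2 ^ Suc j" unfolding j_def by (rule LeastI[of _ j0]) (rule ex)
      have "\<bar>m \<xi>\<bar> \<le> (1/4) ^ j"
      proof (cases j)
        case 0 then show ?thesis using m1 by simp
      next
        case (Suc i)
        have "\<not> norm \<xi> \<le> R * 2 ^ Suc i" using not_less_Least[of i "\<lambda>j. norm \<xi> \<le> R * 2 ^ Suc j"] Suc by (simp add: j_def)
        then have "R * 2 ^ j \<le> norm \<xi>" by (simp add: Suc)
        then have "(R * 2 ^ j)\<^sup>2 \<le> (norm \<xi>)\<^sup>2" using R by (intro power_mono) auto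
        then have "A * 4 ^ j \<le> (norm \<xi>)\<^sup>2"
          by (simp add: power_mult_distrib R2 power_mult[symmetric] mult.commute[of j 2]) (simp add: power_mult)
        then have "A * 4 ^ j * \<bar>m \<xi>\<bar> \<le> (norm \<xi>)\<^sup>2 * \<bar>m \<xi>\<bar>" by (rule mult_right_mono) simp
        also have "\<dots> \<le> A * 1" using mA by simp
        finally have "4 ^ j * \<bar>m \<xi>\<bar> \<le> 1" using A by (simp only: mult.assoc mult_le_cancel_left_pos)
        then show ?thesis by (simp add: power_divide field_simps)
      qed
      then have "\<bar>m \<xi>\<bar>\<^sup>2 \<le> ((1/4) ^ j)\<^sup>2" by (intro power_mono) auto
      also have "((1/4::real) ^ j)\<^sup>2 = (1/16) ^ j" by (simp add: power2_eq_square flip: power_mult_distrib)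
      finally have "ennreal ((m \<xi>)\<^sup>2) \<le> T j \<xi>" unfolding T_def using j by (simp add: ennreal_leI)
      also have "\<dots> \<le> (\<Sum>j. T j \<xi>)" using sum_le_suminf[OF summableI, of "{j}" "\<lambda>j. T j \<xi>"] by simp
      finally show ?thesis .
    qed
    have Tint: "(\<integral>\<^sup>+\<xi>. T j \<xi> \<partial>lborel) = ennreal (?v * 2 ^ ?n * R ^ ?n * q ^ j)" for j
    proof -
      have "(\<integral>\<^sup>+\<xi>. T j \<xi> \<partial>lborel) = ennreal ((1/16) ^ j) * emeasure lborel (cball (0::real^'n) (R * 2 ^ Suc j))"
        unfolding T_def by (rule nn_integral_cmult_indicator) simp
      also have "\<dots> = ennreal ((1/16) ^ j * (?v * (R * 2 ^ Suc j) ^ ?n))"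
        using R by (subst emeasure_cball) (auto simp: ennreal_mult')
      also have "(1/16) ^ j * (?v * (R * 2 ^ Suc j) ^ ?n) = ?v * 2 ^ ?n * R ^ ?n * q ^ j"
      proof -
        have "((2::real) ^ j) ^ ?n = (2 ^ ?n) ^ j" unfolding power_mult[symmetric] by (simp only: mult.commute)
        then have "(R * 2 ^ Suc j) ^ ?n = R ^ ?n * (2 ^ ?n * (2 ^ ?n) ^ j)" by (simp only: power_mult_distrib power_Suc)
        moreover have "q ^ j = (2 ^ ?n) ^ j * (1/16) ^ j" by (simp add: q_def power_divide)
        ultimately show ?thesis by (simp only: ac_simps)
      qed
      finally show ?thesis .
    qed
    have "(\<integral>\<^sup>+\<xi>. ennreal ((m \<xi>)\<^sup>2) \<partial>lborel) \<le> (\<integral>\<^sup>+\<xi>. (\<Sum>j. T j \<xi>) \<partial>lborel)"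
      by (rule nn_integral_mono) (rule bound)
    also have "\<dots> = (\<Sum>j. \<integral>\<^sup>+\<xi>. T j \<xi> \<partial>lborel)"
    proof (rule nn_integral_suminf)
      fix j
      have [measurable]: "cball (0::real^'n) (R * 2 ^ Suc j) \<in> sets borel" by simp
      show "T j \<in> borel_measurable lborel" unfolding T_def by measurable
    qed
    also have "\<dots> = ennreal (\<Sum>j. ?v * 2 ^ ?n * R ^ ?n * q ^ j)"
      unfolding Tint using R q sq by (intro suminf_ennreal2 summable_mult) auto
    also have "(\<Sum>j. ?v * 2 ^ ?n * R ^ ?n * q ^ j) = C * R ^ ?n"
      using suminf_mult[OF sq, of "?v * 2 ^ ?n * R ^ ?n"] by (simp add: C_def ac_simps)
    finally have le: "(\<integral>\<^sup>+\<xi>. ennreal ((m \<xi>)\<^sup>2) \<partial>lborel) \<le> ennreal (C * R ^ ?n)" .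
    have m2: "(\<lambda>\<xi>. (m \<xi>)\<^sup>2) \<in> borel_measurable borel" using m by measurable
    have i: "integrable lborel (\<lambda>\<xi>. (m \<xi>)\<^sup>2)"
      by (rule integrableI_bounded) (use le_less_trans[OF le] m2 in auto)
    have i': "integrable lebesgue (\<lambda>\<xi>. (m \<xi>)\<^sup>2)" using i integrable_completion[of "\<lambda>\<xi>. (m \<xi>)\<^sup>2" lborel] m2 by simp
    have L: "L2 (\<lambda>\<xi>. complex_of_real (m \<xi>))"
      unfolding L2_def using i' lebesgue_borel_measurable[OF m] by simp
    have "ennreal (LINT \<xi>|lborel. (m \<xi>)\<^sup>2) \<le> ennreal (C * R ^ ?n)"
      using le nn_integral_eq_integral[OF i] by simp
    then have "(LINT \<xi>|lborel. (m \<xi>)\<^sup>2) \<le> C * R ^ ?n" using C R by (simp add: ennreal_le_iff)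
    then have "(L2_norm (\<lambda>\<xi>. complex_of_real (m \<xi>)))\<^sup>2 \<le> C * R ^ ?n"
      unfolding L2_norm_power2 using integral_completion[of "\<lambda>\<xi>. (m \<xi>)\<^sup>2" lborel] m2 by simp
    also have "R ^ ?n = (A powr (real ?n / 4))\<^sup>2"
    proof -
      have "R ^ ?n = R powr real ?n" using R by (simp add: powr_realpow)
      also have "\<dots> = (A powr (1/2)) powr real ?n" using A by (simp add: R_def powr_half_sqrt)
      also have "\<dots> = A powr (real ?n / 4 + real ?n / 4)" by (simp add: powr_powr)
      also have "\<dots> = (A powr (real ?n / 4))\<^sup>2" unfolding powr_add power2_eq_square ..
      finally show ?thesis .
    qed
    also have "C * (A powr (real ?n / 4))\<^sup>2 = (sqrt C * A powr (real ?n / 4))\<^sup>2"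
      using C by (simp add: power_mult_distrib)
    finally have "L2_norm (\<lambda>\<xi>. complex_of_real (m \<xi>)) \<le> sqrt C * A powr (real ?n / 4)"
      by (rule power2_le_imp_le) (use C in simp)
    with L show ?thesis by blast
  qed
  moreover have "0 \<le> sqrt C" using C by simp
  ultimately show ?thesis by blast
qed

text \<open>The norm is defined through a chosen transform. Transforms of one function agree almost
  everywhere, so any representative computes it.\<close>

lemma H2_fourier:
  fixes w :: "real ^ 'n \<Rightarrow> complex"
  assumes w: "is_fourier w W" and L: "L2 (\<lambda>\<xi>. (1 + (norm \<xi>)\<^sup>2) *\<^sub>R W \<xi>)"
  shows "H2 w" "H2_norm w = L2_norm (\<lambda>\<xi>. (1 + (norm \<xi>)\<^sup>2) *\<^sub>R W \<xi>)"
proof -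
  have "AE \<xi> in lebesgue. W \<xi> = fourier_L2 w \<xi>"
    by (rule is_fourier_AE_unique[OF w is_fourier_fourier_L2[OF is_fourier_L2(1)[OF w]]])
  then have e: "AE \<xi> in lebesgue. (1 + (norm \<xi>)\<^sup>2) *\<^sub>R W \<xi> = (1 + (norm \<xi>)\<^sup>2) *\<^sub>R fourier_L2 w \<xi>"
    by eventually_elim simp
  show "H2 w" using is_fourier_L2(1)[OF w] L2_cong_AE[OF L e] by (simp add: H2_def)
  show "H2_norm w = L2_norm (\<lambda>\<xi>. (1 + (norm \<xi>)\<^sup>2) *\<^sub>R W \<xi>)"
    unfolding H2_norm_def by (rule L2_norm_cong_AE[OF L2_measurable[OF L] e, symmetric])
qed

lemma Linf_norm_le:
  fixes f :: "real ^ 'n \<Rightarrow> complex"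
  assumes f: "f \<in> borel_measurable lebesgue" and "AE x in lebesgue. norm (f x) \<le> M"
  shows "Linf_norm f \<le> ereal M"
  unfolding Linf_norm_def using assms by (intro esssup_I) auto

lemma Linf_norm_finite:
  fixes f :: "real ^ 'n \<Rightarrow> complex"
  assumes "Linf_norm f < \<infinity>"
  shows "\<exists>M\<ge>0. AE x in lebesgue. norm (f x) \<le> M"
proof -
  have ae: "AE x in lebesgue. ereal (norm (f x)) \<le> Linf_norm f" unfolding Linf_norm_def by (rule esssup_AE)
  show ?thesis
  proof (cases "Linf_norm f")
    case (real r)
    from ae have "AE x in lebesgue. norm (f x) \<le> max r 0" by eventually_elim (simp add: real)
    then show ?thesis by (intro exI[of _ "max r 0"]) auto
  next
    case MInf
    from ae have "AE x in lebesgue. norm (f x) \<le> 0" by eventually_elim (simp add: MInf)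
    then show ?thesis by (intro exI[of _ 0]) auto
  qed (use assms in simp)
qed

section \<open>Regularity, estimates and uniqueness of the solution\<close>

context relaxation_kernel
begin

definition ratio :: "real \<Rightarrow> real" where
  "ratio t = conv (\<lambda>_. 1) kap t / t"

lemma ratio_pos: "0 < t \<Longrightarrow> 0 < ratio t"
  using kap_mass_pos by (simp add: ratio_def)

context
  fixes u0 U0 :: "real ^ 'n \<Rightarrow> complex" and u :: "real \<Rightarrow> real ^ 'n \<Rightarrow> complex"
  assumes u0: "is_fourier u0 U0"
    and u: "\<And>t. is_fourier (u t) (\<lambda>\<xi>. relax ((norm \<xi>)\<^sup>2) t *\<^sub>R U0 \<xi>)"
begin

abbreviation U :: "real \<Rightarrow> real ^ 'n \<Rightarrow> complex" where
  "U t \<xi> \<equiv> relax ((norm \<xi>)\<^sup>2) t *\<^sub>R U0 \<xi>"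

lemma U0_L2: "L2 U0" and U0_norm: "L2_norm U0 = L2_norm u0"
  using is_fourier_L2(2)[OF u0] is_fourier_isometry[OF u0] by auto

lemma U_L2: "L2 (U t)" by (rule is_fourier_L2(2)[OF u])

lemma U_measurable [measurable]: "U t \<in> borel_measurable lebesgue" by (rule L2_measurable[OF U_L2])

lemma decay: "0 < t \<Longrightarrow> (norm \<xi>)\<^sup>2 * relax ((norm \<xi>)\<^sup>2) t \<le> ratio t"
  unfolding ratio_def by (rule relax_decay) auto

lemma u_initial: "AE x in lebesgue. u 0 x = u0 x"
  using is_fourier_eq_iff[OF u[of 0] u0] by (simp add: relax_nonpos_time)

lemma U_norm_le: "norm (U t \<xi>) \<le> norm (U0 \<xi>)"
  using relax_nonneg relax_le_1 by (simp add: mult_left_le_one_le)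

lemma weighted:
  assumes "0 < t"
  shows "norm ((norm \<xi>)\<^sup>2 *\<^sub>R U t \<xi>) \<le> ratio t * norm (U0 \<xi>)"
    "norm ((1 + (norm \<xi>)\<^sup>2) *\<^sub>R U t \<xi>) \<le> (1 + ratio t) * norm (U0 \<xi>)"
proof -
  let ?r = "relax ((norm \<xi>)\<^sup>2) t"
  have "((norm \<xi>)\<^sup>2 * ?r) * norm (U0 \<xi>) \<le> ratio t * norm (U0 \<xi>)"
    using decay[OF assms] by (intro mult_right_mono) auto
  then show "norm ((norm \<xi>)\<^sup>2 *\<^sub>R U t \<xi>) \<le> ratio t * norm (U0 \<xi>)" using relax_nonneg by (simp add: abs_mult)
  have "?r + (norm \<xi>)\<^sup>2 * ?r \<le> 1 + ratio t" using decay[OF assms] relax_le_1 by (intro add_mono) auto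
  then have "((1 + (norm \<xi>)\<^sup>2) * ?r) * norm (U0 \<xi>) \<le> (1 + ratio t) * norm (U0 \<xi>)"
    by (intro mult_right_mono) (auto simp: distrib_right)
  moreover have "norm ((1 + (norm \<xi>)\<^sup>2) *\<^sub>R U t \<xi>) = ((1 + (norm \<xi>)\<^sup>2) * ?r) * norm (U0 \<xi>)"
    using relax_nonneg by (simp add: abs_of_nonneg add_nonneg_nonneg)
  ultimately show "norm ((1 + (norm \<xi>)\<^sup>2) *\<^sub>R U t \<xi>) \<le> (1 + ratio t) * norm (U0 \<xi>)" by (simp only:)
qed

lemma weighted_measurable [measurable]:
  "(\<lambda>\<xi>. (norm \<xi>)\<^sup>2 *\<^sub>R U t \<xi>) \<in> borel_measurable lebesgue"
  "(\<lambda>\<xi>. (1 + (norm \<xi>)\<^sup>2) *\<^sub>R U t \<xi>) \<in> borel_measurable lebesgue"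
  by (intro borel_measurable_scaleR lebesgue_borel_measurable U_measurable; measurable)+

lemma weighted_L2:
  assumes "0 < t"
  shows "L2 (\<lambda>\<xi>. (norm \<xi>)\<^sup>2 *\<^sub>R U t \<xi>)" "L2_norm (\<lambda>\<xi>. (norm \<xi>)\<^sup>2 *\<^sub>R U t \<xi>) \<le> ratio t * L2_norm u0"
    "L2 (\<lambda>\<xi>. (1 + (norm \<xi>)\<^sup>2) *\<^sub>R U t \<xi>)" "L2_norm (\<lambda>\<xi>. (1 + (norm \<xi>)\<^sup>2) *\<^sub>R U t \<xi>) \<le> (1 + ratio t) * L2_norm u0"
proof -
  have r: "0 \<le> ratio t" "0 \<le> 1 + ratio t" using ratio_pos[OF assms] by auto
  show "L2 (\<lambda>\<xi>. (norm \<xi>)\<^sup>2 *\<^sub>R U t \<xi>)" "L2_norm (\<lambda>\<xi>. (norm \<xi>)\<^sup>2 *\<^sub>R U t \<xi>) \<le> ratio t * L2_norm u0"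
    using L2_bound[OF weighted_measurable(1) U0_L2 r(1) AE_I2[OF weighted(1)[OF assms]]] by (simp_all only: U0_norm)
  show "L2 (\<lambda>\<xi>. (1 + (norm \<xi>)\<^sup>2) *\<^sub>R U t \<xi>)" "L2_norm (\<lambda>\<xi>. (1 + (norm \<xi>)\<^sup>2) *\<^sub>R U t \<xi>) \<le> (1 + ratio t) * L2_norm u0"
    using L2_bound[OF weighted_measurable(2) U0_L2 r(2) AE_I2[OF weighted(2)[OF assms]]] by (simp_all only: U0_norm)
qed

lemma U_time_continuous: "continuous_on {0..} (\<lambda>t. U t \<xi>)"
  by (intro continuous_intros relax_continuous) simp

lemma contraction: "L2_norm (u t) \<le> L2_norm u0"
proof -
  have "L2_norm (U t) \<le> 1 * L2_norm U0"
    by (rule L2_bound(2)[OF U_measurable U0_L2]) (use U_norm_le in auto)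
  then show ?thesis using is_fourier_isometry[OF u] U0_norm by simp
qed

lemma U_tendsto:
  assumes "t \<ge> 0" "\<And>i. X i \<ge> 0" "X \<longlonglongrightarrow> t" shows "(\<lambda>i. U (X i) \<xi>) \<longlonglongrightarrow> U t \<xi>"
  by (rule continuous_on_tendsto_compose[OF U_time_continuous assms(3)]) (use assms in auto)

lemma L2_continuous: "continuous_into_L2 {0..} u"
  unfolding continuous_into_L2_def
proof (intro conjI ballI is_fourier_L2(1)[OF u])
  fix t :: real assume t: "t \<in> {0..}"
  show "((\<lambda>r. L2_norm (\<lambda>x. u r x - u t x)) \<longlongrightarrow> 0) (at t within {0..})"
    unfolding tendsto_at_iff_sequentially
  proof (intro allI impI)
    fix X :: "nat \<Rightarrow> real" assume X: "\<forall>i. X i \<in> {0..} - {t}" "X \<longlonglongrightarrow> t"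
    have "(\<lambda>i. L2_norm (\<lambda>\<xi>. U (X i) \<xi> - U t \<xi>)) \<longlonglongrightarrow> 0"
    proof (rule L2_dominated(3)[where f="\<lambda>i. U (X i)", OF U_measurable U_measurable U0_L2])
      show "AE \<xi> in lebesgue. (\<lambda>i. U (X i) \<xi>) \<longlonglongrightarrow> U t \<xi>"
        by (intro AE_I2 U_tendsto) (use X t in auto)
      show "AE \<xi> in lebesgue. norm (U (X i) \<xi>) \<le> norm (U0 \<xi>)" for i by (intro AE_I2 U_norm_le)
    qed
    then show "((\<lambda>r. L2_norm (\<lambda>x. u r x - u t x)) \<circ> X) \<longlonglongrightarrow> 0"
      unfolding o_def is_fourier_isometry[OF is_fourier_diff[OF u u]] .
  qed
qed

text \<open>Continuity at time 0 is relative to \<open>u 0\<close>, which agrees with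
  \<open>u0\<close> only almost everywhere; the L2 distance does not see the difference.\<close>

lemma initial_limit: "((\<lambda>t. L2_norm (\<lambda>x. u t x - u0 x)) \<longlongrightarrow> 0) (at_right 0)"
proof -
  have "((\<lambda>r. L2_norm (\<lambda>x. u r x - u 0 x)) \<longlongrightarrow> 0) (at 0 within {0..})"
    using L2_continuous unfolding continuous_into_L2_def by simp
  then have "((\<lambda>r. L2_norm (\<lambda>x. u r x - u 0 x)) \<longlongrightarrow> 0) (at_right 0)"
    by (rule tendsto_within_subset) auto
  moreover have "L2_norm (\<lambda>x. u r x - u 0 x) = L2_norm (\<lambda>x. u r x - u0 x)" for r
  proof (rule L2_norm_cong_AE[OF L2_measurable[OF L2_diff[OF is_fourier_L2(1)[OF u] is_fourier_L2(1)[OF u]]]])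
    show "AE x in lebesgue. u r x - u 0 x = u r x - u0 x" using u_initial by eventually_elim simp
  qed
  ultimately show ?thesis by simp
qed

lemma H2_bound:
  assumes "0 < t" shows "H2 (u t)" "H2_norm (u t) \<le> (1 + ratio t) * L2_norm u0"
  using H2_fourier[OF u weighted_L2(3)[OF assms]] weighted_L2(4)[OF assms] by auto

lemma kap_mass_mono:
  assumes "s \<le> t" shows "conv (\<lambda>_. 1) kap s \<le> conv (\<lambda>_. 1) kap t"
  unfolding conv_const
proof (rule integral_mono)
  show "indicator {0..s} y * kap y \<le> indicator {0..t} y * kap y" for y
    using assms kap_nonneg[of y] by (auto simp: indicator_def)
qed (use kap_locally_integrable in \<open>auto simp: locally_integrable_def\<close>)

lemma H2_continuous:
  assumes e: "0 < \<epsilon>" shows "continuous_into_H2 {\<epsilon>..} u"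
  unfolding continuous_into_H2_def
proof (intro conjI ballI)
  show "H2 (u t)" if "t \<in> {\<epsilon>..}" for t using that e by (intro H2_bound) auto
  fix t assume t: "t \<in> {\<epsilon>..}"
  let ?p = "\<lambda>\<xi>::real^'n. 1 + (norm \<xi>)\<^sup>2"
  have n: "H2_norm (\<lambda>x. u r x - u t x) = L2_norm (\<lambda>\<xi>. ?p \<xi> *\<^sub>R U r \<xi> - ?p \<xi> *\<^sub>R U t \<xi>)" if "r \<in> {\<epsilon>..}" for r
  proof -
    have "L2 (\<lambda>\<xi>. ?p \<xi> *\<^sub>R U r \<xi> - ?p \<xi> *\<^sub>R U t \<xi>)"
      using that t e by (intro L2_diff weighted_L2) auto
    then show ?thesis
      using H2_fourier(2)[OF is_fourier_diff[OF u u], of r t] by (simp only: scaleR_diff_right)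
  qed
  show "((\<lambda>r. H2_norm (\<lambda>x. u r x - u t x)) \<longlongrightarrow> 0) (at t within {\<epsilon>..})"
    unfolding tendsto_at_iff_sequentially
  proof (intro allI impI)
    fix X :: "nat \<Rightarrow> real" assume X: "\<forall>i. X i \<in> {\<epsilon>..} - {t}" "X \<longlonglongrightarrow> t"
    obtain T where T: "\<And>i. norm (X i) \<le> T"
      using convergent_imp_Bseq[OF convergentI[OF X(2)]] unfolding Bseq_def by blast
    have XT: "\<epsilon> \<le> X i" "X i \<le> T" for i using X(1) T[of i] by auto
    \<comment> \<open>On [\<epsilon>, T] the quotient is at most the mass up to T divided by
      \<epsilon>, which gives one majorant for the whole sequence; it degenerates as \<epsilon>
      tends to 0.\<close>
    define B where "B = 1 + conv (\<lambda>_. 1) kap T / \<epsilon>"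
    have rB: "1 + ratio (X i) \<le> B" for i
    proof -
      have "0 \<le> conv (\<lambda>_. 1) kap T" using kap_mass_pos[of T] XT[of i] e by simp
      then show ?thesis unfolding B_def ratio_def
        using XT[of i] e kap_mass_mono[OF XT(2)[of i]] by (intro add_left_mono frac_le) auto
    qed
    have B0: "0 \<le> B" using rB[of 0] ratio_pos[of "X 0"] XT(1)[of 0] e by simp
    have "(\<lambda>i. L2_norm (\<lambda>\<xi>. ?p \<xi> *\<^sub>R U (X i) \<xi> - ?p \<xi> *\<^sub>R U t \<xi>)) \<longlonglongrightarrow> 0"
    proof (rule L2_dominated(3)[where f="\<lambda>i \<xi>. ?p \<xi> *\<^sub>R U (X i) \<xi>", OF weighted_measurable(2) weighted_measurable(2) L2_scaleR[OF U0_L2]])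
      show "AE \<xi> in lebesgue. (\<lambda>i. ?p \<xi> *\<^sub>R U (X i) \<xi>) \<longlonglongrightarrow> ?p \<xi> *\<^sub>R U t \<xi>"
        by (intro AE_I2 tendsto_scaleR tendsto_const U_tendsto) (use XT X t e in \<open>auto intro: order_trans[OF less_imp_le]\<close>)
      show "AE \<xi> in lebesgue. norm (?p \<xi> *\<^sub>R U (X i) \<xi>) \<le> norm (B *\<^sub>R U0 \<xi>)" for i
      proof (rule AE_I2)
        fix \<xi>
        have "0 < X i" using XT(1)[of i] e by simp
        then have "norm (?p \<xi> *\<^sub>R U (X i) \<xi>) \<le> (1 + ratio (X i)) * norm (U0 \<xi>)" by (rule weighted(2))
        also have "\<dots> \<le> B * norm (U0 \<xi>)" using rB by (intro mult_right_mono) auto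
        finally show "norm (?p \<xi> *\<^sub>R U (X i) \<xi>) \<le> norm (B *\<^sub>R U0 \<xi>)" using B0 by simp
      qed
    qed
    then show "((\<lambda>r. H2_norm (\<lambda>x. u r x - u t x)) \<circ> X) \<longlonglongrightarrow> 0"
      using X(1) by (simp add: o_def n)
  qed
qed

lemma is_solution:
  assumes h: "\<forall>t>0. cont_rep k t = kap t"
  shows "solution k u0 u"
  unfolding solution_def
proof (intro exI[of _ U] exI[of _ U0] conjI)
  show "is_fourier u0 U0" by (rule u0)
  show "fourier_rep u U" unfolding fourier_rep_def using u U_time_continuous by simp
  show "AE \<xi> in lebesgue. U 0 \<xi> = U0 \<xi> \<and> (\<forall>t>0. caputo_exists (cont_rep k) (\<lambda>s. U s \<xi>) t \<and>
      caputo (cont_rep k) (\<lambda>s. U s \<xi>) t = - ((norm \<xi>)\<^sup>2 *\<^sub>R U t \<xi>))"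
    using caputo_relax[OF h] by (intro AE_I2) (simp add: relax_nonpos_time)
qed

text \<open>The exceptional frequencies form a null set independent of the time variable, so for
  almost every \<xi> the whole time section solves the scalar problem and is determined by its
  initial value. Injectivity of the transform leads back to space.\<close>

lemma solution_unique:
  assumes h: "\<forall>t>0. cont_rep k t = kap t" and v: "solution k u0 v" and t: "0 \<le> t"
  shows "AE x in lebesgue. v t x = u t x"
proof -
  obtain V V0 where V: "fourier_rep v V" and V0: "is_fourier u0 V0"
    and eq: "AE \<xi> in lebesgue. V 0 \<xi> = V0 \<xi> \<and> (\<forall>t>0. caputo_exists (cont_rep k) (\<lambda>s. V s \<xi>) t \<and>
      caputo (cont_rep k) (\<lambda>s. V s \<xi>) t = - ((norm \<xi>)\<^sup>2 *\<^sub>R V t \<xi>))"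
    using v unfolding solution_def by (elim exE conjE)
  have vt: "is_fourier (v t) (V t)" and c: "AE \<xi> in lebesgue. continuous_on {0..} (\<lambda>t. V t \<xi>)"
    using V t by (auto simp: fourier_rep_def)
  have "AE \<xi> in lebesgue. V t \<xi> = U t \<xi>"
    using eq c is_fourier_AE_unique[OF V0 u0]
  proof eventually_elim
    case (elim \<xi>)
    have "V t \<xi> = relax ((norm \<xi>)\<^sup>2) t *\<^sub>R V 0 \<xi>"
      by (rule caputo_unique[OF h _ elim(2) _ t]) (use elim(1) in auto)
    with elim show ?case by simp
  qed
  then show ?thesis by (simp add: is_fourier_eq_iff[OF vt u])
qed

text \<open>In frequency the Caputo-type derivative is - |\<xi>|^2 U, which the decay of the
  relaxation function makes square integrable. Surjectivity of the transform supplies w.\<close>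

lemma space_caputo_bound:
  assumes h: "\<forall>t>0. cont_rep k t = kap t" and t: "0 < t"
  shows "\<exists>w. is_space_caputo k u t w \<and> L2_norm w \<le> ratio t * L2_norm u0"
proof -
  have c: "caputo_exists (cont_rep k) (\<lambda>s. U s \<xi>) t" "caputo (cont_rep k) (\<lambda>s. U s \<xi>) t = - ((norm \<xi>)\<^sup>2 *\<^sub>R U t \<xi>)" for \<xi>
    using caputo_relax[OF h _ t] by auto
  have "L2 (\<lambda>\<xi>. (-1) *\<^sub>R ((norm \<xi>)\<^sup>2 *\<^sub>R U t \<xi>))" by (rule L2_scaleR[OF weighted_L2(1)[OF t]])
  from is_fourier_surj[OF this] obtain w where w: "is_fourier w (\<lambda>\<xi>. (-1) *\<^sub>R ((norm \<xi>)\<^sup>2 *\<^sub>R U t \<xi>))" by blast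
  have "is_space_caputo k u t w"
    unfolding is_space_caputo_def
  proof (intro exI conjI)
    show "fourier_rep u U" unfolding fourier_rep_def using u U_time_continuous by simp
    show "AE \<xi> in lebesgue. caputo_exists (cont_rep k) (\<lambda>s. U s \<xi>) t" using c(1) by simp
    show "is_fourier w (\<lambda>\<xi>. caputo (cont_rep k) (\<lambda>s. U s \<xi>) t)" unfolding c(2) using w by simp
  qed
  moreover have "L2_norm w = L2_norm (\<lambda>\<xi>. (norm \<xi>)\<^sup>2 *\<^sub>R U t \<xi>)"
    unfolding is_fourier_isometry[OF w, symmetric] L2_norm_scaleR by simp
  ultimately show ?thesis using weighted_L2(2)[OF t] by auto
qed

lemma preserves:
  assumes maps: "\<And>t. 0 < t \<Longrightarrow> multiplier_maps (\<lambda>\<xi>::real^'n. relax ((norm \<xi>)\<^sup>2) t) A A"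
    and A: "AE x in lebesgue. u0 x \<in> A" and t: "0 \<le> t"
  shows "AE x in lebesgue. u t x \<in> A"
proof (cases "t = 0")
  case True
  from A u_initial show ?thesis unfolding True by eventually_elim simp
next
  case False
  then have "0 < t" using t by simp
  from multiplier_mapsD[OF maps[OF this] u0 u A] show ?thesis .
qed

lemma preserves_real:
  "AE x in lebesgue. u0 x \<in> \<real> \<Longrightarrow> 0 \<le> t \<Longrightarrow> AE x in lebesgue. u t x \<in> \<real>"
  by (rule preserves) (use positive_multiplier_relax in \<open>auto simp: positive_multiplier_def\<close>)

lemma preserves_nonneg:
  "AE x in lebesgue. u0 x \<in> \<real>\<^sub>\<ge>\<^sub>0 \<Longrightarrow> 0 \<le> t \<Longrightarrow> AE x in lebesgue. u t x \<in> \<real>\<^sub>\<ge>\<^sub>0"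
  by (rule preserves) (use positive_multiplier_relax in \<open>auto simp: positive_multiplier_def\<close>)

lemma preserves_cball:
  assumes M: "0 \<le> M"
  shows "AE x in lebesgue. u0 x \<in> cball 0 M \<Longrightarrow> 0 \<le> t \<Longrightarrow> AE x in lebesgue. u t x \<in> cball 0 M"
proof (rule preserves)
  fix t :: real assume "0 < t"
  then have "multiplier_maps (\<lambda>\<xi>::real^'n. relax ((norm \<xi>)\<^sup>2) t) (cball 0 M) (cball 0 (1 * M))"
    using positive_multiplier_relax[of t] M unfolding positive_multiplier_def by blast
  then show "multiplier_maps (\<lambda>\<xi>::real^'n. relax ((norm \<xi>)\<^sup>2) t) (cball 0 M) (cball 0 M)" by simp
qed

section \<open>Bounds with the exponent n/4\<close>

context
  fixes K t :: real
  assumes K: "\<forall>A (m :: real^'n \<Rightarrow> real). 0 < A \<longrightarrow> m \<in> borel_measurable borel \<longrightarrow> (\<forall>\<xi>. \<bar>m \<xi>\<bar> \<le> 1) \<longrightarrow>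
     (\<forall>\<xi>. (norm \<xi>)\<^sup>2 * \<bar>m \<xi>\<bar> \<le> A) \<longrightarrow>
     L2 (\<lambda>\<xi>. complex_of_real (m \<xi>)) \<and> L2_norm (\<lambda>\<xi>. complex_of_real (m \<xi>)) \<le> K * A powr (real CARD('n) / 4)"
    and t: "0 < t"
begin

abbreviation symbol :: "real^'n \<Rightarrow> complex" where
  "symbol \<xi> \<equiv> complex_of_real (relax ((norm \<xi>)\<^sup>2) t)"

lemma symbol_L2: "L2 symbol" "L2_norm symbol \<le> K * ratio t powr (real CARD('n) / 4)"
proof -
  have "L2 symbol \<and> L2_norm symbol \<le> K * ratio t powr (real CARD('n) / 4)"
    by (rule K[rule_format, OF ratio_pos[OF t] relax_space_measurable relax_abs_le])
       (use decay[OF t] relax_nonneg in simp)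
  then show "L2 symbol" "L2_norm symbol \<le> K * ratio t powr (real CARD('n) / 4)" by auto
qed

text \<open>U is the product of the symbol and U0, both in L2. Cauchy-Schwarz bounds its L1 norm,
  and the inversion formula turns this into a bound on the supremum.\<close>

lemma sup_bound:
  "Linf_norm (u t) \<le> ereal ((2 * pi) powr (- (real CARD('n) / 2)) * K * ratio t powr (real CARD('n) / 4) * L2_norm u0)"
proof (rule Linf_norm_le[OF L2_measurable[OF is_fourier_L2(1)[OF u]]])
  let ?c = "(2 * pi) powr (- (real CARD('n) / 2))"
  have e: "U t \<xi> = symbol \<xi> * U0 \<xi>" for \<xi> by (simp add: scaleR_conv_of_real)
  have i: "integrable lebesgue (U t)"
    unfolding e by (rule L2_prod_integrable(1)[OF symbol_L2(1) U0_L2])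
  have le: "norm (?c *\<^sub>R (LINT \<xi>|lebesgue. U t \<xi> * iexp (\<xi> \<bullet> x))) \<le> ?c * K * ratio t powr (real CARD('n) / 4) * L2_norm u0" for x
  proof -
    have "norm (LINT \<xi>|lebesgue. U t \<xi> * iexp (\<xi> \<bullet> x)) \<le> (LINT \<xi>|lebesgue. norm (U t \<xi> * iexp (\<xi> \<bullet> x)))"
      by (rule integral_norm_bound)
    also have "\<dots> = (LINT \<xi>|lebesgue. norm (symbol \<xi>) * norm (U0 \<xi>))" unfolding e by (simp add: norm_mult)
    also have "\<dots> \<le> L2_norm symbol * L2_norm U0" by (rule L2_Cauchy_Schwarz(1)[OF symbol_L2(1) U0_L2])
    also have "\<dots> \<le> (K * ratio t powr (real CARD('n) / 4)) * L2_norm u0"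
      unfolding U0_norm by (rule mult_right_mono[OF symbol_L2(2)]) simp
    finally have "?c * norm (LINT \<xi>|lebesgue. U t \<xi> * iexp (\<xi> \<bullet> x)) \<le> ?c * ((K * ratio t powr (real CARD('n) / 4)) * L2_norm u0)"
      by (rule mult_left_mono) simp
    then show ?thesis by (simp add: mult.assoc)
  qed
  from is_fourier_inversion[OF u i]
  show "AE x in lebesgue. norm (u t x) \<le> ?c * K * ratio t powr (real CARD('n) / 4) * L2_norm u0"
    by eventually_elim (simp only: le)
qed

text \<open>The complementary splitting of the same product: the L1 norm of u0 bounds U0 uniformly,
  and the symbol alone is measured in L2.\<close>

lemma smoothing_bound:
  assumes L1: "L1 u0"
  shows "L2_norm (u t) \<le> (2 * pi) powr (- (real CARD('n) / 2)) * K * ratio t powr (real CARD('n) / 4) * L1_norm u0"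
proof -
  let ?c = "(2 * pi) powr (- (real CARD('n) / 2))"
  have "is_fourier u0 (fourier u0)"
    using L1 is_fourier_L2(1)[OF u0] by (intro is_fourier_fourier) (simp_all add: L1_def)
  from is_fourier_AE_unique[OF u0 this] have U0: "AE \<xi> in lebesgue. norm (U0 \<xi>) \<le> ?c * L1_norm u0"
    by eventually_elim (simp add: L1_norm_def norm_fourier_le)
  have n: "0 \<le> ?c * L1_norm u0" by (simp add: L1_norm_def)
  have "L2_norm (U t) \<le> (?c * L1_norm u0) * L2_norm symbol"
  proof (rule L2_bound(2)[OF U_measurable symbol_L2(1) n])
    show "AE \<xi> in lebesgue. norm (U t \<xi>) \<le> (?c * L1_norm u0) * norm (symbol \<xi>)"
      using U0
    proof eventually_elim
      case (elim \<xi>)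
      have "\<bar>relax ((norm \<xi>)\<^sup>2) t\<bar> * norm (U0 \<xi>) \<le> \<bar>relax ((norm \<xi>)\<^sup>2) t\<bar> * (?c * L1_norm u0)"
        using elim by (rule mult_left_mono) simp
      then show ?case by (simp add: mult.commute)
    qed
  qed
  also have "\<dots> \<le> (?c * L1_norm u0) * (K * ratio t powr (real CARD('n) / 4))"
    by (rule mult_left_mono[OF symbol_L2(2) n])
  finally show ?thesis unfolding is_fourier_isometry[OF u] by (simp only: ac_simps)
qed

end

end

end

text \<open>The constant is quantified before the kernel and the datum, so it depends on the
  dimension only. Functions are complex valued; nonnegativity is membership in
  \<open>\<real>\<^sub>\<ge>\<^sub>0\<close>, preservation of real values is recorded separately,
  and boundedness is uniform in time.\<close>

theorem theorem2p2:
  assumes "CARD('n::finite) \<in> {1, 2, 3}"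
  shows "\<exists>K::real. \<forall>(k :: real \<Rightarrow> real) (u0 :: real ^ 'n \<Rightarrow> complex).
    admissible_kernel k \<longrightarrow> L2 u0 \<longrightarrow>
    (\<exists>u :: real \<Rightarrow> real ^ 'n \<Rightarrow> complex.
       continuous_into_L2 {0..} u \<and> solution k u0 u \<and>
       (\<forall>v. continuous_into_L2 {0..} v \<and> solution k u0 v \<longrightarrow>
          (\<forall>t\<ge>0. AE x in lebesgue. v t x = u t x)) \<and>
       (\<forall>\<epsilon>>0. continuous_into_H2 {\<epsilon>..} u) \<and>
       (\<forall>t\<ge>0. L2_norm (u t) \<le> L2_norm u0) \<and>
       (\<forall>t>0. H2_norm (u t) \<le> (1 + L1_norm_upto k t / t) * L2_norm u0) \<and>
       ((\<lambda>t. L2_norm (\<lambda>x. u t x - u0 x)) \<longlongrightarrow> 0) (at_right 0) \<and>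
       (\<forall>t>0. \<exists>w. is_space_caputo k u t w \<and>
          L2_norm w \<le> L1_norm_upto k t / t * L2_norm u0) \<and>
       (\<forall>t>0. Linf_norm (u t) \<le>
          ereal (K * (L1_norm_upto k t / t) powr (real CARD('n) / 4) * L2_norm u0)) \<and>
       ((AE x in lebesgue. u0 x \<in> \<real>) \<longrightarrow> (\<forall>t\<ge>0. AE x in lebesgue. u t x \<in> \<real>)) \<and>
       ((AE x in lebesgue. u0 x \<in> \<real>\<^sub>\<ge>\<^sub>0) \<longrightarrow> (\<forall>t\<ge>0. AE x in lebesgue. u t x \<in> \<real>\<^sub>\<ge>\<^sub>0)) \<and>
       (Linf_norm u0 < \<infinity> \<longrightarrow> (\<exists>M::real. \<forall>t\<ge>0. Linf_norm (u t) \<le> ereal M)) \<and>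
       (L1 u0 \<longrightarrow>
          (\<forall>t>0. L2_norm (u t) \<le>
             K * (L1_norm_upto k t / t) powr (real CARD('n) / 4) * L1_norm u0)))"
proof -
  have "CARD('n) \<le> 3" using assms by auto
  from inverse_square_decay_L2[OF this] obtain K where
    K: "\<forall>A (m :: real^'n \<Rightarrow> real). 0 < A \<longrightarrow> m \<in> borel_measurable borel \<longrightarrow> (\<forall>\<xi>. \<bar>m \<xi>\<bar> \<le> 1) \<longrightarrow>
     (\<forall>\<xi>. (norm \<xi>)\<^sup>2 * \<bar>m \<xi>\<bar> \<le> A) \<longrightarrow>
     L2 (\<lambda>\<xi>. complex_of_real (m \<xi>)) \<and> L2_norm (\<lambda>\<xi>. complex_of_real (m \<xi>)) \<le> K * A powr (real CARD('n) / 4)"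
    by blast
  show ?thesis
  \<comment> \<open>Both final estimates carry the factor (2 pi)^(-n/2), one from the inversion
    formula, the other from the uniform bound on the transform, so a single constant serves for
    both.\<close>
  proof (intro exI[of _ "(2 * pi) powr (- (real CARD('n) / 2)) * K"] allI impI)
    fix k :: "real \<Rightarrow> real" and u0 :: "real ^ 'n \<Rightarrow> complex"
    assume k: "admissible_kernel k" and u0: "L2 u0"
    obtain g kap where rk: "relaxation_kernel g kap" and h: "\<forall>t>0. cont_rep k t = kap t"
      and norm: "\<forall>t>0. L1_norm_upto k t = conv (\<lambda>_. 1) kap t"
      using admissible_kernel_relaxation_kernel[OF k] by (elim exE conjE)
    interpret relaxation_kernel g kap by (rule rk)
    define U0 where "U0 = fourier_L2 u0"
    have U0: "is_fourier u0 U0" unfolding U0_def by (rule is_fourier_fourier_L2[OF u0])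
    have "L2 (\<lambda>\<xi>. relax ((norm \<xi>)\<^sup>2) t *\<^sub>R U0 \<xi>)" for t
      by (rule multiplier_L2(1)[OF relax_space_measurable relax_abs_le is_fourier_L2(2)[OF U0]])
    from is_fourier_surj[OF this] obtain u where u: "\<And>t. is_fourier (u t) (\<lambda>\<xi>. relax ((norm \<xi>)\<^sup>2) t *\<^sub>R U0 \<xi>)"
      by metis
    note flow = U0 u
    have r: "L1_norm_upto k t / t = ratio t" if "0 < t" for t
      using norm that by (simp add: ratio_def)
    have bounded: "Linf_norm u0 < \<infinity> \<longrightarrow> (\<exists>M::real. \<forall>t\<ge>0. Linf_norm (u t) \<le> ereal M)"
    proof
      assume fin: "Linf_norm u0 < \<infinity>"
      obtain M where M: "0 \<le> M" "AE x in lebesgue. norm (u0 x) \<le> M" using Linf_norm_finite[OF fin] by blast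
      then have "AE x in lebesgue. u0 x \<in> cball 0 M" by simp
      then have "AE x in lebesgue. norm (u t x) \<le> M" if "0 \<le> t" for t
        using preserves_cball[OF flow M(1) _ that] by simp
      then show "\<exists>M::real. \<forall>t\<ge>0. Linf_norm (u t) \<le> ereal M"
        by (intro exI[of _ M] allI impI Linf_norm_le L2_measurable is_fourier_L2(1)[OF u])
    qed
    have unique: "\<forall>v. continuous_into_L2 {0..} v \<and> solution k u0 v \<longrightarrow> (\<forall>t\<ge>0. AE x in lebesgue. v t x = u t x)"
      using solution_unique[OF flow h] by blast
    have smooth: "\<forall>\<epsilon>>0. continuous_into_H2 {\<epsilon>..} u" using H2_continuous[OF flow] by blast
    have contraction: "\<forall>t\<ge>0. L2_norm (u t) \<le> L2_norm u0" using contraction[OF flow] by blast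
    have H2: "\<forall>t>0. H2_norm (u t) \<le> (1 + L1_norm_upto k t / t) * L2_norm u0"
      by (intro allI impI) (simp only: r H2_bound(2)[OF flow])
    have caputo: "\<forall>t>0. \<exists>w. is_space_caputo k u t w \<and> L2_norm w \<le> L1_norm_upto k t / t * L2_norm u0"
      by (intro allI impI) (simp only: r space_caputo_bound[OF flow h])
    have sup: "\<forall>t>0. Linf_norm (u t) \<le>
        ereal ((2 * pi) powr (- (real CARD('n) / 2)) * K * (L1_norm_upto k t / t) powr (real CARD('n) / 4) * L2_norm u0)"
      by (intro allI impI) (simp only: r sup_bound[OF flow K])
    have real: "(AE x in lebesgue. u0 x \<in> \<real>) \<longrightarrow> (\<forall>t\<ge>0. AE x in lebesgue. u t x \<in> \<real>)"
      by (intro allI impI preserves_real[OF flow])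
    have nonneg: "(AE x in lebesgue. u0 x \<in> \<real>\<^sub>\<ge>\<^sub>0) \<longrightarrow> (\<forall>t\<ge>0. AE x in lebesgue. u t x \<in> \<real>\<^sub>\<ge>\<^sub>0)"
      by (intro allI impI preserves_nonneg[OF flow])
    have smoothing: "L1 u0 \<longrightarrow> (\<forall>t>0. L2_norm (u t) \<le>
        (2 * pi) powr (- (real CARD('n) / 2)) * K * (L1_norm_upto k t / t) powr (real CARD('n) / 4) * L1_norm u0)"
      by (intro allI impI) (simp only: r smoothing_bound[OF flow K])
    show "\<exists>u. continuous_into_L2 {0..} u \<and> solution k u0 u \<and>
       (\<forall>v. continuous_into_L2 {0..} v \<and> solution k u0 v \<longrightarrow>
          (\<forall>t\<ge>0. AE x in lebesgue. v t x = u t x)) \<and>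
       (\<forall>\<epsilon>>0. continuous_into_H2 {\<epsilon>..} u) \<and>
       (\<forall>t\<ge>0. L2_norm (u t) \<le> L2_norm u0) \<and>
       (\<forall>t>0. H2_norm (u t) \<le> (1 + L1_norm_upto k t / t) * L2_norm u0) \<and>
       ((\<lambda>t. L2_norm (\<lambda>x. u t x - u0 x)) \<longlongrightarrow> 0) (at_right 0) \<and>
       (\<forall>t>0. \<exists>w. is_space_caputo k u t w \<and>
          L2_norm w \<le> L1_norm_upto k t / t * L2_norm u0) \<and>
       (\<forall>t>0. Linf_norm (u t) \<le>
          ereal ((2 * pi) powr (- (real CARD('n) / 2)) * K * (L1_norm_upto k t / t) powr (real CARD('n) / 4) * L2_norm u0)) \<and>
       ((AE x in lebesgue. u0 x \<in> \<real>) \<longrightarrow> (\<forall>t\<ge>0. AE x in lebesgue. u t x \<in> \<real>)) \<and>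
       ((AE x in lebesgue. u0 x \<in> \<real>\<^sub>\<ge>\<^sub>0) \<longrightarrow> (\<forall>t\<ge>0. AE x in lebesgue. u t x \<in> \<real>\<^sub>\<ge>\<^sub>0)) \<and>
       (Linf_norm u0 < \<infinity> \<longrightarrow> (\<exists>M::real. \<forall>t\<ge>0. Linf_norm (u t) \<le> ereal M)) \<and>
       (L1 u0 \<longrightarrow>
          (\<forall>t>0. L2_norm (u t) \<le>
             (2 * pi) powr (- (real CARD('n) / 2)) * K * (L1_norm_upto k t / t) powr (real CARD('n) / 4) * L1_norm u0))"
      by (intro exI[of _ u] conjI L2_continuous[OF flow] is_solution[OF flow h] unique smooth contraction H2 initial_limit[OF flow]
          caputo sup real nonneg bounded smoothing)
  qed
qed

end
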